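(* Let $X$ be a reflexive separable Banach space, let $M$ be a cylindrical continuous local martingale on $X$ that is closed operator-Brownian representable, and let $G:\mathbb R_+\times\Omega\to\mathcal L_{cl}(H,X)$ be the corresponding operator family. Let $f:\mathbb R_+\times\Omega\to X^*$. Suppose there exist elementary progressive $f_n:\mathbb R_+\times\Omega\to X^*$, $n\ge1$, such that $f_n\to f$ $\mathbb P\times ds$-a.s. Assume also that the limit $N:=\lim_{n\to\infty}f_n\cdot M$ exists in the ucp topology. Then $f\in\operatorname{dom}(G^* )$ $\mathbb P\times ds$-a.s., $G^*f$ is progressively measurable, and $$[N]=\int_0^{\cdot}\|G^*f\|^2\,ds .$$
   Context: $(\Omega,\mathcal F,\mathbb P)$ is a complete probability space with a filtration $\mathbb F=(\mathcal F_t)_{t\ge 0}$ satisfying the usual conditions, and $\mathcal F=\sigma(\bigcup_{t\ge0}\mathcal F_t)$. $\mathcal M^{\rm loc}$ is the space of real-valued continuous local martingales, with the ucp topology (uniform convergence on compact time sets in probability). $[N]$ denotes quadratic variation. A cylindrical continuous local martingale on $X$ is a continuous linear map $M:X^*\to\mathcal M^{\rm loc}$. $\mathcal L_{cl}(X,Y)$ is the set of all closed densely defined linear operators from $X$ to $Y$. For $G$ with values in $\mathcal L_{cl}(H,X)$, $H$ a Hilbert space, $G^*$ denotes the pointwise adjoint, an operator from $X^*$ to $H$ (with $H^*$ identified with $H$). An $X^*$-valued process $f$ is elementary progressive if $$f(t,\omega)=\sum_{n=1}^N\sum_{m=1}^{L}\mathbf 1_{(t_{n-1},t_n]\times B_{mn}}(t,\omega)\sum_{k=1}^K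 y_{kmn}x_k^*,$$ where $0\le t_0<\dots<t_N<\infty$, $B_{1n},\dots,B_{Ln}\in\mathcal F_{t_{n-1}}$ for each $n$, $x_k^*\in X^*$, $y_{kmn}\in\mathbb R$; its integral is $(f\cdot M)(t)=\int_0^tf\,dM=\sum_{n=1}^N\sum_{m=1}^{L}\mathbf 1_{B_{mn}}\sum_{k=1}^K\big(M(t_n\wedge t)x_k^*-M(t_{n-1}\wedge t)x_k^*\big)y_{kmn}$. For a Hilbert space $H$, an $H$-cylindrical Brownian motion $W_H$ is a linear map assigning to each $h\in H$ a Brownian motion $W_Hh$ (relative to the filtration under consideration) with $\mathbb E\,W_H(t)h\,W_H(s)g=\langle h,g\rangle\min\{t,s\}$. An $H$-valued scalarly progressively measurable process $g$ with $\int_0^t\|g\|^2\,ds<\infty$ a.s. for all $t$ has a real-valued stochastic integral $\int_0^\cdot g^*\,dW_H$, where $g(s)\in H$ is identified with the functional $g^*(s)=\langle\cdot,g(s)\rangle$. $M$ is closed operator-Brownian representable, with corresponding operator family $G$, if there exist a Hilbert space $H$, an $H$-cylindrical Brownian motion $W_H$ on an enlarged probability space $(\overline\Omega,\overline{\mathcal F},\overline{\mathbb P})$ with enlarged filtration $\overline{\mathbb F}$, a map $g:\mathbb R_+\times\overline\Omega\times X^*\to H$ with each $g(x^* )$ $\overline{\mathbb F}$-scalarly progressively measurable, stochastically integrable with respect to $W_H$, and a.s. $Mx^*=\int_0^\cdot g^*(x^* )\,dW_H$, and a function $G:\mathbb R_+\times\Omega\to\mathcal L_{cl}(H,X)$ such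 that for each fixed $x^*\in X^*$, $G^*x^*$ is defined $\mathbb P\times ds$-a.s. and is a version of $g(x^* )$. "Enlarged" is in the usual sense: processes on $\Omega$ are regarded as processes on $\overline\Omega$ via a measure-preserving projection $\overline\Omega\to\Omega$, and $\mathbb F$-continuous local martingales remain $\overline{\mathbb F}$-continuous local martingales.
   Formalization: "Progressively measurable" is meant for the enlarged filtration and up to a null set (it can fail for the original one), and each G^*x^* is assumed to have a jointly measurable version on R_+×Ω whose lift to the enlarged space is a version of g(x^* ). *)

theory Defs
  imports "HOL-Probability.Probability"
begin

section \<open>Filtered probability spaces and continuous local martingales\<close>

text \<open>
  Time is the half-line of nonnegative reals. Filtrations and processes are indexed by the type
  of reals, but only their values at times \<open>t \<ge> 0\<close> matter. In a filtration \<open>F\<close>, the measure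
  \<open>F t\<close> only serves as a carrier of a sigma-algebra.
\<close>

locale filtered_prob_space = prob_space P + filtration "space P" F
  for P :: "'a measure" and F :: "real \<Rightarrow> 'a measure" +
  assumes subalg: "\<And>t. subalgebra P (F t)"

locale usual_filtered_prob_space = filtered_prob_space P F + complete_measure P
  for P :: "'a measure" and F :: "real \<Rightarrow> 'a measure" +
  assumes null_sets_F: "null_sets P \<subseteq> sets (F 0)"
    and right_continuous_F: "\<And>t. 0 \<le> t \<Longrightarrow> sets (F t) = (\<Inter>s\<in>{t<..}. sets (F s))"

definition adapted :: "(real \<Rightarrow> 'a measure) \<Rightarrow> (real \<Rightarrow> 'a \<Rightarrow> real) \<Rightarrow> bool" where
  "adapted F X \<longleftrightarrow> (\<forall>t\<ge>0. X t \<in> borel_measurable (F t))"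

definition martingale ::
    "'a measure \<Rightarrow> (real \<Rightarrow> 'a measure) \<Rightarrow> (real \<Rightarrow> 'a \<Rightarrow> real) \<Rightarrow> bool" where
  "martingale P F X \<longleftrightarrow> adapted F X \<and> (\<forall>t\<ge>0. integrable P (X t)) \<and>
     (\<forall>s\<ge>0. \<forall>t\<ge>s. AE \<omega> in P. real_cond_exp P (F s) (X t) \<omega> = X s \<omega>)"

text \<open>
  Processes are identified when indistinguishable, so path properties are required almost surely.
  Localizing sequences consist of finite stopping times; this is no restriction, because an
  extended-valued localizing sequence \<open>\<tau>\<^sub>n\<close> can be replaced by \<open>min \<tau>\<^sub>n n\<close>.
\<close>

definition cont_local_martingale ::
    "'a measure \<Rightarrow> (real \<Rightarrow> 'a measure) \<Rightarrow> (real \<Rightarrow> 'a \<Rightarrow> real) \<Rightarrow> bool" where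
  "cont_local_martingale P F X \<longleftrightarrow>
     adapted F X \<and>
     (AE \<omega> in P. continuous_on {0..} (\<lambda>t. X t \<omega>)) \<and>
     (\<exists>\<tau> :: nat \<Rightarrow> 'a \<Rightarrow> real.
        (\<forall>n. stopping_time F (\<tau> n) \<and> (\<forall>\<omega>\<in>space P. 0 \<le> \<tau> n \<omega>)) \<and>
        (AE \<omega> in P. incseq (\<lambda>n. \<tau> n \<omega>) \<and> filterlim (\<lambda>n. \<tau> n \<omega>) at_top sequentially) \<and>
        (\<forall>n. martingale P F (\<lambda>t \<omega>. X (min t (\<tau> n \<omega>)) \<omega> - X 0 \<omega>)))"

text \<open>
  The outer measure agrees with \<open>P\<close> on measurable sets; it rules out spurious convergence caused
  by the convention that the measure of a non-measurable set is \<open>0\<close>.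
\<close>

definition ucp_tendsto ::
    "'a measure \<Rightarrow> ('i \<Rightarrow> real \<Rightarrow> 'a \<Rightarrow> real) \<Rightarrow> (real \<Rightarrow> 'a \<Rightarrow> real) \<Rightarrow> 'i filter \<Rightarrow> bool" where
  "ucp_tendsto P X Y \<F> \<longleftrightarrow>
     (\<forall>T\<ge>0. \<forall>e>0.
        ((\<lambda>i. outer_measure_of P {\<omega>\<in>space P. \<exists>s\<in>{0..T}. e < \<bar>X i s \<omega> - Y s \<omega>\<bar>}) \<longlongrightarrow> 0) \<F>)"

text \<open>
  \<open>quadratic_variation P F N V\<close> says that \<open>V\<close> is (a version of) the process \<open>[N]\<close>, which is unique
  up to indistinguishability.
\<close>

definition quadratic_variation ::
    "'a measure \<Rightarrow> (real \<Rightarrow> 'a measure) \<Rightarrow> (real \<Rightarrow> 'a \<Rightarrow> real) \<Rightarrow> (real \<Rightarrow> 'a \<Rightarrow> real) \<Rightarrow> bool" where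
  "quadratic_variation P F N V \<longleftrightarrow>
     adapted F V \<and>
     (AE \<omega> in P. V 0 \<omega> = 0 \<and> continuous_on {0..} (\<lambda>t. V t \<omega>) \<and> mono_on {0..} (\<lambda>t. V t \<omega>)) \<and>
     cont_local_martingale P F (\<lambda>t \<omega>. (N t \<omega>)\<^sup>2 - V t \<omega>)"

definition progressively_measurable ::
    "(real \<Rightarrow> 'a measure) \<Rightarrow> (real \<Rightarrow> 'a \<Rightarrow> 'e::topological_space) \<Rightarrow> bool" where
  "progressively_measurable F u \<longleftrightarrow>
     (\<forall>T\<ge>0. (\<lambda>(t, \<omega>). u t \<omega>) \<in> borel_measurable (restrict_space borel {0..T} \<Otimes>\<^sub>M F T))"

definition scalarly_progressively_measurable ::
    "(real \<Rightarrow> 'a measure) \<Rightarrow> (real \<Rightarrow> 'a \<Rightarrow> 'h::real_inner) \<Rightarrow> bool" where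
  "scalarly_progressively_measurable F u \<longleftrightarrow>
     (\<forall>h. progressively_measurable F (\<lambda>t \<omega>. inner (u t \<omega>) h))"

definition time_prod :: "'a measure \<Rightarrow> (real \<times> 'a) measure" where
  "time_prod P = restrict_space lborel {0..} \<Otimes>\<^sub>M P"


section \<open>Elementary progressive processes and their integrals\<close>

record ('a, 'e) elementary =
  el_N :: nat
  el_L :: nat
  el_K :: nat
  el_t :: "nat \<Rightarrow> real"
  el_B :: "nat \<Rightarrow> nat \<Rightarrow> 'a set"
  el_y :: "nat \<Rightarrow> nat \<Rightarrow> nat \<Rightarrow> real"
  el_x :: "nat \<Rightarrow> 'e"

definition elementary_progressive :: "(real \<Rightarrow> 'a measure) \<Rightarrow> ('a, 'e) elementary \<Rightarrow> bool" where
  "elementary_progressive F d \<longleftrightarrow>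
     0 \<le> el_t d 0 \<and>
     (\<forall>n\<in>{1..el_N d}. el_t d (n - 1) < el_t d n) \<and>
     (\<forall>n\<in>{1..el_N d}. \<forall>m\<in>{1..el_L d}. el_B d m n \<in> sets (F (el_t d (n - 1))))"

definition elementary_process ::
    "('a, 'e::real_vector) elementary \<Rightarrow> real \<Rightarrow> 'a \<Rightarrow> 'e" where
  "elementary_process d t \<omega> =
     (\<Sum>n=1..el_N d. \<Sum>m=1..el_L d.
        indicat_real ({el_t d (n - 1)<..el_t d n} \<times> el_B d m n) (t, \<omega>) *\<^sub>R
          (\<Sum>k=1..el_K d. el_y d k m n *\<^sub>R el_x d k))"

text \<open>
  The integrator is any family of real processes indexed by the vector space in which the
  integrand takes its values: a cylindrical local martingale (index space: the dual of \<open>X\<close>) or a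
  cylindrical Brownian motion (index space: \<open>H\<close>).
\<close>

definition elementary_integral ::
    "('a, 'e) elementary \<Rightarrow> ('e \<Rightarrow> real \<Rightarrow> 'a \<Rightarrow> real) \<Rightarrow> real \<Rightarrow> 'a \<Rightarrow> real" where
  "elementary_integral d M t \<omega> =
     (\<Sum>n=1..el_N d. \<Sum>m=1..el_L d.
        indicat_real (el_B d m n) \<omega> *
          (\<Sum>k=1..el_K d.
             (M (el_x d k) (min (el_t d n) t) \<omega> - M (el_x d k) (min (el_t d (n - 1)) t) \<omega>)
               * el_y d k m n))"


section \<open>Cylindrical processes\<close>

definition ae_linear :: "'a measure \<Rightarrow> ('e::real_vector \<Rightarrow> real \<Rightarrow> 'a \<Rightarrow> real) \<Rightarrow> bool" where
  "ae_linear P M \<longleftrightarrow>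
     (\<forall>x y. AE \<omega> in P. \<forall>t\<ge>0. M (x + y) t \<omega> = M x t \<omega> + M y t \<omega>) \<and>
     (\<forall>c x. AE \<omega> in P. \<forall>t\<ge>0. M (c *\<^sub>R x) t \<omega> = c * M x t \<omega>)"

definition cylindrical_cont_local_martingale ::
    "'a measure \<Rightarrow> (real \<Rightarrow> 'a measure) \<Rightarrow> (('x::real_normed_vector \<Rightarrow>\<^sub>L real) \<Rightarrow> real \<Rightarrow> 'a \<Rightarrow> real)
      \<Rightarrow> bool" where
  "cylindrical_cont_local_martingale P F M \<longleftrightarrow>
     (\<forall>x. cont_local_martingale P F (M x)) \<and>
     ae_linear P M \<and>
     (\<forall>x. ucp_tendsto P M (M x) (at x))"

text \<open>
  A Brownian motion relative to \<open>F\<close> whose variance at time \<open>t\<close> is \<open>\<sigma>\<^sup>2 * t\<close>. The degenerate case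
  \<open>\<sigma> = 0\<close> is separate because \<open>normal_density\<close> is meaningful for positive deviation only.
\<close>

definition brownian_motion ::
    "'a measure \<Rightarrow> (real \<Rightarrow> 'a measure) \<Rightarrow> real \<Rightarrow> (real \<Rightarrow> 'a \<Rightarrow> real) \<Rightarrow> bool" where
  "brownian_motion P F \<sigma> B \<longleftrightarrow>
     adapted F B \<and>
     (AE \<omega> in P. B 0 \<omega> = 0 \<and> continuous_on {0..} (\<lambda>t. B t \<omega>)) \<and>
     (\<forall>s\<ge>0. \<forall>t>s.
        prob_space.indep_set P (sets (F s))
          {(\<lambda>\<omega>. B t \<omega> - B s \<omega>) -` A \<inter> space P | A. A \<in> sets borel} \<and>
        (if \<sigma> = 0 then AE \<omega> in P. B t \<omega> - B s \<omega> = 0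
         else distributed P lborel (\<lambda>\<omega>. B t \<omega> - B s \<omega>) (normal_density 0 (\<sigma> * sqrt (t - s)))))"

definition cylindrical_brownian_motion ::
    "'a measure \<Rightarrow> (real \<Rightarrow> 'a measure) \<Rightarrow> ('h::real_inner \<Rightarrow> real \<Rightarrow> 'a \<Rightarrow> real) \<Rightarrow> bool" where
  "cylindrical_brownian_motion P F W \<longleftrightarrow>
     ae_linear P W \<and>
     (\<forall>h. brownian_motion P F (norm h) (W h)) \<and>
     (\<forall>h g. \<forall>t\<ge>0. \<forall>s\<ge>0.
        integrable P (\<lambda>\<omega>. W h t \<omega> * W g s \<omega>) \<and>
        (\<integral>\<omega>. W h t \<omega> * W g s \<omega> \<partial>P) = inner h g * min t s)"

text \<open>
  \<open>N\<close> is the stochastic integral of the (identified) functional-valued process \<open>g\<^sup>*\<close> with respect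
  to \<open>W\<close>: elementary integrands approximate \<open>g\<close> in \<open>L\<^sup>2\<close> on compact time intervals, in probability,
  and the elementary integrals converge to \<open>N\<close> in ucp. For separable \<open>H\<close>, each scalarly
  progressively measurable \<open>g\<close> with locally square-integrable paths has such approximations; for
  general \<open>H\<close> their existence is part of stochastic integrability.
\<close>

definition has_stochastic_integral ::
    "'a measure \<Rightarrow> (real \<Rightarrow> 'a measure) \<Rightarrow> ('h::real_inner \<Rightarrow> real \<Rightarrow> 'a \<Rightarrow> real) \<Rightarrow>
     (real \<Rightarrow> 'a \<Rightarrow> 'h) \<Rightarrow> (real \<Rightarrow> 'a \<Rightarrow> real) \<Rightarrow> bool" where
  "has_stochastic_integral P F W g N \<longleftrightarrow>
     scalarly_progressively_measurable F g \<and>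
     (AE \<omega> in P. \<forall>T\<ge>0. set_integrable lebesgue {0..T} (\<lambda>s. (norm (g s \<omega>))\<^sup>2)) \<and>
     (\<exists>d :: nat \<Rightarrow> ('a, 'h) elementary.
        (\<forall>n. elementary_progressive F (d n)) \<and>
        (\<forall>T\<ge>0. \<forall>e>0.
           (\<lambda>n. outer_measure_of P
              {\<omega>\<in>space P. e <
                 (\<integral>\<^sup>+s\<in>{0..T}. ennreal ((norm (elementary_process (d n) s \<omega> - g s \<omega>))\<^sup>2) \<partial>lebesgue)})
             \<longlonglongrightarrow> 0) \<and>
        ucp_tendsto P (\<lambda>n. elementary_integral (d n) W) N sequentially)"


section \<open>Closed densely defined operators and adjoints\<close>

text \<open>Unbounded operators are represented by their graphs; the domain of \<open>A\<close> is \<open>Domain A\<close>.\<close>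

definition closed_operators :: "('h::real_normed_vector \<times> 'x::real_normed_vector) set set" where
  "closed_operators =
     {A. subspace A \<and> single_valued A \<and> closed A \<and> closure (Domain A) = UNIV}"

text \<open>The graph of the adjoint, with the dual of the Hilbert space identified with the space.\<close>

definition adjoint_graph ::
    "('h::real_inner \<times> 'x::real_normed_vector) set \<Rightarrow> (('x \<Rightarrow>\<^sub>L real) \<times> 'h) set" where
  "adjoint_graph A = {(x', h). \<forall>(u, v)\<in>A. blinfun_apply x' v = inner u h}"

definition adjoint_apply ::
    "('h::real_inner \<times> 'x::real_normed_vector) set \<Rightarrow> ('x \<Rightarrow>\<^sub>L real) \<Rightarrow> 'h" where
  "adjoint_apply A x' = (THE h. (x', h) \<in> adjoint_graph A)"

lemma adjoint_apply_eq:
  assumes "A \<in> closed_operators" "(x', h) \<in> adjoint_graph A"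
  shows "adjoint_apply A x' = h"
  unfolding adjoint_apply_def
proof (rule the_equality)
  show "(x', h) \<in> adjoint_graph A" by fact
next
  fix k assume k: "(x', k) \<in> adjoint_graph A"
  have eq: "inner u (k - h) = 0" if "u \<in> Domain A" for u
    using that k assms(2) by (fastforce simp: adjoint_graph_def inner_diff_right)
  have "closed {u. inner u (k - h) = 0}"
    by (intro closed_Collect_eq continuous_intros)
  then have "closure (Domain A) \<subseteq> {u. inner u (k - h) = 0}"
    using eq by (intro closure_minimal) auto
  then have "inner (k - h) (k - h) = 0"
    using assms(1) unfolding closed_operators_def by blast
  then show "k = h" by simp
qed

definition reflexive_space :: "'x::real_normed_vector itself \<Rightarrow> bool" where
  "reflexive_space _ \<longleftrightarrow>
     (\<forall>\<phi> :: ('x \<Rightarrow>\<^sub>L real) \<Rightarrow>\<^sub>L real. \<exists>x :: 'x. \<forall>x'. blinfun_apply \<phi> x' = blinfun_apply x' x)"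


section \<open>Closed operator-Brownian representability\<close>

text \<open>
  Processes \<open>X\<close> on the original space are regarded as processes \<open>\<lambda>t \<omega>. X t (\<pi> \<omega>)\<close> on the
  enlarged one.
\<close>

definition enlargement ::
    "'a measure \<Rightarrow> (real \<Rightarrow> 'a measure) \<Rightarrow> 'b measure \<Rightarrow> (real \<Rightarrow> 'b measure) \<Rightarrow> ('b \<Rightarrow> 'a) \<Rightarrow> bool"
    where
  "enlargement P F Q E \<pi> \<longleftrightarrow>
     filtered_prob_space Q E \<and>
     \<pi> \<in> measurable Q P \<and> distr Q P \<pi> = P \<and>
     (\<forall>t\<ge>0. \<pi> \<in> measurable (E t) (F t)) \<and>
     (\<forall>X. cont_local_martingale P F X \<longrightarrow> cont_local_martingale Q E (\<lambda>t \<omega>. X t (\<pi> \<omega>)))"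

text \<open>
  In the last conjunct, \<open>\<gamma>\<close> is the process \<open>G\<^sup>*x\<^sup>*\<close>: the adjoint is defined at \<open>x\<^sup>*\<close> with value \<open>\<gamma>\<close>
  almost everywhere on the original space, and \<open>\<gamma>\<close>, regarded as a process on the enlarged space,
  is a version of \<open>g(x\<^sup>*)\<close>.
\<close>

definition closed_operator_brownian_representation ::
    "'a measure \<Rightarrow> (real \<Rightarrow> 'a measure) \<Rightarrow> 'b measure \<Rightarrow> (real \<Rightarrow> 'b measure) \<Rightarrow> ('b \<Rightarrow> 'a) \<Rightarrow>
     (('x::real_normed_vector \<Rightarrow>\<^sub>L real) \<Rightarrow> real \<Rightarrow> 'a \<Rightarrow> real) \<Rightarrow>
     (real \<Rightarrow> 'a \<Rightarrow> ('h::real_inner \<times> 'x) set) \<Rightarrow> bool" where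
  "closed_operator_brownian_representation P F Q E \<pi> M G \<longleftrightarrow>
     enlargement P F Q E \<pi> \<and>
     (\<forall>t\<ge>0. \<forall>\<omega>\<in>space P. G t \<omega> \<in> closed_operators) \<and>
     (\<exists>(W :: 'h \<Rightarrow> real \<Rightarrow> 'b \<Rightarrow> real) (g :: real \<Rightarrow> 'b \<Rightarrow> ('x \<Rightarrow>\<^sub>L real) \<Rightarrow> 'h).
        cylindrical_brownian_motion Q E W \<and>
        (\<forall>x'. has_stochastic_integral Q E W (\<lambda>t \<omega>. g t \<omega> x') (\<lambda>t \<omega>. M x' t (\<pi> \<omega>))) \<and>
        (\<forall>x'. \<exists>\<gamma> \<in> borel_measurable (time_prod P).
           (AE (t, \<omega>) in time_prod P. (x', \<gamma> (t, \<omega>)) \<in> adjoint_graph (G t \<omega>)) \<and>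
           (AE (t, \<omega>) in time_prod Q. \<gamma> (t, \<pi> \<omega>) = g t \<omega> x')))"

end

theory Submission
  imports Defs
begin

text \<open>
  On the enlarged space, \<open>f\<^sub>n \<cdot> M\<close> is the stochastic integral of \<open>G\<^sup>*f\<^sub>n\<close> with respect to the cylindrical
  Brownian motion. An elementary integral that is uniformly small outside a small set has an
  integrand whose \<open>L\<^sup>2\<close> norm in time is small outside a small set: stop it when it leaves a small ball
  and use the isometry. So ucp convergence of the integrals makes a subsequence of \<open>G\<^sup>*f\<^sub>n\<close> converge
  almost everywhere and in \<open>L\<^sup>2\<close> of compact time intervals; the limit is \<open>G\<^sup>*f\<close> because adjoints are
  closed. Truncating the integrands at stopping times turns this into \<open>L\<^sup>2\<close> convergence, which carries
  the martingale property of the square minus the energy over to \<open>N\<close>. This property, unlike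
  adaptedness of \<open>\<integral>\<parallel>G\<^sup>*f\<parallel>\<^sup>2 ds\<close>, passes to the original filtration by projection. Adaptedness
  holds because that integral is a limit in probability of Riemann sums of squared increments
  of \<open>N\<close>, which are adapted on the original space.
\<close>

section \<open>Increments of a cylindrical Brownian motion\<close>

text \<open>\<open>H\<close> is not assumed separable, so sums of \<open>H\<close>-valued Borel maps
  need not be Borel. Integrands are therefore treated as pointwise limits of simple functions; such
  versions exist because stochastic integrability supplies elementary approximations. The enlarged
  filtration is not assumed complete or right-continuous, so stopping is replaced by switching an
  integrand off at grid times. This keeps it elementary, at the price of an overshoot of one grid
  step. Overshoots of integrals are controlled by fourth moments of increments, of the order of the
  squared time step; overshoots of energies by the boundedness of each elementary integrand. The
  rates are linked: integrals within 16^-n of \<open>N\<close> have squared differences of order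
  256^-n, which leaves room to bound the energies of successive differences by 8^-n outside sets of
  summable probability. Weighted by 4^n they still form a convergent series, whence convergence for
  almost every time and path. Riemann sums are compared through their square roots, which obey the
  triangle inequality.\<close>

lemma integrable_indicator_mult:
  fixes f :: "'a \<Rightarrow> real"
  assumes "A \<in> sets M" "integrable M f"
  shows "integrable M (\<lambda>x. indicator A x * f x)"
  using integrable_mult_indicator[OF assms] by simp

lemma (in filtered_prob_space) measurable_of_F:
  assumes "f \<in> measurable (F t) N" shows "f \<in> measurable P N"
  using measurable_from_subalg[OF subalg assms] .

lemma (in filtered_prob_space) measurable_F_mono:
  assumes "f \<in> measurable (F s) N" "s \<le> t" shows "f \<in> measurable (F t) N"
  using assms sets_F_mono[of s t] space_F by (auto simp: measurable_def)

lemma (in filtered_prob_space) sets_F_P: "A \<in> sets (F t) \<Longrightarrow> A \<in> sets P"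
  using subalg[of t] by (auto simp: subalgebra_def)

locale cyl_brownian = filtered_prob_space Q E
  for Q :: "'b measure" and E :: "real \<Rightarrow> 'b measure" +
  fixes W :: "'h::real_inner \<Rightarrow> real \<Rightarrow> 'b \<Rightarrow> real"
  assumes cyl_W: "cylindrical_brownian_motion Q E W"
begin

lemma bm_W: "brownian_motion Q E (norm x) (W x)"
  using cyl_W by (auto simp: cylindrical_brownian_motion_def)

lemma W_measurable: "0 \<le> t \<Longrightarrow> W x t \<in> borel_measurable (E t)"
  using bm_W[of x] by (auto simp: brownian_motion_def adapted_def)

lemma W_measurable_Q [measurable]: "0 \<le> t \<Longrightarrow> W x t \<in> borel_measurable Q"
  using measurable_of_F[OF W_measurable] .

text \<open>These are the moments of a Gaussian variable with deviation
  \<open>norm x * sqrt (t - s)\<close>. For \<open>x = 0\<close> the increment vanishes almost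
  surely and has no density, hence the separate case. The fourth moment later controls overshoots on
  a grid.\<close>

lemma W_increment_moment:
  assumes "0 \<le> s" "s < t"
  shows "integrable Q (\<lambda>\<omega>. (W x t \<omega> - W x s \<omega>) ^ k)"
    and "(\<integral>\<omega>. W x t \<omega> - W x s \<omega> \<partial>Q) = 0"
    and "(\<integral>\<omega>. (W x t \<omega> - W x s \<omega>) ^ 4 \<partial>Q) = 3 * norm x ^ 4 * (t - s)\<^sup>2"
    and "(\<integral>\<omega>. (W x t \<omega> - W x s \<omega>)\<^sup>2 \<partial>Q) = (norm x)\<^sup>2 * (t - s)"
proof -
  have *: "integrable Q (\<lambda>\<omega>. (W x t \<omega> - W x s \<omega>) ^ k) \<and>
     (\<integral>\<omega>. W x t \<omega> - W x s \<omega> \<partial>Q) = 0 \<and>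
     (\<integral>\<omega>. (W x t \<omega> - W x s \<omega>) ^ 4 \<partial>Q) = 3 * norm x ^ 4 * (t - s)\<^sup>2 \<and>
     (\<integral>\<omega>. (W x t \<omega> - W x s \<omega>)\<^sup>2 \<partial>Q) = (norm x)\<^sup>2 * (t - s)"
  proof (cases "x = 0")
    case True
    have m [measurable]: "W x t \<in> borel_measurable Q" "W x s \<in> borel_measurable Q"
      using assms by auto
    have ae: "AE \<omega> in Q. W x t \<omega> - W x s \<omega> = 0"
      using bm_W[of x] assms True by (auto simp: brownian_motion_def)
    have i: "integrable Q (\<lambda>\<omega>. (W x t \<omega> - W x s \<omega>) ^ j)" for j
    proof (rule integrable_cong_AE_imp[where g="\<lambda>_. 0 ^ j"])
      show "AE \<omega> in Q. (0::real) ^ j = (W x t \<omega> - W x s \<omega>) ^ j"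
        using ae by eventually_elim simp
    qed auto
    have z: "(\<integral>\<omega>. (W x t \<omega> - W x s \<omega>) ^ j \<partial>Q) = 0" if "j > 0" for j
    proof -
      have "(\<integral>\<omega>. (W x t \<omega> - W x s \<omega>) ^ j \<partial>Q) = (\<integral>\<omega>. 0 \<partial>Q)"
      proof (rule integral_cong_AE)
        show "AE \<omega> in Q. (W x t \<omega> - W x s \<omega>) ^ j = 0"
          using ae by eventually_elim (use that in simp)
      qed auto
      then show ?thesis by simp
    qed
    show ?thesis using i z[of 1] z[of 2] z[of 4] True by simp
  next
    case False
    let ?\<sigma> = "norm x * sqrt (t - s)"
    have \<sigma>: "?\<sigma> > 0" using False assms by simp
    have d: "distributed Q lborel (\<lambda>\<omega>. W x t \<omega> - W x s \<omega>) (normal_density 0 ?\<sigma>)"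
      using bm_W[of x] assms False by (auto simp: brownian_motion_def)
    have i: "integrable Q (\<lambda>\<omega>. (W x t \<omega> - W x s \<omega>) ^ j)" for j
      using distributed_integrable[OF d, of "\<lambda>y. y ^ j"] integrable_normal_moment[OF \<sigma>, of 0 j]
      by (simp add: normal_density_nonneg)
    have e: "(\<integral>\<omega>. (W x t \<omega> - W x s \<omega>) ^ j \<partial>Q) = (\<integral>y. normal_density 0 ?\<sigma> y * y ^ j \<partial>lborel)" for j
      using distributed_integral[OF d, of "\<lambda>y. y ^ j"] by (simp add: normal_density_nonneg)
    have 1: "(\<integral>\<omega>. (W x t \<omega> - W x s \<omega>) ^ 1 \<partial>Q) = 0"
      unfolding e using integral_normal_moment_odd[OF \<sigma>, of 0 0] by simp
    have s2: "(sqrt (t - s))\<^sup>2 = t - s" using assms by simp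
    have s4: "sqrt (t - s) ^ 4 = (t - s)\<^sup>2"
      using s2 by (metis mult_2 numeral_Bit0 power_add power2_eq_square)
    have "(\<integral>\<omega>. (W x t \<omega> - W x s \<omega>)\<^sup>2 \<partial>Q) = ?\<sigma>\<^sup>2"
      unfolding e using integral_normal_moment_even[OF \<sigma>, of 0 1] by simp
    then have 2: "(\<integral>\<omega>. (W x t \<omega> - W x s \<omega>)\<^sup>2 \<partial>Q) = (norm x)\<^sup>2 * (t - s)"
      by (simp add: power_mult_distrib s2)
    have "(\<integral>\<omega>. (W x t \<omega> - W x s \<omega>) ^ 4 \<partial>Q) = 3 * ?\<sigma> ^ 4"
      unfolding e using integral_normal_moment_even[OF \<sigma>, of 0 2]
      by (simp add: fact_numeral power_divide field_simps flip: power_mult)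
    then have 4: "(\<integral>\<omega>. (W x t \<omega> - W x s \<omega>) ^ 4 \<partial>Q) = 3 * norm x ^ 4 * (t - s)\<^sup>2"
      by (simp add: power_mult_distrib s4)
    show ?thesis using i 1 2 4 by simp
  qed
  show "integrable Q (\<lambda>\<omega>. (W x t \<omega> - W x s \<omega>) ^ k)"
    and "(\<integral>\<omega>. W x t \<omega> - W x s \<omega> \<partial>Q) = 0"
    and "(\<integral>\<omega>. (W x t \<omega> - W x s \<omega>) ^ 4 \<partial>Q) = 3 * norm x ^ 4 * (t - s)\<^sup>2"
    and "(\<integral>\<omega>. (W x t \<omega> - W x s \<omega>)\<^sup>2 \<partial>Q) = (norm x)\<^sup>2 * (t - s)"
    using * by blast+
qed

text \<open>The indicator of \<open>A\<close> generates events of \<open>E s\<close>, and the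
  function of the increment generates events of the increment. Independence of these families passes
  to the generated sigma-algebras because preimages of Borel sets are stable under intersection, and
  the expectation of the product factors.\<close>

lemma W_increment_indep:
  assumes "0 \<le> s" "s < t" "A \<in> sets (E s)"
  assumes [measurable]: "\<psi> \<in> borel_measurable borel"
    and int: "integrable Q (\<lambda>\<omega>. \<psi> (W x t \<omega> - W x s \<omega>))"
  shows "(\<integral>\<omega>. indicator A \<omega> * \<psi> (W x t \<omega> - W x s \<omega>) \<partial>Q)
      = measure Q A * (\<integral>\<omega>. \<psi> (W x t \<omega> - W x s \<omega>) \<partial>Q)"
proof -
  let ?D = "\<lambda>\<omega>. W x t \<omega> - W x s \<omega>"
  have A [measurable]: "A \<in> sets Q" using assms(3) by (rule sets_F_P)
  have [measurable]: "W x t \<in> borel_measurable Q" "W x s \<in> borel_measurable Q"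
    using assms by auto
  have ind: "indep_set (sets (E s)) {?D -` A \<inter> space Q | A. A \<in> sets borel}"
    using bm_W[of x] assms by (auto simp: brownian_motion_def)
  have "indep_var borel (indicator A :: 'b \<Rightarrow> real) borel (\<lambda>\<omega>. \<psi> (?D \<omega>))"
    unfolding indep_var_eq
  proof (intro conjI)
    let ?S1 = "{(indicator A :: 'b \<Rightarrow> real) -` B \<inter> space Q | B. B \<in> sets borel}"
    let ?S2 = "{(\<lambda>\<omega>. \<psi> (?D \<omega>)) -` B \<inter> space Q | B. B \<in> sets borel}"
    have i1: "(indicator A :: 'b \<Rightarrow> real) \<in> borel_measurable (E s)"
      using assms(3) by simp
    have c1: "?S1 \<subseteq> sets (E s)"
      using measurable_sets[OF i1] by (auto simp: space_F)
    have c2: "?S2 \<subseteq> {?D -` A \<inter> space Q | A. A \<in> sets borel}"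
    proof
      fix S assume "S \<in> ?S2"
      then obtain B where B: "B \<in> sets borel" "S = (\<lambda>\<omega>. \<psi> (?D \<omega>)) -` B \<inter> space Q" by auto
      have "\<psi> -` B \<in> sets borel" using measurable_sets[OF assms(4) B(1)] by simp
      moreover have "S = ?D -` (\<psi> -` B) \<inter> space Q" using B by auto
      ultimately show "S \<in> {?D -` A \<inter> space Q | A. A \<in> sets borel}" by blast
    qed
    have "indep_set ?S1 ?S2"
    proof (rule indep_setI)
      show "?S1 \<subseteq> events" using c1 sets_F_P by blast
      show "?S2 \<subseteq> events" by auto
      show "prob (a \<inter> b) = prob a * prob b" if "a \<in> ?S1" "b \<in> ?S2" for a b
        using indep_setD[OF ind subsetD[OF c1 that(1)] subsetD[OF c2 that(2)]] .
    qed
    moreover have "Int_stable {f -` B \<inter> space Q | B. B \<in> sets borel}" for f :: "'b \<Rightarrow> real"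
    proof (rule Int_stableI)
      fix a b assume "a \<in> {f -` B \<inter> space Q | B. B \<in> sets borel}" "b \<in> {f -` B \<inter> space Q | B. B \<in> sets borel}"
      then obtain A B where AB: "A \<in> sets borel" "B \<in> sets borel" "a = f -` A \<inter> space Q" "b = f -` B \<inter> space Q"
        by blast
      then have "a \<inter> b = f -` (A \<inter> B) \<inter> space Q" "A \<inter> B \<in> sets borel" by auto
      then show "a \<inter> b \<in> {f -` B \<inter> space Q | B. B \<in> sets borel}" by blast
    qed
    ultimately show "indep_set (sigma_sets (space Q) ?S1) (sigma_sets (space Q) ?S2)"
      by (intro indep_set_sigma_sets)
  qed auto
  moreover have "integrable Q (indicator A :: 'b \<Rightarrow> real)" by (simp add: emeasure_eq_measure)
  ultimately show ?thesis
    using indep_var_lebesgue_integral[OF _ _ int, of "indicator A"] by simp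
qed

text \<open>Polarization: the increment is almost surely additive in the vector, so the product is
  half of the square at \<open>x + y\<close> minus the squares at \<open>x\<close> and at
  \<open>y\<close>, and each square is independent of \<open>E s\<close>.\<close>

lemma W_increment_cross:
  assumes "0 \<le> s" "s < t" "A \<in> sets (E s)"
  shows "integrable Q (\<lambda>\<omega>. (W x t \<omega> - W x s \<omega>) * (W y t \<omega> - W y s \<omega>))"
    and "(\<integral>\<omega>. indicator A \<omega> * ((W x t \<omega> - W x s \<omega>) * (W y t \<omega> - W y s \<omega>)) \<partial>Q)
      = measure Q A * inner x y * (t - s)"
proof -
  have A [measurable]: "A \<in> sets Q" using assms(3) by (rule sets_F_P)
  have m [measurable]: "W z t \<in> borel_measurable Q" "W z s \<in> borel_measurable Q" for z
    using assms by auto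
  let ?D = "\<lambda>z \<omega>. W z t \<omega> - W z s \<omega>"
  have i: "integrable Q (\<lambda>\<omega>. (?D z \<omega>)\<^sup>2)" for z
    using W_increment_moment[OF assms(1,2)] by blast
  have e: "(\<integral>\<omega>. indicator A \<omega> * (?D z \<omega>)\<^sup>2 \<partial>Q) = measure Q A * ((norm z)\<^sup>2 * (t - s))" for z
    using W_increment_indep[OF assms(1,2,3), of "\<lambda>y. y\<^sup>2" z] i[of z] W_increment_moment(4)[OF assms(1,2), of z]
    by simp
  have lin: "AE \<omega> in Q. ?D (x + y) \<omega> = ?D x \<omega> + ?D y \<omega>"
  proof -
    have "AE \<omega> in Q. \<forall>t\<ge>0. W (x + y) t \<omega> = W x t \<omega> + W y t \<omega>"
      using cyl_W by (auto simp: cylindrical_brownian_motion_def ae_linear_def)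
    then show ?thesis by eventually_elim (use assms in simp)
  qed
  have ae: "AE \<omega> in Q. ((?D (x + y) \<omega>)\<^sup>2 - (?D x \<omega>)\<^sup>2 - (?D y \<omega>)\<^sup>2) / 2 = ?D x \<omega> * ?D y \<omega>"
    using lin
  proof eventually_elim
    case (elim \<omega>)
    show ?case unfolding elim by (simp add: power2_sum)
  qed
  show int: "integrable Q (\<lambda>\<omega>. ?D x \<omega> * ?D y \<omega>)"
    by (rule integrable_cong_AE_imp[OF _ _ ae]) (use i in auto)
  have "(\<integral>\<omega>. indicator A \<omega> * (?D x \<omega> * ?D y \<omega>) \<partial>Q)
      = (\<integral>\<omega>. (indicator A \<omega> * (?D (x + y) \<omega>)\<^sup>2 - indicator A \<omega> * (?D x \<omega>)\<^sup>2 - indicator A \<omega> * (?D y \<omega>)\<^sup>2) / 2 \<partial>Q)"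
  proof (rule integral_cong_AE)
    show "AE \<omega> in Q. indicator A \<omega> * (?D x \<omega> * ?D y \<omega>) = (indicator A \<omega> * (?D (x + y) \<omega>)\<^sup>2
        - indicator A \<omega> * (?D x \<omega>)\<^sup>2 - indicator A \<omega> * (?D y \<omega>)\<^sup>2) / 2"
      using ae
    proof eventually_elim
      case (elim \<omega>)
      show ?case unfolding elim[symmetric] by (simp add: algebra_simps diff_divide_distrib)
    qed
  qed auto
  also have "\<dots> = (measure Q A * ((norm (x + y))\<^sup>2 * (t - s)) - measure Q A * ((norm x)\<^sup>2 * (t - s))
       - measure Q A * ((norm y)\<^sup>2 * (t - s))) / 2"
    using integrable_indicator_mult[OF A i] by (simp add: e)
  also have "\<dots> = measure Q A * inner x y * (t - s)"
    by (simp add: power2_norm_eq_inner inner_add_left inner_add_right inner_commute field_simps)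
  finally show "(\<integral>\<omega>. indicator A \<omega> * (?D x \<omega> * ?D y \<omega>) \<partial>Q) = measure Q A * inner x y * (t - s)" .
qed

end

section \<open>Elementary integrals\<close>

text \<open>The left side is the integral up to \<open>t\<close> of the product of the indicators of
  \<open>{a<..b}\<close> and \<open>{a'<..b'}\<close> against \<open>w\<close>. The outer
  \<open>max\<close> in the right endpoint collapses an empty intersection to a zero
  increment.\<close>

lemma restrict_increment:
  fixes w :: "real \<Rightarrow> real"
  assumes "a \<le> b" "a' \<le> b'"
  shows "(w (min b' (min b t)) - w (min a' (min b t))) - (w (min b' (min a t)) - w (min a' (min a t)))
    = w (min (max (max a a') (min b b')) t) - w (min (max a a') t)"
  using assms by (auto simp: min_def max_def)

lemma power4_add_le: "(u + v) ^ 4 \<le> 8 * (u ^ 4 + v ^ 4)" for u v :: real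
proof -
  have a: "(u + v)\<^sup>2 \<le> 2 * (u\<^sup>2 + v\<^sup>2)"
    using sum_squares_bound[of u v] by (simp add: power2_sum)
  have b: "(u\<^sup>2 + v\<^sup>2)\<^sup>2 \<le> 2 * ((u\<^sup>2)\<^sup>2 + (v\<^sup>2)\<^sup>2)"
    using sum_squares_bound[of "u\<^sup>2" "v\<^sup>2"] by (simp add: power2_sum)
  have "((u + v)\<^sup>2)\<^sup>2 \<le> (2 * (u\<^sup>2 + v\<^sup>2))\<^sup>2"
    using a by (intro power_mono) auto
  also have "\<dots> = 4 * (u\<^sup>2 + v\<^sup>2)\<^sup>2" by (simp only: power_mult_distrib) simp
  finally show ?thesis using b by (simp flip: power_mult)
qed

lemma integrable_mult_of_squares:
  fixes f g :: "'a \<Rightarrow> real"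
  assumes [measurable]: "f \<in> borel_measurable M" "g \<in> borel_measurable M"
    and "integrable M (\<lambda>x. (f x)\<^sup>2)" "integrable M (\<lambda>x. (g x)\<^sup>2)"
  shows "integrable M (\<lambda>x. f x * g x)"
proof (rule Bochner_Integration.integrable_bound)
  show "integrable M (\<lambda>x. (f x)\<^sup>2 + (g x)\<^sup>2)" using assms by simp
  show "AE x in M. norm (f x * g x) \<le> norm ((f x)\<^sup>2 + (g x)\<^sup>2)"
  proof (rule AE_I2)
    fix x
    have "2 * (\<bar>f x\<bar> * \<bar>g x\<bar>) \<le> (f x)\<^sup>2 + (g x)\<^sup>2"
      using sum_squares_bound[of "\<bar>f x\<bar>" "\<bar>g x\<bar>"] by simp
    moreover have "0 \<le> \<bar>f x\<bar> * \<bar>g x\<bar>" by simp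
    ultimately have "\<bar>f x\<bar> * \<bar>g x\<bar> \<le> (f x)\<^sup>2 + (g x)\<^sup>2" by linarith
    then show "norm (f x * g x) \<le> norm ((f x)\<^sup>2 + (g x)\<^sup>2)" by (simp add: abs_mult)
  qed
qed simp

text \<open>Vanishing integrals over all sets of \<open>F s\<close> say that the conditional
  expectation of \<open>X\<close> is zero. Tests against indicators thereby become tests against
  every \<open>F s\<close>-measurable \<open>Y\<close> with integrable product.\<close>

lemma (in filtered_prob_space) integral_mult_zero:
  assumes X: "integrable P X" and Y: "Y \<in> borel_measurable (F s)"
    and YX: "integrable P (\<lambda>\<omega>. Y \<omega> * X \<omega>)"
    and z: "\<And>A. A \<in> sets (F s) \<Longrightarrow> (\<integral>\<omega>. indicator A \<omega> * X \<omega> \<partial>P) = (0::real)"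
  shows "(\<integral>\<omega>. Y \<omega> * X \<omega> \<partial>P) = 0"
proof -
  interpret S: finite_measure_subalgebra P "F s"
    by unfold_locales (rule subalg)
  have "AE \<omega> in P. real_cond_exp P (F s) X \<omega> = 0"
    by (rule S.real_cond_exp_charact) (use X z in \<open>auto simp: set_lebesgue_integral_def\<close>)
  then have "(\<integral>\<omega>. Y \<omega> * real_cond_exp P (F s) X \<omega> \<partial>P) = (\<integral>\<omega>. 0 \<partial>P)"
    using measurable_of_F[OF Y] by (intro integral_cong_AE) auto
  then show ?thesis
    using S.real_cond_exp_intg(2)[OF YX Y] X by auto
qed

lemma simple_function_scaleR_const:
  "simple_function M f \<Longrightarrow> simple_function M (\<lambda>x. f x *\<^sub>R v)"
  using simple_function_compose[of M f "\<lambda>r. r *\<^sub>R v"] by (simp add: comp_def)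

text \<open>Finite ranges avoid the difficulty that addition in a nonseparable space need not
  preserve Borel measurability.\<close>

lemma simple_function_plus:
  "simple_function M f \<Longrightarrow> simple_function M g \<Longrightarrow> simple_function M (\<lambda>x. f x + g x :: 'c::ab_group_add)"
  by (rule simple_function_compose2)

lemma integrable_indicator_Ioc [simp]: "integrable lborel (indicat_real {s<..t::real})"
proof (cases "s \<le> t")
  case True
  then show ?thesis by (simp add: integrable_indicator_iff)
qed simp

section \<open>Elementary integrands with their integrals, built from rectangles\<close>

context cyl_brownian begin

inductive simp_int :: "(real \<Rightarrow> 'b \<Rightarrow> 'h) \<Rightarrow> (real \<Rightarrow> 'b \<Rightarrow> real) \<Rightarrow> bool" where
  zero: "simp_int (\<lambda>_ _. 0) (\<lambda>_ _. 0)"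
| step: "simp_int h J \<Longrightarrow> 0 \<le> a \<Longrightarrow> a \<le> b \<Longrightarrow> B \<in> sets (E a) \<Longrightarrow>
    simp_int (\<lambda>t \<omega>. h t \<omega> + indicat_real ({a<..b} \<times> B) (t, \<omega>) *\<^sub>R (c *\<^sub>R x))
      (\<lambda>t \<omega>. J t \<omega> + indicat_real B \<omega> * ((W x (min b t) \<omega> - W x (min a t) \<omega>) * c))"

lemma simp_int_cong:
  assumes "simp_int h J" "\<And>t \<omega>. h' t \<omega> = h t \<omega>" "\<And>t \<omega>. J' t \<omega> = J t \<omega>"
  shows "simp_int h' J'"
proof -
  have "h' = h" "J' = J" using assms(2,3) by presburger+
  then show ?thesis using assms by simp
qed

lemma simp_int_basic:
  assumes "0 \<le> a" "a \<le> b" "B \<in> sets (E a)"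
  shows "simp_int (\<lambda>t \<omega>. indicat_real ({a<..b} \<times> B) (t, \<omega>) *\<^sub>R (c *\<^sub>R x))
      (\<lambda>t \<omega>. indicat_real B \<omega> * ((W x (min b t) \<omega> - W x (min a t) \<omega>) * c))"
  by (rule simp_int_cong[OF step[OF zero assms]]) auto

lemma simp_int_add:
  assumes "simp_int h2 J2" "simp_int h1 J1"
  shows "simp_int (\<lambda>t \<omega>. h1 t \<omega> + h2 t \<omega>) (\<lambda>t \<omega>. J1 t \<omega> + J2 t \<omega>)"
  using assms
proof (induction rule: simp_int.induct)
  case zero
  then show ?case by simp
next
  case (step h J a b B c x)
  show ?case
    by (rule simp_int_cong[OF simp_int.step[OF step.IH[OF step.prems] step.hyps(2-4), of c x]])
      (simp_all add: algebra_simps)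
qed

lemma simp_int_scale:
  assumes "simp_int h J"
  shows "simp_int (\<lambda>t \<omega>. r *\<^sub>R h t \<omega>) (\<lambda>t \<omega>. r * J t \<omega>)"
  using assms
proof (induction rule: simp_int.induct)
  case zero
  then show ?case using simp_int.zero by simp
next
  case (step h J a b B c x)
  show ?case
    by (rule simp_int_cong[OF simp_int.step[OF step.IH step.hyps(2-4), of "r * c" x]])
      (simp_all add: algebra_simps)
qed

lemma simp_int_diff:
  assumes "simp_int h1 J1" "simp_int h2 J2"
  shows "simp_int (\<lambda>t \<omega>. h1 t \<omega> - h2 t \<omega>) (\<lambda>t \<omega>. J1 t \<omega> - J2 t \<omega>)"
  by (rule simp_int_cong[OF simp_int_add[OF simp_int_scale[OF assms(2), of "-1"] assms(1)]]) auto

lemma simp_int_sum: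
  assumes "\<And>i. i \<in> I \<Longrightarrow> simp_int (h i) (J i)"
  shows "simp_int (\<lambda>t \<omega>. \<Sum>i\<in>I. h i t \<omega>) (\<lambda>t \<omega>. \<Sum>i\<in>I. J i t \<omega>)"
  using assms
  by (induction I rule: infinite_finite_induct) (simp_all add: simp_int.zero simp_int_add)

text \<open>The intersection of two rectangles starts at the later of the two left endpoints, where
  both events are already known. So switching an integrand on and off at deterministic times, on
  events observable at the switch-on time, stays inside the class.\<close>

lemma simp_int_restrict:
  assumes "simp_int h J" "0 \<le> a" "a \<le> b" "B \<in> sets (E a)"
  shows "simp_int (\<lambda>t \<omega>. indicat_real ({a<..b} \<times> B) (t, \<omega>) *\<^sub>R h t \<omega>)
      (\<lambda>t \<omega>. indicat_real B \<omega> * (J (min b t) \<omega> - J (min a t) \<omega>))"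
  using assms
proof (induction rule: simp_int.induct)
  case zero
  then show ?case using simp_int.zero by simp
next
  case (step h J a' b' B' c x)
  let ?a = "max a a'" and ?b = "max (max a a') (min b b')"
  have "B \<inter> B' \<in> sets (E ?a)"
    using step.prems step.hyps sets_F_mono[of a ?a] sets_F_mono[of a' ?a] by auto
  then have s: "simp_int (\<lambda>t \<omega>. indicat_real ({a<..b} \<times> B) (t, \<omega>) *\<^sub>R h t \<omega>
        + indicat_real ({?a<..?b} \<times> (B \<inter> B')) (t, \<omega>) *\<^sub>R (c *\<^sub>R x))
      (\<lambda>t \<omega>. indicat_real B \<omega> * (J (min b t) \<omega> - J (min a t) \<omega>)
        + indicat_real (B \<inter> B') \<omega> * ((W x (min ?b t) \<omega> - W x (min ?a t) \<omega>) * c))"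
    using step.prems by (intro simp_int.step step.IH) auto
  show ?case
  proof (rule simp_int_cong[OF s])
    fix t \<omega>
    have "indicat_real ({a<..b} \<times> B) (t, \<omega>) * indicat_real ({a'<..b'} \<times> B') (t, \<omega>)
      = indicat_real ({?a<..?b} \<times> (B \<inter> B')) (t, \<omega>)"
      by (auto simp: indicator_def)
    then show "indicat_real ({a<..b} \<times> B) (t, \<omega>) *\<^sub>R (h t \<omega> + indicat_real ({a'<..b'} \<times> B') (t, \<omega>) *\<^sub>R c *\<^sub>R x)
      = indicat_real ({a<..b} \<times> B) (t, \<omega>) *\<^sub>R h t \<omega>
        + indicat_real ({?a<..?b} \<times> (B \<inter> B')) (t, \<omega>) *\<^sub>R (c *\<^sub>R x)"
      by (simp add: scaleR_add_right mult.assoc[symmetric])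
    have ii: "indicat_real (B \<inter> B') \<omega> = indicat_real B \<omega> * indicat_real B' \<omega>"
      by (simp add: indicator_inter_arith)
    show "indicat_real B \<omega> * (J (min b t) \<omega> + indicat_real B' \<omega> * ((W x (min b' (min b t)) \<omega> - W x (min a' (min b t)) \<omega>) * c)
        - (J (min a t) \<omega> + indicat_real B' \<omega> * ((W x (min b' (min a t)) \<omega> - W x (min a' (min a t)) \<omega>) * c)))
      = indicat_real B \<omega> * (J (min b t) \<omega> - J (min a t) \<omega>)
        + indicat_real (B \<inter> B') \<omega> * ((W x (min ?b t) \<omega> - W x (min ?a t) \<omega>) * c)"
      unfolding ii restrict_increment[OF \<open>a \<le> b\<close> \<open>a' \<le> b'\<close>, of "\<lambda>t. W x t \<omega>", symmetric]
      by (simp add: algebra_simps)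
  qed
qed

lemma simp_int_0: "simp_int h J \<Longrightarrow> J 0 \<omega> = 0"
  by (induction rule: simp_int.induct) auto

lemma simp_int_adapted:
  assumes "simp_int h J" "0 \<le> t"
  shows "J t \<in> borel_measurable (E t)"
  using assms
proof (induction rule: simp_int.induct)
  case (step h J a b B c x)
  show ?case
  proof (cases "a \<le> t")
    case True
    have "indicat_real B \<in> borel_measurable (E t)"
      using step.hyps(4) sets_F_mono[OF True] by (intro borel_measurable_indicator) auto
    moreover have "W x (min b t) \<in> borel_measurable (E t)" "W x (min a t) \<in> borel_measurable (E t)"
      using step.hyps step.prems
      by (auto intro!: measurable_F_mono[OF W_measurable])
    ultimately show ?thesis using step.IH[OF step.prems] by simp
  next
    case False
    then show ?thesis using step.IH[OF step.prems] step.hyps by (simp add: min_def)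
  qed
qed simp

lemma simp_int_measurable: "simp_int h J \<Longrightarrow> 0 \<le> t \<Longrightarrow> J t \<in> borel_measurable Q"
  using measurable_of_F[OF simp_int_adapted] .

lemma simp_int_bounded:
  assumes "simp_int h J"
  shows "\<exists>C\<ge>0. \<forall>t \<omega>. norm (h t \<omega>) \<le> C"
  using assms
proof (induction rule: simp_int.induct)
  case (step h J a b B c x)
  then obtain C where C: "C \<ge> 0" "\<And>t \<omega>. norm (h t \<omega>) \<le> C" by blast
  have "norm (h t \<omega> + indicat_real ({a<..b} \<times> B) (t, \<omega>) *\<^sub>R c *\<^sub>R x) \<le> C + norm (c *\<^sub>R x)" for t \<omega>
    by (rule norm_triangle_le, rule add_mono[OF C(2)]) (auto simp: indicator_def)
  then show ?case using C by (intro exI[of _ "C + norm (c *\<^sub>R x)"]) auto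
qed auto

lemma simp_int_simple_time:
  assumes "simp_int h J" shows "simple_function borel (\<lambda>r. h r \<omega>)"
  using assms
proof (induction rule: simp_int.induct)
  case (step h J a b B c x)
  have "simple_function borel (\<lambda>r. indicat_real {a<..b} r *\<^sub>R (indicat_real B \<omega> *\<^sub>R c *\<^sub>R x))"
    by (intro simple_function_scaleR_const simple_function_indicator) auto
  then have "simple_function borel (\<lambda>r. h r \<omega> + indicat_real {a<..b} r *\<^sub>R (indicat_real B \<omega> *\<^sub>R c *\<^sub>R x))"
    by (intro simple_function_plus step.IH)
  then show ?case by (simp add: indicator_times mult_ac)
qed auto

lemma simp_int_simple:
  assumes "simp_int h J" shows "simple_function (borel \<Otimes>\<^sub>M Q) (\<lambda>p. h (fst p) (snd p))"
  using assms
proof (induction rule: simp_int.induct)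
  case (step h J a b B c x)
  have [measurable]: "B \<in> sets Q" using sets_F_P step.hyps by blast
  have "simple_function (borel \<Otimes>\<^sub>M Q) (\<lambda>p. indicat_real ({a<..b} \<times> B) p *\<^sub>R (c *\<^sub>R x))"
    by (intro simple_function_scaleR_const simple_function_indicator) auto
  from simple_function_plus[OF step.IH this] show ?case by simp
qed auto

text \<open>With time capped at \<open>t\<close>, a rectangle starting at \<open>a \<ge> t\<close>
  is never entered, and one starting earlier has its event in \<open>E t\<close>. This is
  progressive measurability in a form without restricted time spaces.\<close>

lemma simp_int_simple_upto:
  assumes "simp_int h J" "0 \<le> t"
  shows "simple_function (borel \<Otimes>\<^sub>M E t) (\<lambda>p. h (min (fst p) t) (snd p))"
  using assms
proof (induction rule: simp_int.induct)
  case (step h J a b B c x)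
  have "simple_function (borel \<Otimes>\<^sub>M E t) (\<lambda>p. indicat_real ({a<..b} \<times> B) (min (fst p) t, snd p) *\<^sub>R (c *\<^sub>R x))"
  proof (cases "a < t")
    case True
    then have [measurable]: "B \<in> sets (E t)" using sets_F_mono[of a t] step.hyps by auto
    let ?S = "{p \<in> space (borel \<Otimes>\<^sub>M E t). min (fst p) t \<in> {a<..b} \<and> snd p \<in> B}"
    have "?S \<in> sets (borel \<Otimes>\<^sub>M E t)" by measurable
    then have "simple_function (borel \<Otimes>\<^sub>M E t) (\<lambda>p. indicat_real ?S p *\<^sub>R (c *\<^sub>R x))"
      by (intro simple_function_scaleR_const simple_function_indicator)
    then show ?thesis
      by (rule simple_function_cong[THEN iffD1, rotated]) (auto simp: indicator_def)
  next
    case False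
    then have "indicat_real ({a<..b} \<times> B) (min (fst p) t, snd p) = 0" for p :: "real \<times> 'b"
      by (auto simp: indicator_def)
    then show ?thesis by simp
  qed
  from simple_function_plus[OF step.IH[OF step.prems] this] show ?case by simp
qed auto

section \<open>Energy of an elementary integrand\<close>

definition energy :: "(real \<Rightarrow> 'b \<Rightarrow> 'h) \<Rightarrow> real \<Rightarrow> real \<Rightarrow> 'b \<Rightarrow> real" where
  "energy h s t \<omega> = (LINT r:{s<..t}|lborel. (norm (h r \<omega>))\<^sup>2)"

lemma simp_int_norm_measurable:
  assumes "simp_int h J"
  shows "(\<lambda>r. norm (h r \<omega>)) \<in> borel_measurable borel"
    and "(\<lambda>p. norm (h (fst p) (snd p))) \<in> borel_measurable (borel \<Otimes>\<^sub>M Q)"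
    and "0 \<le> t \<Longrightarrow> (\<lambda>p. norm (h (min (fst p) t) (snd p))) \<in> borel_measurable (borel \<Otimes>\<^sub>M E t)"
  using borel_measurable_simple_function[OF simp_int_simple_time[OF assms]]
    borel_measurable_simple_function[OF simp_int_simple[OF assms]]
    borel_measurable_simple_function[OF simp_int_simple_upto[OF assms]]
  by auto

lemma simp_int_set_integrable:
  assumes "simp_int h J"
  shows "set_integrable lborel {s<..t} (\<lambda>r. (norm (h r \<omega>))\<^sup>2)"
proof -
  obtain C where C: "C \<ge> 0" "\<And>t \<omega>. norm (h t \<omega>) \<le> C" using simp_int_bounded[OF assms] by blast
  note simp_int_norm_measurable(1)[OF assms, measurable]
  show ?thesis unfolding set_integrable_def
  proof (rule Bochner_Integration.integrable_bound)
    show "integrable lborel (\<lambda>r. indicator {s<..t} r * C\<^sup>2)" by simp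
    show "AE r in lborel. norm (indicat_real {s<..t} r *\<^sub>R (norm (h r \<omega>))\<^sup>2) \<le> norm (indicator {s<..t} r * C\<^sup>2)"
      using C by (auto simp: indicator_def intro!: power_mono)
  qed simp
qed

lemma energy_nonneg: "0 \<le> energy h s t \<omega>"
  unfolding energy_def set_lebesgue_integral_def by (rule integral_nonneg_AE) auto

lemma energy_le:
  assumes "simp_int h J" "s \<le> t" "\<And>r. r \<in> {s<..t} \<Longrightarrow> norm (h r \<omega>) \<le> C"
  shows "energy h s t \<omega> \<le> C\<^sup>2 * (t - s)"
proof -
  have "energy h s t \<omega> \<le> (LINT r:{s<..t}|lborel. C\<^sup>2)"
    unfolding energy_def using assms(3)
    by (intro set_integral_mono simp_int_set_integrable[OF assms(1)])
      (auto simp: set_integrable_def intro!: power_mono)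
  also have "\<dots> = C\<^sup>2 * (t - s)"
    using assms(2) by (simp add: set_lebesgue_integral_def)
  finally show ?thesis .
qed

lemma energy_split:
  assumes "simp_int h J" "s \<le> r" "r \<le> t"
  shows "energy h s t \<omega> = energy h s r \<omega> + energy h r t \<omega>"
proof -
  have "{s<..t} = {s<..r} \<union> {r<..t}" using assms by auto
  then show ?thesis unfolding energy_def
    by (simp only:) (intro set_integral_Un simp_int_set_integrable[OF assms(1)], auto)
qed

text \<open>Capping the time at \<open>t\<close> does not change the integrand on
  \<open>{s<..t}\<close> and leaves only data measurable with respect to \<open>E t\<close>.\<close>

lemma energy_measurable_E:
  assumes "simp_int h J" "0 \<le> t"
  shows "energy h s t \<in> borel_measurable (E t)"
proof -
  note simp_int_norm_measurable(3)[OF assms, measurable]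
  have "(\<lambda>\<omega>. LINT r|lborel. indicator {s<..t} r * (norm (h (min r t) \<omega>))\<^sup>2) \<in> borel_measurable (E t)"
  proof (rule lborel.borel_measurable_lebesgue_integral)
    have "(\<lambda>x. norm (h (min (fst (snd x, fst x)) t) (snd (snd x, fst x)))) \<in> borel_measurable (E t \<Otimes>\<^sub>M lborel)"
      by (rule measurable_compose[OF _ simp_int_norm_measurable(3)[OF assms]]) simp
    then have [measurable]: "(\<lambda>x. norm (h (min (snd x) t) (fst x))) \<in> borel_measurable (E t \<Otimes>\<^sub>M lborel)" by simp
    show "(\<lambda>(\<omega>, r). indicator {s<..t} r * (norm (h (min r t) \<omega>))\<^sup>2) \<in> borel_measurable (E t \<Otimes>\<^sub>M lborel)"
      unfolding case_prod_beta by measurable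
  qed
  also have "(\<lambda>\<omega>. LINT r|lborel. indicator {s<..t} r * (norm (h (min r t) \<omega>))\<^sup>2) = energy h s t"
    unfolding energy_def set_lebesgue_integral_def
    by (intro ext Bochner_Integration.integral_cong) (auto simp: indicator_def min_def)
  finally show ?thesis .
qed

lemma energy_measurable: "simp_int h J \<Longrightarrow> 0 \<le> t \<Longrightarrow> energy h s t \<in> borel_measurable Q"
  using measurable_of_F[OF energy_measurable_E] .

end

section \<open>Moments, martingale property and isometry of elementary integrals\<close>

lemma integral_double_sum:
  fixes f :: "'i \<Rightarrow> 'j \<Rightarrow> 'a \<Rightarrow> real"
  assumes "\<And>i j. i \<in> I \<Longrightarrow> j \<in> K \<Longrightarrow> integrable M (f i j)"
  shows "(\<integral>x. (\<Sum>i\<in>I. \<Sum>j\<in>K. f i j x) \<partial>M) = (\<Sum>i\<in>I. \<Sum>j\<in>K. (\<integral>x. f i j x \<partial>M))"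
  using assms by (simp add: Bochner_Integration.integral_sum Bochner_Integration.integrable_sum)

context cyl_brownian begin

text \<open>\<open>Z\<close> collects the endpoints of all rectangles. If none lies strictly between
  \<open>s\<close> and \<open>t\<close>, every rectangle covers \<open>{s<..t}\<close> or misses it.
  The integrand is then frozen on this interval with coefficients known at \<open>s\<close>, and the
  integral is a finite combination of Brownian increments.\<close>

lemma simp_int_local:
  assumes "simp_int h J"
  shows "\<exists>Z. finite Z \<and> (\<forall>s t. 0 \<le> s \<longrightarrow> s < t \<longrightarrow> Z \<inter> {s<..<t} = {} \<longrightarrow>
    (\<exists>n::nat. \<exists>c B x. (\<forall>i<n. B i \<in> sets (E s)) \<and>
       (\<forall>r\<in>{s<..t}. \<forall>\<omega>. h r \<omega> = (\<Sum>i<n. (indicat_real (B i) \<omega> * c i) *\<^sub>R x i)) \<and>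
       (\<forall>\<omega>. J t \<omega> - J s \<omega> = (\<Sum>i<n. indicat_real (B i) \<omega> * c i * (W (x i) t \<omega> - W (x i) s \<omega>)))))"
  using assms
proof (induction rule: simp_int.induct)
  case zero
  show ?case
    by (intro exI[of _ "{}"] conjI allI impI finite.emptyI exI[of _ "0::nat"]) auto
next
  case (step h J a b B' c' x')
  then obtain Z where Z: "finite Z" and loc: "\<forall>s t. 0 \<le> s \<longrightarrow> s < t \<longrightarrow> Z \<inter> {s<..<t} = {} \<longrightarrow>
    (\<exists>n::nat. \<exists>c B x. (\<forall>i<n. B i \<in> sets (E s)) \<and>
       (\<forall>r\<in>{s<..t}. \<forall>\<omega>. h r \<omega> = (\<Sum>i<n. (indicat_real (B i) \<omega> * c i) *\<^sub>R x i)) \<and>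
       (\<forall>\<omega>. J t \<omega> - J s \<omega> = (\<Sum>i<n. indicat_real (B i) \<omega> * c i * (W (x i) t \<omega> - W (x i) s \<omega>))))"
    using step.IH by (elim exE conjE) (rule that)
  show ?case
  proof (intro exI[of _ "insert a (insert b Z)"] conjI allI impI)
    fix s t :: real assume st: "0 \<le> s" "s < t" "insert a (insert b Z) \<inter> {s<..<t} = {}"
    then have "Z \<inter> {s<..<t} = {}" by auto
    from loc[rule_format, OF st(1,2) this] obtain n :: nat and c B x where
      B: "\<forall>i<n. B i \<in> sets (E s)" and
      h: "\<forall>r\<in>{s<..t}. \<forall>\<omega>. h r \<omega> = (\<Sum>i<n. (indicat_real (B i) \<omega> * c i) *\<^sub>R x i)" and
      J: "\<forall>\<omega>. J t \<omega> - J s \<omega> = (\<Sum>i<n. indicat_real (B i) \<omega> * c i * (W (x i) t \<omega> - W (x i) s \<omega>))"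
      by blast
    show "\<exists>n::nat. \<exists>c B x. (\<forall>i<n. B i \<in> sets (E s)) \<and>
       (\<forall>r\<in>{s<..t}. \<forall>\<omega>. h r \<omega> + indicat_real ({a<..b} \<times> B') (r, \<omega>) *\<^sub>R c' *\<^sub>R x' = (\<Sum>i<n. (indicat_real (B i) \<omega> * c i) *\<^sub>R x i)) \<and>
       (\<forall>\<omega>. J t \<omega> + indicat_real B' \<omega> * ((W x' (min b t) \<omega> - W x' (min a t) \<omega>) * c')
         - (J s \<omega> + indicat_real B' \<omega> * ((W x' (min b s) \<omega> - W x' (min a s) \<omega>) * c'))
         = (\<Sum>i<n. indicat_real (B i) \<omega> * c i * (W (x i) t \<omega> - W (x i) s \<omega>)))"
    proof (cases "a \<le> s \<and> t \<le> b")
      case True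
      then have "B' \<in> sets (E s)" using sets_F_mono[of a s] step.hyps by auto
      moreover have "min b t = t" "min a t = a" "min b s = s" "min a s = a"
        using True st by (auto simp: min_def)
      ultimately show ?thesis
        using B h J True
        by (intro exI[of _ "Suc n"] exI[of _ "c(n := c')"] exI[of _ "B(n := B')"] exI[of _ "x(n := x')"])
          (auto simp: less_Suc_eq indicator_times algebra_simps)
    next
      case False
      \<comment> \<open>Neither endpoint lies strictly between \<open>s\<close> and
        \<open>t\<close>, so a rectangle that does not cover the interval misses it and adds the
        same increment at both times.\<close>
      then have "t \<le> a \<or> b \<le> s" using st by (auto simp: disjoint_iff)
      then have 1: "min b t = min b s \<and> min a t = min a s \<or> min b t = t \<and> min a t = t \<and> min b s = s \<and> min a s = s"
        and 2: "indicat_real ({a<..b} \<times> B') (r, \<omega>) = 0" if "r \<in> {s<..t}" for r \<omega>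
        using st step.hyps that by (auto simp: min_def indicator_def)
      have 3: "W x' (min b t) \<omega> - W x' (min a t) \<omega> = W x' (min b s) \<omega> - W x' (min a s) \<omega>" for \<omega>
        using 1[of t] st by auto
      show ?thesis
        using B h J 2 3 by (intro exI[of _ n] exI[of _ c] exI[of _ B] exI[of _ x]) auto
    qed
  qed (use Z in simp)
qed

text \<open>Each rectangle contributes the fourth moment of one Brownian increment, and
  \<open>(u + v)^4 \<le> 8 * (u^4 + v^4)\<close> adds the contributions. The constant depends on the
  representation, which is harmless: it is applied to a fixed integrand on ever finer grids, where
  \<open>m\<close> steps of length \<open>T / m\<close> have a total of order
  \<open>1 / m\<close>.\<close>

lemma simp_int_fourth_moment:
  assumes "simp_int h J"
  shows "\<exists>C\<ge>0. \<forall>s t. 0 \<le> s \<longrightarrow> s \<le> t \<longrightarrow>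
    integrable Q (\<lambda>\<omega>. (J t \<omega> - J s \<omega>) ^ 4) \<and> (\<integral>\<omega>. (J t \<omega> - J s \<omega>) ^ 4 \<partial>Q) \<le> C * (t - s)\<^sup>2"
  using assms
proof (induction rule: simp_int.induct)
  case zero
  show ?case by (intro exI[of _ 0]) auto
next
  case (step h J a b B c x)
  from step.IH obtain C where C0: "C \<ge> 0" and C1: "\<forall>s t. 0 \<le> s \<longrightarrow> s \<le> t \<longrightarrow>
    integrable Q (\<lambda>\<omega>. (J t \<omega> - J s \<omega>) ^ 4) \<and> (\<integral>\<omega>. (J t \<omega> - J s \<omega>) ^ 4 \<partial>Q) \<le> C * (t - s)\<^sup>2"
    by (elim exE conjE) (rule that)
  then have C: "C \<ge> 0" "\<And>s t. 0 \<le> s \<Longrightarrow> s \<le> t \<Longrightarrow> integrable Q (\<lambda>\<omega>. (J t \<omega> - J s \<omega>) ^ 4)"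
    "\<And>s t. 0 \<le> s \<Longrightarrow> s \<le> t \<Longrightarrow> (\<integral>\<omega>. (J t \<omega> - J s \<omega>) ^ 4 \<partial>Q) \<le> C * (t - s)\<^sup>2" by blast+
  let ?C = "8 * (C + c ^ 4 * (3 * norm x ^ 4))"
  show ?case
  proof (intro exI[of _ ?C] conjI allI impI)
    show "0 \<le> ?C" using C by auto
    fix s t :: real assume st: "0 \<le> s" "s \<le> t"
    have B [measurable]: "B \<in> sets Q" using sets_F_P step.hyps by blast
    have J [measurable]: "J s \<in> borel_measurable Q" "J t \<in> borel_measurable Q"
      using simp_int_measurable[OF step.hyps(1)] st by auto
    \<comment> \<open>\<open>s'\<close> and \<open>t'\<close> delimit the part of
      \<open>{s<..t}\<close> inside \<open>{a<..b}\<close>, with \<open>t' = s'\<close> if there is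
      none.\<close>
    define s' where "s' = max s a"
    define t' where "t' = max (max s a) (min t b)"
    have s't': "0 \<le> s'" "s' \<le> t'" "t' - s' \<le> t - s"
      using st step.hyps by (auto simp: s'_def t'_def max_def min_def)
    have [measurable]: "W x u \<in> borel_measurable Q" if "0 \<le> u" for u using that by auto
    have W4: "integrable Q (\<lambda>\<omega>. (W x t' \<omega> - W x s' \<omega>) ^ 4)
      \<and> (\<integral>\<omega>. (W x t' \<omega> - W x s' \<omega>) ^ 4 \<partial>Q) \<le> 3 * norm x ^ 4 * (t - s)\<^sup>2"
    proof (cases "s' = t'")
      case False
      then have "s' < t'" using s't' by simp
      moreover have "(t' - s')\<^sup>2 \<le> (t - s)\<^sup>2" using s't' by (intro power_mono) auto
      ultimately show ?thesis
        using W_increment_moment(1)[OF s't'(1), of t' x 4] W_increment_moment(3)[OF s't'(1), of t' x]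
        by (auto intro!: mult_left_mono)
    qed auto
    define J' where "J' t \<omega> = J t \<omega> + indicat_real B \<omega> * ((W x (min b t) \<omega> - W x (min a t) \<omega>) * c)" for t \<omega>
    have J': "simp_int (\<lambda>t \<omega>. h t \<omega> + indicat_real ({a<..b} \<times> B) (t, \<omega>) *\<^sub>R (c *\<^sub>R x)) J'"
      unfolding J'_def by (rule simp_int.step) fact+
    have [measurable]: "J' s \<in> borel_measurable Q" "J' t \<in> borel_measurable Q"
      using simp_int_measurable[OF J'] st by auto
    have eq: "J' t \<omega> - J' s \<omega> = (J t \<omega> - J s \<omega>) + indicat_real B \<omega> * (c * (W x t' \<omega> - W x s' \<omega>))" for \<omega>
    proof -
      have "W x (min b t) \<omega> - W x (min a t) \<omega> - (W x (min b s) \<omega> - W x (min a s) \<omega>) = W x t' \<omega> - W x s' \<omega>"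
        using st step.hyps by (auto simp: s'_def t'_def max_def min_def)
      moreover have "J' t \<omega> - J' s \<omega> = (J t \<omega> - J s \<omega>) + indicat_real B \<omega> *
          (c * (W x (min b t) \<omega> - W x (min a t) \<omega> - (W x (min b s) \<omega> - W x (min a s) \<omega>)))"
        unfolding J'_def by (simp add: algebra_simps)
      ultimately show ?thesis by simp
    qed
    have bd: "(J' t \<omega> - J' s \<omega>) ^ 4 \<le> 8 * ((J t \<omega> - J s \<omega>) ^ 4 + c ^ 4 * (W x t' \<omega> - W x s' \<omega>) ^ 4)" for \<omega>
    proof -
      have "(indicat_real B \<omega> * (c * (W x t' \<omega> - W x s' \<omega>))) ^ 4 \<le> c ^ 4 * (W x t' \<omega> - W x s' \<omega>) ^ 4"
        by (auto simp: indicator_def power_mult_distrib)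
      then have "8 * ((J t \<omega> - J s \<omega>) ^ 4 + (indicat_real B \<omega> * (c * (W x t' \<omega> - W x s' \<omega>))) ^ 4)
          \<le> 8 * ((J t \<omega> - J s \<omega>) ^ 4 + c ^ 4 * (W x t' \<omega> - W x s' \<omega>) ^ 4)"
        by (intro mult_left_mono add_left_mono) auto
      then show ?thesis
        unfolding eq by (rule order_trans[OF power4_add_le])
    qed
    have i: "integrable Q (\<lambda>\<omega>. 8 * ((J t \<omega> - J s \<omega>) ^ 4 + c ^ 4 * (W x t' \<omega> - W x s' \<omega>) ^ 4))"
      using C(2)[OF st] W4 by auto
    have i': "integrable Q (\<lambda>\<omega>. (J' t \<omega> - J' s \<omega>) ^ 4)"
      by (rule Bochner_Integration.integrable_bound[OF i]) (use bd in \<open>auto intro!: order_trans[OF bd]\<close>)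
    then show "integrable Q (\<lambda>\<omega>. (J t \<omega> + indicat_real B \<omega> * ((W x (min b t) \<omega> - W x (min a t) \<omega>) * c)
       - (J s \<omega> + indicat_real B \<omega> * ((W x (min b s) \<omega> - W x (min a s) \<omega>) * c))) ^ 4)"
      unfolding J'_def .
    have "(\<integral>\<omega>. (J' t \<omega> - J' s \<omega>) ^ 4 \<partial>Q) \<le> (\<integral>\<omega>. 8 * ((J t \<omega> - J s \<omega>) ^ 4 + c ^ 4 * (W x t' \<omega> - W x s' \<omega>) ^ 4) \<partial>Q)"
      by (rule integral_mono[OF i' i bd])
    also have "\<dots> = 8 * ((\<integral>\<omega>. (J t \<omega> - J s \<omega>) ^ 4 \<partial>Q) + c ^ 4 * (\<integral>\<omega>. (W x t' \<omega> - W x s' \<omega>) ^ 4 \<partial>Q))"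
      using C(2)[OF st] W4 by simp
    also have "\<dots> \<le> 8 * (C * (t - s)\<^sup>2 + c ^ 4 * (3 * norm x ^ 4 * (t - s)\<^sup>2))"
      using C(3)[OF st] W4 by (intro mult_left_mono add_mono) auto
    finally show "(\<integral>\<omega>. (J t \<omega> + indicat_real B \<omega> * ((W x (min b t) \<omega> - W x (min a t) \<omega>) * c)
       - (J s \<omega> + indicat_real B \<omega> * ((W x (min b s) \<omega> - W x (min a s) \<omega>) * c))) ^ 4 \<partial>Q) \<le> ?C * (t - s)\<^sup>2"
      unfolding J'_def by (simp add: algebra_simps)
  qed
qed

text \<open>Lower moments are finite because \<open>x^2 \<le> 1 + x^4\<close>, and because the
  integral starts at 0.\<close>

lemma simp_int_square_integrable:
  assumes "simp_int h J" "0 \<le> s" "0 \<le> t"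
  shows "integrable Q (\<lambda>\<omega>. (J t \<omega> - J s \<omega>)\<^sup>2)" "integrable Q (\<lambda>\<omega>. J t \<omega> - J s \<omega>)"
    "integrable Q (\<lambda>\<omega>. (J t \<omega>)\<^sup>2)"
proof -
  have [measurable]: "J u \<in> borel_measurable Q" if "0 \<le> u" for u
    using simp_int_measurable[OF assms(1) that] .
  have 4: "integrable Q (\<lambda>\<omega>. (J v \<omega> - J u \<omega>) ^ 4)" if "0 \<le> u" "u \<le> v" for u v
    using simp_int_fourth_moment[OF assms(1)] that by blast
  have i4: "integrable Q (\<lambda>\<omega>. (J v \<omega> - J u \<omega>) ^ 4)" if "0 \<le> u" "0 \<le> v" for u v
  proof (cases "u \<le> v")
    case False
    have "(J v \<omega> - J u \<omega>) ^ 4 = (J u \<omega> - J v \<omega>) ^ 4" for \<omega> by (simp add: power_even_abs_numeral power4_eq_xxxx algebra_simps)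
    then show ?thesis using 4[of v u] False that by simp
  qed (use 4 that in auto)
  have sq: "x\<^sup>2 \<le> 1 + x ^ 4" for x :: real
  proof -
    have "2 * x\<^sup>2 \<le> 1 + (x\<^sup>2)\<^sup>2" using sum_squares_bound[of 1 "x\<^sup>2"] by simp
    then have "2 * x\<^sup>2 \<le> 1 + x ^ 4" by simp
    then show ?thesis using zero_le_power2[of x] by linarith
  qed
  have i2: "integrable Q (\<lambda>\<omega>. (J v \<omega> - J u \<omega>)\<^sup>2)" if "0 \<le> u" "0 \<le> v" for u v
    by (rule Bochner_Integration.integrable_bound[of _ "\<lambda>\<omega>. 1 + (J v \<omega> - J u \<omega>) ^ 4"])
      (use i4[OF that] that sq in \<open>auto intro!: order_trans[OF sq]\<close>)
  show "integrable Q (\<lambda>\<omega>. (J t \<omega> - J s \<omega>)\<^sup>2)" using i2 assms by auto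
  show "integrable Q (\<lambda>\<omega>. J t \<omega> - J s \<omega>)"
    using integrable_mult_of_squares[of "\<lambda>\<omega>. J t \<omega> - J s \<omega>" Q "\<lambda>_. 1"] i2 assms by simp
  show "integrable Q (\<lambda>\<omega>. (J t \<omega>)\<^sup>2)"
    using i2[of 0 t] assms simp_int_0[OF assms(1)] by simp
qed

lemma energy_integrable:
  assumes "simp_int h J" "0 \<le> s" "s \<le> t"
  shows "integrable Q (energy h s t)"
proof -
  obtain C where C: "C \<ge> 0" "\<And>t \<omega>. norm (h t \<omega>) \<le> C" using simp_int_bounded[OF assms(1)] by blast
  show ?thesis
    by (rule integrable_const_bound[of _ "C\<^sup>2 * (t - s)"])
      (use energy_le[OF assms(1,3)] C energy_nonneg energy_measurable[OF assms(1)] assms in auto)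
qed

text \<open>On an interval where the integrand is frozen, the squared increment expands into
  products of Brownian increments weighted by events of \<open>E s\<close>, whose expectations are
  known covariances. The energy is the length of the interval times a squared norm, and expanding
  that norm gives the same double sum.\<close>

lemma simp_int_martingale_local:
  assumes "simp_int h J"
  shows "\<exists>Z. finite Z \<and> (\<forall>s t A. 0 \<le> s \<longrightarrow> s < t \<longrightarrow> Z \<inter> {s<..<t} = {} \<longrightarrow> A \<in> sets (E s) \<longrightarrow>
    (\<integral>\<omega>. indicator A \<omega> * (J t \<omega> - J s \<omega>) \<partial>Q) = 0 \<and>
    (\<integral>\<omega>. indicator A \<omega> * ((J t \<omega> - J s \<omega>)\<^sup>2 - energy h s t \<omega>) \<partial>Q) = 0)"
proof -
  obtain Z where Z: "finite Z" and loc: "\<forall>s t. 0 \<le> s \<longrightarrow> s < t \<longrightarrow> Z \<inter> {s<..<t} = {} \<longrightarrow>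
    (\<exists>n::nat. \<exists>c B x. (\<forall>i<n. B i \<in> sets (E s)) \<and>
       (\<forall>r\<in>{s<..t}. \<forall>\<omega>. h r \<omega> = (\<Sum>i<n. (indicat_real (B i) \<omega> * c i) *\<^sub>R x i)) \<and>
       (\<forall>\<omega>. J t \<omega> - J s \<omega> = (\<Sum>i<n. indicat_real (B i) \<omega> * c i * (W (x i) t \<omega> - W (x i) s \<omega>))))"
    using simp_int_local[OF assms] by (elim exE conjE) (rule that)
  show ?thesis
  proof (intro exI[of _ Z] conjI Z allI impI)
    fix s t :: real and A assume st: "0 \<le> s" "s < t" "Z \<inter> {s<..<t} = {}" and A: "A \<in> sets (E s)"
    from loc[rule_format, OF st] obtain n :: nat and c B x where
      B: "\<And>i. i < n \<Longrightarrow> B i \<in> sets (E s)" and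
      h: "\<And>r \<omega>. r \<in> {s<..t} \<Longrightarrow> h r \<omega> = (\<Sum>i<n. (indicat_real (B i) \<omega> * c i) *\<^sub>R x i)" and
      J: "\<And>\<omega>. J t \<omega> - J s \<omega> = (\<Sum>i<n. indicat_real (B i) \<omega> * c i * (W (x i) t \<omega> - W (x i) s \<omega>))"
      by blast
    have [measurable]: "A \<in> sets Q" using A sets_F_P by blast
    have BQ [measurable]: "B i \<in> sets Q" if "i < n" for i using B[OF that] sets_F_P by blast
    let ?D = "\<lambda>i \<omega>. W (x i) t \<omega> - W (x i) s \<omega>"
    have i1: "integrable Q (?D i)" for i
      using W_increment_moment(1)[OF st(1,2), of _ 1] by simp
    have i2: "integrable Q (\<lambda>\<omega>. ?D i \<omega> * ?D j \<omega>)" for i j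
      using W_increment_cross(1)[OF st(1,2) sets.top] .
    have ii: "integrable Q (\<lambda>\<omega>. indicator S \<omega> * f \<omega>)" if "S \<in> sets (E s)" "integrable Q f" for S and f :: "'b \<Rightarrow> real"
      using that sets_F_P integrable_indicator_mult by blast
    have "(\<integral>\<omega>. indicator A \<omega> * (J t \<omega> - J s \<omega>) \<partial>Q) = (\<integral>\<omega>. (\<Sum>i<n. c i * (indicator (A \<inter> B i) \<omega> * ?D i \<omega>)) \<partial>Q)"
      by (simp add: J sum_distrib_left indicator_inter_arith mult_ac)
    also have "\<dots> = (\<Sum>i<n. c i * (\<integral>\<omega>. indicator (A \<inter> B i) \<omega> * ?D i \<omega> \<partial>Q))"
      using B A i1 by (subst Bochner_Integration.integral_sum) (auto intro!: integrable_mult_right ii)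
    also have "\<dots> = 0"
    proof (rule sum.neutral, safe)
      fix i assume "i < n"
      then have "A \<inter> B i \<in> sets (E s)" using A B by auto
      from W_increment_indep[OF st(1,2) this, of "\<lambda>y. y" "x i"] i1[of i] W_increment_moment(2)[OF st(1,2), of "x i"]
      show "c i * (\<integral>\<omega>. indicator (A \<inter> B i) \<omega> * ?D i \<omega> \<partial>Q) = 0" by simp
    qed
    finally show "(\<integral>\<omega>. indicator A \<omega> * (J t \<omega> - J s \<omega>) \<partial>Q) = 0" .
    have "(\<integral>\<omega>. indicator A \<omega> * (J t \<omega> - J s \<omega>)\<^sup>2 \<partial>Q)
      = (\<integral>\<omega>. (\<Sum>i<n. \<Sum>j<n. (c i * c j) * (indicator (A \<inter> B i \<inter> B j) \<omega> * (?D i \<omega> * ?D j \<omega>))) \<partial>Q)"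
      by (simp add: J power2_eq_square sum_product sum_distrib_left indicator_inter_arith mult_ac)
    also have "\<dots> = (\<Sum>i<n. \<Sum>j<n. (c i * c j) * (\<integral>\<omega>. indicator (A \<inter> B i \<inter> B j) \<omega> * (?D i \<omega> * ?D j \<omega>) \<partial>Q))"
      using B A i2 by (subst integral_double_sum) (auto intro!: integrable_mult_right ii)
    also have "\<dots> = (\<Sum>i<n. \<Sum>j<n. (c i * c j) * (measure Q (A \<inter> B i \<inter> B j) * inner (x i) (x j) * (t - s)))"
      using B A by (intro sum.cong refl) (subst W_increment_cross(2)[OF st(1,2)], auto)
    finally have 1: "(\<integral>\<omega>. indicator A \<omega> * (J t \<omega> - J s \<omega>)\<^sup>2 \<partial>Q) = \<dots>" .
    have en: "energy h s t \<omega> = (t - s) * (\<Sum>i<n. \<Sum>j<n. (c i * c j) * inner (x i) (x j) * (indicator (B i) \<omega> * indicator (B j) \<omega>))" for \<omega>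
    proof -
      have "energy h s t \<omega> = (LINT r:{s<..t}|lborel. (norm (\<Sum>i<n. (indicat_real (B i) \<omega> * c i) *\<^sub>R x i))\<^sup>2)"
        unfolding energy_def by (rule set_lebesgue_integral_cong) (auto simp: h)
      also have "\<dots> = (t - s) * (norm (\<Sum>i<n. (indicat_real (B i) \<omega> * c i) *\<^sub>R x i))\<^sup>2"
        using st by (simp add: set_lebesgue_integral_def)
      also have "(norm (\<Sum>i<n. (indicat_real (B i) \<omega> * c i) *\<^sub>R x i))\<^sup>2
          = (\<Sum>i<n. \<Sum>j<n. (c i * c j) * inner (x i) (x j) * (indicator (B i) \<omega> * indicator (B j) \<omega>))"
        by (simp add: power2_norm_eq_inner inner_sum_left inner_sum_right sum_distrib_left mult_ac inner_commute)
      finally show ?thesis .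
    qed
    have "(\<integral>\<omega>. indicator A \<omega> * energy h s t \<omega> \<partial>Q)
       = (\<integral>\<omega>. (\<Sum>i<n. \<Sum>j<n. ((c i * c j) * inner (x i) (x j) * (t - s)) * indicator (A \<inter> B i \<inter> B j) \<omega>) \<partial>Q)"
      unfolding en by (simp add: sum_distrib_left indicator_inter_arith mult_ac)
    also have "\<dots> = (\<Sum>i<n. \<Sum>j<n. ((c i * c j) * inner (x i) (x j) * (t - s)) * measure Q (A \<inter> B i \<inter> B j))"
      using BQ by (subst integral_double_sum) (auto intro!: integrable_mult_right simp: emeasure_eq_measure)
    finally have 2: "(\<integral>\<omega>. indicator A \<omega> * energy h s t \<omega> \<partial>Q) = (\<integral>\<omega>. indicator A \<omega> * (J t \<omega> - J s \<omega>)\<^sup>2 \<partial>Q)"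
      unfolding 1 by (simp add: mult_ac)
    have "integrable Q (\<lambda>\<omega>. indicator A \<omega> * energy h s t \<omega>)" "integrable Q (\<lambda>\<omega>. indicator A \<omega> * (J t \<omega> - J s \<omega>)\<^sup>2)"
      using energy_integrable[OF assms] simp_int_square_integrable[OF assms] st
      by (auto intro!: integrable_indicator_mult)
    then show "(\<integral>\<omega>. indicator A \<omega> * ((J t \<omega> - J s \<omega>)\<^sup>2 - energy h s t \<omega>) \<partial>Q) = 0"
      using 2 by (simp add: right_diff_distrib)
  qed
qed

text \<open>Induction on the number of breakpoints strictly between \<open>s\<close> and
  \<open>t\<close>. Cutting at a breakpoint \<open>r\<close> leaves fewer of them on either side;
  increments and energies add.\<close>

lemma simp_int_martingale_sets:
  assumes "simp_int h J" "0 \<le> s" "s \<le> t" "A \<in> sets (E s)"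
  shows "(\<integral>\<omega>. indicator A \<omega> * (J t \<omega> - J s \<omega>) \<partial>Q) = 0"
    and "(\<integral>\<omega>. indicator A \<omega> * ((J t \<omega> - J s \<omega>)\<^sup>2 - energy h s t \<omega>) \<partial>Q) = 0"
proof -
  obtain Z where Z: "finite Z" and loc: "\<And>s t A. 0 \<le> s \<Longrightarrow> s < t \<Longrightarrow> Z \<inter> {s<..<t} = {} \<Longrightarrow> A \<in> sets (E s) \<Longrightarrow>
    (\<integral>\<omega>. indicator A \<omega> * (J t \<omega> - J s \<omega>) \<partial>Q) = 0 \<and>
    (\<integral>\<omega>. indicator A \<omega> * ((J t \<omega> - J s \<omega>)\<^sup>2 - energy h s t \<omega>) \<partial>Q) = 0"
    using simp_int_martingale_local[OF assms(1)] by blast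
  note sq = simp_int_square_integrable[OF assms(1)]
  have "(\<integral>\<omega>. indicator A \<omega> * (J t \<omega> - J s \<omega>) \<partial>Q) = 0 \<and>
    (\<integral>\<omega>. indicator A \<omega> * ((J t \<omega> - J s \<omega>)\<^sup>2 - energy h s t \<omega>) \<partial>Q) = 0"
    using assms(2-4)
  proof (induction "card (Z \<inter> {s<..<t})" arbitrary: s t A rule: less_induct)
    case less
    show ?case
    proof (cases "s = t")
      case True
      then show ?thesis by (simp add: energy_def set_lebesgue_integral_def)
    next
      case False
      show ?thesis
      proof (cases "Z \<inter> {s<..<t} = {}")
        case True
        then show ?thesis using loc less.prems False by auto
      next
        case ne: False
        then obtain r where r: "r \<in> Z" "s < r" "r < t" by auto
        have c1: "card (Z \<inter> {s<..<r}) < card (Z \<inter> {s<..<t})"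
          using r Z by (intro psubset_card_mono) auto
        have c2: "card (Z \<inter> {r<..<t}) < card (Z \<inter> {s<..<t})"
          using r Z by (intro psubset_card_mono) auto
        have A: "A \<in> sets (E r)" "A \<in> sets Q" using less.prems sets_F_mono[of s r] sets_F_P r by auto
        have I1: "(\<integral>\<omega>. indicator A \<omega> * (J r \<omega> - J s \<omega>) \<partial>Q) = 0"
          "(\<integral>\<omega>. indicator A \<omega> * ((J r \<omega> - J s \<omega>)\<^sup>2 - energy h s r \<omega>) \<partial>Q) = 0"
          using less.hyps[OF c1, of A] less.prems r by auto
        have I2: "(\<integral>\<omega>. indicator A \<omega> * (J t \<omega> - J r \<omega>) \<partial>Q) = 0"
          "(\<integral>\<omega>. indicator A \<omega> * ((J t \<omega> - J r \<omega>)\<^sup>2 - energy h r t \<omega>) \<partial>Q) = 0"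
           if "A \<in> sets (E r)" for A
          using less.hyps[OF c2, of A] less.prems r that by auto
        have i: "integrable Q (\<lambda>\<omega>. J r \<omega> - J s \<omega>)" "integrable Q (\<lambda>\<omega>. J t \<omega> - J r \<omega>)"
          using less.prems r by (auto intro!: sq)
        have j: "integrable Q (\<lambda>\<omega>. (J r \<omega> - J s \<omega>)\<^sup>2 - energy h s r \<omega>)" "integrable Q (\<lambda>\<omega>. (J t \<omega> - J r \<omega>)\<^sup>2 - energy h r t \<omega>)"
          using less.prems r by (auto intro!: sq Bochner_Integration.integrable_diff energy_integrable[OF assms(1)])
        have mE: "J r \<in> borel_measurable (E r)" "J s \<in> borel_measurable (E r)"
          using less.prems r by (auto intro!: measurable_F_mono[OF simp_int_adapted[OF assms(1)]])
        have [measurable]: "J r \<in> borel_measurable Q" "J s \<in> borel_measurable Q" "J t \<in> borel_measurable Q"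
          using less.prems r by (auto intro!: simp_int_measurable[OF assms(1)])
        have k: "integrable Q (\<lambda>\<omega>. (J r \<omega> - J s \<omega>) * (J t \<omega> - J r \<omega>))"
          using less.prems r by (intro integrable_mult_of_squares sq) auto
        have "integrable Q (\<lambda>\<omega>. (indicator A \<omega> * (J r \<omega> - J s \<omega>)) * (J t \<omega> - J r \<omega>))"
          using integrable_indicator_mult[OF A(2) k] by (simp add: mult_ac)
        \<comment> \<open>The cross term of the square vanishes because the first increment is known
          at \<open>r\<close>, after which the second has mean zero.\<close>
        moreover have "(\<lambda>\<omega>. indicator A \<omega> * (J r \<omega> - J s \<omega>)) \<in> borel_measurable (E r)"
          using mE A(1) by simp
        ultimately have "(\<integral>\<omega>. (indicator A \<omega> * (J r \<omega> - J s \<omega>)) * (J t \<omega> - J r \<omega>) \<partial>Q) = 0"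
          using integral_mult_zero[OF i(2) _ _ I2(1)] by blast
        then have k0: "(\<integral>\<omega>. indicator A \<omega> * ((J r \<omega> - J s \<omega>) * (J t \<omega> - J r \<omega>)) \<partial>Q) = 0"
          by (simp add: mult_ac)
        have "(\<integral>\<omega>. indicator A \<omega> * (J t \<omega> - J s \<omega>) \<partial>Q)
           = (\<integral>\<omega>. indicator A \<omega> * (J r \<omega> - J s \<omega>) + indicator A \<omega> * (J t \<omega> - J r \<omega>) \<partial>Q)"
          by (simp add: algebra_simps)
        also have "\<dots> = 0" using i I1(1) I2(1)[OF A(1)]
          by (subst Bochner_Integration.integral_add) (auto intro!: integrable_indicator_mult A)
        finally have 1: "(\<integral>\<omega>. indicator A \<omega> * (J t \<omega> - J s \<omega>) \<partial>Q) = 0" .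
        have "energy h s t \<omega> = energy h s r \<omega> + energy h r t \<omega>" for \<omega>
          using energy_split[OF assms(1)] r by simp
        then have "(\<integral>\<omega>. indicator A \<omega> * ((J t \<omega> - J s \<omega>)\<^sup>2 - energy h s t \<omega>) \<partial>Q)
           = (\<integral>\<omega>. indicator A \<omega> * ((J r \<omega> - J s \<omega>)\<^sup>2 - energy h s r \<omega>)
            + (indicator A \<omega> * ((J t \<omega> - J r \<omega>)\<^sup>2 - energy h r t \<omega>)
            + 2 * (indicator A \<omega> * ((J r \<omega> - J s \<omega>) * (J t \<omega> - J r \<omega>)))) \<partial>Q)"
          by (simp add: algebra_simps power2_eq_square)
        also have "\<dots> = 0" using j k I1(2) I2(2)[OF A(1)] k0 integrable_indicator_mult[OF A(2)] by simp
        finally show ?thesis using 1 by simp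
      qed
    qed
  qed
  then show "(\<integral>\<omega>. indicator A \<omega> * (J t \<omega> - J s \<omega>) \<partial>Q) = 0"
    and "(\<integral>\<omega>. indicator A \<omega> * ((J t \<omega> - J s \<omega>)\<^sup>2 - energy h s t \<omega>) \<partial>Q) = 0" by auto
qed

lemma simp_int_martingale:
  assumes "simp_int h J" "0 \<le> s" "s \<le> t" "Y \<in> borel_measurable (E s)"
  shows "integrable Q (\<lambda>\<omega>. Y \<omega> * (J t \<omega> - J s \<omega>)) \<Longrightarrow> (\<integral>\<omega>. Y \<omega> * (J t \<omega> - J s \<omega>) \<partial>Q) = 0"
    and "integrable Q (\<lambda>\<omega>. Y \<omega> * ((J t \<omega> - J s \<omega>)\<^sup>2 - energy h s t \<omega>)) \<Longrightarrow>
      (\<integral>\<omega>. Y \<omega> * ((J t \<omega> - J s \<omega>)\<^sup>2 - energy h s t \<omega>) \<partial>Q) = 0"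
proof -
  show "(\<integral>\<omega>. Y \<omega> * (J t \<omega> - J s \<omega>) \<partial>Q) = 0" if "integrable Q (\<lambda>\<omega>. Y \<omega> * (J t \<omega> - J s \<omega>))"
    using assms(2,3)
    by (intro integral_mult_zero[OF _ assms(4) that] simp_int_martingale_sets[OF assms(1-3)]
        simp_int_square_integrable[OF assms(1)]) auto
  show "(\<integral>\<omega>. Y \<omega> * ((J t \<omega> - J s \<omega>)\<^sup>2 - energy h s t \<omega>) \<partial>Q) = 0"
    if "integrable Q (\<lambda>\<omega>. Y \<omega> * ((J t \<omega> - J s \<omega>)\<^sup>2 - energy h s t \<omega>))"
    using assms(2,3)
    by (intro integral_mult_zero[OF _ assms(4) that] simp_int_martingale_sets[OF assms(1-3)]
        simp_int_square_integrable[OF assms(1)] Bochner_Integration.integrable_diff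
        energy_integrable[OF assms(1-3)]) auto
qed

lemma simp_int_isometry:
  assumes "simp_int h J" "0 \<le> s" "s \<le> t"
  shows "(\<integral>\<omega>. (J t \<omega> - J s \<omega>)\<^sup>2 \<partial>Q) = (\<integral>\<omega>. energy h s t \<omega> \<partial>Q)"
  using simp_int_martingale(2)[OF assms, of "\<lambda>_. 1"] simp_int_square_integrable[OF assms(1)]
    energy_integrable[OF assms] assms by simp

end

section \<open>Energy and size of elementary integrals\<close>

lemma square_diff_le: "(a - b)\<^sup>2 \<le> 2 * a\<^sup>2 + 2 * b\<^sup>2" for a b :: real
  using zero_le_power2[of "a + b"] by (simp add: power2_diff power2_sum)

lemma square_add_le: "(a + b)\<^sup>2 \<le> 2 * a\<^sup>2 + 2 * b\<^sup>2" for a b :: real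
  using square_diff_le[of a "- b"] by simp

text \<open>\<open>k\<close> is a stopping index on the grid: for a condition that is never regained
  once lost, it counts the initial steps on which the condition holds, capped at
  \<open>m\<close>.\<close>

lemma decreasing_threshold:
  fixes P :: "nat \<Rightarrow> bool"
  assumes "\<And>i. P (Suc i) \<Longrightarrow> P i"
  obtains k where "k \<le> m" "\<And>i. i < k \<Longrightarrow> P i" "\<And>i. k \<le> i \<Longrightarrow> i < m \<Longrightarrow> \<not> P i"
proof -
  have "\<exists>k\<le>m. (\<forall>i<k. P i) \<and> (\<forall>i. k \<le> i \<longrightarrow> i < m \<longrightarrow> \<not> P i)"
  proof (induction m)
    case (Suc m)
    then obtain k where k: "k \<le> m" "\<forall>i<k. P i" "\<forall>i. k \<le> i \<longrightarrow> i < m \<longrightarrow> \<not> P i" by blast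
    show ?case
    proof (cases "P m")
      case True
      have "P (m - j)" for j
      proof (induction j)
        case (Suc j)
        show ?case
        proof (cases "j < m")
          case True
          then have "m - j = Suc (m - Suc j)" by simp
          then show ?thesis using assms[of "m - Suc j"] Suc by simp
        qed (use Suc in simp)
      qed (use True in simp)
      then have "P i" if "i \<le> m" for i
        using that diff_diff_cancel[OF that] by metis
      then show ?thesis by (intro exI[of _ "Suc m"]) (auto simp: less_Suc_eq_le)
    next
      case False
      then show ?thesis using k by (intro exI[of _ k]) (auto simp: less_Suc_eq)
    qed
  qed auto
  then show ?thesis using that by blast
qed

lemma grid_index:
  fixes t \<delta> :: real
  assumes "0 < \<delta>" "0 < t" "t \<le> real m * \<delta>"
  obtains i where "i < m" "real i * \<delta> < t" "t \<le> real (Suc i) * \<delta>"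
proof -
  define k where "k = (LEAST k. t \<le> real k * \<delta>)"
  have k: "t \<le> real k * \<delta>" "k \<le> m"
    unfolding k_def using assms by (auto intro: LeastI Least_le)
  then obtain i where i: "k = Suc i" using assms by (cases k) auto
  have "\<not> t \<le> real i * \<delta>"
    using not_less_Least[of i "\<lambda>k. t \<le> real k * \<delta>"] i unfolding k_def by simp
  then show ?thesis using that[of i] k i by auto
qed

lemma grid_index_unique:
  fixes t \<delta> :: real
  assumes "0 < \<delta>" "real i * \<delta> < t" "t \<le> real (Suc i) * \<delta>" "real j * \<delta> < t" "t \<le> real (Suc j) * \<delta>"
  shows "i = j"
proof -
  have "real i * \<delta> < real (Suc j) * \<delta>" "real j * \<delta> < real (Suc i) * \<delta>" using assms by linarith+
  then have "real i < real (Suc j)" "real j < real (Suc i)" using assms(1) by (auto simp: mult_less_cancel_right)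
  then show ?thesis by simp
qed

section \<open>Stopping at grid times\<close>

context cyl_brownian begin

text \<open>Intended for events \<open>D i\<close> that decrease in \<open>i\<close> and are known
  at the left end of the \<open>i\<close>-th interval. Then \<open>gate\<close> is \<open>h\<close>
  stopped at the first grid time at which the event fails, and \<open>gate_int\<close> is
  \<open>J\<close> stopped there.\<close>

definition gate :: "(real \<Rightarrow> 'b \<Rightarrow> 'h) \<Rightarrow> real \<Rightarrow> nat \<Rightarrow> (nat \<Rightarrow> 'b set) \<Rightarrow> real \<Rightarrow> 'b \<Rightarrow> 'h" where
  "gate h \<delta> m D t \<omega> = (\<Sum>i<m. indicat_real ({real i * \<delta><..real (Suc i) * \<delta>} \<times> D i) (t, \<omega>) *\<^sub>R h t \<omega>)"

definition gate_int :: "(real \<Rightarrow> 'b \<Rightarrow> real) \<Rightarrow> real \<Rightarrow> nat \<Rightarrow> (nat \<Rightarrow> 'b set) \<Rightarrow> real \<Rightarrow> 'b \<Rightarrow> real" where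
  "gate_int J \<delta> m D t \<omega> =
    (\<Sum>i<m. indicat_real (D i) \<omega> * (J (min (real (Suc i) * \<delta>) t) \<omega> - J (min (real i * \<delta>) t) \<omega>))"

lemma simp_int_gate:
  assumes "simp_int h J" "0 < \<delta>" "\<And>i. i < m \<Longrightarrow> D i \<in> sets (E (real i * \<delta>))"
  shows "simp_int (gate h \<delta> m D) (gate_int J \<delta> m D)"
  unfolding gate_def gate_int_def
proof (rule simp_int_sum)
  fix i assume "i \<in> {..<m}"
  then show "simp_int (\<lambda>t \<omega>. indicat_real ({real i * \<delta><..real (Suc i) * \<delta>} \<times> D i) (t, \<omega>) *\<^sub>R h t \<omega>)
      (\<lambda>t \<omega>. indicat_real (D i) \<omega> * (J (min (real (Suc i) * \<delta>) t) \<omega> - J (min (real i * \<delta>) t) \<omega>))"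
    using assms(2) assms(3)[of i] mult_right_mono[of "real i" "real (Suc i)" \<delta>]
    by (intro simp_int_restrict[OF assms(1)]) simp_all
qed

lemma gate_eq:
  assumes "0 < \<delta>" "i < m" "real i * \<delta> < t" "t \<le> real (Suc i) * \<delta>"
  shows "gate h \<delta> m D t \<omega> = indicat_real (D i) \<omega> *\<^sub>R h t \<omega>"
proof -
  have "gate h \<delta> m D t \<omega> = (\<Sum>j<m. if j = i then indicat_real (D i) \<omega> *\<^sub>R h t \<omega> else 0)"
    unfolding gate_def
  proof (rule sum.cong)
    fix j
    show "indicat_real ({real j * \<delta><..real (Suc j) * \<delta>} \<times> D j) (t, \<omega>) *\<^sub>R h t \<omega>
        = (if j = i then indicat_real (D i) \<omega> *\<^sub>R h t \<omega> else 0)"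
    proof (cases "j = i")
      case True
      then show ?thesis using assms(3,4) by (simp add: indicator_def)
    next
      case False
      then have "\<not> (real j * \<delta> < t \<and> t \<le> real (Suc j) * \<delta>)"
        using grid_index_unique[OF assms(1,3,4), of j] by blast
      then show ?thesis using False by (auto simp: indicator_def)
    qed
  qed simp
  then show ?thesis using assms(2) by simp
qed

lemma gate_threshold:
  assumes "0 < \<delta>" "k \<le> m" "\<And>i. i < k \<Longrightarrow> \<omega> \<in> D i" "\<And>i. k \<le> i \<Longrightarrow> i < m \<Longrightarrow> \<omega> \<notin> D i"
    and "0 < t" "t \<le> real m * \<delta>"
  shows "gate h \<delta> m D t \<omega> = (if t \<le> real k * \<delta> then h t \<omega> else 0)"
proof -
  obtain i where i: "i < m" "real i * \<delta> < t" "t \<le> real (Suc i) * \<delta>"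
    using grid_index[OF assms(1,5,6)] by blast
  have "i < k \<longleftrightarrow> t \<le> real k * \<delta>"
  proof
    assume "i < k"
    then have "real (Suc i) * \<delta> \<le> real k * \<delta>" using assms(1) by (intro mult_right_mono) auto
    then show "t \<le> real k * \<delta>" using i by simp
  next
    assume "t \<le> real k * \<delta>"
    then have "real i * \<delta> < real k * \<delta>" using i by simp
    then show "i < k" using assms(1) by simp
  qed
  then show ?thesis
    unfolding gate_eq[OF assms(1) i] using assms(3,4)[of i] i(1) by (cases "i < k") auto
qed

text \<open>With the gates open exactly on the first \<open>k\<close> intervals the sum telescopes,
  and the integral starts at 0.\<close>

lemma gate_int_threshold:
  assumes "simp_int h J" "0 < \<delta>" "k \<le> m" "\<And>i. i < k \<Longrightarrow> \<omega> \<in> D i" "\<And>i. k \<le> i \<Longrightarrow> i < m \<Longrightarrow> \<omega> \<notin> D i"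
    and "0 \<le> t"
  shows "gate_int J \<delta> m D t \<omega> = J (min (real k * \<delta>) t) \<omega>"
proof -
  have "{..<m} = {..<k} \<union> {k..<m}" using assms(3) by auto
  then have "gate_int J \<delta> m D t \<omega>
    = (\<Sum>i<k. indicat_real (D i) \<omega> * (J (min (real (Suc i) * \<delta>) t) \<omega> - J (min (real i * \<delta>) t) \<omega>))
     + (\<Sum>i\<in>{k..<m}. indicat_real (D i) \<omega> * (J (min (real (Suc i) * \<delta>) t) \<omega> - J (min (real i * \<delta>) t) \<omega>))"
    unfolding gate_int_def by (simp only: sum.union_disjoint[OF finite_lessThan finite_atLeastLessThan ivl_disj_int_one(2)])
  also have "(\<Sum>i\<in>{k..<m}. indicat_real (D i) \<omega> * (J (min (real (Suc i) * \<delta>) t) \<omega> - J (min (real i * \<delta>) t) \<omega>)) = 0"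
    using assms(5) by (intro sum.neutral) auto
  also have "(\<Sum>i<k. indicat_real (D i) \<omega> * (J (min (real (Suc i) * \<delta>) t) \<omega> - J (min (real i * \<delta>) t) \<omega>))
     = (\<Sum>i<k. J (min (real (Suc i) * \<delta>) t) \<omega> - J (min (real i * \<delta>) t) \<omega>)"
    using assms(4) by (intro sum.cong) auto
  also have "\<dots> = J (min (real k * \<delta>) t) \<omega> - J (min (real 0 * \<delta>) t) \<omega>"
    by (rule sum_lessThan_telescope)
  finally show ?thesis using assms(6) simp_int_0[OF assms(1)] by (simp add: min_def)
qed

lemma energy_cong:
  assumes "\<And>r. s < r \<Longrightarrow> r \<le> t \<Longrightarrow> h r \<omega> = h' r \<omega>"
  shows "energy h s t \<omega> = energy h' s t \<omega>"
  unfolding energy_def by (rule set_lebesgue_integral_cong) (auto simp: assms)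

lemma energy_mono:
  assumes "simp_int h J" "s \<le> r" "r \<le> t"
  shows "energy h s r \<omega> \<le> energy h s t \<omega>"
  using energy_split[OF assms, of \<omega>] energy_nonneg[of h r t \<omega>] by simp

lemma energy_eq_0: "(\<And>r. s < r \<Longrightarrow> r \<le> t \<Longrightarrow> h r \<omega> = 0) \<Longrightarrow> energy h s t \<omega> = 0"
  using energy_cong[of s t h \<omega> "\<lambda>_ _. 0"] by (simp add: energy_def set_lebesgue_integral_def)

text \<open>
  Stopping at the first grid time at which \<open>\<bar>J\<bar> > d\<close>, the overshoot is one grid increment, and
  these are uniformly small by the fourth moment bound.
\<close>

lemma energy_small_of_integral_small:
  assumes "simp_int h J" "0 < T" "0 < d" "0 < e" "B \<in> sets Q"
    and bd: "\<And>\<omega> t. \<omega> \<in> space Q - B \<Longrightarrow> t \<in> {0..T} \<Longrightarrow> \<bar>J t \<omega>\<bar> \<le> d"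
  shows "measure Q {\<omega>\<in>space Q. e \<le> energy h 0 T \<omega>} \<le> measure Q B + 4 * d\<^sup>2 / e"
proof -
  obtain C where C: "C \<ge> 0" "\<And>s t. 0 \<le> s \<Longrightarrow> s \<le> t \<Longrightarrow> integrable Q (\<lambda>\<omega>. (J t \<omega> - J s \<omega>) ^ 4)"
    "\<And>s t. 0 \<le> s \<Longrightarrow> s \<le> t \<Longrightarrow> (\<integral>\<omega>. (J t \<omega> - J s \<omega>) ^ 4 \<partial>Q) \<le> C * (t - s)\<^sup>2"
    using simp_int_fourth_moment[OF assms(1)] by (elim exE conjE) (rule that, blast+)
  \<comment> \<open>Weight in \<open>x^2 \<le> \<eta> + x^4 / \<eta>\<close>, chosen so that
    \<open>2 * \<eta> = d^2\<close>.\<close>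
  define \<eta> where "\<eta> = d\<^sup>2 / 2"
  have \<eta>: "0 < \<eta>" using assms(3) by (simp add: \<eta>_def)
  \<comment> \<open>The grid is so fine that the fourth moments of all increments together
    contribute at most \<open>d^2\<close> to the second moment of the stopped integral.\<close>
  obtain m0 :: nat where "2 * C * T\<^sup>2 / (\<eta> * d\<^sup>2) \<le> real m0" using real_arch_simple by blast
  define m where "m = Suc m0"
  have m: "0 < m" "2 * C * T\<^sup>2 / (\<eta> * d\<^sup>2) \<le> real m"
    using \<open>_ \<le> real m0\<close> by (auto simp: m_def)
  define \<delta> where "\<delta> = T / real m"
  have \<delta>: "0 < \<delta>" "real m * \<delta> = T" using m assms(2) by (auto simp: \<delta>_def)
  \<comment> \<open>The test uses values up to the left end of the interval only. If the path is
    stopped at index \<open>i + 1\<close>, its value at index \<open>i\<close> is therefore still at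
    most \<open>d\<close>.\<close>
  define D where "D i = {\<omega>\<in>space Q. \<forall>j\<le>i. \<bar>J (real j * \<delta>) \<omega>\<bar> \<le> d}" for i :: nat
  have D: "D i \<in> sets (E (real i * \<delta>))" for i
  proof -
    have "{\<omega>\<in>space (E (real i * \<delta>)). \<bar>J (real j * \<delta>) \<omega>\<bar> \<le> d} \<in> sets (E (real i * \<delta>))" if "j \<le> i" for j
    proof -
      have [measurable]: "J (real j * \<delta>) \<in> borel_measurable (E (real i * \<delta>))"
        using that \<delta> by (intro measurable_F_mono[OF simp_int_adapted[OF assms(1)]] mult_right_mono) auto
      show ?thesis by measurable
    qed
    then have "(\<Inter>j\<in>{..i}. {\<omega>\<in>space (E (real i * \<delta>)). \<bar>J (real j * \<delta>) \<omega>\<bar> \<le> d}) \<in> sets (E (real i * \<delta>))"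
      by (intro sets.finite_INT) auto
    also have "(\<Inter>j\<in>{..i}. {\<omega>\<in>space (E (real i * \<delta>)). \<bar>J (real j * \<delta>) \<omega>\<bar> \<le> d}) = D i"
      by (auto simp: D_def space_F)
    finally show ?thesis .
  qed
  let ?h = "gate h \<delta> m D" and ?J = "gate_int J \<delta> m D"
  have S: "simp_int ?h ?J" by (rule simp_int_gate[OF assms(1) \<delta>(1) D])
  define X where "X i \<omega> = J (real (Suc i) * \<delta>) \<omega> - J (real i * \<delta>) \<omega>" for i \<omega>
  have Xi: "integrable Q (\<lambda>\<omega>. X i \<omega> ^ 4)" and Xe: "(\<integral>\<omega>. X i \<omega> ^ 4 \<partial>Q) \<le> C * \<delta>\<^sup>2" for i
    using C(2)[of "real i * \<delta>" "real (Suc i) * \<delta>"] C(3)[of "real i * \<delta>" "real (Suc i) * \<delta>"] \<delta>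
    by (simp_all add: X_def algebra_simps)
  have bound: "(?J T \<omega>)\<^sup>2 \<le> 3 * d\<^sup>2 + 2 * (\<Sum>i<m. X i \<omega> ^ 4) / \<eta>" if \<omega>: "\<omega> \<in> space Q" for \<omega>
  proof -
    have nn: "0 \<le> 2 * (\<Sum>i<m. X i \<omega> ^ 4) / \<eta>" using \<eta> by (simp add: sum_nonneg)
    have "\<omega> \<in> D (Suc i) \<Longrightarrow> \<omega> \<in> D i" for i by (auto simp: D_def)
    from decreasing_threshold[of "\<lambda>i. \<omega> \<in> D i" m, OF this]
    obtain k where k: "k \<le> m" "\<And>i. i < k \<Longrightarrow> \<omega> \<in> D i" "\<And>i. k \<le> i \<Longrightarrow> i < m \<Longrightarrow> \<omega> \<notin> D i" by blast
    have km: "real k * \<delta> \<le> T" unfolding \<delta>(2)[symmetric] using k \<delta> by (intro mult_right_mono) auto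
    have J: "?J T \<omega> = J (real k * \<delta>) \<omega>"
      using gate_int_threshold[OF assms(1) \<delta>(1) k, where t=T] assms(2) km by (simp add: min_def)
    show ?thesis
    proof (cases k)
      case 0
      then have "?J T \<omega> = 0" using J simp_int_0[OF assms(1)] by simp
      then show ?thesis using nn by simp
    next
      case (Suc i)
      then have "\<omega> \<in> D i" using k by auto
      then have Ji: "\<bar>J (real i * \<delta>) \<omega>\<bar> \<le> d" by (auto simp: D_def)
      have "?J T \<omega> = J (real i * \<delta>) \<omega> + X i \<omega>" using J Suc by (simp add: X_def)
      then have "(?J T \<omega>)\<^sup>2 \<le> 2 * (J (real i * \<delta>) \<omega>)\<^sup>2 + 2 * (X i \<omega>)\<^sup>2"
        by (simp only: square_add_le)
      also have "(J (real i * \<delta>) \<omega>)\<^sup>2 \<le> d\<^sup>2" using Ji assms(3) by (simp add: abs_le_square_iff[symmetric])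
      \<comment> \<open>The index of the overshoot is random. Passing to fourth powers permits a
        bound by the sum over all increments: that sum has small expectation on a fine grid, which a
        sum of squares does not.\<close>
      also have "(X i \<omega>)\<^sup>2 \<le> \<eta> + X i \<omega> ^ 4 / \<eta>"
      proof -
        have "2 * (\<eta> * (X i \<omega>)\<^sup>2) \<le> \<eta>\<^sup>2 + ((X i \<omega>)\<^sup>2)\<^sup>2"
          using sum_squares_bound[of \<eta> "(X i \<omega>)\<^sup>2"] by simp
        moreover have "0 \<le> \<eta> * (X i \<omega>)\<^sup>2" using \<eta> by simp
        ultimately have "\<eta> * (X i \<omega>)\<^sup>2 \<le> \<eta>\<^sup>2 + X i \<omega> ^ 4" by simp
        then have "(X i \<omega>)\<^sup>2 \<le> (\<eta>\<^sup>2 + X i \<omega> ^ 4) / \<eta>" using \<eta> by (simp add: pos_le_divide_eq mult.commute)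
        then show ?thesis using \<eta> by (simp add: add_divide_distrib power2_eq_square)
      qed
      also have "X i \<omega> ^ 4 \<le> (\<Sum>i<m. X i \<omega> ^ 4)"
        using k(1) Suc by (intro member_le_sum) auto
      finally show ?thesis using \<eta> by (simp add: \<eta>_def divide_right_mono algebra_simps)
    qed
  qed
  have iS: "integrable Q (\<lambda>\<omega>. (?J T \<omega>)\<^sup>2)" using simp_int_square_integrable(3)[OF S, of 0 T] assms(2) by simp
  have iR: "integrable Q (\<lambda>\<omega>. 3 * d\<^sup>2 + 2 * (\<Sum>i<m. X i \<omega> ^ 4) / \<eta>)"
    using Xi by simp
  have "(\<integral>\<omega>. energy ?h 0 T \<omega> \<partial>Q) = (\<integral>\<omega>. (?J T \<omega>)\<^sup>2 \<partial>Q)"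
    using simp_int_isometry[OF S, of 0 T] simp_int_0[OF S] assms(2) by simp
  also have "\<dots> \<le> (\<integral>\<omega>. 3 * d\<^sup>2 + 2 * (\<Sum>i<m. X i \<omega> ^ 4) / \<eta> \<partial>Q)"
    by (rule integral_mono[OF iS iR bound])
  also have "\<dots> = 3 * d\<^sup>2 + 2 * (\<Sum>i<m. (\<integral>\<omega>. X i \<omega> ^ 4 \<partial>Q)) / \<eta>"
    using Xi by (simp add: prob_space)
  also have "\<dots> \<le> 3 * d\<^sup>2 + 2 * (\<Sum>i<m. C * \<delta>\<^sup>2) / \<eta>"
    using Xe \<eta> by (intro add_left_mono divide_right_mono mult_left_mono sum_mono) auto
  also have "2 * (\<Sum>i<m. C * \<delta>\<^sup>2) / \<eta> = (2 * C * T\<^sup>2 / (\<eta> * d\<^sup>2)) * d\<^sup>2 / real m"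
    using m \<eta> assms(3) by (simp add: \<delta>_def power2_eq_square field_simps)
  also have "\<dots> \<le> real m * d\<^sup>2 / real m"
    using m by (intro divide_right_mono mult_right_mono) auto
  also have "3 * d\<^sup>2 + real m * d\<^sup>2 / real m = 4 * d\<^sup>2" using m by simp
  finally have le: "(\<integral>\<omega>. energy ?h 0 T \<omega> \<partial>Q) \<le> 4 * d\<^sup>2" by simp
  have [measurable]: "energy ?h 0 T \<in> borel_measurable Q" "energy h 0 T \<in> borel_measurable Q"
    using energy_measurable[OF S] energy_measurable[OF assms(1)] assms(2) by auto
  note [measurable] = assms(5)
  have "measure Q {\<omega>\<in>space Q. e \<le> energy ?h 0 T \<omega>} \<le> (\<integral>\<omega>. energy ?h 0 T \<omega> \<partial>Q) / e"
    using assms(2,4) by (intro integral_Markov_inequality_measure[OF energy_integrable[OF S], where A="space Q"]) (auto simp: energy_nonneg)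
  also have "\<dots> \<le> 4 * d\<^sup>2 / e" using le assms(4) by (intro divide_right_mono) auto
  finally have 1: "measure Q {\<omega>\<in>space Q. e \<le> energy ?h 0 T \<omega>} \<le> 4 * d\<^sup>2 / e" .
  \<comment> \<open>Off \<open>B\<close> every gate is open, so gating does not change the integrand
    on \<open>{0<..T}\<close>.\<close>
  have "{\<omega>\<in>space Q. e \<le> energy h 0 T \<omega>} \<subseteq> B \<union> {\<omega>\<in>space Q. e \<le> energy ?h 0 T \<omega>}"
  proof safe
    fix \<omega> assume \<omega>: "\<omega> \<in> space Q" "e \<le> energy h 0 T \<omega>" "\<omega> \<notin> B"
    have "\<omega> \<in> D i" if "i < m" for i
    proof -
      have "real j * \<delta> \<le> T" if "j \<le> i" for j
        unfolding \<delta>(2)[symmetric] using that \<open>i < m\<close> \<delta> by (intro mult_right_mono) auto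
      then show ?thesis using bd[of \<omega>] \<omega> \<delta> unfolding D_def by auto
    qed
    then have "?h r \<omega> = h r \<omega>" if "0 < r" "r \<le> T" for r
      using gate_threshold[OF \<delta>(1), where k=m and m=m and \<omega>=\<omega> and D=D and t=r and h=h] that \<delta> by simp
    then have "energy ?h 0 T \<omega> = energy h 0 T \<omega>" by (intro energy_cong) auto
    then show "e \<le> energy ?h 0 T \<omega>" using \<omega> by simp
  qed
  then have "measure Q {\<omega>\<in>space Q. e \<le> energy h 0 T \<omega>} \<le> measure Q (B \<union> {\<omega>\<in>space Q. e \<le> energy ?h 0 T \<omega>})"
    by (intro finite_measure_mono) auto
  also have "\<dots> \<le> measure Q B + measure Q {\<omega>\<in>space Q. e \<le> energy ?h 0 T \<omega>}"
    by (intro measure_Un_le) auto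
  finally show ?thesis using 1 by simp
qed

text \<open>Here the integrand is stopped when its energy exceeds \<open>d\<close>. One further step
  of a fine grid adds at most \<open>d\<close>, so the stopped energy is at most
  \<open>2 * d\<close>; by the isometry on each interval this bounds the expected Riemann sum, and
  Markov's inequality applies. The bound does not depend on \<open>m\<close>, which is essential
  later.\<close>

lemma riemann_small_of_energy_small:
  assumes "simp_int h J" "0 < t" "0 < d" "0 < e" "0 < m"
  shows "measure Q {\<omega>\<in>space Q. e \<le> (\<Sum>i<m. (J (real (Suc i) * (t / real m)) \<omega> - J (real i * (t / real m)) \<omega>)\<^sup>2)}
    \<le> measure Q {\<omega>\<in>space Q. d < energy h 0 t \<omega>} + 2 * d / e"
proof -
  obtain C where C: "C \<ge> 0" "\<And>t \<omega>. norm (h t \<omega>) \<le> C" using simp_int_bounded[OF assms(1)] by blast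
  \<comment> \<open>This gives \<open>C^2 * \<delta> \<le> d\<close>, the energy bound for a single
    interval. The gating grid with \<open>l\<close> steps is unrelated to the Riemann grid with
    \<open>m\<close> steps.\<close>
  obtain l0 :: nat where "C\<^sup>2 * t / d \<le> real l0" using real_arch_simple by blast
  define l where "l = Suc l0"
  have l: "0 < l" "C\<^sup>2 * t / d \<le> real l" using \<open>_ \<le> real l0\<close> by (auto simp: l_def)
  define \<delta> where "\<delta> = t / real l"
  have \<delta>: "0 < \<delta>" "real l * \<delta> = t" using l assms(2) by (auto simp: \<delta>_def)
  have C\<delta>: "C\<^sup>2 * \<delta> \<le> d" using l assms(3) by (simp add: \<delta>_def field_simps)
  define D where "D i = {\<omega>\<in>space Q. energy h 0 (real i * \<delta>) \<omega> \<le> d}" for i :: nat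
  have D: "D i \<in> sets (E (real i * \<delta>))" for i
  proof -
    have [measurable]: "energy h 0 (real i * \<delta>) \<in> borel_measurable (E (real i * \<delta>))"
      using \<delta> by (intro energy_measurable_E[OF assms(1)]) auto
    have "{\<omega>\<in>space (E (real i * \<delta>)). energy h 0 (real i * \<delta>) \<omega> \<le> d} \<in> sets (E (real i * \<delta>))" by measurable
    then show ?thesis by (simp add: D_def space_F)
  qed
  let ?h = "gate h \<delta> l D" and ?J = "gate_int J \<delta> l D"
  have S: "simp_int ?h ?J" by (rule simp_int_gate[OF assms(1) \<delta>(1) D])
  have bound: "energy ?h 0 t \<omega> \<le> 2 * d" if \<omega>: "\<omega> \<in> space Q" for \<omega>
  proof -
    have "\<omega> \<in> D i" if "\<omega> \<in> D (Suc i)" for i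
      using energy_mono[OF assms(1), of 0 "real i * \<delta>" "real (Suc i) * \<delta>" \<omega>] that \<delta>
      by (auto simp: D_def algebra_simps)
    from decreasing_threshold[of "\<lambda>i. \<omega> \<in> D i" l, OF this]
    obtain k where k: "k \<le> l" "\<And>i. i < k \<Longrightarrow> \<omega> \<in> D i" "\<And>i. k \<le> i \<Longrightarrow> i < l \<Longrightarrow> \<omega> \<notin> D i" by blast
    have kl: "real k * \<delta> \<le> t" unfolding \<delta>(2)[symmetric] using k \<delta> by (intro mult_right_mono) auto
    have hr: "?h r \<omega> = (if r \<le> real k * \<delta> then h r \<omega> else 0)" if "0 < r" "r \<le> t" for r
      using gate_threshold[OF \<delta>(1) k, where t=r and h=h] that \<delta> by simp
    have "energy ?h 0 t \<omega> = energy ?h 0 (real k * \<delta>) \<omega> + energy ?h (real k * \<delta>) t \<omega>"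
      using kl \<delta> by (intro energy_split[OF S]) auto
    also have "energy ?h (real k * \<delta>) t \<omega> = 0"
    proof (rule energy_eq_0)
      fix r assume "real k * \<delta> < r" "r \<le> t"
      moreover have "0 \<le> real k * \<delta>" using \<delta> by simp
      ultimately show "?h r \<omega> = 0" using hr[of r] by simp
    qed
    also have "energy ?h 0 (real k * \<delta>) \<omega> = energy h 0 (real k * \<delta>) \<omega>"
      using hr kl by (intro energy_cong) auto
    also have "energy h 0 (real k * \<delta>) \<omega> \<le> 2 * d"
    proof (cases k)
      case 0
      then show ?thesis using energy_eq_0[of 0 0 h \<omega>] assms(3) by simp
    next
      case (Suc i)
      then have "energy h 0 (real i * \<delta>) \<omega> \<le> d" using k(2)[of i] by (auto simp: D_def)
      moreover have "energy h (real i * \<delta>) (real k * \<delta>) \<omega> \<le> C\<^sup>2 * (real k * \<delta> - real i * \<delta>)"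
        using Suc \<delta> C by (intro energy_le[OF assms(1)]) (auto intro!: mult_right_mono)
      moreover have "real k * \<delta> - real i * \<delta> = \<delta>" using Suc by (simp add: algebra_simps)
      moreover have "energy h 0 (real k * \<delta>) \<omega> = energy h 0 (real i * \<delta>) \<omega> + energy h (real i * \<delta>) (real k * \<delta>) \<omega>"
        using Suc \<delta> by (intro energy_split[OF assms(1)]) (auto intro!: mult_right_mono)
      ultimately show ?thesis using C\<delta> by simp
    qed
    finally show ?thesis by simp
  qed
  define r where "r i = real i * (t / real m)" for i :: nat
  have r: "r 0 = 0" "r m = t" "0 \<le> r i" "r i \<le> r (Suc i)" for i
    using assms(2,5) by (auto simp: r_def divide_right_mono mult_right_mono)
  have rt: "r i \<le> t" if "i \<le> m" for i
    using that assms(2,5) by (simp add: r_def field_simps mult_left_mono)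
  define R where "R J \<omega> = (\<Sum>i<m. (J (r (Suc i)) \<omega> - J (r i) \<omega>)\<^sup>2)" for J :: "real \<Rightarrow> 'b \<Rightarrow> real" and \<omega>
  have [measurable]: "J (r i) \<in> borel_measurable Q" "?J (r i) \<in> borel_measurable Q" for i
    using simp_int_measurable[OF assms(1) r(3)] simp_int_measurable[OF S r(3)] by auto
  have Rm [measurable]: "R J \<in> borel_measurable Q" "R ?J \<in> borel_measurable Q"
    unfolding R_def by measurable
  have i2: "integrable Q (\<lambda>\<omega>. (?J (r (Suc i)) \<omega> - ?J (r i) \<omega>)\<^sup>2)" for i
    using simp_int_square_integrable(1)[OF S r(3) r(3)] .
  then have Ri: "integrable Q (R ?J)" unfolding R_def by auto
  have en: "(\<Sum>i<n. energy ?h (r i) (r (Suc i)) \<omega>) = energy ?h 0 (r n) \<omega>" for n \<omega>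
  proof (induction n)
    case 0
    then show ?case using energy_eq_0[of 0 0 ?h \<omega>] r by simp
  next
    case (Suc n)
    then show ?case using energy_split[OF S, of 0 "r n" "r (Suc n)" \<omega>] r by simp
  qed
  have "(\<integral>\<omega>. R ?J \<omega> \<partial>Q) = (\<Sum>i<m. (\<integral>\<omega>. (?J (r (Suc i)) \<omega> - ?J (r i) \<omega>)\<^sup>2 \<partial>Q))"
    unfolding R_def using i2 by simp
  also have "\<dots> = (\<Sum>i<m. (\<integral>\<omega>. energy ?h (r i) (r (Suc i)) \<omega> \<partial>Q))"
    using simp_int_isometry[OF S r(3) r(4)] by simp
  also have "\<dots> = (\<integral>\<omega>. (\<Sum>i<m. energy ?h (r i) (r (Suc i)) \<omega>) \<partial>Q)"
    using energy_integrable[OF S r(3) r(4)] by simp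
  also have "\<dots> = (\<integral>\<omega>. energy ?h 0 t \<omega> \<partial>Q)" unfolding en r ..
  also have "\<dots> \<le> (\<integral>\<omega>. 2 * d \<partial>Q)"
    using assms(2) bound by (intro integral_mono energy_integrable[OF S]) auto
  finally have le: "(\<integral>\<omega>. R ?J \<omega> \<partial>Q) \<le> 2 * d" by (simp add: prob_space)
  have "measure Q {\<omega>\<in>space Q. e \<le> R ?J \<omega>} \<le> (\<integral>\<omega>. R ?J \<omega> \<partial>Q) / e"
    using assms(4) by (intro integral_Markov_inequality_measure[OF Ri, where A="space Q"]) (auto simp: R_def sum_nonneg)
  also have "\<dots> \<le> 2 * d / e" using le assms(4) by (intro divide_right_mono) auto
  finally have 1: "measure Q {\<omega>\<in>space Q. e \<le> R ?J \<omega>} \<le> 2 * d / e" .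
  have [measurable]: "energy h 0 t \<in> borel_measurable Q"
    using energy_measurable[OF assms(1)] assms(2) by auto
  have "{\<omega>\<in>space Q. e \<le> R J \<omega>} \<subseteq> {\<omega>\<in>space Q. d < energy h 0 t \<omega>} \<union> {\<omega>\<in>space Q. e \<le> R ?J \<omega>}"
  proof
    fix \<omega> assume \<omega>': "\<omega> \<in> {\<omega>\<in>space Q. e \<le> R J \<omega>}"
    { assume "\<not> d < energy h 0 t \<omega>"
    with \<omega>' have \<omega>: "\<omega> \<in> space Q" "e \<le> R J \<omega>" "\<not> d < energy h 0 t \<omega>" by auto
    have "\<omega> \<in> D i" if "i < l" for i
    proof -
      have "real i * \<delta> \<le> t" unfolding \<delta>(2)[symmetric] using that \<delta> by (intro mult_right_mono) auto
      then show ?thesis using energy_mono[OF assms(1), of 0 "real i * \<delta>" t \<omega>] \<omega> \<delta> by (auto simp: D_def)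
    qed
    then have "?J s \<omega> = J s \<omega>" if "0 \<le> s" "s \<le> t" for s
      using gate_int_threshold[OF assms(1) \<delta>(1), where k=l and m=l and \<omega>=\<omega> and D=D and t=s] that \<delta> by (simp add: min_def)
    then have "R ?J \<omega> = R J \<omega>" unfolding R_def using r(3) rt by (intro sum.cong) auto
    then have "e \<le> R ?J \<omega>" using \<omega> by simp
    }
    then show "\<omega> \<in> {\<omega>\<in>space Q. d < energy h 0 t \<omega>} \<union> {\<omega>\<in>space Q. e \<le> R ?J \<omega>}"
      using \<omega>' by blast
  qed
  then have "measure Q {\<omega>\<in>space Q. e \<le> R J \<omega>}
     \<le> measure Q ({\<omega>\<in>space Q. d < energy h 0 t \<omega>} \<union> {\<omega>\<in>space Q. e \<le> R ?J \<omega>})"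
    by (intro finite_measure_mono) auto
  also have "\<dots> \<le> measure Q {\<omega>\<in>space Q. d < energy h 0 t \<omega>} + measure Q {\<omega>\<in>space Q. e \<le> R ?J \<omega>}"
    by (intro measure_Un_le) auto
  finally show ?thesis using 1 unfolding R_def r_def by simp
qed

text \<open>The differences \<open>X i\<close> between squared increment and energy are orthogonal:
  for \<open>i < j\<close> the earlier one is known when the later one, of conditional mean zero,
  begins. Each has second moment of order \<open>1 / m^2\<close>, by the fourth moment bound and the
  boundedness of \<open>h\<close>, and there are \<open>m\<close> of them.\<close>

lemma simp_int_riemann_L2:
  assumes "simp_int h J" "0 < t"
  shows "\<exists>K\<ge>0. \<forall>m>0. 
    integrable Q (\<lambda>\<omega>. ((\<Sum>i<m. (J (real (Suc i) * (t / real m)) \<omega> - J (real i * (t / real m)) \<omega>)\<^sup>2) - energy h 0 t \<omega>)\<^sup>2) \<and>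
    (\<integral>\<omega>. ((\<Sum>i<m. (J (real (Suc i) * (t / real m)) \<omega> - J (real i * (t / real m)) \<omega>)\<^sup>2) - energy h 0 t \<omega>)\<^sup>2 \<partial>Q) \<le> K / real m"
proof -
  obtain C where C: "C \<ge> 0" "\<And>t \<omega>. norm (h t \<omega>) \<le> C" using simp_int_bounded[OF assms(1)] by blast
  obtain C' where C': "C' \<ge> 0" "\<And>s t. 0 \<le> s \<Longrightarrow> s \<le> t \<Longrightarrow> integrable Q (\<lambda>\<omega>. (J t \<omega> - J s \<omega>) ^ 4)"
    "\<And>s t. 0 \<le> s \<Longrightarrow> s \<le> t \<Longrightarrow> (\<integral>\<omega>. (J t \<omega> - J s \<omega>) ^ 4 \<partial>Q) \<le> C' * (t - s)\<^sup>2"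
    using simp_int_fourth_moment[OF assms(1)] by (elim exE conjE) (rule that, blast+)
  show ?thesis
  proof (intro exI[of _ "(2 * C' + 2 * C ^ 4) * t\<^sup>2"] conjI allI impI)
    show "0 \<le> (2 * C' + 2 * C ^ 4) * t\<^sup>2" using C' by simp
    fix m :: nat assume m: "0 < m"
    define r where "r i = real i * (t / real m)" for i :: nat
    have r: "r 0 = 0" "r m = t" "0 \<le> r i" "r i \<le> r (Suc i)" "r (Suc i) - r i = t / real m" for i
      using assms(2) m by (auto simp: r_def divide_right_mono mult_right_mono field_simps)
    have rm: "r i \<le> r j" if "i \<le> j" for i j
      using that assms(2) m by (auto simp: r_def intro!: divide_right_mono mult_right_mono)
    define X where "X i \<omega> = (J (r (Suc i)) \<omega> - J (r i) \<omega>)\<^sup>2 - energy h (r i) (r (Suc i)) \<omega>" for i \<omega>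
    have [measurable]: "J (r i) \<in> borel_measurable Q" "energy h s (r i) \<in> borel_measurable Q" for i s
      using simp_int_measurable[OF assms(1) r(3)] energy_measurable[OF assms(1) r(3)] by auto
    have Xm [measurable]: "X i \<in> borel_measurable Q" for i unfolding X_def by measurable
    have XE: "X i \<in> borel_measurable (E (r j))" if "i < j" for i j
    proof -
      have [measurable]: "J (r (Suc i)) \<in> borel_measurable (E (r j))" "J (r i) \<in> borel_measurable (E (r j))"
         "energy h (r i) (r (Suc i)) \<in> borel_measurable (E (r j))"
        using that r(3) rm
        by (auto intro!: measurable_F_mono[OF simp_int_adapted[OF assms(1)]] measurable_F_mono[OF energy_measurable_E[OF assms(1)]])
      show ?thesis unfolding X_def by measurable
    qed
    have en: "(\<Sum>i<n. energy h (r i) (r (Suc i)) \<omega>) = energy h 0 (r n) \<omega>" for n \<omega>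
    proof (induction n)
      case 0
      then show ?case using energy_eq_0[of 0 0 h \<omega>] r by simp
    next
      case (Suc n)
      then show ?case using energy_split[OF assms(1), of 0 "r n" "r (Suc n)" \<omega>] r by simp
    qed
    have Xb: "(X i \<omega>)\<^sup>2 \<le> 2 * (J (r (Suc i)) \<omega> - J (r i) \<omega>) ^ 4 + 2 * (C\<^sup>2 * (t / real m))\<^sup>2" for i \<omega>
    proof -
      let ?a = "(J (r (Suc i)) \<omega> - J (r i) \<omega>)\<^sup>2" and ?b = "energy h (r i) (r (Suc i)) \<omega>"
      have "?b \<le> C\<^sup>2 * (t / real m)" using energy_le[OF assms(1) r(4) C(2), of i \<omega>] r(5) by simp
      then have "?b\<^sup>2 \<le> (C\<^sup>2 * (t / real m))\<^sup>2" using energy_nonneg by (intro power_mono) auto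
      moreover have "(?a - ?b)\<^sup>2 \<le> 2 * ?a\<^sup>2 + 2 * ?b\<^sup>2"
        by (rule square_diff_le)
      moreover have "?a\<^sup>2 = (J (r (Suc i)) \<omega> - J (r i) \<omega>) ^ 4" by (simp flip: power_mult)
      ultimately show ?thesis unfolding X_def by linarith
    qed
    have ib: "integrable Q (\<lambda>\<omega>. 2 * (J (r (Suc i)) \<omega> - J (r i) \<omega>) ^ 4 + 2 * (C\<^sup>2 * (t / real m))\<^sup>2)" for i
      using C'(2)[OF r(3) r(4)] by simp
    have X2: "integrable Q (\<lambda>\<omega>. (X i \<omega>)\<^sup>2)" for i
      by (rule Bochner_Integration.integrable_bound[OF ib[of i]]) (use Xb in \<open>auto intro!: order_trans[OF Xb]\<close>)
    have XX: "integrable Q (\<lambda>\<omega>. X i \<omega> * X j \<omega>)" for i j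
      by (rule integrable_mult_of_squares) (use X2 in auto)
    have orth: "(\<integral>\<omega>. X i \<omega> * X j \<omega> \<partial>Q) = 0" if "i < j" for i j
      using simp_int_martingale(2)[OF assms(1) r(3) r(4) XE[OF that]] XX[of i j] unfolding X_def[of j] by simp
    have "(\<integral>\<omega>. (X i \<omega>)\<^sup>2 \<partial>Q) \<le> (\<integral>\<omega>. 2 * (J (r (Suc i)) \<omega> - J (r i) \<omega>) ^ 4 + 2 * (C\<^sup>2 * (t / real m))\<^sup>2 \<partial>Q)" for i
      by (rule integral_mono[OF X2 ib Xb])
    also have "(\<integral>\<omega>. 2 * (J (r (Suc i)) \<omega> - J (r i) \<omega>) ^ 4 + 2 * (C\<^sup>2 * (t / real m))\<^sup>2 \<partial>Q)
       \<le> 2 * (C' * (t / real m)\<^sup>2) + 2 * (C\<^sup>2 * (t / real m))\<^sup>2" for i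
      using C'(2,3)[OF r(3) r(4), of i] r(5)[of i] by (simp add: prob_space)
    also have "2 * (C' * (t / real m)\<^sup>2) + 2 * (C\<^sup>2 * (t / real m))\<^sup>2 = (2 * C' + 2 * C ^ 4) * t\<^sup>2 / (real m)\<^sup>2"
      by (simp add: power_mult_distrib power_divide algebra_simps add_divide_distrib flip: power_mult)
    finally have Xe: "(\<integral>\<omega>. (X i \<omega>)\<^sup>2 \<partial>Q) \<le> (2 * C' + 2 * C ^ 4) * t\<^sup>2 / (real m)\<^sup>2" for i .
    have eq: "(\<Sum>i<m. (J (r (Suc i)) \<omega> - J (r i) \<omega>)\<^sup>2) - energy h 0 t \<omega> = (\<Sum>i<m. X i \<omega>)" for \<omega>
      unfolding X_def sum_subtractf en r ..
    have sq: "(\<Sum>i<m. X i \<omega>)\<^sup>2 = (\<Sum>i<m. \<Sum>j<m. X i \<omega> * X j \<omega>)" for \<omega>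
      by (simp add: power2_eq_square sum_product)
    have "(\<integral>\<omega>. (\<Sum>i<m. X i \<omega>)\<^sup>2 \<partial>Q) = (\<Sum>i<m. \<Sum>j<m. \<integral>\<omega>. X i \<omega> * X j \<omega> \<partial>Q)"
      unfolding sq using XX by (intro integral_double_sum) auto
    also have "\<dots> = (\<Sum>i<m. \<Sum>j<m. if j = i then \<integral>\<omega>. (X i \<omega>)\<^sup>2 \<partial>Q else 0)"
    proof (intro sum.cong refl)
      fix i j :: nat
      show "(\<integral>\<omega>. X i \<omega> * X j \<omega> \<partial>Q) = (if j = i then \<integral>\<omega>. (X i \<omega>)\<^sup>2 \<partial>Q else 0)"
        using orth[of i j] orth[of j i] by (cases i j rule: linorder_cases) (auto simp: power2_eq_square mult.commute)
    qed
    also have "\<dots> = (\<Sum>i<m. \<integral>\<omega>. (X i \<omega>)\<^sup>2 \<partial>Q)" by simp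
    also have "\<dots> \<le> (\<Sum>i<m. (2 * C' + 2 * C ^ 4) * t\<^sup>2 / (real m)\<^sup>2)" by (intro sum_mono Xe)
    also have "\<dots> = (2 * C' + 2 * C ^ 4) * t\<^sup>2 / real m" using m by (simp add: power2_eq_square)
    finally show "(\<integral>\<omega>. ((\<Sum>i<m. (J (real (Suc i) * (t / real m)) \<omega> - J (real i * (t / real m)) \<omega>)\<^sup>2) - energy h 0 t \<omega>)\<^sup>2 \<partial>Q)
      \<le> (2 * C' + 2 * C ^ 4) * t\<^sup>2 / real m"
      using eq unfolding r_def by simp
    have "integrable Q (\<lambda>\<omega>. (\<Sum>i<m. X i \<omega>)\<^sup>2)" unfolding sq using XX by auto
    then show "integrable Q (\<lambda>\<omega>. ((\<Sum>i<m. (J (real (Suc i) * (t / real m)) \<omega> - J (real i * (t / real m)) \<omega>)\<^sup>2) - energy h 0 t \<omega>)\<^sup>2)"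
      using eq unfolding r_def by simp
  qed
qed

end

section \<open>Limits of elementary integrands\<close>

text \<open>Bochner's notion with convergence at every point. Unlike Borel measurability it is
  stable under sums and differences when the target is not separable.\<close>

definition strongly_measurable :: "'a measure \<Rightarrow> ('a \<Rightarrow> 'e::real_normed_vector) \<Rightarrow> bool" where
  "strongly_measurable M f \<longleftrightarrow>
    (\<exists>\<phi>. (\<forall>i::nat. simple_function M (\<phi> i)) \<and> (\<forall>x\<in>space M. (\<lambda>i. \<phi> i x) \<longlonglongrightarrow> f x))"

lemma strongly_measurable_simple: "simple_function M f \<Longrightarrow> strongly_measurable M f"
  unfolding strongly_measurable_def by (intro exI[of _ "\<lambda>_. f"]) auto

lemma strongly_measurable_borel:
  assumes "strongly_measurable M f" shows "f \<in> borel_measurable M"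
proof -
  obtain \<phi> where \<phi>: "\<And>i::nat. simple_function M (\<phi> i)" "\<And>x. x \<in> space M \<Longrightarrow> (\<lambda>i. \<phi> i x) \<longlonglongrightarrow> f x"
    using assms unfolding strongly_measurable_def by blast
  show ?thesis
    by (rule borel_measurable_LIMSEQ_metric[OF borel_measurable_simple_function[OF \<phi>(1)] \<phi>(2)])
qed

lemma strongly_measurable_norm:
  assumes "strongly_measurable M f" shows "(\<lambda>x. norm (f x)) \<in> borel_measurable M"
  using strongly_measurable_borel[OF assms] by measurable

lemma strongly_measurable_add:
  assumes "strongly_measurable M f" "strongly_measurable M g"
  shows "strongly_measurable M (\<lambda>x. f x + g x)"
proof -
  obtain \<phi> where \<phi>: "\<And>i::nat. simple_function M (\<phi> i)" "\<And>x. x \<in> space M \<Longrightarrow> (\<lambda>i. \<phi> i x) \<longlonglongrightarrow> f x"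
    using assms(1) unfolding strongly_measurable_def by blast
  obtain \<psi> where \<psi>: "\<And>i::nat. simple_function M (\<psi> i)" "\<And>x. x \<in> space M \<Longrightarrow> (\<lambda>i. \<psi> i x) \<longlonglongrightarrow> g x"
    using assms(2) unfolding strongly_measurable_def by blast
  show ?thesis unfolding strongly_measurable_def
    using \<phi> \<psi> by (intro exI[of _ "\<lambda>i x. \<phi> i x + \<psi> i x"]) (auto intro!: tendsto_add simple_function_plus)
qed

lemma strongly_measurable_scaleR:
  assumes r [measurable]: "r \<in> borel_measurable M" and "strongly_measurable M f"
  shows "strongly_measurable M (\<lambda>x. r x *\<^sub>R f x)"
proof -
  obtain \<phi> where \<phi>: "\<And>i::nat. simple_function M (\<phi> i)" "\<And>x. x \<in> space M \<Longrightarrow> (\<lambda>i. \<phi> i x) \<longlonglongrightarrow> f x"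
    using assms(2) unfolding strongly_measurable_def by blast
  obtain s :: "nat \<Rightarrow> 'a \<Rightarrow> real" where s: "\<And>i. simple_function M (s i)" "\<And>x. x \<in> space M \<Longrightarrow> (\<lambda>i. s i x) \<longlonglongrightarrow> r x"
    using borel_measurable_implies_sequence_metric[OF r, of 0] by blast
  show ?thesis unfolding strongly_measurable_def
  proof (intro exI[of _ "\<lambda>i x. s i x *\<^sub>R \<phi> i x"] conjI allI ballI)
    show "simple_function M (\<lambda>x. s i x *\<^sub>R \<phi> i x)" for i
      by (rule simple_function_compose2[OF s(1) \<phi>(1)])
    show "(\<lambda>i. s i x *\<^sub>R \<phi> i x) \<longlonglongrightarrow> r x *\<^sub>R f x" if "x \<in> space M" for x
      using that by (intro tendsto_scaleR s \<phi>)
  qed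
qed

lemma strongly_measurable_diff:
  assumes "strongly_measurable M f" "strongly_measurable M g"
  shows "strongly_measurable M (\<lambda>x. f x - g x)"
  using strongly_measurable_add[OF assms(1) strongly_measurable_scaleR[OF _ assms(2), of "\<lambda>_. -1"]] by simp

lemma strongly_measurable_sum:
  "(\<And>i. i \<in> I \<Longrightarrow> strongly_measurable M (f i)) \<Longrightarrow> strongly_measurable M (\<lambda>x. \<Sum>i\<in>I. f i x)"
  by (induction I rule: infinite_finite_induct)
    (simp_all add: strongly_measurable_simple strongly_measurable_add)

lemma strongly_measurable_compose:
  assumes "T \<in> measurable N M" "strongly_measurable M f"
  shows "strongly_measurable N (\<lambda>x. f (T x))"
proof -
  obtain \<phi> where \<phi>: "\<And>i::nat. simple_function M (\<phi> i)" "\<And>x. x \<in> space M \<Longrightarrow> (\<lambda>i. \<phi> i x) \<longlonglongrightarrow> f x"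
    using assms(2) unfolding strongly_measurable_def by blast
  show ?thesis unfolding strongly_measurable_def
    using \<phi> measurable_space[OF assms(1)] simple_function_comp[OF assms(1) \<phi>(1)]
    by (intro exI[of _ "\<lambda>i x. \<phi> i (T x)"]) auto
qed

text \<open>
  Approximate by a nearest point among the first members of the enumeration.
\<close>

lemma strongly_measurable_countable_closure:
  fixes f :: "'a \<Rightarrow> 'e::real_normed_vector" and d :: "nat \<Rightarrow> 'e"
  assumes f [measurable]: "f \<in> borel_measurable M" and cl: "\<And>x. x \<in> space M \<Longrightarrow> f x \<in> closure (range d)"
  shows "strongly_measurable M f"
proof -
  \<comment> \<open>The least index attaining the minimal distance to \<open>d 0, ..., d j\<close>;
    taking the least one breaks ties measurably.\<close>
  define k where "k j x = (LEAST k. k \<le> j \<and> (\<forall>l\<le>j. dist (f x) (d k) \<le> dist (f x) (d l)))" for j :: nat and x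
  have ex: "\<exists>k\<le>j. \<forall>l\<le>j. dist (f x) (d k) \<le> dist (f x) (d l)" for j x
  proof -
    have "\<exists>k. is_arg_min (\<lambda>k. dist (f x) (d k)) (\<lambda>k. k \<in> {..j}) k"
      by (rule ex_is_arg_min_if_finite) auto
    then obtain k where "is_arg_min (\<lambda>k. dist (f x) (d k)) (\<lambda>k. k \<in> {..j}) k" ..
    then have "k \<le> j" "\<forall>l\<le>j. dist (f x) (d k) \<le> dist (f x) (d l)"
      by (simp_all add: is_arg_min_linorder)
    then show ?thesis by blast
  qed
  have k: "k j x \<le> j" "l \<le> j \<Longrightarrow> dist (f x) (d (k j x)) \<le> dist (f x) (d l)" for j l x
    using LeastI_ex[OF ex[of j x]] unfolding k_def by blast+
  have km [measurable]: "k j \<in> measurable M (count_space UNIV)" for j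
  proof -
    have [measurable]: "(\<lambda>x. dist (f x) c) \<in> borel_measurable M" for c
      by (rule measurable_compose[OF f borel_measurable_continuous_onI]) (intro continuous_intros)
    have "Measurable.pred M (\<lambda>x. k \<le> j \<and> (\<forall>l\<le>j. dist (f x) (d k) \<le> dist (f x) (d l)))" for k
      by measurable
    then show ?thesis unfolding k_def by (rule measurable_Least)
  qed
  show ?thesis unfolding strongly_measurable_def
  proof (intro exI[of _ "\<lambda>j x. d (k j x)"] conjI allI ballI)
    fix j
    have "simple_function M (k j)"
      unfolding simple_function_def
    proof (intro conjI ballI)
      show "finite (k j ` space M)" by (rule finite_subset[of _ "{..j}"]) (use k in auto)
      show "k j -` {x} \<inter> space M \<in> sets M" for x using measurable_sets[OF km, of "{x}"] by simp
    qed
    then show "simple_function M (\<lambda>x. d (k j x))" by (rule simple_function_compose1)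
  next
    fix x assume x: "x \<in> space M"
    show "(\<lambda>j. d (k j x)) \<longlonglongrightarrow> f x"
    proof (rule metric_LIMSEQ_I)
      fix e :: real assume "0 < e"
      with cl[OF x] obtain y where "y \<in> range d" "dist y (f x) < e"
        unfolding closure_approachable by blast
      then obtain l where l: "dist (f x) (d l) < e" by (auto simp: dist_commute)
      show "\<exists>no. \<forall>n\<ge>no. dist (d (k n x)) (f x) < e"
        using l k(2)[of l _ x] by (intro exI[of _ l]) (auto simp: dist_commute intro: le_less_trans)
    qed
  qed
qed

text \<open>The Cauchy criterion with radii \<open>1 / (j + 1)\<close> involves countably many sets,
  each described by the norm of one difference. Only these real functions are required to be
  measurable.\<close>

lemma Cauchy_set_measurable:
  fixes f :: "nat \<Rightarrow> 'a \<Rightarrow> 'e::real_normed_vector"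
  assumes "\<And>m n. (\<lambda>x. norm (f m x - f n x)) \<in> borel_measurable M"
  shows "{x\<in>space M. Cauchy (\<lambda>n. f n x)} \<in> sets M"
proof -
  have eq: "Cauchy (\<lambda>n. f n x) \<longleftrightarrow> (\<forall>j. \<exists>N. \<forall>m\<ge>N. \<forall>n\<ge>N. norm (f m x - f n x) < inverse (real (Suc j)))" for x
  proof
    assume "Cauchy (\<lambda>n. f n x)"
    then show "\<forall>j. \<exists>N. \<forall>m\<ge>N. \<forall>n\<ge>N. norm (f m x - f n x) < inverse (real (Suc j))"
      unfolding Cauchy_iff by simp
  next
    assume *: "\<forall>j. \<exists>N. \<forall>m\<ge>N. \<forall>n\<ge>N. norm (f m x - f n x) < inverse (real (Suc j))"
    show "Cauchy (\<lambda>n. f n x)"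
    proof (rule CauchyI)
      fix e :: real assume "0 < e"
      then obtain j where j: "inverse (real (Suc j)) < e" using reals_Archimedean by blast
      from * obtain N where "\<forall>m\<ge>N. \<forall>n\<ge>N. norm (f m x - f n x) < inverse (real (Suc j))" by blast
      then show "\<exists>M. \<forall>m\<ge>M. \<forall>n\<ge>M. norm (f m x - f n x) < e"
        by (intro exI[of _ N] allI impI less_trans[OF _ j]) simp
    qed
  qed
  let ?S = "\<lambda>j m n. {x\<in>space M. norm (f m x - f n x) < inverse (real (Suc j))}"
  have S: "?S j m n \<in> sets M" for j m n
    using borel_measurable_less[OF assms borel_measurable_const] .
  define G where "G j N = (\<Inter>m\<in>{N..}. \<Inter>n\<in>{N..}. ?S j m n)" for j N
  have G: "G j N \<in> sets M" for j N
    unfolding G_def by (intro sets.countable_INT' image_subsetI S) auto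
  have G_iff: "x \<in> G j N \<longleftrightarrow> x \<in> space M \<and> (\<forall>m\<ge>N. \<forall>n\<ge>N. norm (f m x - f n x) < inverse (real (Suc j)))" for x j N
    unfolding G_def by auto
  have "{x\<in>space M. Cauchy (\<lambda>n. f n x)} = (\<Inter>j. \<Union>N. G j N)"
    unfolding set_eq_iff INT_iff UN_iff G_iff mem_Collect_eq eq by simp
  also have "\<dots> \<in> sets M"
    using G by (intro sets.countable_INT' sets.countable_UN' image_subsetI) auto
  finally show ?thesis .
qed

text \<open>Successive distances are at most \<open>sqrt W / 2^n\<close>. The geometric tail sums to
  \<open>2 * sqrt W / 2^n\<close>, whose square is the stated bound.\<close>

lemma quadratic_rate_convergent:
  fixes x :: "nat \<Rightarrow> 'e::banach"
  assumes W: "\<And>n. 4 ^ n * (norm (x n - x (Suc n)))\<^sup>2 \<le> W"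
  shows "convergent x" "(norm (x n - lim x))\<^sup>2 \<le> 4 * W / 4 ^ n"
proof -
  have W0: "0 \<le> W" using W[of 0] by (intro order_trans[OF _ W[of 0]]) simp
  have d: "norm (x n - x (Suc n)) \<le> sqrt W / 2 ^ n" for n
  proof (rule power2_le_imp_le)
    have "(norm (x n - x (Suc n)))\<^sup>2 \<le> W / 4 ^ n"
      using W[of n] by (simp add: field_simps)
    also have "W / 4 ^ n = (sqrt W / 2 ^ n)\<^sup>2"
      using W0 by (simp add: power_divide power2_eq_square flip: power_mult_distrib)
    finally show "(norm (x n - x (Suc n)))\<^sup>2 \<le> (sqrt W / 2 ^ n)\<^sup>2" .
  qed (use W0 in simp)
  \<comment> \<open>The subtracted term is the tail beyond \<open>n + k\<close>; it makes the
    induction on \<open>k\<close> close exactly.\<close>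
  have c: "norm (x n - x (n + k)) \<le> 2 * sqrt W / 2 ^ n - 2 * sqrt W / 2 ^ (n + k)" for n k
  proof (induction k)
    case (Suc k)
    have "norm (x n - x (n + Suc k)) \<le> norm (x n - x (n + k)) + norm (x (n + k) - x (Suc (n + k)))"
      using norm_triangle_ineq[of "x n - x (n + k)" "x (n + k) - x (Suc (n + k))"] by simp
    also have "\<dots> \<le> (2 * sqrt W / 2 ^ n - 2 * sqrt W / 2 ^ (n + k)) + sqrt W / 2 ^ (n + k)"
      by (intro add_mono Suc d)
    also have "\<dots> = 2 * sqrt W / 2 ^ n - 2 * sqrt W / 2 ^ (n + Suc k)" by (simp add: field_simps)
    finally show ?case .
  qed simp
  have c': "norm (x n - x m) \<le> 2 * sqrt W / 2 ^ n" if "n \<le> m" for n m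
  proof -
    have "0 \<le> 2 * sqrt W / 2 ^ (n + (m - n))" using W0 by simp
    then show ?thesis using c[of n "m - n"] that by simp
  qed
  have z: "(\<lambda>n. 2 * sqrt W / 2 ^ n) \<longlonglongrightarrow> 0"
    using tendsto_mult_right_zero[OF LIMSEQ_inverse_realpow_zero[of 2], of "2 * sqrt W"] by (simp add: divide_inverse)
  have "Cauchy x"
  proof (rule CauchyI')
    fix e :: real assume "0 < e"
    then have "\<forall>\<^sub>F n in sequentially. 2 * sqrt W / 2 ^ n < e" using order_tendstoD(2)[OF z] by blast
    then obtain M where M: "\<And>n. n \<ge> M \<Longrightarrow> 2 * sqrt W / 2 ^ n < e" by (auto simp: eventually_sequentially)
    show "\<exists>M. \<forall>m\<ge>M. \<forall>n>m. dist (x m) (x n) < e"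
    proof (intro exI allI impI)
      fix m n assume "m \<ge> M" "m < n"
      then show "dist (x m) (x n) < e" using c'[of m n] M[of m] by (simp add: dist_norm)
    qed
  qed
  then show conv: "convergent x" by (rule Cauchy_convergent)
  then have "x \<longlonglongrightarrow> lim x" by (simp add: convergent_LIMSEQ_iff)
  then have "(\<lambda>m. norm (x n - x m)) \<longlonglongrightarrow> norm (x n - lim x)" by (intro tendsto_intros)
  then have "norm (x n - lim x) \<le> 2 * sqrt W / 2 ^ n"
    by (rule LIMSEQ_le_const2) (use c' in blast)
  then have "(norm (x n - lim x))\<^sup>2 \<le> (2 * sqrt W / 2 ^ n)\<^sup>2" by (intro power_mono) auto
  also have "\<dots> = 4 * W / 4 ^ n"
    using W0 by (simp add: power_divide power_mult_distrib power2_eq_square flip: power_mult_distrib)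
  finally show "(norm (x n - lim x))\<^sup>2 \<le> 4 * W / 4 ^ n" .
qed

section \<open>Time sections and squared norms over compact time intervals\<close>

abbreviation time_measure :: "real measure" where
  "time_measure \<equiv> restrict_space lborel {0..}"

lemma sigma_finite_time: "sigma_finite_measure time_measure"
  by (rule sigma_finite_measure_restrict_space[OF sigma_finite_lborel]) auto

lemma pair_sigma_finite_time: "prob_space P \<Longrightarrow> pair_sigma_finite time_measure P"
  using sigma_finite_time
  by (simp add: pair_sigma_finite_def prob_space_imp_sigma_finite)

text \<open>A null set of the product has null sections. The factors are swapped because the outer
  quantifier is to range over paths.\<close>

lemma AE_time_prodD:
  assumes "prob_space P" "AE p in time_prod P. \<Phi> p"
  shows "AE \<omega> in P. AE t in lborel. 0 \<le> t \<longrightarrow> \<Phi> (t, \<omega>)"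
proof -
  interpret pair_sigma_finite P time_measure
    using pair_sigma_finite_time[OF assms(1)] by (simp add: pair_sigma_finite_def)
  interpret S: pair_sigma_finite time_measure P
    using pair_sigma_finite_time[OF assms(1)] .
  have "AE p in distr (P \<Otimes>\<^sub>M time_measure) (time_measure \<Otimes>\<^sub>M P) (\<lambda>(x, y). (y, x)). \<Phi> p"
    using assms(2) unfolding time_prod_def S.distr_pair_swap[symmetric] .
  then have "AE p in P \<Otimes>\<^sub>M time_measure. \<Phi> ((\<lambda>(x, y). (y, x)) p)"
    by (rule AE_distrD[rotated]) (rule measurable_pair_swap')
  then have "AE \<omega> in P. AE t in time_measure. \<Phi> (t, \<omega>)"
    by (auto dest!: AE_pair)
  then show ?thesis by (simp add: AE_restrict_space_iff)
qed

text \<open>Null sections give back a null set of the product by Tonelli's theorem, applied to the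
  measurable set where the property holds.\<close>

lemma AE_time_prodI:
  assumes "prob_space P" "{p\<in>space (time_prod P). \<Phi> p} \<in> sets (time_prod P)"
    and "AE \<omega> in P. AE t in lborel. 0 \<le> t \<longrightarrow> \<Phi> (t, \<omega>)"
  shows "AE p in time_prod P. \<Phi> p"
proof -
  interpret S: pair_sigma_finite time_measure P
    using pair_sigma_finite_time[OF assms(1)] .
  have "AE \<omega> in P. AE t in time_measure. \<Phi> (t, \<omega>)"
    using assms(3) by (simp add: AE_restrict_space_iff)
  then have "AE t in time_measure. AE \<omega> in P. \<Phi> (t, \<omega>)"
    using S.AE_commute[of "\<lambda>t \<omega>. \<Phi> (t, \<omega>)"] assms(2) by (simp add: time_prod_def)
  then show ?thesis
    unfolding time_prod_def using assms(2) by (intro S.AE_pair_measure) (auto simp: time_prod_def)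
qed

lemma measurable_time_prod_of_borel:
  assumes "f \<in> measurable (borel \<Otimes>\<^sub>M P) N" shows "f \<in> measurable (time_prod P) N"
proof -
  have "(\<lambda>p. (fst p, snd p)) \<in> measurable (time_prod P) (borel \<Otimes>\<^sub>M P)"
    unfolding time_prod_def
    by (intro measurable_Pair measurable_snd measurable_compose[OF measurable_fst measurable_restrict_space1]) simp
  from measurable_compose[OF this assms] show ?thesis by simp
qed

lemma strongly_measurable_time_prod_of_borel:
  assumes "strongly_measurable (borel \<Otimes>\<^sub>M P) f" shows "strongly_measurable (time_prod P) f"
  using strongly_measurable_compose[OF measurable_time_prod_of_borel assms, of "\<lambda>x. x"] by simp

lemma time_section_measurable:
  fixes g :: "real \<Rightarrow> 'a \<Rightarrow> ennreal"
  assumes g: "(\<lambda>p. g (fst p) (snd p)) \<in> borel_measurable (time_prod P)" and \<omega>: "\<omega> \<in> space P"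
  shows "(\<lambda>t. g t \<omega> * indicator {0..T} t) \<in> borel_measurable lborel"
proof -
  have "(\<lambda>t. (t, \<omega>)) \<in> measurable time_measure (time_prod P)"
    unfolding time_prod_def using \<omega> by (intro measurable_Pair) auto
  from measurable_compose[OF this g] have "(\<lambda>t. g t \<omega>) \<in> borel_measurable time_measure" by simp
  then have "(\<lambda>t. g t \<omega> * indicator {0..} t) \<in> borel_measurable lborel"
    by (subst (asm) borel_measurable_restrict_space_iff_ennreal) auto
  then have "(\<lambda>t. g t \<omega> * indicator {0..} t * indicator {0..T} t) \<in> borel_measurable lborel" by measurable
  also have "(\<lambda>t. g t \<omega> * indicator {0..} t * indicator {0..T} t) = (\<lambda>t. g t \<omega> * indicator {0..T} t)"
    by (auto simp: indicator_def fun_eq_iff)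
  finally show ?thesis .
qed

lemma time_integral_measurable:
  fixes g :: "real \<Rightarrow> 'a \<Rightarrow> ennreal"
  assumes g: "(\<lambda>p. g (fst p) (snd p)) \<in> borel_measurable (time_prod P)"
  shows "(\<lambda>\<omega>. \<integral>\<^sup>+t\<in>{0..T}. g t \<omega> \<partial>lborel) \<in> borel_measurable P"
proof -
  interpret sigma_finite_measure time_measure by (rule sigma_finite_time)
  have "(\<lambda>p. g (snd p) (fst p)) \<in> borel_measurable (P \<Otimes>\<^sub>M time_measure)"
    using measurable_pair_swap[OF g[unfolded time_prod_def]] by (simp add: case_prod_beta)
  then have [measurable]: "(\<lambda>(\<omega>, t). g t \<omega>) \<in> borel_measurable (P \<Otimes>\<^sub>M time_measure)"
    by (simp add: case_prod_beta)
  have i: "(\<lambda>t. indicator {0..T} t :: ennreal) \<in> borel_measurable time_measure"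
    by (intro measurable_restrict_space1) auto
  have "(\<lambda>(\<omega>, t). g t \<omega> * indicator {0..T} t) \<in> borel_measurable (P \<Otimes>\<^sub>M time_measure)"
    unfolding case_prod_beta
    by (intro borel_measurable_times_ennreal measurable_compose[OF measurable_snd i]) fact
  then have "(\<lambda>\<omega>. \<integral>\<^sup>+t. g t \<omega> * indicator {0..T} t \<partial>time_measure) \<in> borel_measurable P"
    by (rule borel_measurable_nn_integral)
  also have "(\<lambda>\<omega>. \<integral>\<^sup>+t. g t \<omega> * indicator {0..T} t \<partial>time_measure) = (\<lambda>\<omega>. \<integral>\<^sup>+t\<in>{0..T}. g t \<omega> \<partial>lborel)"
    by (auto simp: nn_integral_restrict_space fun_eq_iff indicator_def intro!: nn_integral_cong)
  finally show ?thesis .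
qed

text \<open>Extended-valued, so that it can be used before finiteness is known;
  \<open>energy\<close> is its real counterpart for elementary integrands.\<close>

definition sqnorm :: "(real \<Rightarrow> 'a \<Rightarrow> 'e::real_normed_vector) \<Rightarrow> real \<Rightarrow> 'a \<Rightarrow> ennreal" where
  "sqnorm k T \<omega> = (\<integral>\<^sup>+t\<in>{0..T}. ennreal ((norm (k t \<omega>))\<^sup>2) \<partial>lborel)"

lemma sqnorm_measurable:
  assumes "(\<lambda>p. norm (k (fst p) (snd p))) \<in> borel_measurable (time_prod P)"
  shows "sqnorm k T \<in> borel_measurable P"
proof -
  note assms [measurable]
  have "(\<lambda>p. ennreal ((norm (k (fst p) (snd p)))\<^sup>2)) \<in> borel_measurable (time_prod P)" by measurable
  from time_integral_measurable[where g="\<lambda>t \<omega>. ennreal ((norm (k t \<omega>))\<^sup>2)", OF this]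
  show ?thesis unfolding sqnorm_def by simp
qed

lemma sqnorm_section_measurable:
  assumes "(\<lambda>p. norm (k (fst p) (snd p))) \<in> borel_measurable (time_prod P)" "\<omega> \<in> space P"
  shows "(\<lambda>t. ennreal ((norm (k t \<omega>))\<^sup>2) * indicator {0..T} t) \<in> borel_measurable lborel"
proof -
  note assms(1) [measurable]
  have "(\<lambda>p. ennreal ((norm (k (fst p) (snd p)))\<^sup>2)) \<in> borel_measurable (time_prod P)" by measurable
  from time_section_measurable[where g="\<lambda>t \<omega>. ennreal ((norm (k t \<omega>))\<^sup>2)", OF this assms(2)]
  show ?thesis by simp
qed

lemma sqnorm_cong_AE:
  assumes "AE t in lborel. 0 \<le> t \<longrightarrow> k t \<omega> = k' t \<omega>"
  shows "sqnorm k T \<omega> = sqnorm k' T \<omega>"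
  unfolding sqnorm_def
  by (rule nn_integral_cong_AE) (use assms in \<open>eventually_elim, auto simp: indicator_def\<close>)

lemma sqnorm_mono: "T \<le> T' \<Longrightarrow> sqnorm k T \<omega> \<le> sqnorm k T' \<omega>"
  unfolding sqnorm_def by (rule nn_integral_mono) (auto simp: indicator_def)

text \<open>The factor 2 comes from \<open>(a + b)^2 \<le> 2 * a^2 + 2 * b^2\<close>. Stated for any
  \<open>l\<close> dominated by a sum of two norms, it serves sums and differences alike.\<close>

lemma sqnorm_add_le:
  assumes "(\<lambda>p. norm (k (fst p) (snd p))) \<in> borel_measurable (time_prod P)"
    "(\<lambda>p. norm (k' (fst p) (snd p))) \<in> borel_measurable (time_prod P)" "\<omega> \<in> space P"
    and le: "\<And>t. 0 \<le> t \<Longrightarrow> t \<le> T \<Longrightarrow> norm (l t \<omega>) \<le> norm (k t \<omega>) + norm (k' t \<omega>)"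
  shows "sqnorm l T \<omega> \<le> 2 * sqnorm k T \<omega> + 2 * sqnorm k' T \<omega>"
proof -
  note m [measurable] = sqnorm_section_measurable[OF assms(1,3)] sqnorm_section_measurable[OF assms(2,3)]
  have "sqnorm l T \<omega> \<le> (\<integral>\<^sup>+t. 2 * (ennreal ((norm (k t \<omega>))\<^sup>2) * indicator {0..T} t)
      + 2 * (ennreal ((norm (k' t \<omega>))\<^sup>2) * indicator {0..T} t) \<partial>lborel)"
    unfolding sqnorm_def
  proof (intro nn_integral_mono)
    fix t
    have "(norm (l t \<omega>))\<^sup>2 \<le> 2 * (norm (k t \<omega>))\<^sup>2 + 2 * (norm (k' t \<omega>))\<^sup>2" if "t \<in> {0..T}"
      using that by (intro order_trans[OF power_mono[OF le] square_add_le]) auto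
    then have "ennreal ((norm (l t \<omega>))\<^sup>2) \<le> 2 * ennreal ((norm (k t \<omega>))\<^sup>2) + 2 * ennreal ((norm (k' t \<omega>))\<^sup>2)" if "t \<in> {0..T}"
      using ennreal_leI[OF \<open>t \<in> {0..T} \<Longrightarrow> _\<close>[OF that]] by (simp add: ennreal_plus ennreal_mult)
    then show "ennreal ((norm (l t \<omega>))\<^sup>2) * indicator {0..T} t
       \<le> 2 * (ennreal ((norm (k t \<omega>))\<^sup>2) * indicator {0..T} t) + 2 * (ennreal ((norm (k' t \<omega>))\<^sup>2) * indicator {0..T} t)"
      by (auto simp: indicator_def)
  qed
  also have "\<dots> = 2 * sqnorm k T \<omega> + 2 * sqnorm k' T \<omega>"
    unfolding sqnorm_def by (subst nn_integral_add) (auto simp: nn_integral_cmult)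
  finally show ?thesis .
qed

context cyl_brownian begin

lemma simp_int_strongly_measurable:
  "simp_int h J \<Longrightarrow> strongly_measurable (time_prod Q) (\<lambda>p. h (fst p) (snd p))"
  by (intro strongly_measurable_time_prod_of_borel strongly_measurable_simple simp_int_simple)

text \<open>The two integrals differ only at the single time 0.\<close>

lemma energy_sqnorm:
  assumes "simp_int h J"
  shows "ennreal (energy h 0 T \<omega>) = sqnorm h T \<omega>"
proof -
  have "ennreal (energy h 0 T \<omega>) = (\<integral>\<^sup>+t. ennreal (indicator {0<..T} t *\<^sub>R (norm (h t \<omega>))\<^sup>2) \<partial>lborel)"
    unfolding energy_def set_lebesgue_integral_def
    using simp_int_set_integrable[OF assms, of 0 T \<omega>] unfolding set_integrable_def
    by (subst nn_integral_eq_integral) auto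
  also have "\<dots> = sqnorm h T \<omega>" unfolding sqnorm_def
  proof (rule nn_integral_cong_AE)
    have "AE t in lborel. t \<noteq> (0::real)" by (rule AE_lborel_singleton)
    then show "AE t in lborel. ennreal (indicator {0<..T} t *\<^sub>R (norm (h t \<omega>))\<^sup>2) = ennreal ((norm (h t \<omega>))\<^sup>2) * indicator {0..T} t"
      by eventually_elim (auto simp: indicator_def)
  qed
  finally show ?thesis .
qed

end

section \<open>Limit of a fast convergent sequence of elementary integrands\<close>

locale cyl_brownian_banach = cyl_brownian Q E W
  for Q :: "'b measure" and E :: "real \<Rightarrow> 'b measure" and W :: "'h::{real_inner, banach} \<Rightarrow> real \<Rightarrow> 'b \<Rightarrow> real"
begin

text \<open>The default value 0 makes the limit exist at every time and path. Measurability then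
  holds exactly rather than up to a null set, as is appropriate for a filtration \<open>E\<close>
  that is not assumed complete.\<close>

definition limit_process :: "(nat \<Rightarrow> real \<Rightarrow> 'b \<Rightarrow> 'h) \<Rightarrow> real \<Rightarrow> 'b \<Rightarrow> 'h" where
  "limit_process h t \<omega> = (if Cauchy (\<lambda>n. h n t \<omega>) then lim (\<lambda>n. h n t \<omega>) else 0)"

text \<open>With time capped at \<open>T\<close>, the Cauchy set and the elementary integrands are
  measurable for \<open>E T\<close>; setting the integrands to 0 off that set gives a sequence that
  converges everywhere.\<close>

lemma limit_process_progressive:
  assumes S: "\<And>n. simp_int (h n) (J n)"
  shows "progressively_measurable E (limit_process h)"
  unfolding progressively_measurable_def
proof (intro allI impI)
  fix T :: real assume T: "0 \<le> T"
  let ?M = "(borel :: real measure) \<Otimes>\<^sub>M E T"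
  let ?C = "{p\<in>space ?M. Cauchy (\<lambda>n. h n (min (fst p) T) (snd p))}"
  have C [measurable]: "?C \<in> sets ?M"
    by (rule Cauchy_set_measurable)
      (rule simp_int_norm_measurable(3)[OF simp_int_diff[OF S S] T])
  have [measurable]: "(\<lambda>p. h n (min (fst p) T) (snd p)) \<in> borel_measurable ?M" for n
    using simp_int_simple_upto[OF S T] by (rule borel_measurable_simple_function)
  have m: "(\<lambda>p. if p \<in> ?C then h n (min (fst p) T) (snd p) else 0) \<in> borel_measurable ?M" for n
    by measurable
  have "(\<lambda>p. limit_process h (min (fst p) T) (snd p)) \<in> borel_measurable ?M"
  proof (rule borel_measurable_LIMSEQ_metric[OF m])
    fix p assume p: "p \<in> space ?M"
    show "(\<lambda>n. if p \<in> ?C then h n (min (fst p) T) (snd p) else 0) \<longlonglongrightarrow> limit_process h (min (fst p) T) (snd p)"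
      using p by (auto simp: limit_process_def convergent_LIMSEQ_iff[symmetric] Cauchy_convergent_iff)
  qed
  moreover have "(\<lambda>p. (fst p, snd p)) \<in> measurable (restrict_space borel {0..T} \<Otimes>\<^sub>M E T) ?M"
    by (intro measurable_Pair measurable_snd measurable_compose[OF measurable_fst measurable_restrict_space1]) simp
  ultimately have "(\<lambda>p. limit_process h (min (fst p) T) (snd p)) \<in> borel_measurable (restrict_space borel {0..T} \<Otimes>\<^sub>M E T)"
    using measurable_compose by fastforce
  then show "(\<lambda>(t, \<omega>). limit_process h t \<omega>) \<in> borel_measurable (restrict_space borel {0..T} \<Otimes>\<^sub>M E T)"
    by (rule measurable_cong[THEN iffD1, rotated]) (auto simp: space_pair_measure space_restrict_space min_def)
qed

lemma limit_process_strongly_measurable: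
  assumes S: "\<And>n. simp_int (h n) (J n)"
  shows "strongly_measurable (time_prod Q) (\<lambda>p. limit_process h (fst p) (snd p))"
proof (rule strongly_measurable_time_prod_of_borel)
  let ?M = "(borel :: real measure) \<Otimes>\<^sub>M Q"
  let ?C = "{p\<in>space ?M. Cauchy (\<lambda>n. h n (fst p) (snd p))}"
  have C: "?C \<in> sets ?M"
    by (rule Cauchy_set_measurable) (rule simp_int_norm_measurable(2)[OF simp_int_diff[OF S S]])
  show "strongly_measurable ?M (\<lambda>p. limit_process h (fst p) (snd p))"
    unfolding strongly_measurable_def
  proof (intro exI[of _ "\<lambda>n p. if p \<in> ?C then h n (fst p) (snd p) else 0"] conjI allI ballI)
    show "simple_function ?M (\<lambda>p. if p \<in> ?C then h n (fst p) (snd p) else 0)" for n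
      using simp_int_simple[OF S] C by (intro simple_function_If_set) auto
    show "(\<lambda>n. if p \<in> ?C then h n (fst p) (snd p) else 0) \<longlonglongrightarrow> limit_process h (fst p) (snd p)"
      if "p \<in> space ?M" for p
      using that by (auto simp: limit_process_def convergent_LIMSEQ_iff[symmetric] Cauchy_convergent_iff)
  qed
qed

lemma limit_process_L2:
  assumes S: "\<And>n. simp_int (h n) (J n)"
    and fast: "AE \<omega> in Q. \<forall>T. \<forall>\<^sub>F n in sequentially. energy (\<lambda>t \<omega>. h n t \<omega> - h (Suc n) t \<omega>) 0 T \<omega> \<le> (1 / 8) ^ n"
  shows "AE \<omega> in Q. AE t in lborel. 0 \<le> t \<longrightarrow> (\<lambda>n. h n t \<omega>) \<longlonglongrightarrow> limit_process h t \<omega>"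
    and "AE \<omega> in Q. \<forall>T. (\<lambda>n. sqnorm (\<lambda>t \<omega>. h n t \<omega> - limit_process h t \<omega>) T \<omega>) \<longlonglongrightarrow> 0"
    and "AE \<omega> in Q. \<forall>T. sqnorm (limit_process h) T \<omega> < \<infinity>"
proof -
  let ?u = "limit_process h"
  define d where "d n = (\<lambda>t \<omega>. h n t \<omega> - h (Suc n) t \<omega>)" for n
  have D: "simp_int (d n) (\<lambda>t \<omega>. J n t \<omega> - J (Suc n) t \<omega>)" for n
    unfolding d_def by (rule simp_int_diff[OF S S])
  \<comment> \<open>Energies of order 8^-n against weights 4^n leave a geometric series of ratio
    1/2, so \<open>w\<close> is integrable over compact time intervals. Where \<open>w\<close> is
    finite, it bounds the distance of \<open>h n\<close> to its limit with an explicit rate, and so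
    it also dominates.\<close>
  define w where "w t \<omega> = (\<Sum>n. ennreal (4 ^ n * (norm (d n t \<omega>))\<^sup>2))" for t \<omega>
  have dm: "(\<lambda>p. norm (d n (fst p) (snd p))) \<in> borel_measurable (time_prod Q)" for n
    using simp_int_strongly_measurable[OF D] by (rule strongly_measurable_norm)
  have wm: "(\<lambda>p. w (fst p) (snd p)) \<in> borel_measurable (time_prod Q)"
    unfolding w_def using dm by measurable
  have pt: "(\<lambda>n. h n t \<omega>) \<longlonglongrightarrow> ?u t \<omega> \<and> (\<forall>n. ennreal ((norm (h n t \<omega> - ?u t \<omega>))\<^sup>2) \<le> ennreal (4 / 4 ^ n) * w t \<omega>)"
    if fin: "w t \<omega> < \<infinity>" for t \<omega>
  proof -
    obtain V where V: "w t \<omega> = ennreal V" "0 \<le> V" using fin by (cases "w t \<omega>" rule: ennreal_cases) auto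
    have le: "4 ^ n * (norm (h n t \<omega> - h (Suc n) t \<omega>))\<^sup>2 \<le> V" for n
    proof -
      have "ennreal (4 ^ n * (norm (d n t \<omega>))\<^sup>2) \<le> w t \<omega>"
      proof -
        have "(\<Sum>i\<in>{n}. ennreal (4 ^ i * (norm (d i t \<omega>))\<^sup>2)) \<le> w t \<omega>"
          unfolding w_def by (rule sum_le_suminf) auto
        then show ?thesis by simp
      qed
      then show ?thesis using V by (simp add: d_def)
    qed
    note q = quadratic_rate_convergent[of "\<lambda>n. h n t \<omega>", OF le]
    have u: "?u t \<omega> = lim (\<lambda>n. h n t \<omega>)" using q(1) by (simp add: limit_process_def Cauchy_convergent_iff)
    have "ennreal ((norm (h n t \<omega> - ?u t \<omega>))\<^sup>2) \<le> ennreal (4 / 4 ^ n) * w t \<omega>" for n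
      using ennreal_leI[OF q(2)[of n]] V unfolding u by (simp flip: ennreal_mult)
    then show ?thesis using q(1) u by (simp add: convergent_LIMSEQ_iff)
  qed
  have wfin: "AE \<omega> in Q. \<forall>T. (\<integral>\<^sup>+t\<in>{0..T}. w t \<omega> \<partial>lborel) < \<infinity>"
    using fast AE_space
  proof eventually_elim
    case (elim \<omega>)
    show ?case
    proof
      fix T
      have "(\<integral>\<^sup>+t\<in>{0..T}. w t \<omega> \<partial>lborel) = (\<integral>\<^sup>+t. (\<Sum>n. ennreal (4 ^ n) * (ennreal ((norm (d n t \<omega>))\<^sup>2) * indicator {0..T} t)) \<partial>lborel)"
        unfolding w_def by (intro nn_integral_cong) (simp add: ennreal_suminf_multc[symmetric] ennreal_mult mult.assoc)
      also have "\<dots> = (\<Sum>n. \<integral>\<^sup>+t. ennreal (4 ^ n) * (ennreal ((norm (d n t \<omega>))\<^sup>2) * indicator {0..T} t) \<partial>lborel)"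
        using sqnorm_section_measurable[OF dm elim(2)] by (intro nn_integral_suminf) auto
      also have "\<dots> = (\<Sum>n. ennreal (4 ^ n) * sqnorm (d n) T \<omega>)"
        unfolding sqnorm_def using sqnorm_section_measurable[OF dm elim(2)] by (subst nn_integral_cmult) auto
      also have "\<dots> = (\<Sum>n. ennreal (4 ^ n * energy (d n) 0 T \<omega>))"
        by (simp add: energy_sqnorm[OF D, symmetric] ennreal_mult energy_nonneg)
      also have "\<dots> < \<infinity>"
      proof -
        have "\<forall>\<^sub>F n in sequentially. energy (d n) 0 T \<omega> \<le> (1 / 8) ^ n" using elim(1) unfolding d_def by blast
        then have "\<forall>\<^sub>F n in sequentially. norm (4 ^ n * energy (d n) 0 T \<omega>) \<le> (1 / 2) ^ n"
        proof eventually_elim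
          case (elim n)
          have "4 ^ n * energy (d n) 0 T \<omega> \<le> 4 ^ n * (1 / 8) ^ n" using elim by (intro mult_left_mono) auto
          also have "\<dots> = (1 / 2) ^ n" by (simp flip: power_mult_distrib)
          finally show ?case using energy_nonneg by simp
        qed
        then have "summable (\<lambda>n. 4 ^ n * energy (d n) 0 T \<omega>)"
          by (rule summable_comparison_test_ev) (simp add: summable_geometric)
        then show ?thesis using energy_nonneg by (subst suminf_ennreal2) auto
      qed
      finally show "(\<integral>\<^sup>+t\<in>{0..T}. w t \<omega> \<partial>lborel) < \<infinity>" .
    qed
  qed
  have wae: "AE \<omega> in Q. AE t in lborel. 0 \<le> t \<longrightarrow> w t \<omega> < \<infinity>"
    using wfin AE_space
  proof eventually_elim
    case (elim \<omega>)
    have "AE t in lborel. w t \<omega> * indicator {0..real n} t \<noteq> \<infinity>" for n :: nat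
      using time_section_measurable[OF wm elim(2)] elim(1) by (intro nn_integral_PInf_AE) (auto simp: less_top)
    then have "AE t in lborel. \<forall>n. w t \<omega> * indicator {0..real n} t \<noteq> \<infinity>" by (simp add: AE_all_countable)
    then show ?case
    proof eventually_elim
      case (elim t)
      show ?case
      proof
        assume "0 \<le> t"
        obtain n :: nat where "t \<le> real n" using real_arch_simple by blast
        then show "w t \<omega> < \<infinity>" using elim[rule_format, of n] \<open>0 \<le> t\<close> by (auto simp: indicator_def less_top)
      qed
    qed
  qed
  show "AE \<omega> in Q. AE t in lborel. 0 \<le> t \<longrightarrow> (\<lambda>n. h n t \<omega>) \<longlonglongrightarrow> ?u t \<omega>"
    using wae
  proof eventually_elim
    case (elim \<omega>)
    then show ?case by eventually_elim (use pt in blast)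
  qed
  have bd: "AE \<omega> in Q. \<forall>T n. sqnorm (\<lambda>t \<omega>. h n t \<omega> - ?u t \<omega>) T \<omega> \<le> ennreal (4 / 4 ^ n) * (\<integral>\<^sup>+t\<in>{0..T}. w t \<omega> \<partial>lborel)"
    using wae AE_space
  proof eventually_elim
    case (elim \<omega>)
    show ?case
    proof (intro allI)
      fix T n
      have "sqnorm (\<lambda>t \<omega>. h n t \<omega> - ?u t \<omega>) T \<omega> \<le> (\<integral>\<^sup>+t. ennreal (4 / 4 ^ n) * (w t \<omega> * indicator {0..T} t) \<partial>lborel)"
        unfolding sqnorm_def
      proof (rule nn_integral_mono_AE)
        show "AE t in lborel. ennreal ((norm (h n t \<omega> - ?u t \<omega>))\<^sup>2) * indicator {0..T} t \<le> ennreal (4 / 4 ^ n) * (w t \<omega> * indicator {0..T} t)"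
          using elim(1) by eventually_elim (use pt in \<open>auto simp: indicator_def\<close>)
      qed
      also have "\<dots> = ennreal (4 / 4 ^ n) * (\<integral>\<^sup>+t\<in>{0..T}. w t \<omega> \<partial>lborel)"
        using time_section_measurable[OF wm elim(2)] by (rule nn_integral_cmult)
      finally show "sqnorm (\<lambda>t \<omega>. h n t \<omega> - ?u t \<omega>) T \<omega> \<le> ennreal (4 / 4 ^ n) * (\<integral>\<^sup>+t\<in>{0..T}. w t \<omega> \<partial>lborel)" .
    qed
  qed
  have c0: "(\<lambda>n. 4 / 4 ^ n * c) \<longlonglongrightarrow> (0::real)" for c
    using tendsto_mult_right_zero[OF LIMSEQ_inverse_realpow_zero[of 4], of "4 * c"] by (simp add: divide_inverse mult_ac)
  show lim0: "AE \<omega> in Q. \<forall>T. (\<lambda>n. sqnorm (\<lambda>t \<omega>. h n t \<omega> - ?u t \<omega>) T \<omega>) \<longlonglongrightarrow> 0"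
    using bd wfin
  proof eventually_elim
    case (elim \<omega>)
    show ?case
    proof
      fix T
      obtain V where V: "(\<integral>\<^sup>+t\<in>{0..T}. w t \<omega> \<partial>lborel) = ennreal V" "0 \<le> V"
        using elim(2)[rule_format, of T] by (cases "\<integral>\<^sup>+t\<in>{0..T}. w t \<omega> \<partial>lborel" rule: ennreal_cases) auto
      have up: "(\<lambda>n. ennreal (4 / 4 ^ n * V)) \<longlonglongrightarrow> 0"
        using tendsto_ennrealI[OF c0[of V]] by simp
      show "(\<lambda>n. sqnorm (\<lambda>t \<omega>. h n t \<omega> - ?u t \<omega>) T \<omega>) \<longlonglongrightarrow> 0"
      proof (rule tendsto_sandwich[OF _ _ tendsto_const up])
        show "\<forall>\<^sub>F n in sequentially. sqnorm (\<lambda>t \<omega>. h n t \<omega> - ?u t \<omega>) T \<omega> \<le> ennreal (4 / 4 ^ n * V)"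
        proof (rule always_eventually, rule allI)
          fix n
          have "ennreal (4 / 4 ^ n * V) = ennreal (4 / 4 ^ n) * ennreal V"
            using V by (intro ennreal_mult) auto
          then show "sqnorm (\<lambda>t \<omega>. h n t \<omega> - ?u t \<omega>) T \<omega> \<le> ennreal (4 / 4 ^ n * V)"
            using elim(1)[rule_format, of n T] V by simp
        qed
      qed simp
    qed
  qed
  have um: "strongly_measurable (time_prod Q) (\<lambda>p. ?u (fst p) (snd p))"
    by (rule limit_process_strongly_measurable[OF S])
  have hm: "strongly_measurable (time_prod Q) (\<lambda>p. h n (fst p) (snd p))" for n
    by (rule simp_int_strongly_measurable[OF S])
  show "AE \<omega> in Q. \<forall>T. sqnorm ?u T \<omega> < \<infinity>"
    using bd wfin AE_space
  proof eventually_elim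
    case (elim \<omega>)
    show ?case
    proof
      fix T
      have "sqnorm ?u T \<omega> \<le> 2 * sqnorm (h 0) T \<omega> + 2 * sqnorm (\<lambda>t \<omega>. h 0 t \<omega> - ?u t \<omega>) T \<omega>"
        by (rule sqnorm_add_le[OF strongly_measurable_norm[OF hm] strongly_measurable_norm[OF strongly_measurable_diff[OF hm um]] elim(3)])
          (metis add.commute norm_minus_commute norm_triangle_sub)
      also have "\<dots> < \<infinity>"
      proof -
        have "ennreal (4 / 4 ^ 0) * (\<integral>\<^sup>+t\<in>{0..T}. w t \<omega> \<partial>lborel) < \<infinity>" using elim(2) by (simp add: ennreal_mult_less_top)
        then have "sqnorm (\<lambda>t \<omega>. h 0 t \<omega> - ?u t \<omega>) T \<omega> < \<infinity>" using elim(1) le_less_trans by blast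
        moreover have "sqnorm (h 0) T \<omega> < \<infinity>" using energy_sqnorm[OF S, of 0 T \<omega>] by (metis ennreal_less_top infinity_ennreal_def)
        ultimately show ?thesis by (simp add: ennreal_mult_less_top)
      qed
      finally show "sqnorm ?u T \<omega> < \<infinity>" .
    qed
  qed
qed

end

section \<open>The stopped square martingale\<close>

text \<open>The weight of \<open>b^2\<close> can be made arbitrarily small at the expense of the
  factor of \<open>(a - b)^2\<close>, which is the quantity that tends to 0.\<close>

lemma abs_diff_squares_le:
  fixes a b :: real
  assumes "0 < \<eta>"
  shows "\<bar>a\<^sup>2 - b\<^sup>2\<bar> \<le> (1 + 1 / \<eta>) * (a - b)\<^sup>2 + \<eta> * b\<^sup>2"
proof -
  have young: "2 * (\<bar>a - b\<bar> * \<bar>b\<bar>) \<le> (a - b)\<^sup>2 / \<eta> + \<eta> * b\<^sup>2"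
  proof -
    have "2 * (\<bar>a - b\<bar> / sqrt \<eta>) * (sqrt \<eta> * \<bar>b\<bar>) \<le> (\<bar>a - b\<bar> / sqrt \<eta>)\<^sup>2 + (sqrt \<eta> * \<bar>b\<bar>)\<^sup>2"
      by (rule sum_squares_bound)
    then show ?thesis using assms by (simp add: power_divide power_mult_distrib)
  qed
  have "\<bar>a\<^sup>2 - b\<^sup>2\<bar> = \<bar>a - b\<bar> * \<bar>a + b\<bar>" by (simp add: abs_mult[symmetric] power2_eq_square algebra_simps)
  also have "\<dots> \<le> \<bar>a - b\<bar> * (\<bar>a - b\<bar> + 2 * \<bar>b\<bar>)" by (intro mult_left_mono) auto
  also have "\<dots> = (a - b)\<^sup>2 + 2 * (\<bar>a - b\<bar> * \<bar>b\<bar>)" by (simp add: algebra_simps power2_eq_square flip: abs_mult)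
  also have "\<dots> \<le> (a - b)\<^sup>2 + ((a - b)\<^sup>2 / \<eta> + \<eta> * b\<^sup>2)" using young by simp
  finally show ?thesis by (simp add: algebra_simps)
qed

lemma tendsto_0_of_young:
  fixes a b :: "nat \<Rightarrow> real"
  assumes b: "\<And>\<eta> n. 0 < \<eta> \<Longrightarrow> b n \<le> (1 + 1 / \<eta>) * a n + \<eta> * c" "\<And>n. 0 \<le> b n" and "0 \<le> c" and a: "a \<longlonglongrightarrow> 0"
  shows "b \<longlonglongrightarrow> 0"
proof (rule LIMSEQ_I)
  fix e :: real assume e: "0 < e"
  define \<eta> where "\<eta> = e / (2 * (c + 1))"
  have \<eta>: "0 < \<eta>" using e \<open>0 \<le> c\<close> by (auto simp: \<eta>_def)
  have \<eta>c: "\<eta> * c \<le> e / 2" using e \<open>0 \<le> c\<close> by (auto simp: \<eta>_def field_simps)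
  have "(\<lambda>n. (1 + 1 / \<eta>) * a n) \<longlonglongrightarrow> 0" using tendsto_mult_right_zero[OF a] .
  then have "\<forall>\<^sub>F n in sequentially. (1 + 1 / \<eta>) * a n < e / 2" using e by (intro order_tendstoD(2)) auto
  then obtain N where N: "\<And>n. n \<ge> N \<Longrightarrow> (1 + 1 / \<eta>) * a n < e / 2" by (auto simp: eventually_sequentially)
  show "\<exists>no. \<forall>n\<ge>no. norm (b n - 0) < e"
  proof (intro exI allI impI)
    fix n assume "N \<le> n"
    then have "(1 + 1 / \<eta>) * a n + \<eta> * c < e / 2 + e / 2" by (intro add_less_le_mono N \<eta>c)
    then have "b n < e" using b(1)[OF \<eta>, of n] by simp
    then show "norm (b n - 0) < e" using b(2)[of n] by simp
  qed
qed

text \<open>Fatou's lemma in \<open>m\<close> turns the Cauchy bound into a bound by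
  \<open>a n\<close> for the distance to \<open>L\<close>; Young's estimate then gives convergence
  of the squares in mean. The form \<open>a n + a m\<close> is what distances to a common limit
  integrand produce.\<close>

lemma (in prob_space) L2_limit:
  fixes Y :: "nat \<Rightarrow> 'a \<Rightarrow> real"
  assumes [measurable]: "\<And>n. Y n \<in> borel_measurable M" "L \<in> borel_measurable M"
    and i: "\<And>n. integrable M (\<lambda>x. (Y n x)\<^sup>2)"
    and lim: "AE x in M. (\<lambda>n. Y n x) \<longlonglongrightarrow> L x"
    and le: "\<And>n m. (\<integral>x. (Y n x - Y m x)\<^sup>2 \<partial>M) \<le> a n + a m" and a: "a \<longlonglongrightarrow> 0"
  shows "integrable M (\<lambda>x. (L x)\<^sup>2)" "(\<lambda>n. \<integral>x. \<bar>(Y n x)\<^sup>2 - (L x)\<^sup>2\<bar> \<partial>M) \<longlonglongrightarrow> 0"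
proof -
  have id: "integrable M (\<lambda>x. (Y n x - Y m x)\<^sup>2)" for n m
  proof (rule Bochner_Integration.integrable_bound)
    show "integrable M (\<lambda>x. 2 * (Y n x)\<^sup>2 + 2 * (Y m x)\<^sup>2)" using i by simp
    show "AE x in M. norm ((Y n x - Y m x)\<^sup>2) \<le> norm (2 * (Y n x)\<^sup>2 + 2 * (Y m x)\<^sup>2)"
      using square_diff_le by (intro AE_I2) simp
  qed simp
  have a0: "0 \<le> a n" for n using le[of n n] by simp
  have fatou: "(\<integral>\<^sup>+x. ennreal ((Y n x - L x)\<^sup>2) \<partial>M) \<le> ennreal (a n)" for n
  proof -
    have "(\<integral>\<^sup>+x. ennreal ((Y n x - L x)\<^sup>2) \<partial>M) = (\<integral>\<^sup>+x. liminf (\<lambda>m. ennreal ((Y n x - Y m x)\<^sup>2)) \<partial>M)"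
    proof (rule nn_integral_cong_AE)
      show "AE x in M. ennreal ((Y n x - L x)\<^sup>2) = liminf (\<lambda>m. ennreal ((Y n x - Y m x)\<^sup>2))"
        using lim
      proof eventually_elim
        case (elim x)
        have "(\<lambda>m. ennreal ((Y n x - Y m x)\<^sup>2)) \<longlonglongrightarrow> ennreal ((Y n x - L x)\<^sup>2)"
          by (intro tendsto_ennrealI tendsto_intros elim)
        from lim_imp_Liminf[OF _ this] show ?case by simp
      qed
    qed
    also have "\<dots> \<le> liminf (\<lambda>m. \<integral>\<^sup>+x. ennreal ((Y n x - Y m x)\<^sup>2) \<partial>M)"
      by (rule nn_integral_liminf) simp
    also have "\<dots> \<le> liminf (\<lambda>m. ennreal (a n + a m))"
    proof (intro Liminf_mono always_eventually allI)
      fix m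
      have "(\<integral>\<^sup>+x. ennreal ((Y n x - Y m x)\<^sup>2) \<partial>M) = ennreal (\<integral>x. (Y n x - Y m x)\<^sup>2 \<partial>M)"
        by (rule nn_integral_eq_integral[OF id]) simp
      then show "(\<integral>\<^sup>+x. ennreal ((Y n x - Y m x)\<^sup>2) \<partial>M) \<le> ennreal (a n + a m)"
        using le by (simp add: ennreal_leI)
    qed
    also have "\<dots> = ennreal (a n)"
    proof -
      have "(\<lambda>m. ennreal (a n + a m)) \<longlonglongrightarrow> ennreal (a n + 0)" by (intro tendsto_ennrealI tendsto_intros a)
      from lim_imp_Liminf[OF _ this] show ?thesis by simp
    qed
    finally show ?thesis .
  qed
  have iL: "integrable M (\<lambda>x. (Y n x - L x)\<^sup>2)" for n
    using fatou[of n] by (intro integrableI_bounded) (auto simp: top_unique less_top[symmetric] intro: le_less_trans)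
  have eL: "(\<integral>x. (Y n x - L x)\<^sup>2 \<partial>M) \<le> a n" for n
    using fatou[of n] nn_integral_eq_integral[OF iL[of n]] a0 by (simp add: integral_nonneg_AE)
  show L2: "integrable M (\<lambda>x. (L x)\<^sup>2)"
  proof (rule Bochner_Integration.integrable_bound)
    show "integrable M (\<lambda>x. 2 * (Y 0 x)\<^sup>2 + 2 * (Y 0 x - L x)\<^sup>2)" using i iL by simp
    show "AE x in M. norm ((L x)\<^sup>2) \<le> norm (2 * (Y 0 x)\<^sup>2 + 2 * (Y 0 x - L x)\<^sup>2)"
    proof (rule AE_I2)
      fix x show "norm ((L x)\<^sup>2) \<le> norm (2 * (Y 0 x)\<^sup>2 + 2 * (Y 0 x - L x)\<^sup>2)"
        using square_diff_le[of "Y 0 x" "Y 0 x - L x"] by simp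
    qed
  qed simp
  have iabs: "integrable M (\<lambda>x. \<bar>(Y n x)\<^sup>2 - (L x)\<^sup>2\<bar>)" for n using i L2 by simp
  show "(\<lambda>n. \<integral>x. \<bar>(Y n x)\<^sup>2 - (L x)\<^sup>2\<bar> \<partial>M) \<longlonglongrightarrow> 0"
  proof (rule tendsto_0_of_young[OF _ _ _ a, where c="\<integral>x. (L x)\<^sup>2 \<partial>M"])
    fix \<eta> :: real and n assume \<eta>: "0 < \<eta>"
    have "(\<integral>x. \<bar>(Y n x)\<^sup>2 - (L x)\<^sup>2\<bar> \<partial>M) \<le> (\<integral>x. (1 + 1 / \<eta>) * (Y n x - L x)\<^sup>2 + \<eta> * (L x)\<^sup>2 \<partial>M)"
      using iL L2 by (intro integral_mono iabs abs_diff_squares_le[OF \<eta>]) auto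
    also have "\<dots> = (1 + 1 / \<eta>) * (\<integral>x. (Y n x - L x)\<^sup>2 \<partial>M) + \<eta> * (\<integral>x. (L x)\<^sup>2 \<partial>M)"
      using iL L2 by simp
    also have "\<dots> \<le> (1 + 1 / \<eta>) * a n + \<eta> * (\<integral>x. (L x)\<^sup>2 \<partial>M)"
      using \<eta> eL by (intro add_right_mono mult_left_mono) auto
    finally show "(\<integral>x. \<bar>(Y n x)\<^sup>2 - (L x)\<^sup>2\<bar> \<partial>M) \<le> (1 + 1 / \<eta>) * a n + \<eta> * (\<integral>x. (L x)\<^sup>2 \<partial>M)" .
  qed simp_all
qed

text \<open>The pointwise Young estimate is integrated once in each direction, because differences
  are awkward in \<open>ennreal\<close>. The two one-sided bounds are joined in the reals.\<close>

lemma sqnorm_young: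
  assumes k: "(\<lambda>p. norm (k (fst p) (snd p))) \<in> borel_measurable (time_prod P)"
    and v: "(\<lambda>p. norm (v (fst p) (snd p))) \<in> borel_measurable (time_prod P)"
    and kv: "(\<lambda>p. norm (k (fst p) (snd p) - v (fst p) (snd p))) \<in> borel_measurable (time_prod P)"
    and \<omega>: "\<omega> \<in> space P" and \<eta>: "0 < \<eta>"
    and fin: "sqnorm k T \<omega> = ennreal a" "sqnorm v T \<omega> = ennreal A"
      "sqnorm (\<lambda>t \<omega>. k t \<omega> - v t \<omega>) T \<omega> = ennreal x" "0 \<le> a" "0 \<le> A" "0 \<le> x"
  shows "\<bar>a - A\<bar> \<le> (1 + 1 / \<eta>) * x + \<eta> * A"
proof -
  let ?K = "\<lambda>t. ennreal ((norm (k t \<omega>))\<^sup>2) * indicator {0..T} t"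
  let ?V = "\<lambda>t. ennreal ((norm (v t \<omega>))\<^sup>2) * indicator {0..T} t"
  let ?X = "\<lambda>t. ennreal ((norm (k t \<omega> - v t \<omega>))\<^sup>2) * indicator {0..T} t"
  have m [measurable]: "?K \<in> borel_measurable lborel" "?V \<in> borel_measurable lborel" "?X \<in> borel_measurable lborel"
    using sqnorm_section_measurable[OF k \<omega>] sqnorm_section_measurable[OF v \<omega>]
      sqnorm_section_measurable[where k="\<lambda>t \<omega>. k t \<omega> - v t \<omega>", OF kv \<omega>] by auto
  have pt: "\<bar>(norm (k t \<omega>))\<^sup>2 - (norm (v t \<omega>))\<^sup>2\<bar> \<le> (1 + 1 / \<eta>) * (norm (k t \<omega> - v t \<omega>))\<^sup>2 + \<eta> * (norm (v t \<omega>))\<^sup>2" for t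
  proof -
    have "(norm (k t \<omega>) - norm (v t \<omega>))\<^sup>2 \<le> (norm (k t \<omega> - v t \<omega>))\<^sup>2"
      using norm_triangle_ineq3[of "k t \<omega>" "v t \<omega>"] by (simp add: abs_le_square_iff[symmetric])
    then have "(1 + 1 / \<eta>) * (norm (k t \<omega>) - norm (v t \<omega>))\<^sup>2 \<le> (1 + 1 / \<eta>) * (norm (k t \<omega> - v t \<omega>))\<^sup>2"
      using \<eta> by (intro mult_left_mono) auto
    then show ?thesis using abs_diff_squares_le[OF \<eta>, of "norm (k t \<omega>)" "norm (v t \<omega>)"] by linarith
  qed
  have *: "ennreal p * i \<le> ennreal q * i + (ennreal (1 + 1 / \<eta>) * (ennreal y * i) + ennreal \<eta> * (ennreal z * i))"
    if "p \<le> q + ((1 + 1 / \<eta>) * y + \<eta> * z)" "0 \<le> q" "0 \<le> y" "0 \<le> z" for p q y z and i :: ennreal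
  proof -
    have "ennreal p \<le> ennreal (q + ((1 + 1 / \<eta>) * y + \<eta> * z))" by (rule ennreal_leI) fact
    also have "\<dots> = ennreal q + (ennreal (1 + 1 / \<eta>) * ennreal y + ennreal \<eta> * ennreal z)"
      using that \<eta> by (simp add: ennreal_plus ennreal_mult del: ennreal_plus[symmetric])
    finally have "ennreal p * i \<le> (ennreal q + (ennreal (1 + 1 / \<eta>) * ennreal y + ennreal \<eta> * ennreal z)) * i"
      by (rule mult_right_mono) simp
    then show ?thesis by (simp add: distrib_right mult.assoc)
  qed
  have R: "(\<integral>\<^sup>+t. f t + (ennreal (1 + 1 / \<eta>) * ?X t + ennreal \<eta> * ?V t) \<partial>lborel)
     = (\<integral>\<^sup>+t. f t \<partial>lborel) + ennreal ((1 + 1 / \<eta>) * x + \<eta> * A)" if [measurable]: "f \<in> borel_measurable lborel" for f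
  proof -
    have "(\<integral>\<^sup>+t. f t + (ennreal (1 + 1 / \<eta>) * ?X t + ennreal \<eta> * ?V t) \<partial>lborel)
      = (\<integral>\<^sup>+t. f t \<partial>lborel) + (ennreal (1 + 1 / \<eta>) * (\<integral>\<^sup>+t. ?X t \<partial>lborel) + ennreal \<eta> * (\<integral>\<^sup>+t. ?V t \<partial>lborel))"
      by (simp add: nn_integral_add nn_integral_cmult)
    also have "(\<integral>\<^sup>+t. ?X t \<partial>lborel) = ennreal x" using fin(3) unfolding sqnorm_def .
    also have "(\<integral>\<^sup>+t. ?V t \<partial>lborel) = ennreal A" using fin(2) unfolding sqnorm_def .
    also have "ennreal (1 + 1 / \<eta>) * ennreal x + ennreal \<eta> * ennreal A = ennreal ((1 + 1 / \<eta>) * x + \<eta> * A)"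
      using fin \<eta> by (simp add: ennreal_plus ennreal_mult)
    finally show ?thesis .
  qed
  have nn: "0 \<le> (1 + 1 / \<eta>) * x + \<eta> * A" using fin \<eta> by simp
  have "ennreal a \<le> (\<integral>\<^sup>+t. ?V t + (ennreal (1 + 1 / \<eta>) * ?X t + ennreal \<eta> * ?V t) \<partial>lborel)"
    unfolding fin(1)[symmetric] sqnorm_def
  proof (intro nn_integral_mono *)
    fix t show "(norm (k t \<omega>))\<^sup>2 \<le> (norm (v t \<omega>))\<^sup>2 + ((1 + 1 / \<eta>) * (norm (k t \<omega> - v t \<omega>))\<^sup>2 + \<eta> * (norm (v t \<omega>))\<^sup>2)"
      using pt[of t] by linarith
  qed auto
  also have "\<dots> = ennreal A + ennreal ((1 + 1 / \<eta>) * x + \<eta> * A)"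
    using R[OF m(2)] fin(2) unfolding sqnorm_def by simp
  also have "\<dots> = ennreal (A + ((1 + 1 / \<eta>) * x + \<eta> * A))" using fin nn by simp
  finally have "ennreal a \<le> ennreal (A + ((1 + 1 / \<eta>) * x + \<eta> * A))" .
  then have 1: "a \<le> A + ((1 + 1 / \<eta>) * x + \<eta> * A)"
    by (subst (asm) ennreal_le_iff) (use fin nn in simp_all)
  have "ennreal A \<le> (\<integral>\<^sup>+t. ?K t + (ennreal (1 + 1 / \<eta>) * ?X t + ennreal \<eta> * ?V t) \<partial>lborel)"
    unfolding fin(2)[symmetric] sqnorm_def
  proof (intro nn_integral_mono *)
    fix t show "(norm (v t \<omega>))\<^sup>2 \<le> (norm (k t \<omega>))\<^sup>2 + ((1 + 1 / \<eta>) * (norm (k t \<omega> - v t \<omega>))\<^sup>2 + \<eta> * (norm (v t \<omega>))\<^sup>2)"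
      using pt[of t] by linarith
  qed auto
  also have "\<dots> = ennreal a + ennreal ((1 + 1 / \<eta>) * x + \<eta> * A)"
    using R[OF m(1)] fin(1) unfolding sqnorm_def by simp
  also have "\<dots> = ennreal (a + ((1 + 1 / \<eta>) * x + \<eta> * A))" using fin nn by simp
  finally have "ennreal A \<le> ennreal (a + ((1 + 1 / \<eta>) * x + \<eta> * A))" .
  then have "A \<le> a + ((1 + 1 / \<eta>) * x + \<eta> * A)"
    by (subst (asm) ennreal_le_iff) (use fin nn in simp_all)
  with 1 show ?thesis by linarith
qed

lemma sqnorm_tendsto:
  fixes k :: "nat \<Rightarrow> real \<Rightarrow> 'a \<Rightarrow> 'e::real_normed_vector"
  assumes k: "\<And>n. (\<lambda>p. norm (k n (fst p) (snd p))) \<in> borel_measurable (time_prod P)"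
    and v: "(\<lambda>p. norm (v (fst p) (snd p))) \<in> borel_measurable (time_prod P)"
    and kv: "\<And>n. (\<lambda>p. norm (k n (fst p) (snd p) - v (fst p) (snd p))) \<in> borel_measurable (time_prod P)"
    and \<omega>: "\<omega> \<in> space P"
    and fin: "\<And>n. sqnorm (k n) T \<omega> = ennreal (a n)" "sqnorm v T \<omega> = ennreal A" "\<And>n. 0 \<le> a n" "0 \<le> A"
    and lim: "(\<lambda>n. sqnorm (\<lambda>t \<omega>. k n t \<omega> - v t \<omega>) T \<omega>) \<longlonglongrightarrow> 0"
  shows "a \<longlonglongrightarrow> A"
proof -
  define x where "x n = enn2real (sqnorm (\<lambda>t \<omega>. k n t \<omega> - v t \<omega>) T \<omega>)" for n
  have "sqnorm (\<lambda>t \<omega>. k n t \<omega> - v t \<omega>) T \<omega> \<le> 2 * sqnorm (k n) T \<omega> + 2 * sqnorm v T \<omega>" for n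
    by (rule sqnorm_add_le[OF k v \<omega>]) (rule norm_triangle_ineq4)
  also have "2 * sqnorm (k n) T \<omega> + 2 * sqnorm v T \<omega> < \<infinity>" for n
    using fin by (simp add: ennreal_mult_less_top)
  finally have x: "sqnorm (\<lambda>t \<omega>. k n t \<omega> - v t \<omega>) T \<omega> = ennreal (x n)" for n
    unfolding x_def by (simp add: less_top)
  have x0: "0 \<le> x n" for n by (simp add: x_def)
  have "(\<lambda>n. x n) \<longlonglongrightarrow> 0"
    using tendsto_enn2real[OF lim[folded ennreal_0]] unfolding x_def by simp
  then have "(\<lambda>n. \<bar>a n - A\<bar>) \<longlonglongrightarrow> 0"
  proof (rule tendsto_0_of_young[rotated 3])
    show "\<bar>a n - A\<bar> \<le> (1 + 1 / \<eta>) * x n + \<eta> * A" if "0 < \<eta>" for \<eta> n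
      by (rule sqnorm_young[OF k v kv \<omega> that fin(1,2) x fin(3,4) x0])
  qed (use fin(4) in simp_all)
  then show ?thesis by (simp add: LIM_zero_iff tendsto_rabs_zero_iff)
qed

section \<open>Energy of a gated integrand and the square martingale of an elementary
  integral\<close>

context cyl_brownian begin

text \<open>At the left end of the last open interval the energy is at most \<open>d\<close>; that
  interval adds at most \<open>C^2 * \<delta>\<close>, and nothing is added afterwards.\<close>

lemma gate_energy_le:
  assumes S: "simp_int h J" and \<delta>: "0 < \<delta>" and D: "\<And>i. i < m \<Longrightarrow> D i \<in> sets (E (real i * \<delta>))"
    and dec: "\<And>i. \<omega> \<in> D (Suc i) \<Longrightarrow> \<omega> \<in> D i"
    and d: "\<And>i. \<omega> \<in> D i \<Longrightarrow> energy h 0 (real i * \<delta>) \<omega> \<le> d" "0 \<le> d"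
    and C: "\<And>r. norm (h r \<omega>) \<le> C"
  shows "energy (gate h \<delta> m D) 0 (real m * \<delta>) \<omega> \<le> d + C\<^sup>2 * \<delta>"
proof -
  let ?h = "gate h \<delta> m D"
  have S': "simp_int ?h (gate_int J \<delta> m D)" by (rule simp_int_gate[OF S \<delta> D])
  from decreasing_threshold[of "\<lambda>i. \<omega> \<in> D i" m, OF dec]
  obtain k where k: "k \<le> m" "\<And>i. i < k \<Longrightarrow> \<omega> \<in> D i" "\<And>i. k \<le> i \<Longrightarrow> i < m \<Longrightarrow> \<omega> \<notin> D i" by blast
  have kl: "real k * \<delta> \<le> real m * \<delta>" using k \<delta> by (intro mult_right_mono) auto
  have hr: "?h r \<omega> = (if r \<le> real k * \<delta> then h r \<omega> else 0)" if "0 < r" "r \<le> real m * \<delta>" for r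
    using gate_threshold[OF \<delta> k, where t=r and h=h] that by simp
  have "energy ?h 0 (real m * \<delta>) \<omega> = energy ?h 0 (real k * \<delta>) \<omega> + energy ?h (real k * \<delta>) (real m * \<delta>) \<omega>"
    using kl \<delta> by (intro energy_split[OF S']) auto
  also have "energy ?h (real k * \<delta>) (real m * \<delta>) \<omega> = 0"
  proof (rule energy_eq_0)
    fix r assume "real k * \<delta> < r" "r \<le> real m * \<delta>"
    moreover have "0 \<le> real k * \<delta>" using \<delta> by simp
    ultimately show "?h r \<omega> = 0" using hr[of r] by simp
  qed
  also have "energy ?h 0 (real k * \<delta>) \<omega> = energy h 0 (real k * \<delta>) \<omega>"
    using hr kl by (intro energy_cong) auto
  also have "energy h 0 (real k * \<delta>) \<omega> \<le> d + C\<^sup>2 * \<delta>"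
  proof (cases k)
    case 0
    then show ?thesis using energy_eq_0[of 0 0 h \<omega>] d(2) \<delta> by simp
  next
    case (Suc i)
    then have "energy h 0 (real i * \<delta>) \<omega> \<le> d" using k(2)[of i] d(1) by auto
    moreover have "energy h (real i * \<delta>) (real k * \<delta>) \<omega> \<le> C\<^sup>2 * (real k * \<delta> - real i * \<delta>)"
      using Suc \<delta> C by (intro energy_le[OF S]) (auto intro!: mult_right_mono)
    moreover have "real k * \<delta> - real i * \<delta> = \<delta>" using Suc by (simp add: algebra_simps)
    moreover have "energy h 0 (real k * \<delta>) \<omega> = energy h 0 (real i * \<delta>) \<omega> + energy h (real i * \<delta>) (real k * \<delta>) \<omega>"
      using Suc \<delta> by (intro energy_split[OF S]) (auto intro!: mult_right_mono)
    ultimately show ?thesis by simp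
  qed
  finally show ?thesis by simp
qed

text \<open>Expand \<open>J t\<close> as \<open>J s\<close> plus an increment. The cross term
  vanishes, and the squared increment balances the energy gained between \<open>s\<close> and
  \<open>t\<close>.\<close>

lemma simp_int_martingale_square:
  assumes S: "simp_int h J" and st: "0 \<le> s" "s \<le> t" and A: "A \<in> sets (E s)"
  shows "(\<integral>\<omega>. indicator A \<omega> * ((J t \<omega>)\<^sup>2 - energy h 0 t \<omega>) \<partial>Q)
    = (\<integral>\<omega>. indicator A \<omega> * ((J s \<omega>)\<^sup>2 - energy h 0 s \<omega>) \<partial>Q)"
proof -
  have AQ: "A \<in> sets Q" using A by (rule sets_F_P)
  have t: "0 \<le> t" using st by simp
  note sq = simp_int_square_integrable[OF S]
  have [measurable]: "J s \<in> borel_measurable Q" "J t \<in> borel_measurable Q"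
    using simp_int_measurable[OF S] st by auto
  have k: "integrable Q (\<lambda>\<omega>. J s \<omega> * (J t \<omega> - J s \<omega>))"
    by (intro integrable_mult_of_squares sq(1)[OF st(1) t] sq(3)[OF order_refl st(1)]) measurable
  have k0: "(\<integral>\<omega>. indicator A \<omega> * (J s \<omega> * (J t \<omega> - J s \<omega>)) \<partial>Q) = 0"
  proof -
    have "(\<lambda>\<omega>. indicator A \<omega> * J s \<omega>) \<in> borel_measurable (E s)"
      using A simp_int_adapted[OF S st(1)] by simp
    from simp_int_martingale(1)[OF S st this] integrable_indicator_mult[OF AQ k] show ?thesis
      by (simp add: mult.assoc)
  qed
  have i: "integrable Q (\<lambda>\<omega>. (J t \<omega> - J s \<omega>)\<^sup>2 - energy h s t \<omega>)" "integrable Q (\<lambda>\<omega>. (J s \<omega>)\<^sup>2 - energy h 0 s \<omega>)"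
    by (intro Bochner_Integration.integrable_diff sq(1)[OF st(1) t] sq(3)[OF order_refl st(1)]
        energy_integrable[OF S] st order_refl)+
  have e: "energy h 0 t \<omega> = energy h 0 s \<omega> + energy h s t \<omega>" for \<omega> using energy_split[OF S st] .
  have "(\<integral>\<omega>. indicator A \<omega> * ((J t \<omega>)\<^sup>2 - energy h 0 t \<omega>) \<partial>Q)
     = (\<integral>\<omega>. indicator A \<omega> * ((J t \<omega> - J s \<omega>)\<^sup>2 - energy h s t \<omega>) + (2 * (indicator A \<omega> * (J s \<omega> * (J t \<omega> - J s \<omega>)))
       + indicator A \<omega> * ((J s \<omega>)\<^sup>2 - energy h 0 s \<omega>)) \<partial>Q)"
    unfolding e by (simp add: algebra_simps power2_eq_square)
  also have "\<dots> = (\<integral>\<omega>. indicator A \<omega> * ((J s \<omega>)\<^sup>2 - energy h 0 s \<omega>) \<partial>Q)"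
    using integrable_indicator_mult[OF AQ i(1)] integrable_indicator_mult[OF AQ i(2)]
      integrable_indicator_mult[OF AQ k] k0 simp_int_martingale_sets(2)[OF S st A] by simp
  finally show ?thesis .
qed

end

lemma ennreal_double_add:
  assumes "0 \<le> a" "0 \<le> b"
  shows "2 * ennreal a + 2 * ennreal b = ennreal (2 * a + 2 * b)"
proof -
  have "ennreal (2 * a + 2 * b) = ennreal (2 * a) + ennreal (2 * b)" using assms by (intro ennreal_plus) auto
  also have "\<dots> = ennreal 2 * ennreal a + ennreal 2 * ennreal b" using assms by (simp only: ennreal_mult[of 2])
  finally show ?thesis by simp
qed

lemma uniform_limit_diagonal:
  fixes J :: "nat \<Rightarrow> real \<Rightarrow> real"
  assumes u: "uniform_limit S J N sequentially" and c: "continuous_on S N"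
    and p: "\<And>n. p n \<in> S" "q \<in> S" "p \<longlonglongrightarrow> q"
  shows "(\<lambda>n. J n (p n)) \<longlonglongrightarrow> N q"
proof -
  have 1: "(\<lambda>n. N (p n)) \<longlonglongrightarrow> N q"
    by (rule continuous_on_tendsto_compose[OF c p(3)]) (use p in auto)
  have "(\<lambda>n. J n (p n) - N (p n)) \<longlonglongrightarrow> 0"
  proof (rule tendstoI)
    fix e :: real assume "0 < e"
    then have "\<forall>\<^sub>F n in sequentially. \<forall>x\<in>S. dist (J n x) (N x) < e" by (rule uniform_limitD[OF u])
    then show "\<forall>\<^sub>F n in sequentially. dist (J n (p n) - N (p n)) 0 < e"
      by eventually_elim (use p in \<open>auto simp: dist_norm\<close>)
  qed
  from tendsto_add[OF this 1] show ?thesis by simp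
qed

context cyl_brownian_banach begin

text \<open>
  Truncating \<open>h\<^sub>n\<close> on a fine grid, both at the time \<open>\<tau>\<close> and when its energy exceeds the bound that
  the limit satisfies before \<open>\<tau>\<close>, makes the convergence of integrands hold in \<open>L\<^sup>2\<close>. The isometry
  then gives \<open>L\<^sup>2\<close> convergence of the integrals.
\<close>

lemma stopped_square_martingale:
  assumes S: "\<And>n. simp_int (h n) (J n)"
    and L2: "AE \<omega> in Q. \<forall>T. (\<lambda>n. sqnorm (\<lambda>t \<omega>. h n t \<omega> - limit_process h t \<omega>) T \<omega>) \<longlonglongrightarrow> 0"
    and JN: "AE \<omega> in Q. \<forall>T. uniform_limit {0..T} (\<lambda>n t. J n t \<omega>) (\<lambda>t. N t \<omega>) sequentially"
    and Nc: "AE \<omega> in Q. continuous_on {0..} (\<lambda>t. N t \<omega>)"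
    and V: "AE \<omega> in Q. \<forall>t\<ge>0. sqnorm (limit_process h) t \<omega> = ennreal (V t \<omega>)"
    and V0: "AE \<omega> in Q. \<forall>t\<ge>0. 0 \<le> V t \<omega>"
    and \<tau>: "\<And>r. 0 \<le> r \<Longrightarrow> {\<omega>\<in>space Q. r < \<tau> \<omega>} \<in> sets (E r)" "\<And>\<omega>. \<omega> \<in> space Q \<Longrightarrow> 0 \<le> \<tau> \<omega>"
    and VK: "AE \<omega> in Q. \<forall>t\<ge>0. V (min t (\<tau> \<omega>)) \<omega> \<le> K"
    and Nm: "\<And>t. 0 \<le> t \<Longrightarrow> (\<lambda>\<omega>. N (min t (\<tau> \<omega>)) \<omega>) \<in> borel_measurable Q"
    and Vm: "\<And>t. 0 \<le> t \<Longrightarrow> (\<lambda>\<omega>. V (min t (\<tau> \<omega>)) \<omega>) \<in> borel_measurable Q"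
    and st: "0 \<le> s" "s \<le> t" and A: "A \<in> sets (E s)"
  shows "integrable Q (\<lambda>\<omega>. (N (min t (\<tau> \<omega>)) \<omega>)\<^sup>2 - V (min t (\<tau> \<omega>)) \<omega>)"
    and "(\<integral>\<omega>. indicator A \<omega> * ((N (min t (\<tau> \<omega>)) \<omega>)\<^sup>2 - V (min t (\<tau> \<omega>)) \<omega>) \<partial>Q)
      = (\<integral>\<omega>. indicator A \<omega> * ((N (min s (\<tau> \<omega>)) \<omega>)\<^sup>2 - V (min s (\<tau> \<omega>)) \<omega>) \<partial>Q)"
proof -
  let ?u = "limit_process h"
  \<comment> \<open>A positive horizon even for \<open>t = 0\<close>, as the grid needs a positive
    step.\<close>
  define T where "T = t + 1"
  have T: "0 < T" "s \<le> T" "t \<le> T" "0 \<le> t" using st by (auto simp: T_def)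
  have um: "strongly_measurable (time_prod Q) (\<lambda>p. ?u (fst p) (snd p))"
    by (rule limit_process_strongly_measurable[OF S])
  have \<tau>m [measurable]: "\<tau> \<in> borel_measurable Q"
  proof (rule borel_measurableI_greater)
    fix r
    show "{\<omega>\<in>space Q. r < \<tau> \<omega>} \<in> sets Q"
    proof (cases "0 \<le> r")
      case False
      then have "{\<omega>\<in>space Q. r < \<tau> \<omega>} = space Q" using \<tau>(2) by force
      then show ?thesis by simp
    qed (use \<tau>(1) sets_F_P in blast)
  qed
  have K0: "0 \<le> K"
  proof -
    have "AE \<omega> in Q. 0 \<le> K"
      using V0 VK AE_space
    proof eventually_elim
      case (elim \<omega>)
      have "0 \<le> V (min 0 (\<tau> \<omega>)) \<omega>" using elim(1) \<tau>(2)[OF elim(3)] by simp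
      also have "\<dots> \<le> K" using elim(2) by simp
      finally show ?case .
    qed
    then show ?thesis by simp
  qed
  have "\<exists>C. \<forall>n. 0 \<le> C n \<and> (\<forall>t \<omega>. norm (h n t \<omega>) \<le> C n)"
    using simp_int_bounded[OF S] by metis
  then obtain C where C: "\<And>n. 0 \<le> C n" "\<And>n t \<omega>. norm (h n t \<omega>) \<le> C n" by blast
  \<comment> \<open>Fine enough that both the step \<open>\<delta> n\<close> and the energy
    \<open>(C n)^2 * \<delta> n\<close> of one step are at most \<open>1 / (n + 1)\<close>.\<close>
  define m where "m n = Suc (nat \<lceil>(1 + (C n)\<^sup>2) * T * real (Suc n)\<rceil>)" for n
  define \<delta> where "\<delta> n = T / real (m n)" for n
  have m0: "0 < real (m n)" for n by (simp add: m_def)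
  have mge: "(1 + (C n)\<^sup>2) * T * real (Suc n) \<le> real (m n)" for n
    unfolding m_def using real_nat_ceiling_ge[of "(1 + (C n)\<^sup>2) * T * real (Suc n)"] by linarith
  have \<delta>: "0 < \<delta> n" "real (m n) * \<delta> n = T" for n
    using m0[of n] T by (auto simp: \<delta>_def)
  have \<delta>C: "(1 + (C n)\<^sup>2) * \<delta> n \<le> 1 / real (Suc n)" for n
    using mge[of n] m0[of n] by (simp add: \<delta>_def field_simps)
  have \<delta>1: "\<delta> n \<le> 1 / real (Suc n)" and \<delta>2: "(C n)\<^sup>2 * \<delta> n \<le> 1 / real (Suc n)" for n
  proof -
    have "0 \<le> (C n)\<^sup>2 * \<delta> n" using \<delta>(1)[of n] by simp
    moreover have "\<delta> n + (C n)\<^sup>2 * \<delta> n \<le> 1 / real (Suc n)" using \<delta>C[of n] by (simp only: distrib_right mult_1)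
    ultimately show "\<delta> n \<le> 1 / real (Suc n)" "(C n)\<^sup>2 * \<delta> n \<le> 1 / real (Suc n)"
      using \<delta>(1)[of n] by linarith+
  qed
  have inv0: "(\<lambda>n. 1 / real (Suc n)) \<longlonglongrightarrow> 0" using LIMSEQ_inverse_real_of_nat by (simp add: inverse_eq_divide)
  \<comment> \<open>Before \<open>\<tau>\<close> the limit has energy at most \<open>K\<close>. Once
    \<open>h n\<close> is within squared distance 1 of the limit, its own energy is at most
    \<open>2 * 1 + 2 * K\<close>, so the second test eventually never fails before
    \<open>\<tau>\<close>. Its purpose is a bound valid for every \<open>n\<close>.\<close>
  define D where "D n i = {\<omega>\<in>space Q. real i * \<delta> n < \<tau> \<omega> \<and> energy (h n) 0 (real i * \<delta> n) \<omega> \<le> 2 * K + 2}" for n i :: nat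
  have DE: "D n i \<in> sets (E (real i * \<delta> n))" for n i
  proof -
    have r: "0 \<le> real i * \<delta> n" using \<delta>[of n] by simp
    have [measurable]: "energy (h n) 0 (real i * \<delta> n) \<in> borel_measurable (E (real i * \<delta> n))"
      by (rule energy_measurable_E[OF S r])
    have "{\<omega>\<in>space (E (real i * \<delta> n)). energy (h n) 0 (real i * \<delta> n) \<omega> \<le> 2 * K + 2} \<in> sets (E (real i * \<delta> n))"
      by measurable
    with \<tau>(1)[OF r] have "{\<omega>\<in>space Q. real i * \<delta> n < \<tau> \<omega>} \<inter> {\<omega>\<in>space (E (real i * \<delta> n)). energy (h n) 0 (real i * \<delta> n) \<omega> \<le> 2 * K + 2}
       \<in> sets (E (real i * \<delta> n))" by blast
    also have "{\<omega>\<in>space Q. real i * \<delta> n < \<tau> \<omega>} \<inter> {\<omega>\<in>space (E (real i * \<delta> n)). energy (h n) 0 (real i * \<delta> n) \<omega> \<le> 2 * K + 2} = D n i"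
      by (auto simp: D_def space_F)
    finally show ?thesis .
  qed
  define h' where "h' n = gate (h n) (\<delta> n) (m n) (D n)" for n
  define J' where "J' n = gate_int (J n) (\<delta> n) (m n) (D n)" for n
  have S': "simp_int (h' n) (J' n)" for n
    unfolding h'_def J'_def by (rule simp_int_gate[OF S \<delta>(1) DE])
  have en: "energy (h' n) 0 T \<omega> \<le> 2 * K + 3" if \<omega>: "\<omega> \<in> space Q" for n \<omega>
  proof -
    have "energy (h' n) 0 (real (m n) * \<delta> n) \<omega> \<le> (2 * K + 2) + (C n)\<^sup>2 * \<delta> n"
      unfolding h'_def
    proof (rule gate_energy_le[OF S \<delta>(1) DE])
      fix i assume i: "\<omega> \<in> D n (Suc i)"
      have "real i * \<delta> n \<le> real (Suc i) * \<delta> n" using \<delta>(1)[of n] by (intro mult_right_mono) auto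
      then show "\<omega> \<in> D n i"
        using i energy_mono[OF S, of 0 "real i * \<delta> n" "real (Suc i) * \<delta> n" n \<omega>] \<delta>(1)[of n]
        unfolding D_def mem_Collect_eq by (smt (verit) mult_nonneg_nonneg of_nat_0_le_iff)
    qed (use K0 C in \<open>auto simp: D_def\<close>)
    moreover have "1 / real (Suc n) \<le> 1" by simp
    ultimately show ?thesis using \<delta>2[of n] unfolding \<delta>(2) by linarith
  qed
  \<comment> \<open>The limit integrand stopped at \<open>\<tau>\<close>; its energy up to
    \<open>r\<close> is \<open>V\<close> at time \<open>min r \<tau>\<close>.\<close>
  define v where "v r \<omega> = indicat_real {..\<tau> \<omega>} r *\<^sub>R ?u r \<omega>" for r \<omega>
  have vm: "strongly_measurable (time_prod Q) (\<lambda>p. v (fst p) (snd p))"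
    unfolding v_def
  proof (rule strongly_measurable_scaleR[OF _ um])
    have [measurable]: "fst \<in> borel_measurable (time_prod Q)" "snd \<in> measurable (time_prod Q) Q"
      unfolding time_prod_def by (auto intro: measurable_compose[OF measurable_fst measurable_restrict_space1])
    have "(\<lambda>p. indicat_real {..\<tau> (snd p)} (fst p)) = (\<lambda>p. if fst p \<le> \<tau> (snd p) then 1 else 0)"
      by (auto simp: indicator_def)
    then show "(\<lambda>p. indicat_real {..\<tau> (snd p)} (fst p)) \<in> borel_measurable (time_prod Q)" by simp
  qed
  have hm': "strongly_measurable (time_prod Q) (\<lambda>p. h' n (fst p) (snd p))" for n
    by (rule simp_int_strongly_measurable[OF S'])
  have hm: "strongly_measurable (time_prod Q) (\<lambda>p. h n (fst p) (snd p))" for n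
    by (rule simp_int_strongly_measurable[OF S])
  define X where "X n \<omega> = sqnorm (\<lambda>r \<omega>. h' n r \<omega> - v r \<omega>) T \<omega>" for n \<omega>
  have Xm [measurable]: "X n \<in> borel_measurable Q" for n
    unfolding X_def by (intro sqnorm_measurable strongly_measurable_norm strongly_measurable_diff hm' vm)
  have vsq: "AE \<omega> in Q. \<forall>r\<ge>0. sqnorm v r \<omega> = ennreal (V (min r (\<tau> \<omega>)) \<omega>)"
    using V AE_space
  proof eventually_elim
    case (elim \<omega>)
    show ?case
    proof (intro allI impI)
      fix r :: real assume "0 \<le> r"
      have "sqnorm v r \<omega> = sqnorm ?u (min r (\<tau> \<omega>)) \<omega>"
        unfolding sqnorm_def v_def by (intro nn_integral_cong) (auto simp: indicator_def)
      then show "sqnorm v r \<omega> = ennreal (V (min r (\<tau> \<omega>)) \<omega>)" using elim \<open>0 \<le> r\<close> \<tau>(2) by simp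
    qed
  qed
  \<comment> \<open>\<open>6 * K + 6\<close> is \<open>2 * (2 * K + 3) + 2 * K\<close>, from the
    energies of \<open>h' n\<close> and of \<open>v\<close>. It is the constant majorant for
    dominated convergence.\<close>
  have Xbound: "AE \<omega> in Q. \<forall>n. X n \<omega> \<le> ennreal (6 * K + 6)"
    using vsq VK V0 AE_space
  proof eventually_elim
    case (elim \<omega>)
    show ?case
    proof
      fix n
      have "X n \<omega> \<le> 2 * sqnorm (h' n) T \<omega> + 2 * sqnorm v T \<omega>"
        unfolding X_def by (rule sqnorm_add_le[OF strongly_measurable_norm[OF hm'] strongly_measurable_norm[OF vm] elim(4)])
          (rule norm_triangle_ineq4)
      also have "\<dots> \<le> 2 * ennreal (2 * K + 3) + 2 * ennreal K"
        using elim T en[OF elim(4)] by (intro add_mono mult_left_mono) (auto simp: energy_sqnorm[OF S', symmetric] intro!: ennreal_leI)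
      also have "\<dots> = ennreal (2 * (2 * K + 3) + 2 * K)"
        using K0 by (intro ennreal_double_add) auto
      also have "2 * (2 * K + 3) + 2 * K = 6 * K + 6" by simp
      finally show "X n \<omega> \<le> ennreal (6 * K + 6)" .
    qed
  qed
  \<comment> \<open>For large \<open>n\<close> the gated process stops at a grid time that is not
    before \<open>min T \<tau>\<close> and at most one step after \<open>\<tau>\<close>.\<close>
  have thr: "AE \<omega> in Q. \<forall>\<^sub>F n in sequentially. \<exists>k\<le>m n. (\<forall>i<k. \<omega> \<in> D n i) \<and> (\<forall>i. k \<le> i \<longrightarrow> i < m n \<longrightarrow> \<omega> \<notin> D n i)
      \<and> (\<forall>r. 0 \<le> r \<longrightarrow> r \<le> T \<longrightarrow> r \<le> \<tau> \<omega> \<longrightarrow> r \<le> real k * \<delta> n) \<and> (real k * \<delta> n \<le> \<tau> \<omega> + \<delta> n)"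
    using L2 V VK V0 AE_space
  proof eventually_elim
    case (elim \<omega>)
    have \<omega>: "\<omega> \<in> space Q" by fact
    have "\<forall>\<^sub>F n in sequentially. sqnorm (\<lambda>t \<omega>. h n t \<omega> - ?u t \<omega>) T \<omega> < 1"
      using elim(1) by (intro order_tendstoD(2)[of _ 0]) auto
    then show ?case
    proof eventually_elim
      case (elim n)
      have Diff: "\<omega> \<in> D n i \<longleftrightarrow> real i * \<delta> n < \<tau> \<omega>" if i: "i < m n" for i
      proof
        assume "real i * \<delta> n < \<tau> \<omega>"
        have r: "0 \<le> real i * \<delta> n" using \<delta>(1)[of n] by simp
        have rT: "real i * \<delta> n \<le> T" unfolding \<delta>(2)[of n, symmetric] using i \<delta>(1)[of n] by (intro mult_right_mono) auto
        have "ennreal (energy (h n) 0 (real i * \<delta> n) \<omega>) \<le> 2 * sqnorm (\<lambda>t \<omega>. h n t \<omega> - ?u t \<omega>) (real i * \<delta> n) \<omega> + 2 * sqnorm ?u (real i * \<delta> n) \<omega>"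
          unfolding energy_sqnorm[OF S]
          by (rule sqnorm_add_le[OF strongly_measurable_norm[OF strongly_measurable_diff[OF hm um]] strongly_measurable_norm[OF um] \<omega>])
            (metis diff_add_cancel norm_triangle_ineq)
        also have "\<dots> \<le> 2 * 1 + 2 * ennreal K"
        proof (intro add_mono mult_left_mono)
          show "sqnorm (\<lambda>t \<omega>. h n t \<omega> - ?u t \<omega>) (real i * \<delta> n) \<omega> \<le> 1"
            using sqnorm_mono[OF rT, of "\<lambda>t \<omega>. h n t \<omega> - ?u t \<omega>" \<omega>] elim by simp
          have "V (min (real i * \<delta> n) (\<tau> \<omega>)) \<omega> \<le> K" using \<open>\<forall>t\<ge>0. V (min t (\<tau> \<omega>)) \<omega> \<le> K\<close> r by blast
          then show "sqnorm ?u (real i * \<delta> n) \<omega> \<le> ennreal K"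
            using \<open>\<forall>t\<ge>0. sqnorm ?u t \<omega> = _\<close> r \<open>real i * \<delta> n < \<tau> \<omega>\<close> by (simp add: ennreal_leI)
        qed auto
        also have "\<dots> = ennreal (2 * K + 2)" using K0 ennreal_double_add[of 1 K] by (simp add: add.commute)
        finally have "energy (h n) 0 (real i * \<delta> n) \<omega> \<le> 2 * K + 2"
          by (subst (asm) ennreal_le_iff) (use K0 in auto)
        then show "\<omega> \<in> D n i" using \<open>real i * \<delta> n < \<tau> \<omega>\<close> \<omega> by (simp add: D_def)
      qed (simp add: D_def)
      have "real i * \<delta> n < \<tau> \<omega>" if "real (Suc i) * \<delta> n < \<tau> \<omega>" for i
        using that \<delta>(1)[of n] by (simp add: distrib_right)
      from decreasing_threshold[of "\<lambda>i. real i * \<delta> n < \<tau> \<omega>" "m n", OF this]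
      obtain k where k: "k \<le> m n" "\<And>i. i < k \<Longrightarrow> real i * \<delta> n < \<tau> \<omega>" "\<And>i. k \<le> i \<Longrightarrow> i < m n \<Longrightarrow> \<not> real i * \<delta> n < \<tau> \<omega>" by blast
      show ?case
      proof (intro exI[of _ k] conjI allI impI)
        show "k \<le> m n" by fact
        show "\<omega> \<in> D n i" if "i < k" for i using that k Diff[of i] by simp
        show "\<omega> \<notin> D n i" if "k \<le> i" "i < m n" for i using that k Diff[of i] by simp
        show "r \<le> real k * \<delta> n" if "0 \<le> r" "r \<le> T" "r \<le> \<tau> \<omega>" for r
        proof (cases "k = m n")
          case True
          then show ?thesis using that \<delta>(2)[of n] by simp
        next
          case False
          then show ?thesis using k(3)[of k] k(1) that by simp
        qed
        show "real k * \<delta> n \<le> \<tau> \<omega> + \<delta> n"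
        proof (cases k)
          case 0
          then show ?thesis using \<tau>(2)[OF \<omega>] \<delta>(1)[of n] by simp
        next
          case (Suc i)
          then show ?thesis using k(2)[of i] by (simp add: distrib_right)
        qed
      qed
    qed
  qed
  have Xlim: "AE \<omega> in Q. (\<lambda>n. X n \<omega>) \<longlonglongrightarrow> 0"
    using L2 thr AE_space
  proof eventually_elim
    case (elim \<omega>)
    have \<omega>: "\<omega> \<in> space Q" by fact
    have up: "(\<lambda>n. sqnorm (\<lambda>t \<omega>. h n t \<omega> - ?u t \<omega>) T \<omega> + ennreal (1 / real (Suc n))) \<longlonglongrightarrow> 0 + 0"
      using elim(1) tendsto_ennrealI[OF inv0] by (intro tendsto_add) auto
    show ?case
    proof (rule tendsto_sandwich[OF _ _ tendsto_const, where h="\<lambda>n. sqnorm (\<lambda>t \<omega>. h n t \<omega> - ?u t \<omega>) T \<omega> + ennreal (1 / real (Suc n))"])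
      show "\<forall>\<^sub>F n in sequentially. X n \<omega> \<le> sqnorm (\<lambda>t \<omega>. h n t \<omega> - ?u t \<omega>) T \<omega> + ennreal (1 / real (Suc n))"
        using elim(2)
      proof eventually_elim
        case (elim n)
        then obtain k where k: "k \<le> m n" "\<And>i. i < k \<Longrightarrow> \<omega> \<in> D n i" "\<And>i. k \<le> i \<Longrightarrow> i < m n \<Longrightarrow> \<omega> \<notin> D n i"
          and k4: "\<And>r. 0 \<le> r \<Longrightarrow> r \<le> T \<Longrightarrow> r \<le> \<tau> \<omega> \<Longrightarrow> r \<le> real k * \<delta> n" and k5: "real k * \<delta> n \<le> \<tau> \<omega> + \<delta> n" by blast
        let ?Y = "\<lambda>r. ennreal ((norm (h n r \<omega> - ?u r \<omega>))\<^sup>2) * indicator {0..T} r"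
        have Ym: "?Y \<in> borel_measurable lborel"
          using sqnorm_section_measurable[where k="\<lambda>t \<omega>. h n t \<omega> - ?u t \<omega>", OF strongly_measurable_norm[OF strongly_measurable_diff[OF hm um]] \<omega>] .
        \<comment> \<open>Up to \<open>\<tau>\<close> the difference of the gated integrand and
          \<open>v\<close> is that of \<open>h n\<close> and the limit. After \<open>\<tau>\<close>
          the gated integrand survives for at most one step, where it is bounded by
          \<open>C n\<close>.\<close>
        have "X n \<omega> \<le> (\<integral>\<^sup>+r. ?Y r + ennreal ((C n)\<^sup>2) * indicator {\<tau> \<omega>..\<tau> \<omega> + \<delta> n} r \<partial>lborel)"
          unfolding X_def sqnorm_def
        proof (rule nn_integral_mono_AE)
          have "AE r in lborel. r \<noteq> (0::real)" by (rule AE_lborel_singleton)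
          then show "AE r in lborel. ennreal ((norm (h' n r \<omega> - v r \<omega>))\<^sup>2) * indicator {0..T} r \<le> ?Y r + ennreal ((C n)\<^sup>2) * indicator {\<tau> \<omega>..\<tau> \<omega> + \<delta> n} r"
          proof eventually_elim
            case (elim r)
            show ?case
            proof (cases "0 < r \<and> r \<le> T")
              case True
              then have h': "h' n r \<omega> = (if r \<le> real k * \<delta> n then h n r \<omega> else 0)"
                unfolding h'_def using gate_threshold[OF \<delta>(1) k, where t=r and h="h n"] \<delta>(2)[of n] by simp
              show ?thesis
              proof (cases "r \<le> \<tau> \<omega>")
                case le: True
                then have "h' n r \<omega> - v r \<omega> = h n r \<omega> - ?u r \<omega>" using h' k4[of r] True by (simp add: v_def)
                then show ?thesis using True by simp
              next
                case False
                then have v0: "v r \<omega> = 0" by (simp add: v_def)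
                show ?thesis
                proof (cases "r \<le> real k * \<delta> n")
                  case T2: True
                  have "ennreal ((norm (h n r \<omega>))\<^sup>2) \<le> ennreal ((C n)\<^sup>2)" using C by (intro ennreal_leI power_mono) auto
                  then show ?thesis using T2 False k5 True h' v0 by (simp add: add_increasing)
                qed (use h' v0 in simp)
              qed
            next
              case False
              then have "r \<notin> {0..T}" using elim by auto
              then show ?thesis by simp
            qed
          qed
        qed
        also have "\<dots> = (\<integral>\<^sup>+r. ?Y r \<partial>lborel) + ennreal ((C n)\<^sup>2) * ennreal (\<delta> n)"
          using Ym \<delta>(1)[of n] by (subst nn_integral_add) (auto simp: nn_integral_cmult)
        also have "\<dots> \<le> sqnorm (\<lambda>t \<omega>. h n t \<omega> - ?u t \<omega>) T \<omega> + ennreal (1 / real (Suc n))"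
          unfolding sqnorm_def using \<delta>2[of n] \<delta>(1)[of n] by (intro add_left_mono) (simp add: ennreal_mult[symmetric] ennreal_leI)
        finally show ?case .
      qed
    qed (use up in auto)
  qed
  define x where "x n = (\<integral>\<omega>. enn2real (X n \<omega>) \<partial>Q)" for n
  have Xr: "AE \<omega> in Q. \<forall>n. X n \<omega> = ennreal (enn2real (X n \<omega>)) \<and> enn2real (X n \<omega>) \<le> 6 * K + 6"
    using Xbound
  proof eventually_elim
    case (elim \<omega>)
    show ?case
    proof
      fix n
      have "X n \<omega> < top" using elim le_less_trans[OF _ ennreal_less_top] by blast
      moreover have "enn2real (X n \<omega>) \<le> 6 * K + 6"
        using elim[rule_format, of n] K0 by (intro enn2real_leI) auto
      ultimately show "X n \<omega> = ennreal (enn2real (X n \<omega>)) \<and> enn2real (X n \<omega>) \<le> 6 * K + 6" by simp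
    qed
  qed
  have Xi: "integrable Q (\<lambda>\<omega>. enn2real (X n \<omega>))" for n
    by (rule integrable_const_bound[of _ "6 * K + 6"]) (use Xr in auto)
  have x0: "x \<longlonglongrightarrow> 0"
  proof -
    have "(\<lambda>n. \<integral>\<omega>. enn2real (X n \<omega>) \<partial>Q) \<longlonglongrightarrow> (\<integral>\<omega>. 0 \<partial>Q)"
    proof (rule integral_dominated_convergence[where w="\<lambda>_. 6 * K + 6"])
      show "AE \<omega> in Q. (\<lambda>n. enn2real (X n \<omega>)) \<longlonglongrightarrow> 0"
        using Xlim
      proof eventually_elim
        case (elim \<omega>)
        from tendsto_enn2real[OF this[folded ennreal_0]] show ?case by simp
      qed
      show "AE \<omega> in Q. norm (enn2real (X n \<omega>)) \<le> 6 * K + 6" for n using Xr by eventually_elim auto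
    qed auto
    then show ?thesis unfolding x_def by simp
  qed
  \<comment> \<open>The isometry turns the distances of two gated integrands to \<open>v\<close>
    into the Cauchy bound required by the mean square limit.\<close>
  have JJ: "(\<integral>\<omega>. (J' n r \<omega> - J' k r \<omega>)\<^sup>2 \<partial>Q) \<le> 2 * x n + 2 * x k" if r: "0 \<le> r" "r \<le> T" for n k r
  proof -
    have Sd: "simp_int (\<lambda>t \<omega>. h' n t \<omega> - h' k t \<omega>) (\<lambda>t \<omega>. J' n t \<omega> - J' k t \<omega>)"
      by (rule simp_int_diff[OF S' S'])
    have "(\<integral>\<omega>. (J' n r \<omega> - J' k r \<omega>)\<^sup>2 \<partial>Q) = (\<integral>\<omega>. energy (\<lambda>t \<omega>. h' n t \<omega> - h' k t \<omega>) 0 r \<omega> \<partial>Q)"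
      using simp_int_isometry[OF Sd order_refl r(1)] simp_int_0[OF S'] by simp
    also have "\<dots> \<le> (\<integral>\<omega>. 2 * enn2real (X n \<omega>) + 2 * enn2real (X k \<omega>) \<partial>Q)"
    proof (rule integral_mono_AE[OF energy_integrable[OF Sd order_refl r(1)]])
      show "integrable Q (\<lambda>\<omega>. 2 * enn2real (X n \<omega>) + 2 * enn2real (X k \<omega>))" using Xi by simp
      show "AE \<omega> in Q. energy (\<lambda>t \<omega>. h' n t \<omega> - h' k t \<omega>) 0 r \<omega> \<le> 2 * enn2real (X n \<omega>) + 2 * enn2real (X k \<omega>)"
        using Xr AE_space
      proof eventually_elim
        case (elim \<omega>)
        have "ennreal (energy (\<lambda>t \<omega>. h' n t \<omega> - h' k t \<omega>) 0 r \<omega>) \<le> sqnorm (\<lambda>t \<omega>. h' n t \<omega> - h' k t \<omega>) T \<omega>"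
          unfolding energy_sqnorm[OF Sd] by (rule sqnorm_mono[OF r(2)])
        also have "\<dots> \<le> 2 * X n \<omega> + 2 * X k \<omega>"
          unfolding X_def
        proof (rule sqnorm_add_le[OF strongly_measurable_norm[OF strongly_measurable_diff[OF hm' vm]] strongly_measurable_norm[OF strongly_measurable_diff[OF hm' vm]] elim(2)])
          fix t show "norm (h' n t \<omega> - h' k t \<omega>) \<le> norm (h' n t \<omega> - v t \<omega>) + norm (h' k t \<omega> - v t \<omega>)"
            using norm_triangle_ineq4[of "h' n t \<omega> - v t \<omega>" "h' k t \<omega> - v t \<omega>"] by simp
        qed
        also have "\<dots> = ennreal (2 * enn2real (X n \<omega>) + 2 * enn2real (X k \<omega>))"
        proof -
          have "X n \<omega> = ennreal (enn2real (X n \<omega>))" "X k \<omega> = ennreal (enn2real (X k \<omega>))"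
            using elim(1) by blast+
          then show ?thesis
            using ennreal_double_add[OF enn2real_nonneg[of "X n \<omega>"] enn2real_nonneg[of "X k \<omega>"]] by metis
        qed
        finally show ?case by (subst (asm) ennreal_le_iff) auto
      qed
    qed
    also have "\<dots> = 2 * x n + 2 * x k" using Xi by (simp add: x_def)
    finally show ?thesis .
  qed
  have Jlim: "AE \<omega> in Q. (\<lambda>n. J' n r \<omega>) \<longlonglongrightarrow> N (min r (\<tau> \<omega>)) \<omega>" if r: "0 \<le> r" "r \<le> T" for r
    using thr JN Nc AE_space
  proof eventually_elim
    case (elim \<omega>)
    have \<omega>: "\<omega> \<in> space Q" by fact
    obtain n0 where n0: "\<And>n. n \<ge> n0 \<Longrightarrow> \<exists>k\<le>m n. (\<forall>i<k. \<omega> \<in> D n i) \<and> (\<forall>i. k \<le> i \<longrightarrow> i < m n \<longrightarrow> \<omega> \<notin> D n i)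
      \<and> (\<forall>r. 0 \<le> r \<longrightarrow> r \<le> T \<longrightarrow> r \<le> \<tau> \<omega> \<longrightarrow> r \<le> real k * \<delta> n) \<and> (real k * \<delta> n \<le> \<tau> \<omega> + \<delta> n)"
      using elim(1) unfolding eventually_sequentially by blast
    define k where "k n = (SOME k. k\<le>m n \<and> (\<forall>i<k. \<omega> \<in> D n i) \<and> (\<forall>i. k \<le> i \<longrightarrow> i < m n \<longrightarrow> \<omega> \<notin> D n i)
      \<and> (\<forall>r. 0 \<le> r \<longrightarrow> r \<le> T \<longrightarrow> r \<le> \<tau> \<omega> \<longrightarrow> r \<le> real k * \<delta> n) \<and> (real k * \<delta> n \<le> \<tau> \<omega> + \<delta> n))" for n
    have k: "k n\<le>m n \<and> (\<forall>i<k n. \<omega> \<in> D n i) \<and> (\<forall>i. k n \<le> i \<longrightarrow> i < m n \<longrightarrow> \<omega> \<notin> D n i)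
      \<and> (\<forall>r. 0 \<le> r \<longrightarrow> r \<le> T \<longrightarrow> r \<le> \<tau> \<omega> \<longrightarrow> r \<le> real (k n) * \<delta> n) \<and> (real (k n) * \<delta> n \<le> \<tau> \<omega> + \<delta> n)" if "n \<ge> n0" for n
      unfolding k_def using n0[OF that] by (rule someI_ex)
    \<comment> \<open>The time at which \<open>J n\<close> is evaluated by its gated version. It
      depends on \<open>n\<close> and tends to \<open>min r \<tau>\<close>, so uniform convergence
      and continuity of \<open>N\<close> are used together.\<close>
    define p where "p n = min (real (k n) * \<delta> n) r" for n
    have p: "p n \<in> {0..T}" for n using \<delta>(1)[of n] r by (auto simp: p_def)
    have pd: "\<bar>p n - min r (\<tau> \<omega>)\<bar> \<le> 1 / real (Suc n)" if "n \<ge> n0" for n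
    proof -
      have "min r (\<tau> \<omega>) \<le> real (k n) * \<delta> n" using k[OF that] r \<tau>(2)[OF \<omega>] by (auto simp: min_def)
      moreover have "real (k n) * \<delta> n \<le> \<tau> \<omega> + \<delta> n" using k[OF that] by blast
      ultimately show ?thesis using \<delta>1[of n] \<delta>(1)[of n] by (auto simp: p_def min_def abs_le_iff)
    qed
    have plim: "p \<longlonglongrightarrow> min r (\<tau> \<omega>)"
    proof -
      have "(\<lambda>n. p n - min r (\<tau> \<omega>)) \<longlonglongrightarrow> 0"
        by (rule Lim_null_comparison[OF _ inv0]) (use pd in \<open>auto simp: eventually_sequentially\<close>)
      then show ?thesis by (simp add: LIM_zero_iff)
    qed
    have "(\<lambda>n. J n (p n) \<omega>) \<longlonglongrightarrow> N (min r (\<tau> \<omega>)) \<omega>"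
      by (rule uniform_limit_diagonal[where J="\<lambda>n t. J n t \<omega>" and N="\<lambda>t. N t \<omega>", OF elim(2)[rule_format, of T] _ p _ plim])
        (use r \<tau>(2)[OF \<omega>] in \<open>auto intro: continuous_on_subset[OF elim(3)]\<close>)
    moreover have "\<forall>\<^sub>F n in sequentially. J' n r \<omega> = J n (p n) \<omega>"
      unfolding eventually_sequentially
    proof (intro exI allI impI)
      fix n assume "n0 \<le> n"
      with k show "J' n r \<omega> = J n (p n) \<omega>"
        unfolding J'_def p_def by (intro gate_int_threshold[OF S \<delta>(1)]) (use r in auto)
    qed
    ultimately show ?case by (simp add: filterlim_cong)
  qed
  have Jm: "J' n r \<in> borel_measurable Q" if "0 \<le> r" for n r using simp_int_measurable[OF S' that] .
  have x20: "(\<lambda>n. 2 * x n) \<longlonglongrightarrow> 0" using tendsto_mult_right_zero[OF x0] .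
  have N2: "integrable Q (\<lambda>\<omega>. (N (min r (\<tau> \<omega>)) \<omega>)\<^sup>2)"
     "(\<lambda>n. \<integral>\<omega>. \<bar>(J' n r \<omega>)\<^sup>2 - (N (min r (\<tau> \<omega>)) \<omega>)\<^sup>2\<bar> \<partial>Q) \<longlonglongrightarrow> 0" if r: "0 \<le> r" "r \<le> T" for r
    using L2_limit[OF Jm[OF r(1)] Nm[OF r(1)] simp_int_square_integrable(3)[OF S' r(1) r(1)] Jlim[OF r] JJ[OF r] x20] by blast+
  have Vi: "integrable Q (\<lambda>\<omega>. V (min r (\<tau> \<omega>)) \<omega>)" if r: "0 \<le> r" for r
    by (rule integrable_const_bound[of _ K, OF _ Vm[OF r]])
      (use V0 VK AE_space in \<open>eventually_elim, use r \<tau>(2) in simp\<close>)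
  have Vlim: "(\<lambda>n. \<integral>\<omega>. \<bar>energy (h' n) 0 r \<omega> - V (min r (\<tau> \<omega>)) \<omega>\<bar> \<partial>Q) \<longlonglongrightarrow> 0" if r: "0 \<le> r" "r \<le> T" for r
  proof -
    have [measurable]: "energy (h' n) 0 r \<in> borel_measurable Q" for n using energy_measurable[OF S' r(1)] .
    note [measurable] = Vm[OF r(1)]
    have "(\<lambda>n. \<integral>\<omega>. \<bar>energy (h' n) 0 r \<omega> - V (min r (\<tau> \<omega>)) \<omega>\<bar> \<partial>Q) \<longlonglongrightarrow> (\<integral>\<omega>. 0 \<partial>Q)"
    proof (rule integral_dominated_convergence[where w="\<lambda>_. 3 * K + 3"])
      show "AE \<omega> in Q. (\<lambda>n. \<bar>energy (h' n) 0 r \<omega> - V (min r (\<tau> \<omega>)) \<omega>\<bar>) \<longlonglongrightarrow> 0"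
        using Xlim vsq V0 AE_space
      proof eventually_elim
        case (elim \<omega>)
        have "(\<lambda>n. sqnorm (\<lambda>t \<omega>. h' n t \<omega> - v t \<omega>) r \<omega>) \<longlonglongrightarrow> 0"
          by (rule tendsto_sandwich[OF _ _ tendsto_const elim(1)])
            (simp_all add: X_def sqnorm_mono[OF r(2)] always_eventually)
        then have "(\<lambda>n. energy (h' n) 0 r \<omega>) \<longlonglongrightarrow> V (min r (\<tau> \<omega>)) \<omega>"
          using elim r \<tau>(2)
          by (intro sqnorm_tendsto[OF strongly_measurable_norm[OF hm'] strongly_measurable_norm[OF vm]
               strongly_measurable_norm[OF strongly_measurable_diff[OF hm' vm]] elim(4) energy_sqnorm[OF S', symmetric]])
            (auto simp: energy_nonneg)
        then show ?case by (simp add: tendsto_rabs_zero_iff LIM_zero_iff)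
      qed
      show "AE \<omega> in Q. norm \<bar>energy (h' n) 0 r \<omega> - V (min r (\<tau> \<omega>)) \<omega>\<bar> \<le> 3 * K + 3" for n
        using VK V0 AE_space
      proof eventually_elim
        case (elim \<omega>)
        have "V (min r (\<tau> \<omega>)) \<omega> \<le> K" "0 \<le> V (min r (\<tau> \<omega>)) \<omega>" using elim r \<tau>(2) by auto
        moreover have "energy (h' n) 0 r \<omega> \<le> 2 * K + 3"
          using energy_mono[OF S' r, of n \<omega>] en[OF elim(3), of n] by linarith
        ultimately show ?case using energy_nonneg[of "h' n" 0 r \<omega>] K0 by simp
      qed
    qed auto
    then show ?thesis by simp
  qed
  define Z where "Z r \<omega> = (N (min r (\<tau> \<omega>)) \<omega>)\<^sup>2 - V (min r (\<tau> \<omega>)) \<omega>" for r \<omega>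
  have Zi: "integrable Q (Z r)" if r: "0 \<le> r" "r \<le> T" for r
    unfolding Z_def using N2(1)[OF r] Vi[OF r(1)] by simp
  have AQ: "A \<in> sets Q" using A by (rule sets_F_P)
  have lim: "(\<lambda>n. \<integral>\<omega>. indicator A \<omega> * ((J' n r \<omega>)\<^sup>2 - energy (h' n) 0 r \<omega>) \<partial>Q) \<longlonglongrightarrow> (\<integral>\<omega>. indicator A \<omega> * Z r \<omega> \<partial>Q)"
    if r: "0 \<le> r" "r \<le> T" for r
  proof -
    have i1: "integrable Q (\<lambda>\<omega>. (J' n r \<omega>)\<^sup>2 - energy (h' n) 0 r \<omega>)" for n
      using simp_int_square_integrable(3)[OF S' r(1) r(1)] energy_integrable[OF S' order_refl r(1)] by simp
    have i2: "integrable Q (\<lambda>\<omega>. \<bar>(J' n r \<omega>)\<^sup>2 - (N (min r (\<tau> \<omega>)) \<omega>)\<^sup>2\<bar>)" for n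
      using simp_int_square_integrable(3)[OF S' r(1) r(1)] N2(1)[OF r] by simp
    have i3: "integrable Q (\<lambda>\<omega>. \<bar>energy (h' n) 0 r \<omega> - V (min r (\<tau> \<omega>)) \<omega>\<bar>)" for n
      using energy_integrable[OF S' order_refl r(1)] Vi[OF r(1)] by simp
    have "(\<lambda>n. (\<integral>\<omega>. indicator A \<omega> * ((J' n r \<omega>)\<^sup>2 - energy (h' n) 0 r \<omega>) \<partial>Q) - (\<integral>\<omega>. indicator A \<omega> * Z r \<omega> \<partial>Q)) \<longlonglongrightarrow> 0"
    proof (rule Lim_null_comparison[OF always_eventually tendsto_add[OF N2(2)[OF r] Vlim[OF r], simplified]], rule allI)
      fix n
      have eq: "(\<integral>\<omega>. indicator A \<omega> * ((J' n r \<omega>)\<^sup>2 - energy (h' n) 0 r \<omega>) \<partial>Q) - (\<integral>\<omega>. indicator A \<omega> * Z r \<omega> \<partial>Q)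
        = (\<integral>\<omega>. indicator A \<omega> * ((J' n r \<omega>)\<^sup>2 - energy (h' n) 0 r \<omega>) - indicator A \<omega> * Z r \<omega> \<partial>Q)"
        using integrable_indicator_mult[OF AQ i1] integrable_indicator_mult[OF AQ Zi[OF r]] by simp
      have le: "norm (\<integral>\<omega>. indicator A \<omega> * ((J' n r \<omega>)\<^sup>2 - energy (h' n) 0 r \<omega>) - indicator A \<omega> * Z r \<omega> \<partial>Q) \<le> (\<integral>\<omega>. \<bar>(J' n r \<omega>)\<^sup>2 - (N (min r (\<tau> \<omega>)) \<omega>)\<^sup>2\<bar> + \<bar>energy (h' n) 0 r \<omega> - V (min r (\<tau> \<omega>)) \<omega>\<bar> \<partial>Q)"
      proof (rule order_trans[OF integral_norm_bound integral_mono])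
        show "integrable Q (\<lambda>\<omega>. norm (indicator A \<omega> * ((J' n r \<omega>)\<^sup>2 - energy (h' n) 0 r \<omega>) - indicator A \<omega> * Z r \<omega>))"
          using integrable_indicator_mult[OF AQ i1] integrable_indicator_mult[OF AQ Zi[OF r]] by simp
        show "integrable Q (\<lambda>\<omega>. \<bar>(J' n r \<omega>)\<^sup>2 - (N (min r (\<tau> \<omega>)) \<omega>)\<^sup>2\<bar> + \<bar>energy (h' n) 0 r \<omega> - V (min r (\<tau> \<omega>)) \<omega>\<bar>)"
          using i2 i3 by simp
        show "norm (indicator A \<omega> * ((J' n r \<omega>)\<^sup>2 - energy (h' n) 0 r \<omega>) - indicator A \<omega> * Z r \<omega>)
           \<le> \<bar>(J' n r \<omega>)\<^sup>2 - (N (min r (\<tau> \<omega>)) \<omega>)\<^sup>2\<bar> + \<bar>energy (h' n) 0 r \<omega> - V (min r (\<tau> \<omega>)) \<omega>\<bar>" for \<omega>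
          by (auto simp: Z_def indicator_def)
      qed
      show "norm ((\<integral>\<omega>. indicator A \<omega> * ((J' n r \<omega>)\<^sup>2 - energy (h' n) 0 r \<omega>) \<partial>Q) - (\<integral>\<omega>. indicator A \<omega> * Z r \<omega> \<partial>Q))
        \<le> (\<integral>\<omega>. \<bar>(J' n r \<omega>)\<^sup>2 - (N (min r (\<tau> \<omega>)) \<omega>)\<^sup>2\<bar> \<partial>Q) + (\<integral>\<omega>. \<bar>energy (h' n) 0 r \<omega> - V (min r (\<tau> \<omega>)) \<omega>\<bar> \<partial>Q)"
        unfolding eq using le by (simp only: Bochner_Integration.integral_add[OF i2 i3])
    qed
    then show ?thesis by (simp add: LIM_zero_iff)
  qed
  show "integrable Q (\<lambda>\<omega>. (N (min t (\<tau> \<omega>)) \<omega>)\<^sup>2 - V (min t (\<tau> \<omega>)) \<omega>)"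
    using Zi[OF T(4,3)] unfolding Z_def .
  \<comment> \<open>The elementary identity rewrites the integrals at \<open>t\<close> as integrals
    at \<open>s\<close> for every \<open>n\<close>; uniqueness of limits then gives the identity for
    \<open>N\<close> and \<open>V\<close>.\<close>
  have "(\<lambda>n. \<integral>\<omega>. indicator A \<omega> * ((J' n s \<omega>)\<^sup>2 - energy (h' n) 0 s \<omega>) \<partial>Q) \<longlonglongrightarrow> (\<integral>\<omega>. indicator A \<omega> * Z t \<omega> \<partial>Q)"
    using lim[OF T(4,3)] unfolding simp_int_martingale_square[OF S' st A] .
  from LIMSEQ_unique[OF this lim[OF st(1) T(2)]]
  show "(\<integral>\<omega>. indicator A \<omega> * ((N (min t (\<tau> \<omega>)) \<omega>)\<^sup>2 - V (min t (\<tau> \<omega>)) \<omega>) \<partial>Q)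
      = (\<integral>\<omega>. indicator A \<omega> * ((N (min s (\<tau> \<omega>)) \<omega>)\<^sup>2 - V (min s (\<tau> \<omega>)) \<omega>) \<partial>Q)"
    unfolding Z_def .
qed

end

section \<open>Riemann sums of squared increments\<close>

text \<open>Truncating the distance at \<open>e\<close> supplies a constant majorant; Markov's
  inequality converts convergence in mean into convergence in probability.\<close>

lemma (in prob_space) AE_tendsto_imp_measure:
  fixes Y :: "nat \<Rightarrow> 'a \<Rightarrow> real"
  assumes [measurable]: "\<And>n. Y n \<in> borel_measurable M" "L \<in> borel_measurable M"
    and lim: "AE x in M. (\<lambda>n. Y n x) \<longlonglongrightarrow> L x" and e: "0 < e"
  shows "(\<lambda>n. measure M {x\<in>space M. e \<le> \<bar>Y n x - L x\<bar>}) \<longlonglongrightarrow> 0"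
proof -
  have "(\<lambda>n. \<integral>x. min \<bar>Y n x - L x\<bar> e \<partial>M) \<longlonglongrightarrow> (\<integral>x. 0 \<partial>M)"
  proof (rule integral_dominated_convergence[where w="\<lambda>_. e"])
    show "AE x in M. (\<lambda>n. min \<bar>Y n x - L x\<bar> e) \<longlonglongrightarrow> 0"
      using lim
    proof eventually_elim
      case (elim x)
      then have "(\<lambda>n. Y n x - L x) \<longlonglongrightarrow> 0" by (simp add: LIM_zero_iff)
      then have "(\<lambda>n. min \<bar>Y n x - L x\<bar> e) \<longlonglongrightarrow> min \<bar>0\<bar> e" by (intro tendsto_min tendsto_rabs tendsto_const)
      then show ?case using e by simp
    qed
    show "AE x in M. norm (min \<bar>Y n x - L x\<bar> e) \<le> e" for n using e by (intro AE_I2) auto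
  qed auto
  then have "(\<lambda>n. (\<integral>x. min \<bar>Y n x - L x\<bar> e \<partial>M) / e) \<longlonglongrightarrow> 0" using tendsto_divide_zero by fastforce
  then show ?thesis
  proof (rule tendsto_sandwich[OF _ _ tendsto_const, rotated 2])
    show "\<forall>\<^sub>F n in sequentially. measure M {x\<in>space M. e \<le> \<bar>Y n x - L x\<bar>} \<le> (\<integral>x. min \<bar>Y n x - L x\<bar> e \<partial>M) / e"
    proof (intro always_eventually allI)
      fix n
      have i: "integrable M (\<lambda>x. min \<bar>Y n x - L x\<bar> e)"
        by (rule integrable_const_bound[of _ e]) (use e in auto)
      have "measure M {x\<in>space M. e \<le> min \<bar>Y n x - L x\<bar> e} \<le> (\<integral>x. min \<bar>Y n x - L x\<bar> e \<partial>M) / e"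
        using e by (intro integral_Markov_inequality_measure[OF i, where A="space M"]) auto
      then show "measure M {x\<in>space M. e \<le> \<bar>Y n x - L x\<bar>} \<le> (\<integral>x. min \<bar>Y n x - L x\<bar> e \<partial>M) / e" by simp
    qed
  qed simp
qed

definition riemann_sum :: "real \<Rightarrow> nat \<Rightarrow> (real \<Rightarrow> 'a \<Rightarrow> real) \<Rightarrow> 'a \<Rightarrow> real" where
  "riemann_sum t m Y \<omega> = (\<Sum>i<m. (Y (real (Suc i) * (t / real m)) \<omega> - Y (real i * (t / real m)) \<omega>)\<^sup>2)"

lemma riemann_sum_nonneg: "0 \<le> riemann_sum t m Y \<omega>"
  unfolding riemann_sum_def by (intro sum_nonneg) simp

text \<open>The square root of the Riemann sum is the Euclidean norm of the vector of increments, so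
  this is Minkowski's inequality.\<close>

lemma riemann_sum_triangle:
  "sqrt (riemann_sum t m Y \<omega>) \<le> sqrt (riemann_sum t m Z \<omega>) + sqrt (riemann_sum t m (\<lambda>s \<omega>. Y s \<omega> - Z s \<omega>) \<omega>)"
proof -
  have "sqrt (riemann_sum t m Y \<omega>) = L2_set (\<lambda>i. (Z (real (Suc i) * (t / real m)) \<omega> - Z (real i * (t / real m)) \<omega>)
     + ((Y (real (Suc i) * (t / real m)) \<omega> - Z (real (Suc i) * (t / real m)) \<omega>) - (Y (real i * (t / real m)) \<omega> - Z (real i * (t / real m)) \<omega>))) {..<m}"
    unfolding riemann_sum_def L2_set_def by simp
  also have "\<dots> \<le> sqrt (riemann_sum t m Z \<omega>) + sqrt (riemann_sum t m (\<lambda>s \<omega>. Y s \<omega> - Z s \<omega>) \<omega>)"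
    unfolding riemann_sum_def L2_set_def[symmetric] by (rule L2_set_triangle_ineq)
  finally show ?thesis .
qed

lemma riemann_sum_minus: "riemann_sum t m (\<lambda>s \<omega>. Y s \<omega> - Z s \<omega>) \<omega> = riemann_sum t m (\<lambda>s \<omega>. Z s \<omega> - Y s \<omega>) \<omega>"
  unfolding riemann_sum_def by (intro sum.cong) (auto simp: power2_commute algebra_simps)

lemma sqrt_diff_le: "0 \<le> a \<Longrightarrow> 0 \<le> b \<Longrightarrow> \<bar>sqrt a - sqrt b\<bar> \<le> sqrt \<bar>a - b\<bar>"
proof (induction a b rule: linorder_wlog)
  case (le a b)
  have "sqrt b \<le> sqrt a + sqrt (b - a)"
    using sqrt_add_le_add_sqrt[of a "b - a"] le by simp
  then show ?case using le by simp
qed (simp add: abs_minus_commute)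

lemma riemann_sum_grid:
  assumes "0 < t" "0 < m" "i \<le> m"
  shows "0 \<le> real i * (t / real m)" "real i * (t / real m) \<le> t"
proof -
  show "0 \<le> real i * (t / real m)" using assms by simp
  have "real i * (t / real m) \<le> real m * (t / real m)" using assms by (intro mult_right_mono) auto
  then show "real i * (t / real m) \<le> t" using assms by simp
qed

lemma riemann_sum_measurable:
  assumes "\<And>r. 0 \<le> r \<Longrightarrow> r \<le> t \<Longrightarrow> Y r \<in> borel_measurable M" "0 < t"
  shows "riemann_sum t m Y \<in> borel_measurable M"
proof (cases "m = 0")
  case False
  have "Y (real i * (t / real m)) \<in> borel_measurable M" if "i \<le> m" for i
    using riemann_sum_grid[of t m i] that assms False by auto
  then show ?thesis unfolding riemann_sum_def
    by (intro borel_measurable_sum borel_measurable_power borel_measurable_diff; simp del: of_nat_Suc)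
next
  case True
  then have "riemann_sum t m Y = (\<lambda>_. 0)" by (simp add: riemann_sum_def fun_eq_iff)
  then show ?thesis by simp
qed

section \<open>Elementary integrals that approximate a process at a fixed rate\<close>

text \<open>The exceptional probabilities are summable for the Borel-Cantelli lemma. The rate 16^-n
  becomes 256^-n after squaring, which remains summable when divided by the thresholds 8^-n and
  16^-n. The horizon grows with \<open>n\<close>, so that one exceptional event serves all compact
  intervals.\<close>

locale approximated_integral = cyl_brownian_banach Q E W
  for Q :: "'b measure" and E :: "real \<Rightarrow> 'b measure" and W :: "'h::{real_inner, banach} \<Rightarrow> real \<Rightarrow> 'b \<Rightarrow> real" +
  fixes h :: "nat \<Rightarrow> real \<Rightarrow> 'b \<Rightarrow> 'h" and J :: "nat \<Rightarrow> real \<Rightarrow> 'b \<Rightarrow> real"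
    and N :: "real \<Rightarrow> 'b \<Rightarrow> real" and B :: "nat \<Rightarrow> 'b set"
  assumes S: "\<And>n. simp_int (h n) (J n)"
    and B: "\<And>n. B n \<in> sets Q" "\<And>n. measure Q (B n) \<le> (1 / 2) ^ n"
    and close: "\<And>n \<omega> t. \<omega> \<in> space Q - B n \<Longrightarrow> t \<in> {0..real n} \<Longrightarrow> \<bar>J n t \<omega> - N t \<omega>\<bar> \<le> (1 / 16) ^ n"
begin

lemma eventually_not_B: "AE \<omega> in Q. \<forall>\<^sub>F n in sequentially. \<omega> \<in> space Q - B n"
proof (rule borel_cantelli_AE1)
  show "summable (\<lambda>n. measure Q (B n))"
    by (rule summable_comparison_test'[of "\<lambda>n. (1 / 2) ^ n" 0]) (use B in \<open>auto simp: summable_geometric\<close>)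
qed (use B in \<open>auto simp: emeasure_eq_measure\<close>)

lemma integrals_uniform_limit:
  "AE \<omega> in Q. \<forall>T. uniform_limit {0..T} (\<lambda>n t. J n t \<omega>) (\<lambda>t. N t \<omega>) sequentially"
  using eventually_not_B
proof eventually_elim
  case (elim \<omega>)
  show ?case
  proof
    fix T
    show "uniform_limit {0..T} (\<lambda>n t. J n t \<omega>) (\<lambda>t. N t \<omega>) sequentially"
    proof (rule uniform_limitI)
      fix e :: real assume "0 < e"
      have "(\<lambda>n. (1 / 16 :: real) ^ n) \<longlonglongrightarrow> 0" by (rule LIMSEQ_realpow_zero) auto
      then have "\<forall>\<^sub>F n in sequentially. (1 / 16 :: real) ^ n < e" using \<open>0 < e\<close> by (rule order_tendstoD)
      moreover have "\<forall>\<^sub>F n in sequentially. T \<le> real n" by (metis eventually_sequentiallyI nat_ceiling_le_eq)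
      ultimately show "\<forall>\<^sub>F n in sequentially. \<forall>x\<in>{0..T}. dist (J n x \<omega>) (N x \<omega>) < e"
        using elim
      proof eventually_elim
        case (elim n)
        show ?case
        proof
          fix x assume "x \<in> {0..T}"
          then have "x \<in> {0..real n}" using elim by auto
          with close[OF elim(3) this] elim(1) show "dist (J n x \<omega>) (N x \<omega>) < e" by (simp add: dist_real_def)
        qed
      qed
    qed
  qed
qed

text \<open>Off both exceptional sets the integrals differ by at most
  \<open>d = 2 * (1/16)^n\<close>, and \<open>4 * d^2\<close> is
  \<open>16 * (1/256)^n\<close>.\<close>

lemma energy_diff_small:
  assumes "n \<le> k" "0 < T" "T \<le> real n" "0 < e"
  shows "measure Q {\<omega>\<in>space Q. e \<le> energy (\<lambda>t \<omega>. h n t \<omega> - h k t \<omega>) 0 T \<omega>} \<le> 2 * (1 / 2) ^ n + 16 * (1 / 256) ^ n / e"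
proof -
  have p: "(1 / 16 :: real) ^ k \<le> (1 / 16) ^ n" "(1 / 2 :: real) ^ k \<le> (1 / 2) ^ n"
    using assms(1) by (auto intro!: power_decreasing)
  have "measure Q {\<omega>\<in>space Q. e \<le> energy (\<lambda>t \<omega>. h n t \<omega> - h k t \<omega>) 0 T \<omega>}
     \<le> measure Q (B n \<union> B k) + 4 * (2 * (1 / 16) ^ n)\<^sup>2 / e"
  proof (rule energy_small_of_integral_small[OF simp_int_diff[OF S S] assms(2) _ assms(4)])
    fix \<omega> t assume \<omega>: "\<omega> \<in> space Q - (B n \<union> B k)" "t \<in> {0..T}"
    then have "\<bar>J n t \<omega> - N t \<omega>\<bar> \<le> (1 / 16) ^ n" "\<bar>J k t \<omega> - N t \<omega>\<bar> \<le> (1 / 16) ^ k"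
      using assms by (auto intro!: close)
    then show "\<bar>J n t \<omega> - J k t \<omega>\<bar> \<le> 2 * (1 / 16) ^ n" using p(1) by linarith
  qed (use B in auto)
  also have "measure Q (B n \<union> B k) \<le> 2 * (1 / 2) ^ n"
    using measure_Un_le[OF B(1) B(1), of n k] B(2)[of n] B(2)[of k] p(2) by linarith
  also have "(2 * (1 / 16 :: real) ^ n)\<^sup>2 = 4 * (1 / 256) ^ n"
    by (simp add: power_mult_distrib power2_eq_square flip: power_mult_distrib)
  finally show ?thesis by simp
qed

lemma fast_energy:
  "AE \<omega> in Q. \<forall>T. \<forall>\<^sub>F n in sequentially. energy (\<lambda>t \<omega>. h n t \<omega> - h (Suc n) t \<omega>) 0 T \<omega> \<le> (1 / 8) ^ n"
proof -
  \<comment> \<open>The index 0 is excluded because the energy estimate needs a positive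
    horizon.\<close>
  define S' where "S' n = (if n = 0 then {} else {\<omega>\<in>space Q. (1 / 8) ^ n \<le> energy (\<lambda>t \<omega>. h n t \<omega> - h (Suc n) t \<omega>) 0 (real n) \<omega>})" for n
  have D: "simp_int (\<lambda>t \<omega>. h n t \<omega> - h (Suc n) t \<omega>) (\<lambda>t \<omega>. J n t \<omega> - J (Suc n) t \<omega>)" for n
    by (rule simp_int_diff[OF S S])
  have [measurable]: "energy (\<lambda>t \<omega>. h n t \<omega> - h (Suc n) t \<omega>) 0 (real n) \<in> borel_measurable Q" for n
    by (rule energy_measurable[OF D]) simp
  have Sm: "S' n \<in> sets Q" for n unfolding S'_def by (cases "n = 0") simp_all
  have Sb: "measure Q (S' n) \<le> 18 * (1 / 2) ^ n" for n
  proof (cases "n = 0")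
    case False
    have "measure Q (S' n) \<le> 2 * (1 / 2) ^ n + 16 * (1 / 256) ^ n / (1 / 8) ^ n"
      using energy_diff_small[of n "Suc n" "real n" "(1 / 8) ^ n"] False by (simp add: S'_def)
    also have "16 * (1 / 256 :: real) ^ n / (1 / 8) ^ n = 16 * (1 / 32) ^ n"
      by (simp add: power_divide[symmetric] del: power_divide flip: times_divide_eq_right)
    also have "\<dots> \<le> 16 * (1 / 2) ^ n" by (intro mult_left_mono power_mono) auto
    finally show ?thesis by simp
  qed (simp add: S'_def)
  have "AE \<omega> in Q. \<forall>\<^sub>F n in sequentially. \<omega> \<in> space Q - S' n"
  proof (rule borel_cantelli_AE1)
    show "summable (\<lambda>n. measure Q (S' n))"
      by (rule summable_comparison_test'[of "\<lambda>n. 18 * (1 / 2) ^ n" 0]) (use Sb in \<open>auto intro!: summable_mult simp: summable_geometric\<close>)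
  qed (use Sm in \<open>auto simp: emeasure_eq_measure\<close>)
  then show ?thesis
  proof eventually_elim
    case (elim \<omega>)
    show ?case
    proof
      fix T
      have "\<forall>\<^sub>F n in sequentially. T \<le> real n" by (metis eventually_sequentiallyI nat_ceiling_le_eq)
      moreover have "\<forall>\<^sub>F n::nat in sequentially. 0 < n" by (rule eventually_gt_at_top)
      ultimately show "\<forall>\<^sub>F n in sequentially. energy (\<lambda>t \<omega>. h n t \<omega> - h (Suc n) t \<omega>) 0 T \<omega> \<le> (1 / 8) ^ n"
        using elim
      proof eventually_elim
        case (elim n)
        show ?case
        proof (cases "0 \<le> T")
          case True
          have "energy (\<lambda>t \<omega>. h n t \<omega> - h (Suc n) t \<omega>) 0 T \<omega> \<le> energy (\<lambda>t \<omega>. h n t \<omega> - h (Suc n) t \<omega>) 0 (real n) \<omega>"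
            by (rule energy_mono[OF D True elim(1)])
          also have "\<dots> \<le> (1 / 8) ^ n" using elim(2,3) by (auto simp: S'_def)
          finally show ?thesis .
        next
          case False
          then have "energy (\<lambda>t \<omega>. h n t \<omega> - h (Suc n) t \<omega>) 0 T \<omega> = 0" by (intro energy_eq_0) auto
          then show ?thesis by simp
        qed
      qed
    qed
  qed
qed

lemmas limit_L2 = limit_process_L2[OF S fast_energy]

text \<open>\<open>N\<close> need not be an elementary integral, so it is replaced by
  \<open>J k\<close> with \<open>k\<close> large depending on \<open>m\<close>: on \<open>m\<close>
  steps this costs little. The difference \<open>J n - J k\<close> is elementary with small energy,
  so its Riemann sum is small in probability. \<open>k\<close> disappears from the bound, which is
  uniform in \<open>m\<close>; the constant 19 is 1 + 2 + 16.\<close>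

lemma riemann_sum_diff_small:
  assumes t: "0 < t" "t \<le> real n" and m: "0 < m" and \<eta>: "0 < \<eta>"
    and Nm: "\<And>r. 0 \<le> r \<Longrightarrow> N r \<in> borel_measurable Q"
  shows "measure Q {\<omega>\<in>space Q. 4 * \<eta> \<le> riemann_sum t m (\<lambda>s \<omega>. J n s \<omega> - N s \<omega>) \<omega>} \<le> 19 * (1 / 2) ^ n + 2 * (1 / 16) ^ n / \<eta>"
proof -
  have "(\<lambda>k. 8 * real m * (1 / 256 :: real) ^ k) \<longlonglongrightarrow> 0"
    by (intro tendsto_mult_right_zero LIMSEQ_realpow_zero) auto
  then have "\<forall>\<^sub>F k in sequentially. 8 * real m * (1 / 256 :: real) ^ k < 2 * \<eta>" using \<eta> by (intro order_tendstoD) auto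
  moreover have "\<forall>\<^sub>F k in sequentially. n \<le> k" by (rule eventually_ge_at_top)
  ultimately have "\<forall>\<^sub>F k in sequentially. n \<le> k \<and> 8 * real m * (1 / 256 :: real) ^ k < 2 * \<eta>" by eventually_elim simp
  \<comment> \<open>Replacing \<open>N\<close> by \<open>J k\<close> adds at most
    \<open>8 * m * (1/256)^k < 2 * \<eta>\<close> to twice the Riemann sum. A total of
    \<open>4 * \<eta>\<close> therefore forces the sum for \<open>J n - J k\<close> to be at least
    \<open>\<eta>\<close>.\<close>
  from eventually_happens'[OF sequentially_bot this] obtain k where k: "n \<le> k" "8 * real m * (1 / 256 :: real) ^ k < 2 * \<eta>" by blast
  let ?R = "riemann_sum t m"
  let ?JN = "\<lambda>s \<omega>. J n s \<omega> - N s \<omega>" and ?JK = "\<lambda>s \<omega>. J n s \<omega> - J k s \<omega>"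
  have [measurable]: "?R ?JN \<in> borel_measurable Q" "?R ?JK \<in> borel_measurable Q"
    using t by (auto intro!: riemann_sum_measurable borel_measurable_diff Nm simp_int_measurable[OF S])
  note [measurable] = B(1)
  have "{\<omega>\<in>space Q. 4 * \<eta> \<le> ?R ?JN \<omega>} \<subseteq> B k \<union> {\<omega>\<in>space Q. \<eta> \<le> ?R ?JK \<omega>}"
  proof
    fix \<omega> assume \<omega>: "\<omega> \<in> {\<omega>\<in>space Q. 4 * \<eta> \<le> ?R ?JN \<omega>}"
    { assume nB: "\<omega> \<notin> B k"
      define r where "r i = real i * (t / real m)" for i :: nat
      have r: "r i \<in> {0..real k}" if "i \<le> m" for i
        using riemann_sum_grid[OF t(1) m that] t k(1) by (auto simp: r_def)
      have c: "\<bar>J k (r i) \<omega> - N (r i) \<omega>\<bar> \<le> (1 / 16) ^ k" if "i \<le> m" for i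
        using close[OF _ r[OF that], of \<omega>] nB \<omega> by simp
      have "?R ?JN \<omega> \<le> (\<Sum>i<m. 2 * (?JK (r (Suc i)) \<omega> - ?JK (r i) \<omega>)\<^sup>2 + 8 * (1 / 256) ^ k)"
        unfolding riemann_sum_def r_def[symmetric]
      proof (rule sum_mono)
        fix i assume "i \<in> {..<m}"
        then have "\<bar>J k (r (Suc i)) \<omega> - N (r (Suc i)) \<omega>\<bar> \<le> (1 / 16) ^ k" "\<bar>J k (r i) \<omega> - N (r i) \<omega>\<bar> \<le> (1 / 16) ^ k"
          using c by auto
        then have "\<bar>(J k (r (Suc i)) \<omega> - N (r (Suc i)) \<omega>) - (J k (r i) \<omega> - N (r i) \<omega>)\<bar> \<le> \<bar>2 * (1 / 16) ^ k\<bar>" by linarith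
        then have "((J k (r (Suc i)) \<omega> - N (r (Suc i)) \<omega>) - (J k (r i) \<omega> - N (r i) \<omega>))\<^sup>2 \<le> (2 * (1 / 16) ^ k)\<^sup>2"
          by (simp only: abs_le_square_iff)
        also have "(2 * (1 / 16 :: real) ^ k)\<^sup>2 = 4 * (1 / 256) ^ k"
          by (simp add: power_mult_distrib power2_eq_square flip: power_mult_distrib)
        finally have b: "((J k (r (Suc i)) \<omega> - N (r (Suc i)) \<omega>) - (J k (r i) \<omega> - N (r i) \<omega>))\<^sup>2 \<le> 4 * (1 / 256) ^ k" .
        have "?JN (r (Suc i)) \<omega> - ?JN (r i) \<omega> = (?JK (r (Suc i)) \<omega> - ?JK (r i) \<omega>)
           + ((J k (r (Suc i)) \<omega> - N (r (Suc i)) \<omega>) - (J k (r i) \<omega> - N (r i) \<omega>))" by simp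
        then show "(?JN (r (Suc i)) \<omega> - ?JN (r i) \<omega>)\<^sup>2 \<le> 2 * (?JK (r (Suc i)) \<omega> - ?JK (r i) \<omega>)\<^sup>2 + 8 * (1 / 256) ^ k"
          using square_add_le[of "?JK (r (Suc i)) \<omega> - ?JK (r i) \<omega>" "(J k (r (Suc i)) \<omega> - N (r (Suc i)) \<omega>) - (J k (r i) \<omega> - N (r i) \<omega>)"] b
          by (simp only:)
      qed
      also have "\<dots> = 2 * ?R ?JK \<omega> + 8 * real m * (1 / 256) ^ k"
        by (simp add: riemann_sum_def r_def sum.distrib sum_distrib_left)
      finally have "\<eta> \<le> ?R ?JK \<omega>" using k(2) \<omega> by simp }
    then show "\<omega> \<in> B k \<union> {\<omega>\<in>space Q. \<eta> \<le> ?R ?JK \<omega>}" using \<omega> by blast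
  qed
  then have "measure Q {\<omega>\<in>space Q. 4 * \<eta> \<le> ?R ?JN \<omega>} \<le> measure Q (B k \<union> {\<omega>\<in>space Q. \<eta> \<le> ?R ?JK \<omega>})"
    by (intro finite_measure_mono) auto
  also have "\<dots> \<le> measure Q (B k) + measure Q {\<omega>\<in>space Q. \<eta> \<le> ?R ?JK \<omega>}"
    by (intro measure_Un_le) auto
  also have "measure Q (B k) \<le> (1 / 2) ^ n"
  proof -
    have "(1 / 2 :: real) ^ k \<le> (1 / 2) ^ n" using k(1) by (intro power_decreasing) auto
    then show ?thesis using B(2)[of k] by linarith
  qed
  also have "measure Q {\<omega>\<in>space Q. \<eta> \<le> ?R ?JK \<omega>} \<le> measure Q {\<omega>\<in>space Q. (1 / 16) ^ n < energy (\<lambda>t \<omega>. h n t \<omega> - h k t \<omega>) 0 t \<omega>} + 2 * (1 / 16) ^ n / \<eta>"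
    unfolding riemann_sum_def
    by (rule riemann_small_of_energy_small[OF simp_int_diff[OF S S] t(1) _ \<eta> m]) simp
  also have "measure Q {\<omega>\<in>space Q. (1 / 16) ^ n < energy (\<lambda>t \<omega>. h n t \<omega> - h k t \<omega>) 0 t \<omega>}
     \<le> measure Q {\<omega>\<in>space Q. (1 / 16) ^ n \<le> energy (\<lambda>t \<omega>. h n t \<omega> - h k t \<omega>) 0 t \<omega>}"
  proof (rule finite_measure_mono)
    have [measurable]: "energy (\<lambda>t \<omega>. h n t \<omega> - h k t \<omega>) 0 t \<in> borel_measurable Q"
      using t by (intro energy_measurable[OF simp_int_diff[OF S S]]) auto
    show "{\<omega>\<in>space Q. (1 / 16) ^ n \<le> energy (\<lambda>t \<omega>. h n t \<omega> - h k t \<omega>) 0 t \<omega>} \<in> sets Q" by measurable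
  qed auto
  also have "\<dots> \<le> 2 * (1 / 2) ^ n + 16 * (1 / 256) ^ n / (1 / 16) ^ n"
    by (rule energy_diff_small[OF k(1) t]) simp
  also have "16 * (1 / 256 :: real) ^ n / (1 / 16) ^ n = 16 * (1 / 16) ^ n"
    by (simp add: power_divide[symmetric] del: power_divide flip: times_divide_eq_right)
  also have "16 * (1 / 16 :: real) ^ n \<le> 16 * (1 / 2) ^ n" by (intro mult_left_mono power_mono) auto
  finally show ?thesis by simp
qed

text \<open>Three comparisons: the sums of \<open>N\<close> and \<open>J n\<close>, the sum of
  \<open>J n\<close> and its energy, that energy and \<open>V\<close>. The first is uniform in the
  grid, so \<open>n\<close> can be fixed before the grid is refined for the second.\<close>

lemma riemann_sums_converge:
  assumes t: "0 < t" and e: "0 < e"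
    and Nm: "\<And>r. 0 \<le> r \<Longrightarrow> N r \<in> borel_measurable Q"
    and Vm: "V \<in> borel_measurable Q"
    and V: "AE \<omega> in Q. sqnorm (limit_process h) t \<omega> = ennreal (V \<omega>)" "\<And>\<omega>. \<omega> \<in> space Q \<Longrightarrow> 0 \<le> V \<omega>"
  shows "\<exists>m>0. measure Q {\<omega>\<in>space Q. e < \<bar>sqrt (riemann_sum t m N \<omega>) - sqrt (V \<omega>)\<bar>} \<le> e"
proof -
  \<comment> \<open>Square roots turn each error below \<open>\<eta>\<close> into an error below
    \<open>e / 3\<close>.\<close>
  define \<eta> where "\<eta> = (e / 3)\<^sup>2"
  have \<eta>: "0 < \<eta>" "sqrt \<eta> = e / 3" using e by (auto simp: \<eta>_def)
  let ?A = "\<lambda>n. energy (h n) 0 t"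
  have Am [measurable]: "?A n \<in> borel_measurable Q" for n using t by (intro energy_measurable[OF S]) auto
  note [measurable] = Vm
  have "AE \<omega> in Q. (\<lambda>n. ?A n \<omega>) \<longlonglongrightarrow> V \<omega>"
    using limit_L2(2) V(1) AE_space
  proof eventually_elim
    case (elim \<omega>)
    have um: "strongly_measurable (time_prod Q) (\<lambda>p. limit_process h (fst p) (snd p))"
      by (rule limit_process_strongly_measurable[OF S])
    have hm: "strongly_measurable (time_prod Q) (\<lambda>p. h n (fst p) (snd p))" for n
      by (rule simp_int_strongly_measurable[OF S])
    show ?case
      using elim V(2)
      by (intro sqnorm_tendsto[OF strongly_measurable_norm[OF hm] strongly_measurable_norm[OF um]
               strongly_measurable_norm[OF strongly_measurable_diff[OF hm um]] elim(3) energy_sqnorm[OF S, symmetric]])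
        (auto simp: energy_nonneg)
  qed
  from AE_tendsto_imp_measure[OF Am Vm this \<eta>(1)]
  have 3: "\<forall>\<^sub>F n in sequentially. measure Q {\<omega>\<in>space Q. \<eta> \<le> \<bar>?A n \<omega> - V \<omega>\<bar>} < e / 3"
    using e by (intro order_tendstoD) auto
  have "(\<lambda>n. 19 * (1 / 2) ^ n + 2 * (1 / 16) ^ n / (\<eta> / 4)) \<longlonglongrightarrow> 19 * 0 + 2 * 0 / (\<eta> / 4)"
    using \<eta> by (intro tendsto_intros LIMSEQ_realpow_zero) auto
  then have 1: "\<forall>\<^sub>F n in sequentially. 19 * (1 / 2) ^ n + 2 * (1 / 16) ^ n / (\<eta> / 4) < e / 3"
    using e by (intro order_tendstoD) auto
  have "\<forall>\<^sub>F n in sequentially. t \<le> real n" by (metis eventually_sequentiallyI nat_ceiling_le_eq)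
  with 1 3 have "\<forall>\<^sub>F n in sequentially. t \<le> real n \<and> measure Q {\<omega>\<in>space Q. \<eta> \<le> \<bar>?A n \<omega> - V \<omega>\<bar>} < e / 3
    \<and> 19 * (1 / 2) ^ n + 2 * (1 / 16) ^ n / (\<eta> / 4) < e / 3" by eventually_elim simp
  from eventually_happens'[OF sequentially_bot this] obtain n where n: "t \<le> real n" "measure Q {\<omega>\<in>space Q. \<eta> \<le> \<bar>?A n \<omega> - V \<omega>\<bar>} < e / 3"
     "19 * (1 / 2) ^ n + 2 * (1 / 16) ^ n / (\<eta> / 4) < e / 3"
    by blast
  obtain K where K0: "0 \<le> K" and K1: "\<forall>m>0. integrable Q (\<lambda>\<omega>. (riemann_sum t m (J n) \<omega> - ?A n \<omega>)\<^sup>2) \<and>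
    (\<integral>\<omega>. (riemann_sum t m (J n) \<omega> - ?A n \<omega>)\<^sup>2 \<partial>Q) \<le> K / real m"
    using simp_int_riemann_L2[OF S t, of n, folded riemann_sum_def] by (elim exE conjE) (rule that)
  have K: "integrable Q (\<lambda>\<omega>. (riemann_sum t m (J n) \<omega> - ?A n \<omega>)\<^sup>2)"
    "(\<integral>\<omega>. (riemann_sum t m (J n) \<omega> - ?A n \<omega>)\<^sup>2 \<partial>Q) \<le> K / real m" if "0 < m" for m
    using K1[rule_format, OF that] by blast+
  \<comment> \<open>Markov's inequality for the mean square error \<open>K / m\<close> then gives
    probability at most \<open>e / 3\<close>.\<close>
  obtain m0 :: nat where m0: "3 * K / (\<eta>\<^sup>2 * e) \<le> real m0" using real_arch_simple by blast
  define m where "m = Suc m0"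
  have m: "0 < m" "3 * K / (\<eta>\<^sup>2 * e) \<le> real m" using m0 by (auto simp: m_def)
  let ?R = "riemann_sum t m"
  let ?JN = "\<lambda>s \<omega>. J n s \<omega> - N s \<omega>"
  have Rm [measurable]: "?R N \<in> borel_measurable Q" "?R (J n) \<in> borel_measurable Q" "?R ?JN \<in> borel_measurable Q"
    using t by (auto intro!: riemann_sum_measurable borel_measurable_diff Nm simp_int_measurable[OF S])
  have 2: "measure Q {\<omega>\<in>space Q. \<eta>\<^sup>2 \<le> (?R (J n) \<omega> - ?A n \<omega>)\<^sup>2} \<le> e / 3"
  proof -
    have "measure Q {\<omega>\<in>space Q. \<eta>\<^sup>2 \<le> (?R (J n) \<omega> - ?A n \<omega>)\<^sup>2} \<le> (\<integral>\<omega>. (?R (J n) \<omega> - ?A n \<omega>)\<^sup>2 \<partial>Q) / \<eta>\<^sup>2"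
      using \<eta> by (intro integral_Markov_inequality_measure[OF K(1)[OF m(1)], where A="space Q"]) auto
    also have "\<dots> \<le> (K / real m) / \<eta>\<^sup>2" using K(2)[OF m(1)] by (intro divide_right_mono) auto
    also have "\<dots> \<le> e / 3" using m e \<eta> by (simp add: field_simps)
    finally show ?thesis .
  qed
  let ?B1 = "{\<omega>\<in>space Q. 4 * (\<eta> / 4) \<le> ?R ?JN \<omega>}" and ?B2 = "{\<omega>\<in>space Q. \<eta>\<^sup>2 \<le> (?R (J n) \<omega> - ?A n \<omega>)\<^sup>2}"
    and ?B3 = "{\<omega>\<in>space Q. \<eta> \<le> \<bar>?A n \<omega> - V \<omega>\<bar>}"
  have "{\<omega>\<in>space Q. e < \<bar>sqrt (?R N \<omega>) - sqrt (V \<omega>)\<bar>} \<subseteq> ?B1 \<union> (?B2 \<union> ?B3)"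
  proof
    fix \<omega> assume \<omega>: "\<omega> \<in> {\<omega>\<in>space Q. e < \<bar>sqrt (?R N \<omega>) - sqrt (V \<omega>)\<bar>}"
    { assume "\<omega> \<notin> ?B1 \<union> (?B2 \<union> ?B3)"
      then have b: "?R ?JN \<omega> < \<eta>" "(?R (J n) \<omega> - ?A n \<omega>)\<^sup>2 < \<eta>\<^sup>2" "\<bar>?A n \<omega> - V \<omega>\<bar> < \<eta>"
        using \<omega> by auto
      have b2: "\<bar>?R (J n) \<omega> - ?A n \<omega>\<bar> < \<eta>" using b(2) \<eta>(1) by (intro power2_less_imp_less[of "\<bar>_\<bar>"]) auto
      have "sqrt (?R ?JN \<omega>) < e / 3" "sqrt \<bar>?R (J n) \<omega> - ?A n \<omega>\<bar> < e / 3" "sqrt \<bar>?A n \<omega> - V \<omega>\<bar> < e / 3"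
        unfolding \<eta>(2)[symmetric] using b b2 by (auto intro: real_sqrt_less_mono)
      moreover have "\<bar>sqrt (?R N \<omega>) - sqrt (?R (J n) \<omega>)\<bar> \<le> sqrt (?R ?JN \<omega>)"
        using riemann_sum_triangle[of t m N \<omega> "J n"] riemann_sum_triangle[of t m "J n" \<omega> N]
          riemann_sum_minus[of t m N "J n" \<omega>] by simp
      moreover have "\<bar>sqrt (?R (J n) \<omega>) - sqrt (?A n \<omega>)\<bar> \<le> sqrt \<bar>?R (J n) \<omega> - ?A n \<omega>\<bar>"
        by (rule sqrt_diff_le[OF riemann_sum_nonneg energy_nonneg])
      moreover have "\<bar>sqrt (?A n \<omega>) - sqrt (V \<omega>)\<bar> \<le> sqrt \<bar>?A n \<omega> - V \<omega>\<bar>"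
        using V(2) \<omega> by (intro sqrt_diff_le energy_nonneg) auto
      ultimately have False using \<omega> by auto }
    then show "\<omega> \<in> ?B1 \<union> (?B2 \<union> ?B3)" by blast
  qed
  then have "measure Q {\<omega>\<in>space Q. e < \<bar>sqrt (?R N \<omega>) - sqrt (V \<omega>)\<bar>} \<le> measure Q (?B1 \<union> (?B2 \<union> ?B3))"
    by (intro finite_measure_mono) auto
  also have "\<dots> \<le> measure Q ?B1 + (measure Q ?B2 + measure Q ?B3)"
    by (intro order_trans[OF measure_Un_le] add_left_mono measure_Un_le) auto
  also have "\<dots> \<le> e / 3 + (e / 3 + e / 3)"
    using riemann_sum_diff_small[OF t n(1) m(1), of "\<eta> / 4"] Nm \<eta> n 2 by (intro add_mono) auto
  finally show ?thesis using m(1) by (intro exI[of _ m]) auto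
qed

end

section \<open>Adjoint graphs and approximable integrands\<close>

lemma adjoint_graph_iff:
  "(x, h) \<in> adjoint_graph A \<longleftrightarrow> (\<forall>u v. (u, v) \<in> A \<longrightarrow> blinfun_apply x v = inner u h)"
  unfolding adjoint_graph_def by auto

lemma adjoint_graph_zero: "(0, 0) \<in> adjoint_graph A"
  by (simp add: adjoint_graph_iff)

lemma adjoint_graph_add:
  "(x, h) \<in> adjoint_graph A \<Longrightarrow> (y, k) \<in> adjoint_graph A \<Longrightarrow> (x + y, h + k) \<in> adjoint_graph A"
  by (simp add: adjoint_graph_iff blinfun.add_left inner_add_right)

lemma adjoint_graph_scaleR: "(x, h) \<in> adjoint_graph A \<Longrightarrow> (c *\<^sub>R x, c *\<^sub>R h) \<in> adjoint_graph A"
  by (simp add: adjoint_graph_iff blinfun.scaleR_left)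

lemma adjoint_graph_sum:
  "(\<And>i. i \<in> I \<Longrightarrow> (x i, h i) \<in> adjoint_graph A) \<Longrightarrow> ((\<Sum>i\<in>I. x i), (\<Sum>i\<in>I. h i)) \<in> adjoint_graph A"
  by (induction I rule: infinite_finite_induct) (simp_all add: adjoint_graph_zero adjoint_graph_add)

text \<open>For a fixed pair \<open>(u, v)\<close> both sides of the defining equation are
  continuous in the pair of functional and vector. \<open>A\<close> itself enters only through its
  elements.\<close>

lemma adjoint_graph_closed:
  assumes "\<And>n. (x n, h n) \<in> adjoint_graph A" "x \<longlonglongrightarrow> y" "h \<longlonglongrightarrow> k"
  shows "(y, k) \<in> adjoint_graph A"
  unfolding adjoint_graph_iff
proof (intro allI impI)
  fix u v assume uv: "(u, v) \<in> A"
  have "(\<lambda>n. blinfun_apply (x n) v) \<longlonglongrightarrow> blinfun_apply y v"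
    by (intro tendsto_intros assms)
  moreover have "(\<lambda>n. inner u (h n)) \<longlonglongrightarrow> inner u k" by (intro tendsto_intros assms)
  moreover have "blinfun_apply (x n) v = inner u (h n)" for n
    using assms(1)[of n] uv by (auto simp: adjoint_graph_iff)
  ultimately show "blinfun_apply y v = inner u k" using LIMSEQ_unique by simp
qed

text \<open>Every subset of the space has a measurable cover whose measure is its outer measure.
  Exceptional sets that may be nonmeasurable are thus traded for measurable ones.\<close>

lemma (in prob_space) outer_measure_tendsto_0D:
  assumes "(\<lambda>n. outer_measure_of M (A n)) \<longlonglongrightarrow> 0" "\<And>n. A n \<subseteq> space M" "0 < e"
  shows "\<forall>\<^sub>F n in sequentially. \<exists>B\<in>sets M. A n \<subseteq> B \<and> measure M B \<le> e"
proof -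
  have "\<forall>\<^sub>F n in sequentially. outer_measure_of M (A n) < ennreal e"
    using assms by (intro order_tendstoD) auto
  then show ?thesis
  proof eventually_elim
    case (elim n)
    obtain B where B: "B \<in> sets M" "A n \<subseteq> B" "outer_measure_of M (A n) = emeasure M B"
      using outer_measure_of_attain[OF assms(2)] by blast
    have "measure M B \<le> e" using elim B by (simp add: emeasure_eq_measure ennreal_less_iff)
    then show ?case using B by blast
  qed
qed

lemma (in prob_space) ucp_tendstoD:
  assumes "ucp_tendsto M X Y sequentially" "0 < e"
  shows "\<forall>\<^sub>F n in sequentially. \<exists>B\<in>sets M. measure M B \<le> e \<and>
    (\<forall>\<omega>\<in>space M - B. \<forall>t\<in>{0..T}. \<bar>X n t \<omega> - Y t \<omega>\<bar> \<le> e)"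
proof -
  \<comment> \<open>Convergence in ucp speaks of nonnegative horizons; for negative \<open>T\<close>
    the claim is vacuous, and \<open>max\<close> covers both cases.\<close>
  let ?A = "\<lambda>n. {\<omega>\<in>space M. \<exists>s\<in>{0..max 0 T}. e < \<bar>X n s \<omega> - Y s \<omega>\<bar>}"
  have "(\<lambda>n. outer_measure_of M (?A n)) \<longlonglongrightarrow> 0"
    using assms by (auto simp: ucp_tendsto_def)
  then have "\<forall>\<^sub>F n in sequentially. \<exists>B\<in>sets M. ?A n \<subseteq> B \<and> measure M B \<le> e"
    by (rule outer_measure_tendsto_0D) (use assms in auto)
  then show ?thesis
  proof eventually_elim
    case (elim n)
    then obtain B where B: "B \<in> sets M" "?A n \<subseteq> B" "measure M B \<le> e" by blast
    show ?case
    proof (intro bexI[of _ B] conjI ballI)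
      fix \<omega> t assume "\<omega> \<in> space M - B" "t \<in> {0..T}"
      moreover from this have "\<omega> \<notin> ?A n" "t \<in> {0..max 0 T}" using B(2) by auto
      ultimately show "\<bar>X n t \<omega> - Y t \<omega>\<bar> \<le> e" by force
    qed (use B in auto)
  qed
qed

section \<open>Integrands with elementary approximations\<close>

context cyl_brownian_banach begin

text \<open>Says that \<open>N\<close> is the stochastic integral of \<open>k\<close>: off a small
  event, one elementary pair is close in both components at once. The filtration constrains only the
  approximants; \<open>k\<close> itself is merely strongly measurable on the product.\<close>

definition approximable :: "(real \<Rightarrow> 'b \<Rightarrow> 'h) \<Rightarrow> (real \<Rightarrow> 'b \<Rightarrow> real) \<Rightarrow> bool" where
  "approximable k N \<longleftrightarrow> strongly_measurable (time_prod Q) (\<lambda>p. k (fst p) (snd p)) \<and>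
    (\<forall>T e. 0 < e \<longrightarrow> (\<exists>h J B. simp_int h J \<and> B \<in> sets Q \<and> measure Q B \<le> e \<and>
      (\<forall>\<omega>\<in>space Q - B. (\<forall>t\<in>{0..T}. \<bar>J t \<omega> - N t \<omega>\<bar> \<le> e) \<and> sqnorm (\<lambda>t \<omega>. h t \<omega> - k t \<omega>) T \<omega> \<le> ennreal e)))"

lemma approximableE:
  assumes "approximable k N" "0 < e"
  obtains h J B where "simp_int h J" "B \<in> sets Q" "measure Q B \<le> e"
    "\<And>\<omega> t. \<omega> \<in> space Q - B \<Longrightarrow> t \<in> {0..T} \<Longrightarrow> \<bar>J t \<omega> - N t \<omega>\<bar> \<le> e"
    "\<And>\<omega>. \<omega> \<in> space Q - B \<Longrightarrow> sqnorm (\<lambda>t \<omega>. h t \<omega> - k t \<omega>) T \<omega> \<le> ennreal e"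
proof -
  from assms have "\<exists>h J B. simp_int h J \<and> B \<in> sets Q \<and> measure Q B \<le> e \<and>
      (\<forall>\<omega>\<in>space Q - B. (\<forall>t\<in>{0..T}. \<bar>J t \<omega> - N t \<omega>\<bar> \<le> e) \<and> sqnorm (\<lambda>t \<omega>. h t \<omega> - k t \<omega>) T \<omega> \<le> ennreal e)"
    unfolding approximable_def by blast
  then obtain h J B where 1: "simp_int h J" "B \<in> sets Q" "measure Q B \<le> e" and
    2: "\<forall>\<omega>\<in>space Q - B. (\<forall>t\<in>{0..T}. \<bar>J t \<omega> - N t \<omega>\<bar> \<le> e) \<and> sqnorm (\<lambda>t \<omega>. h t \<omega> - k t \<omega>) T \<omega> \<le> ennreal e"
    by (elim exE conjE)
  show ?thesis
    by (rule that[OF 1]) (use 2 in auto)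
qed

lemma approximableI:
  assumes "strongly_measurable (time_prod Q) (\<lambda>p. k (fst p) (snd p))"
    and "\<And>T e. 0 < e \<Longrightarrow> \<exists>h J B. simp_int h J \<and> B \<in> sets Q \<and> measure Q B \<le> e \<and>
      (\<forall>\<omega>\<in>space Q - B. (\<forall>t\<in>{0..T}. \<bar>J t \<omega> - N t \<omega>\<bar> \<le> e) \<and> sqnorm (\<lambda>t \<omega>. h t \<omega> - k t \<omega>) T \<omega> \<le> ennreal e)"
  shows "approximable k N"
  unfolding approximable_def using assms by blast

lemma approximable_strongly_measurable:
  "approximable k N \<Longrightarrow> strongly_measurable (time_prod Q) (\<lambda>p. k (fst p) (snd p))"
  unfolding approximable_def by blast

lemma space_time_prod: "space (time_prod P) = {0..} \<times> space P"
  by (simp add: time_prod_def space_pair_measure space_restrict_space)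

lemma approximable_cong:
  assumes "approximable k N"
    and k: "\<And>t \<omega>. 0 \<le> t \<Longrightarrow> \<omega> \<in> space Q \<Longrightarrow> k' t \<omega> = k t \<omega>"
    and N: "\<And>t \<omega>. 0 \<le> t \<Longrightarrow> \<omega> \<in> space Q \<Longrightarrow> N' t \<omega> = N t \<omega>"
  shows "approximable k' N'"
proof (rule approximableI)
  show "strongly_measurable (time_prod Q) (\<lambda>p. k' (fst p) (snd p))"
    using approximable_strongly_measurable[OF assms(1)] k unfolding strongly_measurable_def
    by (auto simp: space_time_prod)
  fix T e :: real assume e: "0 < e"
  obtain h J B where "simp_int h J" "B \<in> sets Q" "measure Q B \<le> e"
    "\<And>\<omega> t. \<omega> \<in> space Q - B \<Longrightarrow> t \<in> {0..T} \<Longrightarrow> \<bar>J t \<omega> - N t \<omega>\<bar> \<le> e"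
    "\<And>\<omega>. \<omega> \<in> space Q - B \<Longrightarrow> sqnorm (\<lambda>t \<omega>. h t \<omega> - k t \<omega>) T \<omega> \<le> ennreal e"
    using approximableE[OF assms(1) e, where T=T] by blast
  moreover have "sqnorm (\<lambda>t \<omega>. h t \<omega> - k' t \<omega>) T \<omega> = sqnorm (\<lambda>t \<omega>. h t \<omega> - k t \<omega>) T \<omega>" if "\<omega> \<in> space Q" for \<omega>
    by (rule sqnorm_cong_AE) (use k that in auto)
  ultimately show "\<exists>h J B. simp_int h J \<and> B \<in> sets Q \<and> measure Q B \<le> e \<and>
      (\<forall>\<omega>\<in>space Q - B. (\<forall>t\<in>{0..T}. \<bar>J t \<omega> - N' t \<omega>\<bar> \<le> e) \<and> sqnorm (\<lambda>t \<omega>. h t \<omega> - k' t \<omega>) T \<omega> \<le> ennreal e)"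
    using N by (intro exI[of _ h] exI[of _ J] exI[of _ B]) auto
qed

lemma approximable_zero: "approximable (\<lambda>_ _. 0) (\<lambda>_ _. 0)"
proof (rule approximableI)
  fix T e :: real assume "0 < e"
  then show "\<exists>h J B. simp_int h J \<and> B \<in> sets Q \<and> measure Q B \<le> e \<and>
      (\<forall>\<omega>\<in>space Q - B. (\<forall>t\<in>{0..T}. \<bar>J t \<omega> - 0\<bar> \<le> e) \<and> sqnorm (\<lambda>t \<omega>. h t \<omega> - 0) T \<omega> \<le> ennreal e)"
    using simp_int.zero by (intro exI[of _ "\<lambda>_ _. 0"] exI[of _ "{}"]) (auto simp: sqnorm_def)
qed (simp add: strongly_measurable_simple)

lemma approximable_add:
  assumes 1: "approximable k1 N1" and 2: "approximable k2 N2"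
  shows "approximable (\<lambda>t \<omega>. k1 t \<omega> + k2 t \<omega>) (\<lambda>t \<omega>. N1 t \<omega> + N2 t \<omega>)"
proof (rule approximableI)
  note m1 = approximable_strongly_measurable[OF 1] and m2 = approximable_strongly_measurable[OF 2]
  show "strongly_measurable (time_prod Q) (\<lambda>p. k1 (fst p) (snd p) + k2 (fst p) (snd p))"
    by (rule strongly_measurable_add[OF m1 m2])
  fix T e :: real assume e: "0 < e"
  \<comment> \<open>Quarters, because the squared norm of a sum costs a factor 2 for each
    summand.\<close>
  then have e4: "0 < e / 4" by simp
  obtain h1 J1 B1 where h1: "simp_int h1 J1" "B1 \<in> sets Q" "measure Q B1 \<le> e / 4"
    "\<And>\<omega> t. \<omega> \<in> space Q - B1 \<Longrightarrow> t \<in> {0..T} \<Longrightarrow> \<bar>J1 t \<omega> - N1 t \<omega>\<bar> \<le> e / 4"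
    "\<And>\<omega>. \<omega> \<in> space Q - B1 \<Longrightarrow> sqnorm (\<lambda>t \<omega>. h1 t \<omega> - k1 t \<omega>) T \<omega> \<le> ennreal (e / 4)"
    using approximableE[OF 1 e4, where T=T] by blast
  obtain h2 J2 B2 where h2: "simp_int h2 J2" "B2 \<in> sets Q" "measure Q B2 \<le> e / 4"
    "\<And>\<omega> t. \<omega> \<in> space Q - B2 \<Longrightarrow> t \<in> {0..T} \<Longrightarrow> \<bar>J2 t \<omega> - N2 t \<omega>\<bar> \<le> e / 4"
    "\<And>\<omega>. \<omega> \<in> space Q - B2 \<Longrightarrow> sqnorm (\<lambda>t \<omega>. h2 t \<omega> - k2 t \<omega>) T \<omega> \<le> ennreal (e / 4)"
    using approximableE[OF 2 e4, where T=T] by blast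
  note s1 = strongly_measurable_diff[OF simp_int_strongly_measurable[OF h1(1)] m1]
    and s2 = strongly_measurable_diff[OF simp_int_strongly_measurable[OF h2(1)] m2]
  show "\<exists>h J B. simp_int h J \<and> B \<in> sets Q \<and> measure Q B \<le> e \<and>
      (\<forall>\<omega>\<in>space Q - B. (\<forall>t\<in>{0..T}. \<bar>J t \<omega> - (N1 t \<omega> + N2 t \<omega>)\<bar> \<le> e) \<and> sqnorm (\<lambda>t \<omega>. h t \<omega> - (k1 t \<omega> + k2 t \<omega>)) T \<omega> \<le> ennreal e)"
  proof (intro exI conjI ballI)
    show "simp_int (\<lambda>t \<omega>. h1 t \<omega> + h2 t \<omega>) (\<lambda>t \<omega>. J1 t \<omega> + J2 t \<omega>)" by (rule simp_int_add[OF h2(1) h1(1)])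
    show "B1 \<union> B2 \<in> sets Q" using h1 h2 by auto
    show "measure Q (B1 \<union> B2) \<le> e" using measure_Un_le[OF h1(2) h2(2)] h1(3) h2(3) e by simp
    fix \<omega> assume \<omega>: "\<omega> \<in> space Q - (B1 \<union> B2)"
    then have \<omega>': "\<omega> \<in> space Q" "\<omega> \<in> space Q - B1" "\<omega> \<in> space Q - B2" by auto
    show "\<bar>J1 t \<omega> + J2 t \<omega> - (N1 t \<omega> + N2 t \<omega>)\<bar> \<le> e" if "t \<in> {0..T}" for t
      using h1(4)[OF \<omega>'(2) that] h2(4)[OF \<omega>'(3) that] e by linarith
    have "sqnorm (\<lambda>t \<omega>. h1 t \<omega> + h2 t \<omega> - (k1 t \<omega> + k2 t \<omega>)) T \<omega>
        \<le> 2 * sqnorm (\<lambda>t \<omega>. h1 t \<omega> - k1 t \<omega>) T \<omega> + 2 * sqnorm (\<lambda>t \<omega>. h2 t \<omega> - k2 t \<omega>) T \<omega>"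
    proof (rule sqnorm_add_le[OF strongly_measurable_norm[OF s1] strongly_measurable_norm[OF s2] \<omega>'(1)])
      fix t show "norm (h1 t \<omega> + h2 t \<omega> - (k1 t \<omega> + k2 t \<omega>)) \<le> norm (h1 t \<omega> - k1 t \<omega>) + norm (h2 t \<omega> - k2 t \<omega>)"
        using norm_triangle_ineq[of "h1 t \<omega> - k1 t \<omega>" "h2 t \<omega> - k2 t \<omega>"] by (simp add: algebra_simps)
    qed
    also have "\<dots> \<le> 2 * ennreal (e / 4) + 2 * ennreal (e / 4)"
      using h1(5)[OF \<omega>'(2)] h2(5)[OF \<omega>'(3)] by (intro add_mono mult_left_mono) auto
    also have "\<dots> = ennreal e" using e ennreal_double_add[of "e / 4" "e / 4"] by simp
    finally show "sqnorm (\<lambda>t \<omega>. h1 t \<omega> + h2 t \<omega> - (k1 t \<omega> + k2 t \<omega>)) T \<omega> \<le> ennreal e" .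
  qed
qed

lemma approximable_sum:
  "(\<And>i. i \<in> I \<Longrightarrow> approximable (k i) (N i)) \<Longrightarrow> approximable (\<lambda>t \<omega>. \<Sum>i\<in>I. k i t \<omega>) (\<lambda>t \<omega>. \<Sum>i\<in>I. N i t \<omega>)"
  by (induction I rule: infinite_finite_induct) (simp_all add: approximable_zero approximable_add)

lemma sqnorm_le_scale:
  assumes "(\<lambda>p. norm (k (fst p) (snd p))) \<in> borel_measurable (time_prod P)" "\<omega> \<in> space P"
    and "\<And>t. 0 \<le> t \<Longrightarrow> norm (l t \<omega>) \<le> c * norm (k t \<omega>)"
  shows "sqnorm l T \<omega> \<le> ennreal (c\<^sup>2) * sqnorm k T \<omega>"
proof -
  have "sqnorm l T \<omega> \<le> (\<integral>\<^sup>+t. ennreal (c\<^sup>2) * (ennreal ((norm (k t \<omega>))\<^sup>2) * indicator {0..T} t) \<partial>lborel)"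
    unfolding sqnorm_def
  proof (rule nn_integral_mono)
    fix t
    show "ennreal ((norm (l t \<omega>))\<^sup>2) * indicator {0..T} t \<le> ennreal (c\<^sup>2) * (ennreal ((norm (k t \<omega>))\<^sup>2) * indicator {0..T} t)"
    proof (cases "t \<in> {0..T}")
      case True
      then have "(norm (l t \<omega>))\<^sup>2 \<le> (c * norm (k t \<omega>))\<^sup>2" using assms(3) by (intro power_mono) auto
      then have "ennreal ((norm (l t \<omega>))\<^sup>2) \<le> ennreal (c\<^sup>2) * ennreal ((norm (k t \<omega>))\<^sup>2)"
        by (simp add: ennreal_mult[symmetric] power_mult_distrib ennreal_leI)
      then show ?thesis using True by simp
    qed simp
  qed
  also have "\<dots> = ennreal (c\<^sup>2) * sqnorm k T \<omega>"
    unfolding sqnorm_def using sqnorm_section_measurable[OF assms(1,2)] by (rule nn_integral_cmult)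
  finally show ?thesis .
qed

lemma approximable_scale:
  assumes 1: "approximable k N"
  shows "approximable (\<lambda>t \<omega>. c *\<^sub>R k t \<omega>) (\<lambda>t \<omega>. c * N t \<omega>)"
proof (rule approximableI)
  note m = approximable_strongly_measurable[OF 1]
  show "strongly_measurable (time_prod Q) (\<lambda>p. c *\<^sub>R k (fst p) (snd p))"
    by (rule strongly_measurable_scaleR[OF _ m]) simp
  fix T e :: real assume e: "0 < e"
  \<comment> \<open>One divisor that serves the probability (factor 1), the integral (factor
    \<open>\<bar>c\<bar>\<close>) and the squared norm (factor \<open>c^2\<close>).\<close>
  define e' where "e' = e / (1 + \<bar>c\<bar> + c\<^sup>2)"
  have pos: "0 < 1 + \<bar>c\<bar> + c\<^sup>2" by (simp add: add_pos_nonneg)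
  have e': "0 < e'" using e pos by (simp add: e'_def)
  have "e' * (1 + \<bar>c\<bar> + c\<^sup>2) = e" using pos by (simp add: e'_def)
  then have ee: "e' + \<bar>c\<bar> * e' + c\<^sup>2 * e' = e" by (simp add: algebra_simps)
  have nn: "0 \<le> \<bar>c\<bar> * e'" "0 \<le> c\<^sup>2 * e'" using e' by auto
  have b: "e' \<le> e" "\<bar>c\<bar> * e' \<le> e" "c\<^sup>2 * e' \<le> e" using ee nn e' by linarith+
  obtain h J B where h: "simp_int h J" "B \<in> sets Q" "measure Q B \<le> e'"
    "\<And>\<omega> t. \<omega> \<in> space Q - B \<Longrightarrow> t \<in> {0..T} \<Longrightarrow> \<bar>J t \<omega> - N t \<omega>\<bar> \<le> e'"
    "\<And>\<omega>. \<omega> \<in> space Q - B \<Longrightarrow> sqnorm (\<lambda>t \<omega>. h t \<omega> - k t \<omega>) T \<omega> \<le> ennreal e'"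
    using approximableE[OF 1 e', where T=T] by blast
  note s = strongly_measurable_diff[OF simp_int_strongly_measurable[OF h(1)] m]
  show "\<exists>h J B. simp_int h J \<and> B \<in> sets Q \<and> measure Q B \<le> e \<and>
      (\<forall>\<omega>\<in>space Q - B. (\<forall>t\<in>{0..T}. \<bar>J t \<omega> - c * N t \<omega>\<bar> \<le> e) \<and> sqnorm (\<lambda>t \<omega>. h t \<omega> - c *\<^sub>R k t \<omega>) T \<omega> \<le> ennreal e)"
  proof (intro exI conjI ballI)
    show "simp_int (\<lambda>t \<omega>. c *\<^sub>R h t \<omega>) (\<lambda>t \<omega>. c * J t \<omega>)" by (rule simp_int_scale[OF h(1)])
    show "B \<in> sets Q" "measure Q B \<le> e" using h b by auto
    fix \<omega> assume \<omega>: "\<omega> \<in> space Q - B"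
    show "\<bar>c * J t \<omega> - c * N t \<omega>\<bar> \<le> e" if "t \<in> {0..T}" for t
    proof -
      have "\<bar>c * J t \<omega> - c * N t \<omega>\<bar> = \<bar>c\<bar> * \<bar>J t \<omega> - N t \<omega>\<bar>" by (simp add: abs_mult[symmetric] algebra_simps)
      also have "\<dots> \<le> \<bar>c\<bar> * e'" using h(4)[OF \<omega> that] by (intro mult_left_mono) auto
      finally show ?thesis using b by simp
    qed
    have "sqnorm (\<lambda>t \<omega>. c *\<^sub>R h t \<omega> - c *\<^sub>R k t \<omega>) T \<omega> \<le> ennreal (\<bar>c\<bar>\<^sup>2) * sqnorm (\<lambda>t \<omega>. h t \<omega> - k t \<omega>) T \<omega>"
      using \<omega> by (intro sqnorm_le_scale[OF strongly_measurable_norm[OF s]]) (auto simp flip: scaleR_diff_right)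
    also have "\<dots> \<le> ennreal (\<bar>c\<bar>\<^sup>2) * ennreal e'" using h(5)[OF \<omega>] by (intro mult_left_mono) auto
    also have "\<dots> \<le> ennreal e" using b e' by (simp add: ennreal_mult[symmetric] ennreal_leI)
    finally show "sqnorm (\<lambda>t \<omega>. c *\<^sub>R h t \<omega> - c *\<^sub>R k t \<omega>) T \<omega> \<le> ennreal e" .
  qed
qed

text \<open>The same rectangle is applied to the approximants, which stay elementary. The squared
  norm does not increase, and each of the two values of \<open>N\<close> in the increment costs
  \<open>e / 2\<close>.\<close>

lemma approximable_restrict:
  assumes 1: "approximable k N" and ab: "0 \<le> a" "a \<le> b" "A \<in> sets (E a)"
  shows "approximable (\<lambda>t \<omega>. indicat_real ({a<..b} \<times> A) (t, \<omega>) *\<^sub>R k t \<omega>)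
     (\<lambda>t \<omega>. indicat_real A \<omega> * (N (min b t) \<omega> - N (min a t) \<omega>))"
proof (rule approximableI)
  note m = approximable_strongly_measurable[OF 1]
  have [measurable]: "A \<in> sets Q" using ab by (blast intro: sets_F_P)
  have "{a<..b} \<times> A \<in> sets (borel \<Otimes>\<^sub>M Q)" by simp
  then have "indicat_real ({a<..b} \<times> A) \<in> borel_measurable (borel \<Otimes>\<^sub>M Q)" by simp
  from measurable_time_prod_of_borel[OF this]
  show "strongly_measurable (time_prod Q) (\<lambda>p. indicat_real ({a<..b} \<times> A) (fst p, snd p) *\<^sub>R k (fst p) (snd p))"
    by (intro strongly_measurable_scaleR[OF _ m]) simp
  fix T e :: real assume e: "0 < e"
  then have e2: "0 < e / 2" by simp
  obtain h J B where h: "simp_int h J" "B \<in> sets Q" "measure Q B \<le> e / 2"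
    "\<And>\<omega> t. \<omega> \<in> space Q - B \<Longrightarrow> t \<in> {0..T} \<Longrightarrow> \<bar>J t \<omega> - N t \<omega>\<bar> \<le> e / 2"
    "\<And>\<omega>. \<omega> \<in> space Q - B \<Longrightarrow> sqnorm (\<lambda>t \<omega>. h t \<omega> - k t \<omega>) T \<omega> \<le> ennreal (e / 2)"
    using approximableE[OF 1 e2, where T=T] by blast
  note s = strongly_measurable_diff[OF simp_int_strongly_measurable[OF h(1)] m]
  show "\<exists>h J B. simp_int h J \<and> B \<in> sets Q \<and> measure Q B \<le> e \<and>
      (\<forall>\<omega>\<in>space Q - B. (\<forall>t\<in>{0..T}. \<bar>J t \<omega> - indicat_real A \<omega> * (N (min b t) \<omega> - N (min a t) \<omega>)\<bar> \<le> e) \<and>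
       sqnorm (\<lambda>t \<omega>. h t \<omega> - indicat_real ({a<..b} \<times> A) (t, \<omega>) *\<^sub>R k t \<omega>) T \<omega> \<le> ennreal e)"
  proof (intro exI conjI ballI)
    show "simp_int (\<lambda>t \<omega>. indicat_real ({a<..b} \<times> A) (t, \<omega>) *\<^sub>R h t \<omega>)
      (\<lambda>t \<omega>. indicat_real A \<omega> * (J (min b t) \<omega> - J (min a t) \<omega>))" by (rule simp_int_restrict[OF h(1) ab])
    show "B \<in> sets Q" "measure Q B \<le> e" using h e by auto
    fix \<omega> assume \<omega>: "\<omega> \<in> space Q - B"
    show "\<bar>indicat_real A \<omega> * (J (min b t) \<omega> - J (min a t) \<omega>) - indicat_real A \<omega> * (N (min b t) \<omega> - N (min a t) \<omega>)\<bar> \<le> e"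
      if "t \<in> {0..T}" for t
    proof -
      have "\<bar>J (min b t) \<omega> - N (min b t) \<omega>\<bar> \<le> e / 2" "\<bar>J (min a t) \<omega> - N (min a t) \<omega>\<bar> \<le> e / 2"
        using that ab h(4)[OF \<omega>, of "min b t"] h(4)[OF \<omega>, of "min a t"] by auto
      then have "\<bar>(J (min b t) \<omega> - J (min a t) \<omega>) - (N (min b t) \<omega> - N (min a t) \<omega>)\<bar> \<le> e" by linarith
      then show ?thesis using e by (auto simp: indicator_def)
    qed
    have "sqnorm (\<lambda>t \<omega>. indicat_real ({a<..b} \<times> A) (t, \<omega>) *\<^sub>R h t \<omega> - indicat_real ({a<..b} \<times> A) (t, \<omega>) *\<^sub>R k t \<omega>) T \<omega>
      \<le> ennreal (1\<^sup>2) * sqnorm (\<lambda>t \<omega>. h t \<omega> - k t \<omega>) T \<omega>"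
      using \<omega> by (intro sqnorm_le_scale[OF strongly_measurable_norm[OF s]]) (auto simp: indicator_def)
    also have "\<dots> \<le> ennreal (e / 2)" using h(5)[OF \<omega>] by simp
    also have "\<dots> \<le> ennreal e" using e by (simp add: ennreal_leI)
    finally show "sqnorm (\<lambda>t \<omega>. indicat_real ({a<..b} \<times> A) (t, \<omega>) *\<^sub>R h t \<omega> - indicat_real ({a<..b} \<times> A) (t, \<omega>) *\<^sub>R k t \<omega>) T \<omega> \<le> ennreal e" .
  qed
qed

lemma elementary_times:
  assumes d: "elementary_progressive F d" "n \<in> {1..el_N d}"
  shows "0 \<le> el_t d (n - 1)" "el_t d (n - 1) \<le> el_t d n"
proof -
  have less: "el_t d (n - 1) < el_t d n" if "n \<in> {1..el_N d}" for n
    using d(1) that unfolding elementary_progressive_def by blast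
  have "j < el_N d \<longrightarrow> 0 \<le> el_t d j" for j
  proof (induction j)
    case (Suc j)
    show ?case
    proof
      assume j: "Suc j < el_N d"
      then have "el_t d j < el_t d (Suc j)" using less[of "Suc j"] by simp
      with Suc j show "0 \<le> el_t d (Suc j)" by simp
    qed
  qed (use d(1) in \<open>simp add: elementary_progressive_def\<close>)
  from this[of "n - 1"] show "0 \<le> el_t d (n - 1)" using d(2) by force
  show "el_t d (n - 1) \<le> el_t d n" using less[OF d(2)] by simp
qed

text \<open>Passage from the record of an elementary process to a sum of single rectangles, one for
  each time interval, event and vector.\<close>

lemma simp_int_elementary:
  assumes d: "elementary_progressive E d"
  shows "simp_int (elementary_process d) (elementary_integral d W)"
proof -
  have "simp_int (\<lambda>t \<omega>. \<Sum>n=1..el_N d. \<Sum>m=1..el_L d. \<Sum>k=1..el_K d.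
      indicat_real ({el_t d (n - 1)<..el_t d n} \<times> el_B d m n) (t, \<omega>) *\<^sub>R (el_y d k m n *\<^sub>R el_x d k))
     (\<lambda>t \<omega>. \<Sum>n=1..el_N d. \<Sum>m=1..el_L d. \<Sum>k=1..el_K d.
      indicat_real (el_B d m n) \<omega> * ((W (el_x d k) (min (el_t d n) t) \<omega> - W (el_x d k) (min (el_t d (n - 1)) t) \<omega>) * el_y d k m n))"
    using elementary_times[OF d] d
    by (intro simp_int_sum simp_int_basic) (auto simp: elementary_progressive_def)
  then show ?thesis
    by (rule simp_int_cong) (simp_all add: elementary_process_def elementary_integral_def scaleR_sum_right sum_distrib_left)
qed

end

section \<open>Integrands on the original space\<close>

locale enlarged_brownian = P: usual_filtered_prob_space P F + cyl_brownian_banach Q E W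
  for P :: "'a measure" and F :: "real \<Rightarrow> 'a measure" and Q :: "'b measure" and E :: "real \<Rightarrow> 'b measure"
    and W :: "'h::{real_inner, banach} \<Rightarrow> real \<Rightarrow> 'b \<Rightarrow> real" +
  fixes \<pi> :: "'b \<Rightarrow> 'a"
  assumes proj: "enlargement P F Q E \<pi>"
begin

lemma proj_measurable [measurable]: "\<pi> \<in> measurable Q P"
  using proj by (simp add: enlargement_def)

lemma distr_proj: "distr Q P \<pi> = P"
  using proj by (simp add: enlargement_def)

lemma proj_measurable_filtration: "0 \<le> t \<Longrightarrow> \<pi> \<in> measurable (E t) (F t)"
  using proj by (simp add: enlargement_def)

lemma proj_space: "\<omega> \<in> space Q \<Longrightarrow> \<pi> \<omega> \<in> space P"
  using measurable_space[OF proj_measurable] .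

lemma measure_proj: "A \<in> sets P \<Longrightarrow> measure Q (\<pi> -` A \<inter> space Q) = measure P A"
  using measure_distr[OF proj_measurable, of A] by (simp add: distr_proj)

lemma AE_proj: "AE \<omega> in P. \<Phi> \<omega> \<Longrightarrow> AE \<omega> in Q. \<Phi> (\<pi> \<omega>)"
  using AE_distrD[OF proj_measurable, of \<Phi>, unfolded distr_proj] .

text \<open>Descent from the enlarged to the original space, which preserves the probability of
  measurable sets. Most of the later work proves measurability in order to use this
  direction.\<close>

lemma AE_proj_iff: "{\<omega>\<in>space P. \<Phi> \<omega>} \<in> sets P \<Longrightarrow> (AE \<omega> in P. \<Phi> \<omega>) \<longleftrightarrow> (AE \<omega> in Q. \<Phi> (\<pi> \<omega>))"
  using AE_distr_iff[OF proj_measurable, of \<Phi>, unfolded distr_proj] .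

abbreviation time_proj :: "real \<times> 'b \<Rightarrow> real \<times> 'a" where
  "time_proj q \<equiv> (fst q, \<pi> (snd q))"

lemma time_proj_measurable [measurable]: "time_proj \<in> measurable (time_prod Q) (time_prod P)"
  unfolding time_prod_def by measurable

lemma distr_time_proj: "distr (time_prod Q) (time_prod P) time_proj = time_prod P"
proof -
  have "distr time_measure time_measure (\<lambda>x. x) \<Otimes>\<^sub>M distr Q P \<pi>
     = distr (time_measure \<Otimes>\<^sub>M Q) (time_measure \<Otimes>\<^sub>M P) (\<lambda>(x, y). (x, \<pi> y))"
    by (rule pair_measure_distr) (auto simp: distr_proj P.sigma_finite_measure_axioms)
  moreover have "(\<lambda>(x, y). (x, \<pi> y)) = time_proj" by (auto simp: fun_eq_iff)
  ultimately show ?thesis unfolding time_prod_def by (simp only: distr_proj distr_id)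
qed

lemma AE_time_proj: "AE p in time_prod P. \<Phi> p \<Longrightarrow> AE q in time_prod Q. \<Phi> (time_proj q)"
  using AE_distrD[OF time_proj_measurable, of \<Phi>, unfolded distr_time_proj] .

lemma AE_time_proj_iff:
  "{p\<in>space (time_prod P). \<Phi> p} \<in> sets (time_prod P) \<Longrightarrow>
    (AE p in time_prod P. \<Phi> p) \<longleftrightarrow> (AE q in time_prod Q. \<Phi> (time_proj q))"
  using AE_distr_iff[OF time_proj_measurable, of \<Phi>, unfolded distr_time_proj] .

text \<open>
  A stochastic integrand that factors through the original space is essentially separably valued
  there, because it is a limit of elementary processes on the enlarged space.
\<close>

lemma integrand_strongly_measurable_version:
  assumes I: "has_stochastic_integral Q E W g N"
    and \<gamma> [measurable]: "\<gamma> \<in> borel_measurable (time_prod P)"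
    and ae: "AE (t, \<omega>) in time_prod Q. \<gamma> (t, \<pi> \<omega>) = g t \<omega>"
  obtains \<gamma>' where "strongly_measurable (time_prod P) \<gamma>'" "AE p in time_prod P. \<gamma>' p = \<gamma> p"
    "approximable (\<lambda>t \<omega>. \<gamma>' (t, \<pi> \<omega>)) N"
proof -
  obtain d where d: "\<And>n. elementary_progressive E (d n)"
    and dg: "\<And>T e. 0 \<le> T \<Longrightarrow> 0 < e \<Longrightarrow> (\<lambda>n. outer_measure_of Q
              {\<omega>\<in>space Q. e < (\<integral>\<^sup>+s\<in>{0..T}. ennreal ((norm (elementary_process (d n) s \<omega> - g s \<omega>))\<^sup>2) \<partial>lebesgue)}) \<longlonglongrightarrow> 0"
    and dN: "ucp_tendsto Q (\<lambda>n. elementary_integral (d n) W) N sequentially"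
    using I unfolding has_stochastic_integral_def by blast
  define h where "h n = elementary_process (d n)" for n
  have S: "simp_int (h n) (elementary_integral (d n) W)" for n
    unfolding h_def by (rule simp_int_elementary[OF d])
  \<comment> \<open>Completion does not change a nonnegative integral, so the Lebesgue integral in
    the hypothesis equals \<open>sqnorm\<close>.\<close>
  have dg': "(\<lambda>n. outer_measure_of Q {\<omega>\<in>space Q. ennreal e < sqnorm (\<lambda>t \<omega>. h n t \<omega> - g t \<omega>) T \<omega>}) \<longlonglongrightarrow> 0"
    if "0 \<le> T" "0 < e" for T e
    using dg[OF that(1), of "ennreal e"] that(2) unfolding sqnorm_def h_def nn_integral_completion by simp
  \<comment> \<open>All values of all approximating elementary processes: a countable set, each
    process having finite range.\<close>
  define D where "D = (\<Union>n. (\<lambda>p. h n (fst p) (snd p)) ` (UNIV \<times> space Q))"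
  have Dc: "countable D" unfolding D_def
  proof (intro countable_UN countableI_type countable_finite)
    fix n show "finite ((\<lambda>p. h n (fst p) (snd p)) ` (UNIV \<times> space Q))"
      using simp_int_simple[OF S, of n] by (simp add: simple_function_def space_pair_measure)
  qed
  obtain \<omega>0 where \<omega>0: "\<omega>0 \<in> space Q" using not_empty by blast
  have D0: "h n t \<omega> \<in> D" if "\<omega> \<in> space Q" for n t \<omega>
    unfolding D_def using that by force
  then have Dne: "D \<noteq> {}" using \<omega>0 by blast
  define c where "c = from_nat_into D"
  have cD: "range c = D" unfolding c_def by (rule range_from_nat_into[OF Dne Dc])
  have [measurable]: "(\<lambda>x. infdist (\<gamma> x) D) \<in> borel_measurable (time_prod P)"
    by (rule measurable_compose[OF \<gamma> borel_measurable_continuous_onI]) (intro continuous_intros)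
  \<comment> \<open>The distance to \<open>D\<close> is a continuous real function of
    \<open>\<gamma>\<close>, hence measurable, and it is bounded by the distance to any approximant.
    Convergence of the approximants forces it to vanish almost everywhere.\<close>
  define \<phi> where "\<phi> t \<omega> = infdist (\<gamma> (t, \<pi> \<omega>)) D" for t \<omega>
  have \<phi>m: "(\<lambda>q. \<phi> (fst q) (snd q)) \<in> borel_measurable (time_prod Q)"
    unfolding \<phi>_def by (rule measurable_compose[OF time_proj_measurable]) measurable
  have \<phi>0: "0 \<le> \<phi> t \<omega>" for t \<omega> by (simp add: \<phi>_def infdist_nonneg)
  have \<phi>nm: "(\<lambda>q. norm (\<phi> (fst q) (snd q))) \<in> borel_measurable (time_prod Q)" using \<phi>m by measurable
  have aeg: "AE \<omega> in Q. AE t in lborel. 0 \<le> t \<longrightarrow> \<gamma> (t, \<pi> \<omega>) = g t \<omega>"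
    using AE_time_prodD[OF prob_space_axioms ae] by simp
  have \<phi>le: "AE \<omega> in Q. \<forall>n T. sqnorm \<phi> T \<omega> \<le> sqnorm (\<lambda>t \<omega>. h n t \<omega> - g t \<omega>) T \<omega>"
    using aeg AE_space
  proof eventually_elim
    case (elim \<omega>)
    show ?case
    proof (intro allI)
      fix n T
      show "sqnorm \<phi> T \<omega> \<le> sqnorm (\<lambda>t \<omega>. h n t \<omega> - g t \<omega>) T \<omega>"
        unfolding sqnorm_def
      proof (rule nn_integral_mono_AE)
        show "AE t in lborel. ennreal ((norm (\<phi> t \<omega>))\<^sup>2) * indicator {0..T} t \<le> ennreal ((norm (h n t \<omega> - g t \<omega>))\<^sup>2) * indicator {0..T} t"
          using elim(1)
        proof eventually_elim
          case (elim t)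
          show ?case
          proof (cases "t \<in> {0..T}")
            case True
            then have "\<phi> t \<omega> \<le> norm (h n t \<omega> - g t \<omega>)"
              using elim infdist_le[OF D0[OF \<open>\<omega> \<in> space Q\<close>, of n t], of "g t \<omega>"] by (simp add: \<phi>_def dist_norm norm_minus_commute)
            then show ?thesis using True \<phi>0[of t \<omega>] by (auto intro!: ennreal_leI power_mono)
          qed simp
        qed
      qed
    qed
  qed
  have \<phi>T: "AE \<omega> in Q. sqnorm \<phi> T \<omega> = 0" if T: "0 \<le> T" for T
  proof -
    have [measurable]: "sqnorm \<phi> T \<in> borel_measurable Q" by (rule sqnorm_measurable[OF \<phi>nm])
    have "AE \<omega> in Q. sqnorm \<phi> T \<omega> \<le> ennreal e" if e: "0 < e" for e
    proof -
      have "measure Q {\<omega>\<in>space Q. ennreal e < sqnorm \<phi> T \<omega>} \<le> 0 + r" if r: "0 < r" for r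
      proof -
        have "\<forall>\<^sub>F n in sequentially. \<exists>B\<in>sets Q. {\<omega>\<in>space Q. ennreal e < sqnorm (\<lambda>t \<omega>. h n t \<omega> - g t \<omega>) T \<omega>} \<subseteq> B \<and> measure Q B \<le> r"
          by (rule outer_measure_tendsto_0D[OF dg'[OF T e]]) (use r in auto)
        from eventually_happens'[OF sequentially_bot this] obtain n B where
          B: "B \<in> sets Q" "{\<omega>\<in>space Q. ennreal e < sqnorm (\<lambda>t \<omega>. h n t \<omega> - g t \<omega>) T \<omega>} \<subseteq> B" "measure Q B \<le> r" by blast
        have "measure Q {\<omega>\<in>space Q. ennreal e < sqnorm \<phi> T \<omega>} \<le> measure Q B"
        proof (rule finite_measure_mono_AE[OF _ B(1)])
          show "AE x in Q. x \<in> {\<omega>\<in>space Q. ennreal e < sqnorm \<phi> T \<omega>} \<longrightarrow> x \<in> B"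
            using \<phi>le
          proof eventually_elim
            case (elim \<omega>)
            then have "sqnorm \<phi> T \<omega> \<le> sqnorm (\<lambda>t \<omega>. h n t \<omega> - g t \<omega>) T \<omega>" by blast
            then show ?case using B(2) by (auto intro: less_le_trans)
          qed
        qed
        then show ?thesis using B(3) by simp
      qed
      then have "measure Q {\<omega>\<in>space Q. ennreal e < sqnorm \<phi> T \<omega>} \<le> 0" by (rule field_le_epsilon)
      then have "measure Q {\<omega>\<in>space Q. ennreal e < sqnorm \<phi> T \<omega>} = 0" using measure_nonneg by (metis antisym)
      then have "AE \<omega> in Q. \<omega> \<notin> {\<omega>\<in>space Q. ennreal e < sqnorm \<phi> T \<omega>}"
        by (intro AE_not_in) (simp add: null_sets_def emeasure_eq_measure)
      then show ?thesis using AE_space by eventually_elim auto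
    qed
    then have "AE \<omega> in Q. \<forall>j. sqnorm \<phi> T \<omega> \<le> ennreal (1 / real (Suc j))" by (simp add: AE_all_countable)
    then show ?thesis
    proof eventually_elim
      case (elim \<omega>)
      have "(\<lambda>j. ennreal (1 / real (Suc j))) \<longlonglongrightarrow> ennreal 0"
        using LIMSEQ_inverse_real_of_nat by (intro tendsto_ennrealI) (simp add: inverse_eq_divide)
      then have "sqnorm \<phi> T \<omega> \<le> ennreal 0" by (rule LIMSEQ_le_const) (use elim in blast)
      then show ?case by simp
    qed
  qed
  have \<phi>z: "AE \<omega> in Q. AE t in lborel. 0 \<le> t \<longrightarrow> \<phi> t \<omega> = 0"
  proof -
    have "AE \<omega> in Q. \<forall>n::nat. sqnorm \<phi> (real n) \<omega> = 0" using \<phi>T by (simp add: AE_all_countable)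
    then show ?thesis using AE_space
    proof eventually_elim
      case (elim \<omega>)
      have "AE t in lborel. ennreal ((norm (\<phi> t \<omega>))\<^sup>2) * indicator {0..real n} t = 0" for n :: nat
        using elim(1)[rule_format, of n] sqnorm_section_measurable[OF \<phi>nm elim(2), of "real n"]
        unfolding sqnorm_def by (subst (asm) nn_integral_0_iff_AE) auto
      then have "AE t in lborel. \<forall>n::nat. ennreal ((norm (\<phi> t \<omega>))\<^sup>2) * indicator {0..real n} t = 0"
        unfolding AE_all_countable by blast
      then show ?case
      proof eventually_elim
        case (elim t)
        show ?case
        proof
          assume "0 \<le> t"
          obtain n :: nat where "t \<le> real n" using real_arch_simple by blast
          then show "\<phi> t \<omega> = 0" using elim[rule_format, of n] \<open>0 \<le> t\<close> by (simp add: indicator_def)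
        qed
      qed
    qed
  qed
  have zP: "AE p in time_prod P. infdist (\<gamma> p) D = 0"
  proof (subst AE_time_proj_iff)
    show "{p \<in> space (time_prod P). infdist (\<gamma> p) D = 0} \<in> sets (time_prod P)" by measurable
    have "AE q in time_prod Q. \<phi> (fst q) (snd q) = 0"
    proof (rule AE_time_prodI[OF prob_space_axioms])
      show "{p \<in> space (time_prod Q). \<phi> (fst p) (snd p) = 0} \<in> sets (time_prod Q)" using \<phi>m by measurable
    qed (use \<phi>z in simp)
    then show "AE q in time_prod Q. infdist (\<gamma> (time_proj q)) D = 0" by (simp add: \<phi>_def)
  qed
  \<comment> \<open>Values outside the closure of \<open>D\<close> are replaced by an element of
    \<open>D\<close>; this alters \<open>\<gamma>\<close> only on a null set.\<close>
  define \<gamma>' where "\<gamma>' p = (if infdist (\<gamma> p) D = 0 then \<gamma> p else c 0)" for p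
  have \<gamma>m: "strongly_measurable (time_prod P) \<gamma>'"
  proof (rule strongly_measurable_countable_closure[where d=c])
    show "\<gamma>' \<in> borel_measurable (time_prod P)" unfolding \<gamma>'_def by measurable
    show "\<gamma>' x \<in> closure (range c)" for x
      unfolding cD \<gamma>'_def in_closure_iff_infdist_zero[OF Dne] using cD by auto
  qed
  have \<gamma>ae: "AE p in time_prod P. \<gamma>' p = \<gamma> p"
    using zP by eventually_elim (simp add: \<gamma>'_def)
  have g': "AE \<omega> in Q. AE t in lborel. 0 \<le> t \<longrightarrow> \<gamma>' (t, \<pi> \<omega>) = g t \<omega>"
  proof -
    have "AE q in time_prod Q. \<gamma>' (fst q, \<pi> (snd q)) = g (fst q) (snd q)"
      using AE_time_proj[OF \<gamma>ae] ae by eventually_elim auto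
    from AE_time_prodD[OF prob_space_axioms this] show ?thesis by simp
  qed
  have "approximable (\<lambda>t \<omega>. \<gamma>' (t, \<pi> \<omega>)) N"
  proof (rule approximableI)
    show "strongly_measurable (time_prod Q) (\<lambda>p. \<gamma>' (fst p, \<pi> (snd p)))"
      by (rule strongly_measurable_compose[OF time_proj_measurable \<gamma>m])
    fix T e :: real assume e: "0 < e"
    then have e2: "0 < e / 2" by simp
    have "\<forall>\<^sub>F n in sequentially. \<exists>B\<in>sets Q. {\<omega>\<in>space Q. ennreal (e / 2) < sqnorm (\<lambda>t \<omega>. h n t \<omega> - g t \<omega>) (max 0 T) \<omega>} \<subseteq> B \<and> measure Q B \<le> e / 2"
      by (rule outer_measure_tendsto_0D[OF dg'[OF _ e2]]) (use e in auto)
    moreover have "\<forall>\<^sub>F n in sequentially. \<exists>B\<in>sets Q. measure Q B \<le> e / 2 \<and>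
      (\<forall>\<omega>\<in>space Q - B. \<forall>t\<in>{0..T}. \<bar>elementary_integral (d n) W t \<omega> - N t \<omega>\<bar> \<le> e / 2)"
      by (rule ucp_tendstoD[OF dN e2])
    ultimately have "\<forall>\<^sub>F n in sequentially. (\<exists>B\<in>sets Q. {\<omega>\<in>space Q. ennreal (e / 2) < sqnorm (\<lambda>t \<omega>. h n t \<omega> - g t \<omega>) (max 0 T) \<omega>} \<subseteq> B \<and> measure Q B \<le> e / 2)
      \<and> (\<exists>B\<in>sets Q. measure Q B \<le> e / 2 \<and> (\<forall>\<omega>\<in>space Q - B. \<forall>t\<in>{0..T}. \<bar>elementary_integral (d n) W t \<omega> - N t \<omega>\<bar> \<le> e / 2))"
      by eventually_elim blast
    from eventually_happens'[OF sequentially_bot this] obtain n B1 B2 where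
      B1: "B1 \<in> sets Q" "{\<omega>\<in>space Q. ennreal (e / 2) < sqnorm (\<lambda>t \<omega>. h n t \<omega> - g t \<omega>) (max 0 T) \<omega>} \<subseteq> B1" "measure Q B1 \<le> e / 2"
      and B2: "B2 \<in> sets Q" "measure Q B2 \<le> e / 2" "\<forall>\<omega>\<in>space Q - B2. \<forall>t\<in>{0..T}. \<bar>elementary_integral (d n) W t \<omega> - N t \<omega>\<bar> \<le> e / 2"
      by blast
    \<comment> \<open>\<open>Q\<close> is not assumed complete, so the paths on which
      \<open>\<gamma>'\<close> and \<open>g\<close> disagree are put into a measurable null
      set.\<close>
    obtain B0 where B0: "B0 \<in> null_sets Q" "{\<omega>\<in>space Q. \<not> (AE t in lborel. 0 \<le> t \<longrightarrow> \<gamma>' (t, \<pi> \<omega>) = g t \<omega>)} \<subseteq> B0"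
      using g' by (auto elim!: AE_E simp: null_sets_def)
    show "\<exists>h J B. simp_int h J \<and> B \<in> sets Q \<and> measure Q B \<le> e \<and>
      (\<forall>\<omega>\<in>space Q - B. (\<forall>t\<in>{0..T}. \<bar>J t \<omega> - N t \<omega>\<bar> \<le> e) \<and> sqnorm (\<lambda>t \<omega>. h t \<omega> - \<gamma>' (t, \<pi> \<omega>)) T \<omega> \<le> ennreal e)"
    proof (intro exI conjI ballI)
      show "simp_int (h n) (elementary_integral (d n) W)" by (rule S)
      show "(B1 \<union> B2) \<union> B0 \<in> sets Q" using B0 B1 B2 by auto
      have "measure Q ((B1 \<union> B2) \<union> B0) \<le> measure Q (B1 \<union> B2) + measure Q B0"
        using B0 B1 B2 by (intro measure_Un_le) auto
      also have "measure Q B0 = 0" using B0(1) by (simp add: measure_def null_sets_def)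
      also have "measure Q (B1 \<union> B2) \<le> e" using measure_Un_le[OF B1(1) B2(1)] B1(3) B2(2) by simp
      finally show "measure Q ((B1 \<union> B2) \<union> B0) \<le> e" by simp
      fix \<omega> assume \<omega>: "\<omega> \<in> space Q - ((B1 \<union> B2) \<union> B0)"
      show "\<bar>elementary_integral (d n) W t \<omega> - N t \<omega>\<bar> \<le> e" if "t \<in> {0..T}" for t
      proof -
        have "\<bar>elementary_integral (d n) W t \<omega> - N t \<omega>\<bar> \<le> e / 2" using B2(3) \<omega> that by auto
        then show ?thesis using e by linarith
      qed
      have ae\<omega>: "AE t in lborel. 0 \<le> t \<longrightarrow> \<gamma>' (t, \<pi> \<omega>) = g t \<omega>" using B0(2) \<omega> by blast
      have "sqnorm (\<lambda>t \<omega>. h n t \<omega> - \<gamma>' (t, \<pi> \<omega>)) T \<omega> = sqnorm (\<lambda>t \<omega>. h n t \<omega> - g t \<omega>) T \<omega>"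
        by (rule sqnorm_cong_AE) (use ae\<omega> in \<open>eventually_elim, simp\<close>)
      also have "\<dots> \<le> sqnorm (\<lambda>t \<omega>. h n t \<omega> - g t \<omega>) (max 0 T) \<omega>" by (rule sqnorm_mono) simp
      also have "\<dots> \<le> ennreal (e / 2)" using B1(2) \<omega> by (auto simp: not_less[symmetric])
      also have "\<dots> \<le> ennreal e" using e by (intro ennreal_leI) simp
      finally show "sqnorm (\<lambda>t \<omega>. h n t \<omega> - \<gamma>' (t, \<pi> \<omega>)) T \<omega> \<le> ennreal e" .
    qed
  qed
  with \<gamma>m \<gamma>ae show ?thesis by (rule that)
qed

section \<open>Adjoint images of elementary processes\<close>

text \<open>With \<open>\<gamma> x\<close> a version of the process \<open>G^* x\<close>, this is
  \<open>G^*\<close> applied to the elementary process. The explicit combination is measurable by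
  construction, whereas adjoint values are available only almost everywhere.\<close>

definition elementary_image :: "('a, 'e) elementary \<Rightarrow> ('e \<Rightarrow> real \<times> 'a \<Rightarrow> 'h) \<Rightarrow> real \<times> 'a \<Rightarrow> 'h" where
  "elementary_image d \<gamma> p = (\<Sum>n=1..el_N d. \<Sum>m=1..el_L d.
     indicat_real ({el_t d (n - 1)<..el_t d n} \<times> el_B d m n) p *\<^sub>R (\<Sum>k=1..el_K d. el_y d k m n *\<^sub>R \<gamma> (el_x d k) p))"

lemma elementary_image_adjoint:
  assumes "\<And>k. k \<in> {1..el_K d} \<Longrightarrow> (el_x d k, \<gamma> (el_x d k) (t, \<omega>)) \<in> adjoint_graph A"
  shows "(elementary_process d t \<omega>, elementary_image d \<gamma> (t, \<omega>)) \<in> adjoint_graph A"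
  unfolding elementary_process_def elementary_image_def
  by (intro adjoint_graph_sum adjoint_graph_scaleR assms)

lemma elementary_image_strongly_measurable:
  assumes d: "elementary_progressive F d" and \<gamma>: "\<And>x. strongly_measurable (time_prod P) (\<gamma> x)"
  shows "strongly_measurable (time_prod P) (elementary_image d \<gamma>)"
proof -
  have B: "el_B d m n \<in> sets P" if "n \<in> {1..el_N d}" "m \<in> {1..el_L d}" for m n
    using d that P.sets_F_P unfolding elementary_progressive_def by blast
  have i: "indicat_real ({el_t d (n - 1)<..el_t d n} \<times> el_B d m n) \<in> borel_measurable (time_prod P)"
    if "n \<in> {1..el_N d}" "m \<in> {1..el_L d}" for m n
    using B[OF that] by (intro measurable_time_prod_of_borel) simp
  show ?thesis unfolding elementary_image_def[abs_def]
    by (intro strongly_measurable_sum strongly_measurable_scaleR i \<gamma>) auto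
qed

text \<open>The events of the elementary process are pulled back along \<open>\<pi>\<close> and are
  then known in \<open>E\<close> at the same times. Linearity and restriction to rectangles do the
  rest.\<close>

lemma elementary_image_approximable:
  assumes d: "elementary_progressive F d"
    and a: "\<And>x. approximable (\<lambda>t \<omega>. \<gamma> x (t, \<pi> \<omega>)) (\<lambda>t \<omega>. M x t (\<pi> \<omega>))"
  shows "approximable (\<lambda>t \<omega>. elementary_image d \<gamma> (t, \<pi> \<omega>)) (\<lambda>t \<omega>. elementary_integral d M t (\<pi> \<omega>))"
proof -
  define B where "B m n = \<pi> -` el_B d m n \<inter> space Q" for m n
  have B: "B m n \<in> sets (E (el_t d (n - 1)))" if "n \<in> {1..el_N d}" "m \<in> {1..el_L d}" for m n
  proof -
    have "el_B d m n \<in> sets (F (el_t d (n - 1)))" using d that by (auto simp: elementary_progressive_def)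
    from measurable_sets[OF proj_measurable_filtration[OF elementary_times(1)[OF d that(1)]] this]
    show ?thesis by (simp add: B_def space_F)
  qed
  have "approximable (\<lambda>t \<omega>. \<Sum>n=1..el_N d. \<Sum>m=1..el_L d.
       indicat_real ({el_t d (n - 1)<..el_t d n} \<times> B m n) (t, \<omega>) *\<^sub>R (\<Sum>k=1..el_K d. el_y d k m n *\<^sub>R \<gamma> (el_x d k) (t, \<pi> \<omega>)))
    (\<lambda>t \<omega>. \<Sum>n=1..el_N d. \<Sum>m=1..el_L d. indicat_real (B m n) \<omega> *
       ((\<Sum>k=1..el_K d. el_y d k m n * M (el_x d k) (min (el_t d n) t) (\<pi> \<omega>)) - (\<Sum>k=1..el_K d. el_y d k m n * M (el_x d k) (min (el_t d (n - 1)) t) (\<pi> \<omega>))))"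
    by (intro approximable_sum approximable_restrict[where N="\<lambda>t \<omega>. \<Sum>k=1..el_K d. el_y d k _ _ * M (el_x d k) t (\<pi> \<omega>)"]
        approximable_scale a B elementary_times[OF d])
  then show ?thesis
  proof (rule approximable_cong)
    fix t \<omega> assume \<omega>: "\<omega> \<in> space Q"
    have i: "indicat_real (el_B d m n) (\<pi> \<omega>) = indicat_real (B m n) \<omega>" for m n
      using \<omega> by (simp add: B_def indicator_def)
    have i2: "indicat_real ({el_t d (n - 1)<..el_t d n} \<times> el_B d m n) (t, \<pi> \<omega>) = indicat_real ({el_t d (n - 1)<..el_t d n} \<times> B m n) (t, \<omega>)" for m n
      by (simp add: indicator_times i)
    show "elementary_image d \<gamma> (t, \<pi> \<omega>) = (\<Sum>n=1..el_N d. \<Sum>m=1..el_L d.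
       indicat_real ({el_t d (n - 1)<..el_t d n} \<times> B m n) (t, \<omega>) *\<^sub>R (\<Sum>k=1..el_K d. el_y d k m n *\<^sub>R \<gamma> (el_x d k) (t, \<pi> \<omega>)))"
      unfolding elementary_image_def i2 ..
    show "elementary_integral d M t (\<pi> \<omega>) = (\<Sum>n=1..el_N d. \<Sum>m=1..el_L d. indicat_real (B m n) \<omega> *
       ((\<Sum>k=1..el_K d. el_y d k m n * M (el_x d k) (min (el_t d n) t) (\<pi> \<omega>)) - (\<Sum>k=1..el_K d. el_y d k m n * M (el_x d k) (min (el_t d (n - 1)) t) (\<pi> \<omega>))))"
      unfolding elementary_integral_def i
      by (simp add: sum_subtractf[symmetric] left_diff_distrib mult.commute[of _ "el_y _ _ _ _"] right_diff_distrib)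
  qed
qed

end

lemma (in complete_measure) borel_measurable_cong_AE:
  assumes f: "f \<in> borel_measurable M" and ae: "AE x in M. f x = g x"
  shows "g \<in> borel_measurable M"
proof (rule measurableI)
  fix S :: "'b set" assume S: "S \<in> sets borel"
  show "g -` S \<inter> space M \<in> sets M"
  proof (rule in_sets_AE)
    show "AE x in M. x \<in> f -` S \<inter> space M \<longleftrightarrow> x \<in> g -` S \<inter> space M"
      using ae by eventually_elim auto
    show "f -` S \<inter> space M \<in> sets M" by (rule measurable_sets[OF f S])
  qed auto
qed simp

text \<open>Completeness makes every subset of a null set measurable, and null sets belong to
  \<open>F 0\<close>. A change on a null set therefore respects each \<open>F t\<close>.\<close>

lemma (in usual_filtered_prob_space) borel_measurable_F_cong_AE:
  assumes t: "0 \<le> t" and f: "f \<in> borel_measurable (F t)" and ae: "AE x in P. f x = g x"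
  shows "g \<in> borel_measurable (F t)"
proof (rule measurableI)
  fix S :: "'b set" assume S: "S \<in> sets borel"
  obtain N where N: "N \<in> null_sets P" "{x\<in>space P. f x \<noteq> g x} \<subseteq> N"
    using ae by (auto elim!: AE_E simp: null_sets_def)
  have nF: "A \<in> sets (F t)" if "A \<in> null_sets P" for A
    using that null_sets_F sets_F_mono[OF t] by blast
  have "(g -` S \<inter> space P) \<inter> N \<in> null_sets P"
    by (rule complete2[OF _ N(1)]) auto
  moreover have "g -` S \<inter> space P = ((f -` S \<inter> space P) - N) \<union> ((g -` S \<inter> space P) \<inter> N)"
    using N(2) by auto
  moreover have "f -` S \<inter> space P \<in> sets (F t)" using measurable_sets[OF f S] by (simp add: space_F)
  ultimately have "g -` S \<inter> space P \<in> sets (F t)"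
    using nF[OF N(1)] nF by (metis sets.Diff sets.Un)
  then show "g -` S \<inter> space (F t) \<in> sets (F t)" by (simp add: space_F)
qed simp

text \<open>The sum of the functions has finite integral, so it is finite almost everywhere and its
  terms tend to 0. Finitely many exceptions in the bound are removed by a shift.\<close>

lemma AE_tendsto_0_of_summable_integrals:
  fixes f :: "nat \<Rightarrow> 'a \<Rightarrow> ennreal"
  assumes [measurable]: "\<And>n. f n \<in> borel_measurable M"
    and ev: "\<forall>\<^sub>F n in sequentially. (\<integral>\<^sup>+x. f n x \<partial>M) \<le> ennreal (c n)" and c: "summable c" "\<And>n. 0 \<le> c n"
  shows "AE x in M. (\<lambda>n. f n x) \<longlonglongrightarrow> 0"
proof -
  obtain n0 where n0: "\<And>n. n \<ge> n0 \<Longrightarrow> (\<integral>\<^sup>+x. f n x \<partial>M) \<le> ennreal (c n)" using ev by (auto simp: eventually_sequentially)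
  have "(\<integral>\<^sup>+x. (\<Sum>n. f (n + n0) x) \<partial>M) = (\<Sum>n. \<integral>\<^sup>+x. f (n + n0) x \<partial>M)"
    by (rule nn_integral_suminf) simp
  also have "\<dots> \<le> (\<Sum>n. ennreal (c (n + n0)))"
    using n0 by (intro suminf_le) auto
  also have "\<dots> = ennreal (\<Sum>n. c (n + n0))"
    using c by (intro suminf_ennreal2) (auto simp: summable_iff_shift)
  also have "\<dots> < \<infinity>" by simp
  finally have "AE x in M. (\<Sum>n. f (n + n0) x) \<noteq> \<infinity>"
    by (intro nn_integral_PInf_AE) auto
  then show ?thesis
  proof eventually_elim
    case (elim x)
    have fin: "f (n + n0) x < top" for n
    proof -
      have "(\<Sum>i\<in>{n}. f (i + n0) x) \<le> (\<Sum>n. f (n + n0) x)" by (rule sum_le_suminf) auto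
      then show ?thesis using elim by (auto simp: less_top intro: le_less_trans)
    qed
    define g where "g n = enn2real (f (n + n0) x)" for n
    have g: "f (n + n0) x = ennreal (g n)" for n using fin[of n] by (simp add: g_def)
    have "(\<Sum>n. ennreal (g n)) \<noteq> top" using elim unfolding g by simp
    then have "summable g" by (rule summable_suminf_not_top[rotated]) (simp add: g_def)
    then have "g \<longlonglongrightarrow> 0" by (rule summable_LIMSEQ_zero)
    then have "(\<lambda>n. ennreal (g n)) \<longlonglongrightarrow> ennreal 0" by (rule tendsto_ennrealI)
    then have "(\<lambda>n. f (n + n0) x) \<longlonglongrightarrow> 0" unfolding g by simp
    then show ?case by (rule LIMSEQ_offset)
  qed
qed

locale convergent_integrals = enlarged_brownian P F Q E W \<pi>
  for P :: "'a measure" and F :: "real \<Rightarrow> 'a measure" and Q :: "'b measure" and E :: "real \<Rightarrow> 'b measure"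
    and W :: "'h::{real_inner, banach} \<Rightarrow> real \<Rightarrow> 'b \<Rightarrow> real" and \<pi> :: "'b \<Rightarrow> 'a" +
  fixes \<Gamma> :: "nat \<Rightarrow> real \<times> 'a \<Rightarrow> 'h" and X :: "nat \<Rightarrow> real \<Rightarrow> 'a \<Rightarrow> real" and N :: "real \<Rightarrow> 'a \<Rightarrow> real"
  assumes \<Gamma>m: "\<And>n. strongly_measurable (time_prod P) (\<Gamma> n)"
    and approx: "\<And>n. approximable (\<lambda>t \<omega>. \<Gamma> n (t, \<pi> \<omega>)) (\<lambda>t \<omega>. X n t (\<pi> \<omega>))"
    and N_martingale: "cont_local_martingale P F N"
    and ucp: "ucp_tendsto P X N sequentially"
begin

lemma selection:
  "\<exists>i h J B. n \<le> i \<and> simp_int h J \<and> B \<in> sets Q \<and> measure Q B \<le> (1 / 2) ^ n \<and>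
    (\<forall>\<omega>\<in>space Q - B. (\<forall>t\<in>{0..real n}. \<bar>J t \<omega> - N t (\<pi> \<omega>)\<bar> \<le> (1 / 16) ^ n) \<and>
      sqnorm (\<lambda>t \<omega>. h t \<omega> - \<Gamma> i (t, \<pi> \<omega>)) (real n) \<omega> \<le> ennreal ((1 / 16) ^ n))"
proof -
  \<comment> \<open>Half of the tolerance is spent between \<open>X i\<close> and \<open>N\<close>,
    on the original space, the other half between \<open>J\<close> and \<open>X i\<close>, on the
    enlarged one.\<close>
  define e where "e = (1 / 16 :: real) ^ n / 2"
  have e: "0 < e" by (simp add: e_def)
  have ee: "e + e = (1 / 16) ^ n" by (simp add: e_def)
  have "\<forall>\<^sub>F i in sequentially. \<exists>B\<in>sets P. measure P B \<le> e \<and>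
    (\<forall>\<omega>\<in>space P - B. \<forall>t\<in>{0..real n}. \<bar>X i t \<omega> - N t \<omega>\<bar> \<le> e)"
    by (rule P.ucp_tendstoD[OF ucp e])
  moreover have "\<forall>\<^sub>F i in sequentially. n \<le> i" by (rule eventually_ge_at_top)
  ultimately have "\<forall>\<^sub>F i in sequentially. n \<le> i \<and> (\<exists>B\<in>sets P. measure P B \<le> e \<and>
    (\<forall>\<omega>\<in>space P - B. \<forall>t\<in>{0..real n}. \<bar>X i t \<omega> - N t \<omega>\<bar> \<le> e))" by eventually_elim simp
  from eventually_happens'[OF sequentially_bot this] obtain i B1 where
    i: "n \<le> i" and B1: "B1 \<in> sets P" "measure P B1 \<le> e"
      "\<And>\<omega> t. \<omega> \<in> space P - B1 \<Longrightarrow> t \<in> {0..real n} \<Longrightarrow> \<bar>X i t \<omega> - N t \<omega>\<bar> \<le> e" by blast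
  obtain h J B2 where h: "simp_int h J" and B2: "B2 \<in> sets Q" "measure Q B2 \<le> e"
    "\<And>\<omega> t. \<omega> \<in> space Q - B2 \<Longrightarrow> t \<in> {0..real n} \<Longrightarrow> \<bar>J t \<omega> - X i t (\<pi> \<omega>)\<bar> \<le> e"
    "\<And>\<omega>. \<omega> \<in> space Q - B2 \<Longrightarrow> sqnorm (\<lambda>t \<omega>. h t \<omega> - \<Gamma> i (t, \<pi> \<omega>)) (real n) \<omega> \<le> ennreal e"
    using approximableE[OF approx e, where T="real n"] by blast
  define B1' where "B1' = \<pi> -` B1 \<inter> space Q"
  have B1': "B1' \<in> sets Q" "measure Q B1' \<le> e"
    using B1 measure_proj[OF B1(1)] measurable_sets[OF proj_measurable B1(1)] by (auto simp: B1'_def)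
  show ?thesis
  proof (intro exI conjI ballI)
    show "n \<le> i" "simp_int h J" by fact+
    show "B1' \<union> B2 \<in> sets Q" using B1' B2 by auto
    have "measure Q (B1' \<union> B2) \<le> (1 / 16) ^ n"
      using measure_Un_le[OF B1'(1) B2(1)] B1'(2) B2(2) ee by linarith
    also have "(1 / 16 :: real) ^ n \<le> (1 / 2) ^ n" by (intro power_mono) auto
    finally show "measure Q (B1' \<union> B2) \<le> (1 / 2) ^ n" .
    fix \<omega> assume \<omega>: "\<omega> \<in> space Q - (B1' \<union> B2)"
    then have \<omega>': "\<omega> \<in> space Q - B2" "\<pi> \<omega> \<in> space P - B1" using proj_space by (auto simp: B1'_def)
    show "\<bar>J t \<omega> - N t (\<pi> \<omega>)\<bar> \<le> (1 / 16) ^ n" if "t \<in> {0..real n}" for t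
      using B2(3)[OF \<omega>'(1) that] B1(3)[OF \<omega>'(2) that] ee by linarith
    have "ennreal e \<le> ennreal ((1 / 16) ^ n)" using ee e by (intro ennreal_leI) linarith
    with B2(4)[OF \<omega>'(1)] show "sqnorm (\<lambda>t \<omega>. h t \<omega> - \<Gamma> i (t, \<pi> \<omega>)) (real n) \<omega> \<le> ennreal ((1 / 16) ^ n)"
      by (rule order_trans)
  qed
qed

end

text \<open>\<open>r\<close> picks the members of the given sequence that the elementary pairs
  approximate. It need not be monotone: \<open>n \<le> r n\<close> already forces it to
  infinity.\<close>

locale selected_integrals = convergent_integrals P F Q E W \<pi> \<Gamma> X N
    + approximated_integral Q E W h J "\<lambda>t \<omega>. N t (\<pi> \<omega>)" B
  for P :: "'a measure" and F :: "real \<Rightarrow> 'a measure" and Q :: "'b measure" and E :: "real \<Rightarrow> 'b measure"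
    and W :: "'h::{real_inner, banach} \<Rightarrow> real \<Rightarrow> 'b \<Rightarrow> real" and \<pi> :: "'b \<Rightarrow> 'a"
    and \<Gamma> :: "nat \<Rightarrow> real \<times> 'a \<Rightarrow> 'h" and X :: "nat \<Rightarrow> real \<Rightarrow> 'a \<Rightarrow> real" and N :: "real \<Rightarrow> 'a \<Rightarrow> real"
    and h :: "nat \<Rightarrow> real \<Rightarrow> 'b \<Rightarrow> 'h" and J :: "nat \<Rightarrow> real \<Rightarrow> 'b \<Rightarrow> real" and B :: "nat \<Rightarrow> 'b set" +
  fixes r :: "nat \<Rightarrow> nat"
  assumes r: "\<And>n. n \<le> r n"
    and h\<Gamma>: "\<And>n \<omega>. \<omega> \<in> space Q - B n \<Longrightarrow>
      sqnorm (\<lambda>t \<omega>. h n t \<omega> - \<Gamma> (r n) (t, \<pi> \<omega>)) (real n) \<omega> \<le> ennreal ((1 / 16) ^ n)"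

lemma (in convergent_integrals) selected_integrals_exist:
  "\<exists>h J B r. selected_integrals P F Q E W \<pi> \<Gamma> X N h J B r"
proof -
  have "\<forall>n. \<exists>z. case z of (i, h, J, B) \<Rightarrow> n \<le> i \<and> simp_int h J \<and> B \<in> sets Q \<and> measure Q B \<le> (1 / 2) ^ n \<and>
    (\<forall>\<omega>\<in>space Q - B. (\<forall>t\<in>{0..real n}. \<bar>J t \<omega> - N t (\<pi> \<omega>)\<bar> \<le> (1 / 16) ^ n) \<and>
      sqnorm (\<lambda>t \<omega>. h t \<omega> - \<Gamma> i (t, \<pi> \<omega>)) (real n) \<omega> \<le> ennreal ((1 / 16) ^ n))"
    using selection by simp
  from choice[OF this] obtain z where z: "\<And>n. case z n of (i, h, J, B) \<Rightarrow> n \<le> i \<and> simp_int h J \<and> B \<in> sets Q \<and> measure Q B \<le> (1 / 2) ^ n \<and>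
    (\<forall>\<omega>\<in>space Q - B. (\<forall>t\<in>{0..real n}. \<bar>J t \<omega> - N t (\<pi> \<omega>)\<bar> \<le> (1 / 16) ^ n) \<and>
      sqnorm (\<lambda>t \<omega>. h t \<omega> - \<Gamma> i (t, \<pi> \<omega>)) (real n) \<omega> \<le> ennreal ((1 / 16) ^ n))" by blast
  define r where "r n = fst (z n)" for n :: nat
  define h where "h n = fst (snd (z n))" for n :: nat
  define J where "J n = fst (snd (snd (z n)))" for n :: nat
  define B where "B n = snd (snd (snd (z n)))" for n :: nat
  note [simp] = r_def h_def J_def B_def
  have "selected_integrals P F Q E W \<pi> \<Gamma> X N h J B r"
  proof (unfold_locales, goal_cases)
    case (1 n) show ?case using z[of n] by (simp add: case_prod_beta)
  next
    case (2 n) show ?case using z[of n] by (simp add: case_prod_beta)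
  next
    case (3 n) show ?case using z[of n] by (simp add: case_prod_beta)
  next
    case (4 n \<omega> t) then show ?case using z[of n] by (simp add: case_prod_beta)
  next
    case (5 n) show ?case using z[of n] by (simp add: case_prod_beta)
  next
    case (6 n \<omega>) then show ?case using z[of n] by (simp add: case_prod_beta)
  qed
  then show ?thesis by blast
qed

section \<open>Descent of the limit integrand to the original space\<close>

context selected_integrals begin

abbreviation u :: "real \<Rightarrow> 'b \<Rightarrow> 'h" where "u \<equiv> limit_process h"

definition \<Gamma>\<^sub>0 :: "real \<Rightarrow> 'a \<Rightarrow> 'h" where
  "\<Gamma>\<^sub>0 t \<omega> = (if Cauchy (\<lambda>n. \<Gamma> (r n) (t, \<omega>)) then lim (\<lambda>n. \<Gamma> (r n) (t, \<omega>)) else 0)"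

lemma u_strongly_measurable: "strongly_measurable (time_prod Q) (\<lambda>p. u (fst p) (snd p))"
  by (rule limit_process_strongly_measurable[OF S])

text \<open>For almost every path the squared distances of \<open>h n\<close> and
  \<open>\<Gamma> (r n)\<close> have summable integrals over each compact time interval, so the
  distances vanish for almost every time, and \<open>h n\<close> tends to \<open>u\<close>.\<close>

lemma \<Gamma>_tendsto_u: "AE \<omega> in Q. AE t in lborel. 0 \<le> t \<longrightarrow> (\<lambda>n. \<Gamma> (r n) (t, \<pi> \<omega>)) \<longlonglongrightarrow> u t \<omega>"
  using eventually_not_B limit_L2(1) AE_space
proof eventually_elim
  case (elim \<omega>)
  have \<omega>: "\<omega> \<in> space Q" by fact
  let ?D = "\<lambda>n t. h n t \<omega> - \<Gamma> (r n) (t, \<pi> \<omega>)"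
  have m: "strongly_measurable (time_prod Q) (\<lambda>p. h n (fst p) (snd p) - \<Gamma> (r n) (fst p, \<pi> (snd p)))" for n
    by (intro strongly_measurable_diff simp_int_strongly_measurable[OF S] strongly_measurable_compose[OF time_proj_measurable \<Gamma>m])
  have "AE t in lborel. (\<lambda>n. ennreal ((norm (?D n t))\<^sup>2) * indicator {0..real k} t) \<longlonglongrightarrow> 0" for k
  proof (rule AE_tendsto_0_of_summable_integrals[where c="\<lambda>n. (1 / 16) ^ n"])
    show "(\<lambda>t. ennreal ((norm (?D n t))\<^sup>2) * indicator {0..real k} t) \<in> borel_measurable lborel" for n
      using sqnorm_section_measurable[where k="\<lambda>t \<omega>. h n t \<omega> - \<Gamma> (r n) (t, \<pi> \<omega>)", OF strongly_measurable_norm[OF m] \<omega>] .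
    have "\<forall>\<^sub>F n in sequentially. k \<le> n" by (rule eventually_ge_at_top)
    then show "\<forall>\<^sub>F n in sequentially. (\<integral>\<^sup>+t\<in>{0..real k}. ennreal ((norm (?D n t))\<^sup>2) \<partial>lborel) \<le> ennreal ((1 / 16) ^ n)"
      using elim(1)
    proof eventually_elim
      case (elim n)
      have "sqnorm (\<lambda>t \<omega>. h n t \<omega> - \<Gamma> (r n) (t, \<pi> \<omega>)) (real k) \<omega> \<le> sqnorm (\<lambda>t \<omega>. h n t \<omega> - \<Gamma> (r n) (t, \<pi> \<omega>)) (real n) \<omega>"
        using elim by (intro sqnorm_mono) simp
      also have "\<dots> \<le> ennreal ((1 / 16) ^ n)" using elim by (intro h\<Gamma>)
      finally show ?case by (simp add: sqnorm_def)
    qed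
  qed (auto simp: summable_geometric)
  then have "AE t in lborel. \<forall>k. (\<lambda>n. ennreal ((norm (?D n t))\<^sup>2) * indicator {0..real k} t) \<longlonglongrightarrow> 0"
    unfolding AE_all_countable by blast
  then show ?case using elim(2)
  proof eventually_elim
    case (elim t)
    show ?case
    proof
      assume t: "0 \<le> t"
      obtain k :: nat where "t \<le> real k" using real_arch_simple by blast
      then have "(\<lambda>n. ennreal ((norm (?D n t))\<^sup>2)) \<longlonglongrightarrow> ennreal 0" using elim(1)[rule_format, of k] t by (simp add: indicator_def)
      from tendsto_enn2real[OF this] have "(\<lambda>n. (norm (?D n t))\<^sup>2) \<longlonglongrightarrow> 0" by simp
      from tendsto_real_sqrt[OF this] have "(\<lambda>n. norm (?D n t)) \<longlonglongrightarrow> 0" by simp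
      then have "(\<lambda>n. ?D n t) \<longlonglongrightarrow> 0" by (rule tendsto_norm_zero_cancel)
      from tendsto_diff[OF elim(2)[rule_format, OF t] this] show "(\<lambda>n. \<Gamma> (r n) (t, \<pi> \<omega>)) \<longlonglongrightarrow> u t \<omega>" by simp
    qed
  qed
qed

lemma Cauchy_\<Gamma>_measurable: "{p\<in>space (time_prod P). Cauchy (\<lambda>n. \<Gamma> (r n) p)} \<in> sets (time_prod P)"
  by (rule Cauchy_set_measurable) (intro strongly_measurable_norm strongly_measurable_diff \<Gamma>m)

text \<open>Convergence is known only on the enlarged space. The Cauchy property can be transferred
  because it defines a measurable set there and below; the limit on the enlarged space cannot be
  mentioned below.\<close>

lemma \<Gamma>_converges: "AE p in time_prod P. (\<lambda>n. \<Gamma> (r n) p) \<longlonglongrightarrow> \<Gamma>\<^sub>0 (fst p) (snd p)"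
proof -
  have "AE p in time_prod P. Cauchy (\<lambda>n. \<Gamma> (r n) p)"
  proof (subst AE_time_proj_iff[OF Cauchy_\<Gamma>_measurable], rule AE_time_prodI[OF prob_space_axioms])
    show "{q \<in> space (time_prod Q). Cauchy (\<lambda>n. \<Gamma> (r n) (time_proj q))} \<in> sets (time_prod Q)"
      by (rule Cauchy_set_measurable)
        (intro strongly_measurable_norm strongly_measurable_diff strongly_measurable_compose[OF time_proj_measurable \<Gamma>m])
    show "AE \<omega> in Q. AE t in lborel. 0 \<le> t \<longrightarrow> Cauchy (\<lambda>n. \<Gamma> (r n) (time_proj (t, \<omega>)))"
      using \<Gamma>_tendsto_u
    proof eventually_elim
      case (elim \<omega>)
      then show ?case by eventually_elim (auto intro: LIMSEQ_imp_Cauchy)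
    qed
  qed
  then show ?thesis
    by eventually_elim (simp add: \<Gamma>\<^sub>0_def Cauchy_convergent_iff convergent_LIMSEQ_iff)
qed

lemma \<Gamma>\<^sub>0_norm_measurable: "(\<lambda>p. norm (\<Gamma>\<^sub>0 (fst p) (snd p))) \<in> borel_measurable (time_prod P)"
proof (rule borel_measurable_LIMSEQ_real)
  let ?C = "{p\<in>space (time_prod P). Cauchy (\<lambda>n. \<Gamma> (r n) p)}"
  note [measurable] = Cauchy_\<Gamma>_measurable strongly_measurable_norm[OF \<Gamma>m]
  show "(\<lambda>p. if p \<in> ?C then norm (\<Gamma> (r n) p) else 0) \<in> borel_measurable (time_prod P)" for n
    by measurable
  show "(\<lambda>n. if p \<in> ?C then norm (\<Gamma> (r n) p) else 0) \<longlonglongrightarrow> norm (\<Gamma>\<^sub>0 (fst p) (snd p))"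
    if "p \<in> space (time_prod P)" for p
    using that by (auto simp: \<Gamma>\<^sub>0_def Cauchy_convergent_iff convergent_LIMSEQ_iff intro: tendsto_norm)
qed

lemma \<Gamma>\<^sub>0_eq_u_sections: "AE \<omega> in Q. AE t in lborel. 0 \<le> t \<longrightarrow> \<Gamma>\<^sub>0 t (\<pi> \<omega>) = u t \<omega>"
  using \<Gamma>_tendsto_u
proof eventually_elim
  case (elim \<omega>)
  then show ?case
  proof eventually_elim
    case (elim t)
    show ?case
    proof
      assume "0 \<le> t"
      with elim have "(\<lambda>n. \<Gamma> (r n) (t, \<pi> \<omega>)) \<longlonglongrightarrow> u t \<omega>" by simp
      then show "\<Gamma>\<^sub>0 t (\<pi> \<omega>) = u t \<omega>" by (simp add: \<Gamma>\<^sub>0_def limI LIMSEQ_imp_Cauchy)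
    qed
  qed
qed

text \<open>Equality on sections becomes equality on the product once the set of agreement is
  measurable. For this the norm of the difference is written as a limit of measurable functions,
  with the default value 0 of \<open>\<Gamma>\<^sub>0\<close> off the Cauchy set.\<close>

lemma \<Gamma>\<^sub>0_eq_u: "AE q in time_prod Q. \<Gamma>\<^sub>0 (fst q) (\<pi> (snd q)) = u (fst q) (snd q)"
proof -
  let ?C = "{q\<in>space (time_prod Q). Cauchy (\<lambda>n. \<Gamma> (r n) (time_proj q))}"
  have sm: "strongly_measurable (time_prod Q) (\<lambda>q. \<Gamma> n (time_proj q))" for n
    by (rule strongly_measurable_compose[OF time_proj_measurable \<Gamma>m])
  have [measurable]: "?C \<in> sets (time_prod Q)"
    by (rule Cauchy_set_measurable) (intro strongly_measurable_norm strongly_measurable_diff sm)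
  note [measurable] = strongly_measurable_norm[OF strongly_measurable_diff[OF sm u_strongly_measurable]]
    strongly_measurable_norm[OF u_strongly_measurable]
  have "(\<lambda>q. norm (\<Gamma>\<^sub>0 (fst q) (\<pi> (snd q)) - u (fst q) (snd q))) \<in> borel_measurable (time_prod Q)"
  proof (rule borel_measurable_LIMSEQ_real)
    show "(\<lambda>q. if q \<in> ?C then norm (\<Gamma> (r n) (time_proj q) - u (fst q) (snd q)) else norm (u (fst q) (snd q))) \<in> borel_measurable (time_prod Q)" for n
      by measurable
    show "(\<lambda>n. if q \<in> ?C then norm (\<Gamma> (r n) (time_proj q) - u (fst q) (snd q)) else norm (u (fst q) (snd q)))
       \<longlonglongrightarrow> norm (\<Gamma>\<^sub>0 (fst q) (\<pi> (snd q)) - u (fst q) (snd q))" if "q \<in> space (time_prod Q)" for q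
      using that by (auto simp: \<Gamma>\<^sub>0_def Cauchy_convergent_iff convergent_LIMSEQ_iff intro!: tendsto_norm tendsto_diff)
  qed
  then have "{q\<in>space (time_prod Q). norm (\<Gamma>\<^sub>0 (fst q) (\<pi> (snd q)) - u (fst q) (snd q)) = 0} \<in> sets (time_prod Q)"
    by measurable
  then have "AE q in time_prod Q. norm (\<Gamma>\<^sub>0 (fst q) (\<pi> (snd q)) - u (fst q) (snd q)) = 0"
  proof (rule AE_time_prodI[OF prob_space_axioms])
    show "AE \<omega> in Q. AE t in lborel. 0 \<le> t \<longrightarrow> norm (\<Gamma>\<^sub>0 (fst (t, \<omega>)) (\<pi> (snd (t, \<omega>))) - u (fst (t, \<omega>)) (snd (t, \<omega>))) = 0"
      using \<Gamma>\<^sub>0_eq_u_sections by simp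
  qed
  then show ?thesis by eventually_elim simp
qed

lemma sqnorm_\<Gamma>\<^sub>0: "AE \<omega> in Q. \<forall>T. sqnorm \<Gamma>\<^sub>0 T (\<pi> \<omega>) = sqnorm u T \<omega>"
  using \<Gamma>\<^sub>0_eq_u_sections
proof eventually_elim
  case (elim \<omega>)
  have "sqnorm \<Gamma>\<^sub>0 T (\<pi> \<omega>) = sqnorm (\<lambda>t \<omega>. \<Gamma>\<^sub>0 t (\<pi> \<omega>)) T \<omega>" for T by (simp add: sqnorm_def)
  then show ?case using sqnorm_cong_AE[of "\<lambda>t \<omega>. \<Gamma>\<^sub>0 t (\<pi> \<omega>)" \<omega> u] elim by simp
qed

lemma sqnorm_\<Gamma>\<^sub>0_finite: "AE \<omega> in P. \<forall>T. sqnorm \<Gamma>\<^sub>0 T \<omega> < \<infinity>"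
proof -
  note [measurable] = sqnorm_measurable[OF \<Gamma>\<^sub>0_norm_measurable]
  have "AE \<omega> in P. sqnorm \<Gamma>\<^sub>0 (real n) \<omega> < \<infinity>" for n :: nat
  proof (subst AE_proj_iff)
    show "{\<omega> \<in> space P. sqnorm \<Gamma>\<^sub>0 (real n) \<omega> < \<infinity>} \<in> sets P" by measurable
    show "AE \<omega> in Q. sqnorm \<Gamma>\<^sub>0 (real n) (\<pi> \<omega>) < \<infinity>"
      using sqnorm_\<Gamma>\<^sub>0 limit_L2(3) by eventually_elim simp
  qed
  then have "AE \<omega> in P. \<forall>n::nat. sqnorm \<Gamma>\<^sub>0 (real n) \<omega> < \<infinity>" unfolding AE_all_countable by blast
  then show ?thesis
  proof eventually_elim
    case (elim \<omega>)
    show ?case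
    proof
      fix T
      obtain n :: nat where "T \<le> real n" using real_arch_simple by blast
      then show "sqnorm \<Gamma>\<^sub>0 T \<omega> < \<infinity>" using sqnorm_mono[of T "real n" \<Gamma>\<^sub>0 \<omega>] elim le_less_trans by blast
    qed
  qed
qed

end

section \<open>Quadratic variation of the limit\<close>

text \<open>Passage from a finite extended-valued integral to a real one that is continuous and
  increasing in its upper end. Continuity holds on each compact interval, and near a point the
  half-line looks like such an interval.\<close>

lemma running_integral:
  fixes k :: "real \<Rightarrow> real"
  assumes k: "\<And>t. 0 \<le> k t" and m: "\<And>T. (\<lambda>t. ennreal (k t) * indicator {0..T} t) \<in> borel_measurable lborel"
    and fin: "\<And>T. (\<integral>\<^sup>+t\<in>{0..T}. ennreal (k t) \<partial>lborel) < \<infinity>"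
  shows "set_integrable lborel {0..T} k"
    and "(LINT t:{0..T}|lborel. k t) = enn2real (\<integral>\<^sup>+t\<in>{0..T}. ennreal (k t) \<partial>lborel)"
    and "continuous_on {0..} (\<lambda>T. enn2real (\<integral>\<^sup>+t\<in>{0..T}. ennreal (k t) \<partial>lborel))"
    and "mono_on {0..} (\<lambda>T. enn2real (\<integral>\<^sup>+t\<in>{0..T}. ennreal (k t) \<partial>lborel))"
    and "enn2real (\<integral>\<^sup>+t\<in>{0..0}. ennreal (k t) \<partial>lborel) = 0"
proof -
  let ?I = "\<lambda>T. enn2real (\<integral>\<^sup>+t\<in>{0..T}. ennreal (k t) \<partial>lborel)"
  have e: "ennreal (indicat_real {0..T} t * k t) = ennreal (k t) * indicator {0..T} t" for t T
    by (simp add: indicator_def)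
  have "(\<lambda>t. enn2real (ennreal (k t) * indicator {0..T} t)) \<in> borel_measurable lborel" for T
    using m by measurable
  also have "(\<lambda>t. enn2real (ennreal (k t) * indicator {0..T} t)) = (\<lambda>t. indicator {0..T} t *\<^sub>R k t)" for T
    using k by (auto simp: indicator_def fun_eq_iff)
  finally have m': "(\<lambda>t. indicator {0..T} t *\<^sub>R k t) \<in> borel_measurable lborel" for T .
  show si: "set_integrable lborel {0..T} k" for T
    unfolding set_integrable_def using m' k fin[of T]
    by (intro integrableI_nonneg) (auto simp: e)
  show LI: "(LINT t:{0..T}|lborel. k t) = ?I T" for T
    unfolding set_lebesgue_integral_def using k
    by (subst integral_eq_nn_integral[OF m']) (auto simp: e)
  have "continuous_on {0..T} ?I" for T
  proof -
    have "continuous_on {0..T} (\<lambda>x. integral {0..x} k)"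
      by (rule indefinite_integral_continuous_1) (rule set_borel_integral_eq_integral(1)[OF si])
    moreover have "integral {0..x} k = ?I x" for x
      using set_borel_integral_eq_integral(2)[OF si[of x]] LI by simp
    ultimately show ?thesis by simp
  qed
  then show "continuous_on {0..} ?I"
  proof (subst continuous_on_eq_continuous_within, intro ballI)
    fix x :: real assume "x \<in> {0..}" and c: "\<And>T. continuous_on {0..T} ?I"
    then have x: "x \<in> {0..x + 1}" by simp
    have "continuous (at x within {0..x + 1}) ?I"
      using c[of "x + 1"] x by (simp add: continuous_on_eq_continuous_within)
    moreover have "at x within {0..x + 1} = at x within {0..}"
      by (rule at_within_nhd[of _ "{..<x + 1}"]) auto
    ultimately show "continuous (at x within {0..}) ?I" by (simp add: continuous_within)
  qed
  show "mono_on {0..} ?I"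
  proof (rule mono_onI)
    fix s t :: real assume "s \<le> t"
    then have "(\<integral>\<^sup>+r\<in>{0..s}. ennreal (k r) \<partial>lborel) \<le> (\<integral>\<^sup>+r\<in>{0..t}. ennreal (k r) \<partial>lborel)"
      by (intro nn_integral_mono) (auto simp: indicator_def)
    then show "?I s \<le> ?I t" using fin by (intro enn2real_mono) auto
  qed
  have "AE t in lborel. t \<noteq> (0::real)" by (rule AE_lborel_singleton)
  have "(\<integral>\<^sup>+t\<in>{0..0}. ennreal (k t) \<partial>lborel) = (\<integral>\<^sup>+t. 0 \<partial>(lborel :: real measure))"
  proof (intro nn_integral_cong_AE)
    show "AE t in lborel. ennreal (k t) * indicator {0..0} t = 0"
      using \<open>AE t in lborel. t \<noteq> (0::real)\<close> by eventually_elim (simp add: indicator_def)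
  qed
  then show "?I 0 = 0" by simp
qed

text \<open>First time at which \<open>f\<close> reaches the level \<open>k\<close>, capped at time
  \<open>k\<close>. The added point keeps the set nonempty and the time finite when the level is
  never reached.\<close>

definition level_time :: "real \<Rightarrow> (real \<Rightarrow> real) \<Rightarrow> real" where
  "level_time k f = Inf ({s. 0 \<le> s \<and> k \<le> f s} \<union> {k})"

lemma level_time:
  assumes c: "continuous_on {0..} f" and mono: "mono_on {0..} f" and k: "0 \<le> k"
  shows level_time_nonneg: "0 \<le> level_time k f"
    and level_time_le_iff: "0 \<le> r \<Longrightarrow> level_time k f \<le> r \<longleftrightarrow> k \<le> r \<or> k \<le> f r"
    and level_time_bound: "f 0 = 0 \<Longrightarrow> 0 \<le> t \<Longrightarrow> f (min t (level_time k f)) \<le> k"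
proof -
  let ?A = "{s. 0 \<le> s \<and> k \<le> f s} \<union> {k}"
  have bdd: "bdd_below ?A" by (rule bdd_belowI[of _ 0]) (use k in auto)
  have ne: "?A \<noteq> {}" by simp
  have "closed ({0..} \<inter> f -` {k..})" by (rule continuous_closed_preimage[OF c]) auto
  then have "closed ?A" by (intro closed_Un) (auto simp: vimage_def Int_def)
  then have inA: "level_time k f \<in> ?A" unfolding level_time_def by (intro closed_contains_Inf ne bdd)
  show nn: "0 \<le> level_time k f" using inA k by auto
  show iff: "level_time k f \<le> r \<longleftrightarrow> k \<le> r \<or> k \<le> f r" if r: "0 \<le> r" for r
  proof
    assume le: "level_time k f \<le> r"
    from inA show "k \<le> r \<or> k \<le> f r"
    proof
      assume "level_time k f \<in> {s. 0 \<le> s \<and> k \<le> f s}"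
      then have "k \<le> f (level_time k f)" by simp
      also have "\<dots> \<le> f r" using mono_onD[OF mono, of "level_time k f" r] nn r le by simp
      finally show ?thesis ..
    next
      assume "level_time k f \<in> {k}"
      then show ?thesis using le by simp
    qed
  next
    assume "k \<le> r \<or> k \<le> f r"
    then show "level_time k f \<le> r"
    proof
      assume "k \<le> r"
      have "level_time k f \<le> k" unfolding level_time_def by (rule cInf_lower[OF _ bdd]) simp
      then show ?thesis using \<open>k \<le> r\<close> by simp
    next
      assume "k \<le> f r"
      then show ?thesis unfolding level_time_def using r by (intro cInf_lower[OF _ bdd]) simp
    qed
  qed
  show "f (min t (level_time k f)) \<le> k" if f0: "f 0 = 0" and t: "0 \<le> t"
  proof -
    define m where "m = min t (level_time k f)"
    have m0: "0 \<le> m" using nn t by (simp add: m_def)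
    show ?thesis
    proof (cases "m = 0")
      case True
      then show ?thesis using f0 k by (simp add: m_def)
    next
      case False
      then have mp: "0 < m" using m0 by simp
      \<comment> \<open>Times strictly before the level time, where \<open>f\<close> is still below
        \<open>k\<close>; continuity carries the bound to the limit.\<close>
      define s where "s n = m - m / real (Suc n)" for n
      have s0: "0 \<le> s n" and sm: "s n < m" for n
        using mp by (auto simp: s_def field_simps)
      have "(\<lambda>n. m * inverse (real (Suc n))) \<longlonglongrightarrow> 0"
        by (rule tendsto_mult_right_zero[OF LIMSEQ_inverse_real_of_nat])
      then have "s \<longlonglongrightarrow> m - 0" unfolding s_def divide_inverse by (intro tendsto_diff tendsto_const)
      then have "s \<longlonglongrightarrow> m" by simp
      then have "(\<lambda>n. f (s n)) \<longlonglongrightarrow> f m"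
        by (intro continuous_on_tendsto_compose[OF c]) (use s0 m0 in auto)
      moreover have "f (s n) \<le> k" for n
      proof -
        have "\<not> level_time k f \<le> s n" using sm[of n] by (simp add: m_def)
        then show ?thesis using iff[OF s0[of n]] by simp
      qed
      ultimately have "f m \<le> k" by (intro LIMSEQ_le_const2) auto
      then show ?thesis by (simp add: m_def)
    qed
  qed
qed

text \<open>The random time is approximated from below by countably valued times, so that only
  values of \<open>Y\<close> up to time \<open>t\<close> enter.\<close>

lemma (in filtered_prob_space) measurable_at_random_time:
  assumes t: "0 \<le> t" and Y: "\<And>s. 0 \<le> s \<Longrightarrow> Y s \<in> borel_measurable (F s)"
    and c: "\<And>\<omega>. \<omega> \<in> space P \<Longrightarrow> continuous_on {0..} (\<lambda>s. Y s \<omega>)"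
    and \<sigma> [measurable]: "\<sigma> \<in> borel_measurable (F t)" and \<sigma>t: "\<And>\<omega>. \<omega> \<in> space P \<Longrightarrow> 0 \<le> \<sigma> \<omega> \<and> \<sigma> \<omega> \<le> t"
  shows "(\<lambda>\<omega>. Y (\<sigma> \<omega>) \<omega> :: real) \<in> borel_measurable (F t)"
proof (rule borel_measurable_LIMSEQ_real)
  define g where "g j \<omega> = nat \<lfloor>real (Suc j) * \<sigma> \<omega>\<rfloor>" for j \<omega>
  have gm: "g j \<in> measurable (F t) (count_space UNIV)" for j unfolding g_def by measurable
  \<comment> \<open>The cap at \<open>t\<close> keeps the indices measurable for \<open>F t\<close>
    even when they are not attained by the discretized time.\<close>
  have Ym: "(\<lambda>\<omega>. Y (min t (real i / real (Suc j))) \<omega>) \<in> borel_measurable (F t)" for i j :: nat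
    using t by (intro measurable_F_mono[OF Y]) auto
  show "(\<lambda>\<omega>. Y (min t (real (g j \<omega>) / real (Suc j))) \<omega>) \<in> borel_measurable (F t)" for j
    by (rule measurable_compose_countable[OF Ym gm])
  fix \<omega> assume "\<omega> \<in> space (F t)"
  then have \<omega>: "\<omega> \<in> space P" by (simp add: space_F)
  note s = \<sigma>t[OF \<omega>]
  define p where "p j = real (g j \<omega>) / real (Suc j)" for j
  have p: "p j \<le> \<sigma> \<omega>" "\<sigma> \<omega> - 1 / real (Suc j) \<le> p j" "0 \<le> p j" for j
  proof -
    have "0 \<le> real (Suc j) * \<sigma> \<omega>" using s by simp
    then have "real (g j \<omega>) \<le> real (Suc j) * \<sigma> \<omega>" "real (Suc j) * \<sigma> \<omega> - 1 \<le> real (g j \<omega>)"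
      unfolding g_def by linarith+
    then have "p j \<le> real (Suc j) * \<sigma> \<omega> / real (Suc j)" "(real (Suc j) * \<sigma> \<omega> - 1) / real (Suc j) \<le> p j"
      unfolding p_def by (intro divide_right_mono; simp)+
    then show "p j \<le> \<sigma> \<omega>" "\<sigma> \<omega> - 1 / real (Suc j) \<le> p j"
      by (simp_all only: diff_divide_distrib nonzero_mult_div_cancel_left[OF of_nat_neq_0])
    show "0 \<le> p j" by (simp add: p_def)
  qed
  have "(\<lambda>j. p j - \<sigma> \<omega>) \<longlonglongrightarrow> 0"
  proof (rule Lim_null_comparison)
    show "\<forall>\<^sub>F j in sequentially. norm (p j - \<sigma> \<omega>) \<le> inverse (real (Suc j))"
    proof (intro always_eventually allI)
      fix j show "norm (p j - \<sigma> \<omega>) \<le> inverse (real (Suc j))"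
        using p(1,2)[of j] by (simp only: real_norm_def inverse_eq_divide)
    qed
  qed (rule LIMSEQ_inverse_real_of_nat)
  then have "p \<longlonglongrightarrow> \<sigma> \<omega>" by (simp add: LIM_zero_iff)
  then have "(\<lambda>j. Y (p j) \<omega>) \<longlonglongrightarrow> Y (\<sigma> \<omega>) \<omega>"
    by (intro continuous_on_tendsto_compose[OF c[OF \<omega>]]) (use p s in auto)
  moreover have "min t (p j) = p j" for j using p(1)[of j] s by (simp add: min_def)
  ultimately show "(\<lambda>j. Y (min t (real (g j \<omega>) / real (Suc j))) \<omega>) \<longlonglongrightarrow> Y (\<sigma> \<omega>) \<omega>"
    unfolding p_def[symmetric] by simp
qed

section \<open>The running energy as quadratic variation\<close>

context selected_integrals begin

context
  fixes V :: "real \<Rightarrow> 'a \<Rightarrow> real"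
  assumes V_eq: "AE \<omega> in P. \<forall>t\<ge>0. V t \<omega> = enn2real (sqnorm \<Gamma>\<^sub>0 t \<omega>)"
    and V_nonneg: "\<And>t \<omega>. 0 \<le> V t \<omega>"
begin

lemma V_paths: "AE \<omega> in P. V 0 \<omega> = 0 \<and> continuous_on {0..} (\<lambda>t. V t \<omega>) \<and> mono_on {0..} (\<lambda>t. V t \<omega>)"
  using V_eq sqnorm_\<Gamma>\<^sub>0_finite AE_space
proof eventually_elim
  case (elim \<omega>)
  note R = running_integral[where k="\<lambda>t. (norm (\<Gamma>\<^sub>0 t \<omega>))\<^sup>2", OF _ sqnorm_section_measurable[OF \<Gamma>\<^sub>0_norm_measurable elim(3)]
      elim(2)[rule_format, unfolded sqnorm_def], simplified]
  have eq: "V t \<omega> = enn2real (\<integral>\<^sup>+x\<in>{0..t}. ennreal ((norm (\<Gamma>\<^sub>0 x \<omega>))\<^sup>2) \<partial>lborel)" if "0 \<le> t" for t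
    using elim(1) that by (simp add: sqnorm_def)
  have "V 0 \<omega> = 0" using eq[of 0] R(5) by simp
  moreover have "continuous_on {0..} (\<lambda>t. V t \<omega>)"
    using R(3) by (rule continuous_on_eq) (simp add: eq)
  moreover have "mono_on {0..} (\<lambda>t. V t \<omega>)"
    using R(4) by (simp add: mono_on_def eq)
  ultimately show ?case by blast
qed

lemma V_measurable: "0 \<le> t \<Longrightarrow> V t \<in> borel_measurable P"
proof -
  assume t: "0 \<le> t"
  have "(\<lambda>\<omega>. enn2real (sqnorm \<Gamma>\<^sub>0 t \<omega>)) \<in> borel_measurable P"
    using sqnorm_measurable[OF \<Gamma>\<^sub>0_norm_measurable, of t] by measurable
  moreover have "AE \<omega> in P. enn2real (sqnorm \<Gamma>\<^sub>0 t \<omega>) = V t \<omega>"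
    using V_eq by eventually_elim (use t in simp)
  ultimately show ?thesis by (rule P.borel_measurable_cong_AE)
qed

lemma V_eq_sqnorm_u: "AE \<omega> in Q. \<forall>t\<ge>0. sqnorm u t \<omega> = ennreal (V t (\<pi> \<omega>))"
  using AE_proj[OF V_eq] AE_proj[OF sqnorm_\<Gamma>\<^sub>0_finite] sqnorm_\<Gamma>\<^sub>0
  by eventually_elim (simp add: less_top)

lemma N_adapted: "0 \<le> t \<Longrightarrow> N t \<in> borel_measurable (F t)"
  using N_martingale by (simp add: cont_local_martingale_def adapted_def)

lemma N_measurable_P: "0 \<le> t \<Longrightarrow> N t \<in> borel_measurable P"
  using P.measurable_of_F[OF N_adapted] .

lemma N_continuous: "AE \<omega> in P. continuous_on {0..} (\<lambda>t. N t \<omega>)"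
  using N_martingale by (simp add: cont_local_martingale_def)

text \<open>Elementary integrals vanish at time 0 and approximate \<open>N\<close> there.\<close>

lemma N_0: "AE \<omega> in P. N 0 \<omega> = 0"
proof (subst AE_proj_iff)
  note [measurable] = N_measurable_P[OF order_refl]
  show "{\<omega> \<in> space P. N 0 \<omega> = 0} \<in> sets P" by measurable
  show "AE \<omega> in Q. N 0 (\<pi> \<omega>) = 0"
    using eventually_not_B
  proof eventually_elim
    case (elim \<omega>)
    have "(\<lambda>n. (1 / 16 :: real) ^ n) \<longlonglongrightarrow> 0" by (rule LIMSEQ_realpow_zero) auto
    moreover have "\<forall>\<^sub>F n in sequentially. \<bar>N 0 (\<pi> \<omega>)\<bar> \<le> (1 / 16) ^ n"
      using elim
    proof eventually_elim
      case (elim n)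
      then show ?case using close[of \<omega> n 0] simp_int_0[OF S, of n \<omega>] by simp
    qed
    ultimately have "\<bar>N 0 (\<pi> \<omega>)\<bar> \<le> 0" by (rule tendsto_lowerbound) simp
    then show ?case by simp
  qed
qed

text \<open>
  The Riemann sums of \<open>N\<close> are adapted on the original space, although \<open>\<Gamma>\<^sub>0\<close> need not be.
\<close>

lemma V_adapted: "0 \<le> t \<Longrightarrow> V t \<in> borel_measurable (F t)"
proof -
  assume t0: "0 \<le> t"
  show ?thesis
  proof (cases "t = 0")
    case True
    have "AE \<omega> in P. 0 = V t \<omega>" using V_paths by eventually_elim (use True in simp)
    then show ?thesis by (rule P.borel_measurable_F_cong_AE[OF t0, rotated]) simp
  next
    case False
    then have t: "0 < t" using t0 by simp
    have NQ: "(\<lambda>\<omega>. N s (\<pi> \<omega>)) \<in> borel_measurable Q" if "0 \<le> s" for s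
      using measurable_compose[OF proj_measurable N_measurable_P[OF that]] .
    have VQ: "(\<lambda>\<omega>. V t (\<pi> \<omega>)) \<in> borel_measurable Q"
      using measurable_compose[OF proj_measurable V_measurable[OF t0]] .
    have VuQ: "AE \<omega> in Q. sqnorm u t \<omega> = ennreal (V t (\<pi> \<omega>))"
      using V_eq_sqnorm_u by eventually_elim (use t0 in simp)
    have RF: "riemann_sum t m N \<in> borel_measurable (F t)" for m
      by (rule riemann_sum_measurable[OF _ t]) (rule P.measurable_F_mono[OF N_adapted])
    note [measurable] = P.measurable_of_F[OF RF] V_measurable[OF t0]
    \<comment> \<open>Both \<open>N\<close> and \<open>V\<close> are processes on the original
      space, so the probability of the exceptional event can be computed there. The bounds
      \<open>(1/2)^j\<close> are summable, as the Borel-Cantelli lemma requires.\<close>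
    have "\<exists>m>0. measure P {\<omega>\<in>space P. (1 / 2) ^ j < \<bar>sqrt (riemann_sum t m N \<omega>) - sqrt (V t \<omega>)\<bar>} \<le> (1 / 2) ^ j" for j :: nat
    proof -
      obtain m where m: "0 < m" "measure Q {\<omega>\<in>space Q. (1 / 2) ^ j < \<bar>sqrt (riemann_sum t m (\<lambda>s \<omega>. N s (\<pi> \<omega>)) \<omega>) - sqrt (V t (\<pi> \<omega>))\<bar>} \<le> (1 / 2) ^ j"
        using riemann_sums_converge[OF t _ NQ VQ VuQ V_nonneg, of "(1 / 2) ^ j"] by auto
      have "{\<omega>\<in>space Q. (1 / 2) ^ j < \<bar>sqrt (riemann_sum t m (\<lambda>s \<omega>. N s (\<pi> \<omega>)) \<omega>) - sqrt (V t (\<pi> \<omega>))\<bar>}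
         = \<pi> -` {\<omega>\<in>space P. (1 / 2) ^ j < \<bar>sqrt (riemann_sum t m N \<omega>) - sqrt (V t \<omega>)\<bar>} \<inter> space Q"
        using proj_space by (auto simp: riemann_sum_def)
      then have "measure P {\<omega>\<in>space P. (1 / 2) ^ j < \<bar>sqrt (riemann_sum t m N \<omega>) - sqrt (V t \<omega>)\<bar>} \<le> (1 / 2) ^ j"
        using m(2) by (subst measure_proj[symmetric]) auto
      with m(1) show ?thesis by blast
    qed
    then obtain m where m: "\<And>j::nat. measure P {\<omega>\<in>space P. (1 / 2) ^ j < \<bar>sqrt (riemann_sum t (m j) N \<omega>) - sqrt (V t \<omega>)\<bar>} \<le> (1 / 2) ^ j"
      by metis
    have "AE \<omega> in P. \<forall>\<^sub>F j in sequentially. \<omega> \<in> space P - {\<omega>\<in>space P. (1 / 2) ^ j < \<bar>sqrt (riemann_sum t (m j) N \<omega>) - sqrt (V t \<omega>)\<bar>}"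
    proof (rule borel_cantelli_AE1)
      show "summable (\<lambda>j. measure P {\<omega>\<in>space P. (1 / 2) ^ j < \<bar>sqrt (riemann_sum t (m j) N \<omega>) - sqrt (V t \<omega>)\<bar>})"
        by (rule summable_comparison_test'[of "\<lambda>j. (1 / 2) ^ j" 0]) (use m in \<open>auto simp: summable_geometric\<close>)
    qed (auto simp: P.emeasure_eq_measure)
    then have "AE \<omega> in P. (lim (\<lambda>j. sqrt (riemann_sum t (m j) N \<omega>)))\<^sup>2 = V t \<omega>"
    proof eventually_elim
      case (elim \<omega>)
      have "(\<lambda>j. sqrt (riemann_sum t (m j) N \<omega>) - sqrt (V t \<omega>)) \<longlonglongrightarrow> 0"
      proof (rule Lim_null_comparison)
        show "\<forall>\<^sub>F j in sequentially. norm (sqrt (riemann_sum t (m j) N \<omega>) - sqrt (V t \<omega>)) \<le> (1 / 2) ^ j"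
          using elim by eventually_elim auto
      qed (rule LIMSEQ_realpow_zero, auto)
      then have "(\<lambda>j. sqrt (riemann_sum t (m j) N \<omega>)) \<longlonglongrightarrow> sqrt (V t \<omega>)" by (simp add: LIM_zero_iff)
      then show ?case using V_nonneg by (simp add: limI)
    qed
    \<comment> \<open>The square of the limit of adapted square roots is measurable for
      \<open>F t\<close>; \<open>V t\<close> agrees with it up to a null set, which the usual
      conditions permit.\<close>
    moreover have "(\<lambda>\<omega>. (lim (\<lambda>j. sqrt (riemann_sum t (m j) N \<omega>)))\<^sup>2) \<in> borel_measurable (F t)"
      using RF by measurable
    ultimately show ?thesis by (rule P.borel_measurable_F_cong_AE[OF t0, rotated])
  qed
qed

text \<open>Localization at the level times of \<open>V\<close> bounds the energy, which makes the
  stopped difference of \<open>N^2\<close> and \<open>V\<close> a martingale for the enlarged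
  filtration. Its integrals over events of \<open>F s\<close> are integrals over pulled-back events,
  so the property holds for the original filtration too.\<close>

lemma quadratic_variation_V: "quadratic_variation P F N V"
proof -
  let ?good = "\<lambda>\<omega>. V 0 \<omega> = 0 \<and> continuous_on {0..} (\<lambda>t. V t \<omega>) \<and> mono_on {0..} (\<lambda>t. V t \<omega>)
    \<and> continuous_on {0..} (\<lambda>t. N t \<omega>) \<and> N 0 \<omega> = 0"
  have "AE \<omega> in P. ?good \<omega>" using V_paths N_continuous N_0 by eventually_elim simp
  from AE_E[OF this] obtain B0 where "{\<omega>\<in>space P. \<not> ?good \<omega>} \<subseteq> B0" "emeasure P B0 = 0" "B0 \<in> sets P"
    by blast
  then have B0: "B0 \<in> null_sets P" "{\<omega>\<in>space P. \<not> ?good \<omega>} \<subseteq> B0" by (simp_all add: null_sets_def)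
  have B0F: "B0 \<in> sets (F t)" if "0 \<le> t" for t
    using B0(1) P.null_sets_F P.sets_F_mono[OF that] by blast
  \<comment> \<open>Path properties hold only almost surely. Setting the paths to 0 on a null set in
    \<open>F 0\<close> makes them hold everywhere, so that the level times are stopping times and
    bounds hold at every path.\<close>
  define V' where "V' t \<omega> = (if \<omega> \<in> B0 then 0 else V t \<omega>)" for t \<omega>
  define N' where "N' t \<omega> = (if \<omega> \<in> B0 then 0 else N t \<omega>)" for t \<omega>
  have V'F: "V' t \<in> borel_measurable (F t)" and N'F: "N' t \<in> borel_measurable (F t)" if "0 \<le> t" for t
    using V_adapted[OF that] N_adapted[OF that] B0F[OF that] unfolding V'_def N'_def by (auto intro!: measurable_If_set)
  have V': "V' 0 \<omega> = 0" "continuous_on {0..} (\<lambda>t. V' t \<omega>)" "mono_on {0..} (\<lambda>t. V' t \<omega>)" "continuous_on {0..} (\<lambda>t. N' t \<omega>)" "N' 0 \<omega> = 0"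
    if "\<omega> \<in> space P" for \<omega>
  proof -
    have "V' 0 \<omega> = 0 \<and> continuous_on {0..} (\<lambda>t. V' t \<omega>) \<and> mono_on {0..} (\<lambda>t. V' t \<omega>)
      \<and> continuous_on {0..} (\<lambda>t. N' t \<omega>) \<and> N' 0 \<omega> = 0"
    proof (cases "\<omega> \<in> B0")
      case True
      then show ?thesis by (simp add: V'_def N'_def mono_on_def)
    next
      case False
      then have "?good \<omega>" using B0(2) that by blast
      then show ?thesis using False by (simp add: V'_def N'_def)
    qed
    then show "V' 0 \<omega> = 0" "continuous_on {0..} (\<lambda>t. V' t \<omega>)" "mono_on {0..} (\<lambda>t. V' t \<omega>)"
      "continuous_on {0..} (\<lambda>t. N' t \<omega>)" "N' 0 \<omega> = 0" by blast+
  qed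
  have nB0: "AE \<omega> in P. \<omega> \<notin> B0" by (rule AE_not_in[OF B0(1)])
  have eqVN: "AE \<omega> in P. \<forall>t. V' t \<omega> = V t \<omega> \<and> N' t \<omega> = N t \<omega>"
    using nB0 by eventually_elim (simp add: V'_def N'_def)
  define \<tau> where "\<tau> k \<omega> = level_time (real k) (\<lambda>t. V' t \<omega>)" for k :: nat and \<omega>
  have \<tau>0: "0 \<le> \<tau> k \<omega>" if "\<omega> \<in> space P" for k \<omega>
    unfolding \<tau>_def by (rule level_time_nonneg[OF V'(2,3)[OF that]]) simp
  have \<tau>le: "\<tau> k \<omega> \<le> r \<longleftrightarrow> real k \<le> r \<or> real k \<le> V' r \<omega>" if "\<omega> \<in> space P" "0 \<le> r" for k \<omega> r
    unfolding \<tau>_def by (rule level_time_le_iff[OF V'(2,3)[OF that(1)] _ that(2)]) simp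
  have \<tau>b: "V' (min t (\<tau> k \<omega>)) \<omega> \<le> real k" if "\<omega> \<in> space P" "0 \<le> t" for k \<omega> t
    unfolding \<tau>_def by (rule level_time_bound[OF V'(2,3)[OF that(1)] _ V'(1)[OF that(1)] that(2)]) simp
  have st: "stopping_time F (\<tau> k)" for k
  proof (rule stopping_timeI)
    fix t
    show "Measurable.pred (F t) (\<lambda>\<omega>. \<tau> k \<omega> \<le> t)"
    proof (cases "0 \<le> t")
      case True
      note [measurable] = V'F[OF True]
      have "Measurable.pred (F t) (\<lambda>\<omega>. real k \<le> t \<or> real k \<le> V' t \<omega>)" by measurable
      then show ?thesis
        by (rule measurable_cong[THEN iffD1, rotated]) (use \<tau>le True in \<open>simp add: P.space_F\<close>)
    next
      case False
      have "Measurable.pred (F t) (\<lambda>\<omega>. False)" by simp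
      then show ?thesis
      proof (rule measurable_cong[THEN iffD1, rotated])
        fix \<omega> assume "\<omega> \<in> space (F t)"
        then show "False = (\<tau> k \<omega> \<le> t)" using \<tau>0[of \<omega> k] False by (simp add: P.space_F)
      qed
    qed
  qed
  \<comment> \<open>For \<open>r < t\<close> the event that the minimum is at most \<open>r\<close>
    is decided by time \<open>r\<close>; for \<open>r \<ge> t\<close> it is the whole space.\<close>
  have minF: "(\<lambda>\<omega>. min t (\<tau> k \<omega>)) \<in> borel_measurable (F t)" for t k
  proof (rule borel_measurableI_le)
    fix r
    show "{\<omega> \<in> space (F t). min t (\<tau> k \<omega>) \<le> r} \<in> sets (F t)"
    proof (cases "t \<le> r")
      case True
      then have "{\<omega> \<in> space (F t). min t (\<tau> k \<omega>) \<le> r} = space (F t)" by (auto simp: min_def)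
      then show ?thesis by simp
    next
      case False
      then have "{\<omega> \<in> space (F t). min t (\<tau> k \<omega>) \<le> r} = {\<omega> \<in> space (F r). \<tau> k \<omega> \<le> r}"
        by (auto simp: P.space_F)
      also have "\<dots> \<in> sets (F r)" using stopping_timeD[OF st[of k], of r] by (simp add: pred_def)
      also have "sets (F r) \<subseteq> sets (F t)" using False by (intro P.sets_F_mono) simp
      finally show ?thesis .
    qed
  qed
  have N'm: "(\<lambda>\<omega>. N' (min t (\<tau> k \<omega>)) \<omega>) \<in> borel_measurable (F t)"
    and V'm: "(\<lambda>\<omega>. V' (min t (\<tau> k \<omega>)) \<omega>) \<in> borel_measurable (F t)" if t: "0 \<le> t" for t k
    by (rule P.measurable_at_random_time[OF t N'F V'(4) minF], use t \<tau>0 in auto)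
      (rule P.measurable_at_random_time[OF t V'F V'(2) minF], use t \<tau>0 in auto)
  define Z where "Z k t \<omega> = (N' (min t (\<tau> k \<omega>)) \<omega>)\<^sup>2 - V' (min t (\<tau> k \<omega>)) \<omega>" for k :: nat and t \<omega>
  have Zm: "Z k t \<in> borel_measurable (F t)" if "0 \<le> t" for k t
    unfolding Z_def using N'm[OF that] V'm[OF that] by measurable
  \<comment> \<open>The general statement about stopped squares is applied on the enlarged space
    with the projected processes, and with the level \<open>k\<close> as energy bound.\<close>
  have stopped: "integrable Q (\<lambda>\<omega>. Z k t (\<pi> \<omega>))"
     "(\<integral>\<omega>. indicator A \<omega> * Z k t (\<pi> \<omega>) \<partial>Q) = (\<integral>\<omega>. indicator A \<omega> * Z k s (\<pi> \<omega>) \<partial>Q)"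
    if s: "0 \<le> s" "s \<le> t" and A: "A \<in> sets (E s)" for k s t A
  proof -
    have eqQ: "AE \<omega> in Q. \<forall>t. V' t (\<pi> \<omega>) = V t (\<pi> \<omega>) \<and> N' t (\<pi> \<omega>) = N t (\<pi> \<omega>)" by (rule AE_proj[OF eqVN])
    have JN: "AE \<omega> in Q. \<forall>T. uniform_limit {0..T} (\<lambda>n t. J n t \<omega>) (\<lambda>t. N' t (\<pi> \<omega>)) sequentially"
      using integrals_uniform_limit eqQ by eventually_elim simp
    have Nc: "AE \<omega> in Q. continuous_on {0..} (\<lambda>t. N' t (\<pi> \<omega>))"
      using V'(4) proj_space by (intro AE_I2) blast
    have VQ: "AE \<omega> in Q. \<forall>t\<ge>0. sqnorm u t \<omega> = ennreal (V' t (\<pi> \<omega>))"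
      using V_eq_sqnorm_u eqQ by eventually_elim simp
    have V0: "AE \<omega> in Q. \<forall>t\<ge>0. 0 \<le> V' t (\<pi> \<omega>)" using V_nonneg by (simp add: V'_def)
    have \<tau>E: "{\<omega>\<in>space Q. r < \<tau> k (\<pi> \<omega>)} \<in> sets (E r)" if r: "0 \<le> r" for r
    proof -
      have "{\<omega>\<in>space (F r). r < \<tau> k \<omega>} \<in> sets (F r)" using stopping_timeD2[OF st[of k], of r] by (simp add: pred_def)
      from measurable_sets[OF proj_measurable_filtration[OF r] this] show ?thesis
        by (rule back_subst[of "\<lambda>S. S \<in> sets (E r)"]) (use proj_space in \<open>auto simp: space_F P.space_F\<close>)
    qed
    have VK: "AE \<omega> in Q. \<forall>t\<ge>0. V' (min t (\<tau> k (\<pi> \<omega>))) (\<pi> \<omega>) \<le> real k"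
      using \<tau>b proj_space by (intro AE_I2) blast
    have Nm: "(\<lambda>\<omega>. N' (min t (\<tau> k (\<pi> \<omega>))) (\<pi> \<omega>)) \<in> borel_measurable Q"
      and Vm: "(\<lambda>\<omega>. V' (min t (\<tau> k (\<pi> \<omega>))) (\<pi> \<omega>)) \<in> borel_measurable Q" if "0 \<le> t" for t
      using measurable_compose[OF proj_measurable P.measurable_of_F[OF N'm[OF that]]]
        measurable_compose[OF proj_measurable P.measurable_of_F[OF V'm[OF that]]] by auto
    note sq = stopped_square_martingale[where h=h and J=J and N="\<lambda>t \<omega>. N' t (\<pi> \<omega>)" and V="\<lambda>t \<omega>. V' t (\<pi> \<omega>)"
        and \<tau>="\<lambda>\<omega>. \<tau> k (\<pi> \<omega>)" and K="real k", OF S limit_L2(2) JN Nc VQ V0 \<tau>E \<tau>0[OF proj_space] VK Nm Vm s A]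
    show "integrable Q (\<lambda>\<omega>. Z k t (\<pi> \<omega>))"
      "(\<integral>\<omega>. indicator A \<omega> * Z k t (\<pi> \<omega>) \<partial>Q) = (\<integral>\<omega>. indicator A \<omega> * Z k s (\<pi> \<omega>) \<partial>Q)"
      using sq unfolding Z_def by blast+
  qed
  have ZmP: "Z k t \<in> borel_measurable P" if "0 \<le> t" for k t using P.measurable_of_F[OF Zm[OF that]] .
  have Zint: "integrable P (Z k t)" if t: "0 \<le> t" for k t
    using stopped(1)[OF order_refl t sets.empty_sets] integrable_distr_eq[OF proj_measurable ZmP[OF t], of k]
    unfolding distr_proj by simp
  have Zmart: "(\<integral>\<omega>. indicator A \<omega> * Z k t \<omega> \<partial>P) = (\<integral>\<omega>. indicator A \<omega> * Z k s \<omega> \<partial>P)"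
    if s: "0 \<le> s" "s \<le> t" and A: "A \<in> sets (F s)" for k s t A
  proof -
    have t: "0 \<le> t" using s by simp
    have AP: "A \<in> sets P" using A by (rule P.sets_F_P)
    \<comment> \<open>Events known to \<open>F\<close> at time \<open>s\<close> pull back to events
      known to \<open>E\<close>; this lets the martingale property descend.\<close>
    have A': "\<pi> -` A \<inter> space Q \<in> sets (E s)"
      using measurable_sets[OF proj_measurable_filtration[OF s(1)] A] by (simp add: space_F)
    have tr: "(\<integral>\<omega>. indicator A \<omega> * Z k v \<omega> \<partial>P) = (\<integral>\<omega>. indicator (\<pi> -` A \<inter> space Q) \<omega> * Z k v (\<pi> \<omega>) \<partial>Q)" if "0 \<le> v" for v
    proof -
      note [measurable] = AP ZmP[OF that]
      have "(\<integral>\<omega>. indicator A \<omega> * Z k v \<omega> \<partial>P) = (\<integral>\<omega>. indicator A \<omega> * Z k v \<omega> \<partial>distr Q P \<pi>)" by (simp add: distr_proj)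
      also have "\<dots> = (\<integral>\<omega>. indicator A (\<pi> \<omega>) * Z k v (\<pi> \<omega>) \<partial>Q)" by (rule integral_distr) measurable
      also have "\<dots> = (\<integral>\<omega>. indicator (\<pi> -` A \<inter> space Q) \<omega> * Z k v (\<pi> \<omega>) \<partial>Q)"
        by (intro Bochner_Integration.integral_cong) (auto simp: indicator_def)
      finally show ?thesis .
    qed
    show ?thesis unfolding tr[OF t] tr[OF s(1)] by (rule stopped(2)[OF s A'])
  qed
  have Y_eq: "AE \<omega> in P. \<forall>t. Z k t \<omega> = ((N (min t (\<tau> k \<omega>)) \<omega>)\<^sup>2 - V (min t (\<tau> k \<omega>)) \<omega>) - ((N 0 \<omega>)\<^sup>2 - V 0 \<omega>)" for k
    using nB0 AE_space
  proof eventually_elim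
    case (elim \<omega>)
    then have "N 0 \<omega> = 0" "V 0 \<omega> = 0" using V'(1,5)[of \<omega>] by (auto simp: V'_def N'_def)
    then show ?case using elim by (simp add: Z_def V'_def N'_def)
  qed
  have mart: "martingale P F (\<lambda>t \<omega>. ((N (min t (\<tau> k \<omega>)) \<omega>)\<^sup>2 - V (min t (\<tau> k \<omega>)) \<omega>) - ((N 0 \<omega>)\<^sup>2 - V 0 \<omega>))" for k
  proof -
    define Y where "Y t \<omega> = ((N (min t (\<tau> k \<omega>)) \<omega>)\<^sup>2 - V (min t (\<tau> k \<omega>)) \<omega>) - ((N 0 \<omega>)\<^sup>2 - V 0 \<omega>)" for t \<omega>
    have ZY: "AE \<omega> in P. Z k t \<omega> = Y t \<omega>" for t using Y_eq[of k] unfolding Y_def by eventually_elim simp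
    have Ym: "Y t \<in> borel_measurable (F t)" if "0 \<le> t" for t
      by (rule P.borel_measurable_F_cong_AE[OF that Zm[OF that] ZY])
    have Yi: "integrable P (Y t)" if "0 \<le> t" for t
      by (rule integrable_cong_AE_imp[OF Zint[OF that] P.measurable_of_F[OF Ym[OF that]]])
        (use ZY[of t] in \<open>eventually_elim, simp\<close>)
    have "AE \<omega> in P. real_cond_exp P (F s) (Y t) \<omega> = Y s \<omega>" if s: "0 \<le> s" "s \<le> t" for s t
    proof -
      interpret C: finite_measure_subalgebra P "F s"
        by unfold_locales (rule P.subalg)
      have t: "0 \<le> t" using s by simp
      have tr: "(\<integral>\<omega>. indicator A \<omega> * Y v \<omega> \<partial>P) = (\<integral>\<omega>. indicator A \<omega> * Z k v \<omega> \<partial>P)" if "0 \<le> v" "A \<in> sets (F s)" for v A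
      proof (rule integral_cong_AE)
        note [measurable] = P.sets_F_P[OF that(2)] P.measurable_of_F[OF Ym[OF that(1)]] ZmP[OF that(1)]
        show "(\<lambda>\<omega>. indicat_real A \<omega> * Y v \<omega>) \<in> borel_measurable P" "(\<lambda>\<omega>. indicat_real A \<omega> * Z k v \<omega>) \<in> borel_measurable P"
          by measurable
        show "AE \<omega> in P. indicat_real A \<omega> * Y v \<omega> = indicat_real A \<omega> * Z k v \<omega>" using ZY[of v] by eventually_elim simp
      qed
      show ?thesis
      proof (rule C.real_cond_exp_charact)
        fix A assume A: "A \<in> sets (F s)"
        show "(\<integral>x\<in>A. Y t x \<partial>P) = (\<integral>x\<in>A. Y s x \<partial>P)"
          unfolding set_lebesgue_integral_def using tr[OF t A] tr[OF s(1) A] Zmart[OF s A] by simp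
      qed (use Yi t s Ym in auto)
    qed
    then have "martingale P F Y"
      unfolding martingale_def adapted_def using Ym Yi by blast
    then show ?thesis unfolding Y_def .
  qed
  show ?thesis
    unfolding quadratic_variation_def cont_local_martingale_def
  proof (intro conjI exI[of _ \<tau>] allI ballI)
    show "adapted F V" using V_adapted by (simp add: adapted_def)
    show "AE \<omega> in P. V 0 \<omega> = 0 \<and> continuous_on {0..} (\<lambda>t. V t \<omega>) \<and> mono_on {0..} (\<lambda>t. V t \<omega>)"
      by (rule V_paths)
    show "adapted F (\<lambda>t \<omega>. (N t \<omega>)\<^sup>2 - V t \<omega>)"
      unfolding adapted_def using V_adapted N_adapted by auto
    show "AE \<omega> in P. continuous_on {0..} (\<lambda>t. (N t \<omega>)\<^sup>2 - V t \<omega>)"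
      using V_paths N_continuous by eventually_elim (intro continuous_intros, auto)
    show "stopping_time F (\<tau> k)" for k by (rule st)
    show "0 \<le> \<tau> k \<omega>" if "\<omega> \<in> space P" for k \<omega> by (rule \<tau>0[OF that])
    show "AE \<omega> in P. incseq (\<lambda>n. \<tau> n \<omega>) \<and> filterlim (\<lambda>n. \<tau> n \<omega>) at_top sequentially"
    proof (rule AE_I2, intro conjI)
      fix \<omega> assume \<omega>: "\<omega> \<in> space P"
      show "incseq (\<lambda>n. \<tau> n \<omega>)"
      proof (rule incseq_SucI)
        fix n
        \<comment> \<open>At its own level time \<open>V'\<close> has reached level
          \<open>n + 1\<close>, or the cap \<open>n + 1\<close> has been reached; in either case the
          test for \<open>n\<close> has been passed.\<close>
        have "real (Suc n) \<le> \<tau> (Suc n) \<omega> \<or> real (Suc n) \<le> V' (\<tau> (Suc n) \<omega>) \<omega>"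
          using \<tau>le[OF \<omega> \<tau>0[OF \<omega>], of "Suc n" "Suc n"] by simp
        then show "\<tau> n \<omega> \<le> \<tau> (Suc n) \<omega>" using \<tau>le[OF \<omega> \<tau>0[OF \<omega>], of n "Suc n"] by auto
      qed
      show "filterlim (\<lambda>n. \<tau> n \<omega>) at_top sequentially"
      proof (subst filterlim_at_top_ge[where c=0], intro allI impI)
        fix T :: real assume T: "0 \<le> T"
        obtain n0 :: nat where n0: "max T (V' T \<omega>) < real n0" using reals_Archimedean2 by blast
        show "\<forall>\<^sub>F n in sequentially. T \<le> \<tau> n \<omega>"
          unfolding eventually_sequentially
        proof (intro exI allI impI)
          fix n assume "n0 \<le> n"
          then have "max T (V' T \<omega>) < real n" using n0 by simp
          then have "\<not> \<tau> n \<omega> \<le> T" using \<tau>le[OF \<omega> T, of n] by simp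
          then show "T \<le> \<tau> n \<omega>" by simp
        qed
      qed
    qed
    show "martingale P F (\<lambda>t \<omega>. (N (min t (\<tau> k \<omega>)) \<omega>)\<^sup>2 - V (min t (\<tau> k \<omega>)) \<omega> - ((N 0 \<omega>)\<^sup>2 - V 0 \<omega>))" for k
      by (rule mart)
  qed
qed

end

end

text \<open>The integrand given by the adjoint need not be Borel in time, as it agrees with a Borel
  function only almost everywhere. On the completion such a change is harmless.\<close>

lemma set_integral_lebesgue_cong_AE:
  fixes k l :: "real \<Rightarrow> real"
  assumes k: "set_integrable lborel A k" and ae: "AE s in lborel. s \<in> A \<longrightarrow> k s = l s"
  shows "set_integrable lebesgue A l" and "(LINT s:A|lebesgue. l s) = (LINT s:A|lborel. k s)"
proof -
  let ?k = "\<lambda>s. indicator A s *\<^sub>R k s" and ?l = "\<lambda>s. indicator A s *\<^sub>R l s"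
  have m: "?k \<in> borel_measurable lborel"
    using k unfolding set_integrable_def by (rule borel_measurable_integrable)
  then have mk: "?k \<in> borel_measurable lebesgue" by (rule measurable_completion)
  have ae': "AE s in lebesgue. ?k s = ?l s"
    by (rule AE_completion) (use ae in \<open>eventually_elim, simp add: indicator_def\<close>)
  have ml: "?l \<in> borel_measurable lebesgue"
    by (rule completion.borel_measurable_cong_AE[OF mk ae'])
  have ik: "integrable lebesgue ?k" using k integrable_completion[OF m] by (simp add: set_integrable_def)
  show "set_integrable lebesgue A l"
    unfolding set_integrable_def by (rule integrable_cong_AE_imp[OF ik ml]) (use ae' in \<open>eventually_elim, simp\<close>)
  show "(LINT s:A|lebesgue. l s) = (LINT s:A|lborel. k s)"
    unfolding set_lebesgue_integral_def integral_completion[OF m, symmetric]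
    by (rule integral_cong_AE[OF ml mk]) (use ae' in \<open>eventually_elim, auto\<close>)
qed

section \<open>Identification of the limit with the adjoint\<close>

context selected_integrals begin

context
  fixes A :: "real \<Rightarrow> 'a \<Rightarrow> ('h \<times> 'x::real_normed_vector) set" and \<phi> :: "nat \<Rightarrow> real \<Rightarrow> 'a \<Rightarrow> ('x \<Rightarrow>\<^sub>L real)"
    and f :: "real \<Rightarrow> 'a \<Rightarrow> ('x \<Rightarrow>\<^sub>L real)"
  assumes A_closed: "\<And>t \<omega>. 0 \<le> t \<Longrightarrow> \<omega> \<in> space P \<Longrightarrow> A t \<omega> \<in> closed_operators"
    and \<Gamma>_adjoint: "\<And>n. AE (t, \<omega>) in time_prod P. (\<phi> n t \<omega>, \<Gamma> n (t, \<omega>)) \<in> adjoint_graph (A t \<omega>)"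
    and \<phi>_tendsto: "AE (t, \<omega>) in time_prod P. (\<lambda>n. \<phi> n t \<omega>) \<longlonglongrightarrow> f t \<omega>"
begin

text \<open>At almost every time and path all pairs of the subsequence lie in one adjoint graph, and
  both coordinates converge; closedness of that graph gives the limit pair.\<close>

lemma limit_in_adjoint_graph: "AE (t, \<omega>) in time_prod P. (f t \<omega>, \<Gamma>\<^sub>0 t \<omega>) \<in> adjoint_graph (A t \<omega>)"
proof -
  have "AE p in time_prod P. \<forall>n. (\<phi> n (fst p) (snd p), \<Gamma> n p) \<in> adjoint_graph (A (fst p) (snd p))"
    using \<Gamma>_adjoint unfolding AE_all_countable by (simp add: case_prod_beta)
  moreover have "AE p in time_prod P. (\<lambda>n. \<phi> n (fst p) (snd p)) \<longlonglongrightarrow> f (fst p) (snd p)"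
    using \<phi>_tendsto by (simp add: case_prod_beta)
  ultimately have "AE p in time_prod P. (f (fst p) (snd p), \<Gamma>\<^sub>0 (fst p) (snd p)) \<in> adjoint_graph (A (fst p) (snd p))"
    using \<Gamma>_converges
  proof eventually_elim
    case (elim p)
    have "filterlim r at_top sequentially"
      by (rule filterlim_at_top_mono[OF filterlim_ident]) (simp add: r)
    from filterlim_compose[OF elim(2) this] have "(\<lambda>n. \<phi> (r n) (fst p) (snd p)) \<longlonglongrightarrow> f (fst p) (snd p)" .
    from adjoint_graph_closed[OF _ this elim(3)] elim(1) show ?case by blast
  qed
  then show ?thesis by (simp add: case_prod_beta)
qed

lemma adjoint_apply_limit: "AE p in time_prod P. adjoint_apply (A (fst p) (snd p)) (f (fst p) (snd p)) = \<Gamma>\<^sub>0 (fst p) (snd p)"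
proof -
  have "AE p in time_prod P. p \<in> space (time_prod P)" by (rule AE_space)
  then show ?thesis
    using limit_in_adjoint_graph
  proof eventually_elim
    case (elim p)
    then have "A (fst p) (snd p) \<in> closed_operators" using A_closed by (auto simp: space_time_prod)
    with elim(2) show ?case by (intro adjoint_apply_eq) auto
  qed
qed

lemma limit_in_domain: "AE (t, \<omega>) in time_prod P. f t \<omega> \<in> Domain (adjoint_graph (A t \<omega>))"
  using limit_in_adjoint_graph by eventually_elim auto

text \<open>The construction of \<open>\<Gamma>\<^sub>0\<close> involves no filtration. Progressive
  measurability is carried by \<open>u\<close>, with which it agrees almost everywhere on the
  enlarged space.\<close>

lemma adjoint_apply_limit_progressive:
  "\<exists>u. progressively_measurable E u \<and>
    (AE (t, \<omega>) in time_prod Q. adjoint_apply (A t (\<pi> \<omega>)) (f t (\<pi> \<omega>)) = u t \<omega>)"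
proof (intro exI conjI)
  show "progressively_measurable E u" by (rule limit_process_progressive[OF S])
  show "AE (t, \<omega>) in time_prod Q. adjoint_apply (A t (\<pi> \<omega>)) (f t (\<pi> \<omega>)) = u t \<omega>"
    using AE_time_proj[OF adjoint_apply_limit] \<Gamma>\<^sub>0_eq_u by eventually_elim auto
qed

lemma adjoint_apply_limit_integral:
  "AE \<omega> in P. \<forall>t. set_integrable lebesgue {0..t} (\<lambda>s. (norm (adjoint_apply (A s \<omega>) (f s \<omega>)))\<^sup>2) \<and>
    (LINT s:{0..t}|lebesgue. (norm (adjoint_apply (A s \<omega>) (f s \<omega>)))\<^sup>2) = enn2real (sqnorm \<Gamma>\<^sub>0 t \<omega>)"
  using AE_time_prodD[OF P.prob_space_axioms adjoint_apply_limit] sqnorm_\<Gamma>\<^sub>0_finite AE_space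
proof eventually_elim
  case (elim \<omega>)
  note R = running_integral[where k="\<lambda>t. (norm (\<Gamma>\<^sub>0 t \<omega>))\<^sup>2", OF _ sqnorm_section_measurable[OF \<Gamma>\<^sub>0_norm_measurable elim(3)]
      elim(2)[rule_format, unfolded sqnorm_def], simplified]
  show ?case
  proof
    fix t
    have "AE s in lborel. s \<in> {0..t} \<longrightarrow> (norm (\<Gamma>\<^sub>0 s \<omega>))\<^sup>2 = (norm (adjoint_apply (A s \<omega>) (f s \<omega>)))\<^sup>2"
      using elim(1) by eventually_elim simp
    note set_integral_lebesgue_cong_AE[OF R(1) this]
    then show "set_integrable lebesgue {0..t} (\<lambda>s. (norm (adjoint_apply (A s \<omega>) (f s \<omega>)))\<^sup>2) \<and>
      (LINT s:{0..t}|lebesgue. (norm (adjoint_apply (A s \<omega>) (f s \<omega>)))\<^sup>2) = enn2real (sqnorm \<Gamma>\<^sub>0 t \<omega>)"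
      using R(2)[of t] by (simp add: sqnorm_def)
  qed
qed

lemma quadratic_variation_adjoint_apply:
  "quadratic_variation P F N (\<lambda>t \<omega>. LINT s:{0..t}|lebesgue. (norm (adjoint_apply (A s \<omega>) (f s \<omega>)))\<^sup>2)"
proof (rule quadratic_variation_V)
  show "AE \<omega> in P. \<forall>t\<ge>0. (LINT s:{0..t}|lebesgue. (norm (adjoint_apply (A s \<omega>) (f s \<omega>)))\<^sup>2) = enn2real (sqnorm \<Gamma>\<^sub>0 t \<omega>)"
    using adjoint_apply_limit_integral by eventually_elim simp
qed (simp add: set_lebesgue_integral_def)

end

end

theorem theorem3p9:
  fixes P :: "'a measure" and F :: "real \<Rightarrow> 'a measure"
    and Q :: "'b measure" and E :: "real \<Rightarrow> 'b measure" and \<pi> :: "'b \<Rightarrow> 'a"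
    and M :: "('x::{banach, second_countable_topology} \<Rightarrow>\<^sub>L real) \<Rightarrow> real \<Rightarrow> 'a \<Rightarrow> real"
    and G :: "real \<Rightarrow> 'a \<Rightarrow> ('h::{real_inner, banach} \<times> 'x) set"
    and f :: "real \<Rightarrow> 'a \<Rightarrow> ('x \<Rightarrow>\<^sub>L real)"
    and fs :: "nat \<Rightarrow> ('a, 'x \<Rightarrow>\<^sub>L real) elementary"
    and N :: "real \<Rightarrow> 'a \<Rightarrow> real"
  assumes "usual_filtered_prob_space P F"
    and "sets P = sigma_sets (space P) (\<Union>t\<in>{0..}. sets (F t))"
    and "reflexive_space TYPE('x)"
    and "cylindrical_cont_local_martingale P F M"
    and "closed_operator_brownian_representation P F Q E \<pi> M G"
    and "\<And>n. elementary_progressive F (fs n)"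
    and "AE (t, \<omega>) in time_prod P. (\<lambda>n. elementary_process (fs n) t \<omega>) \<longlonglongrightarrow> f t \<omega>"
    and "cont_local_martingale P F N"
    and "ucp_tendsto P (\<lambda>n. elementary_integral (fs n) M) N sequentially"
  shows "(AE (t, \<omega>) in time_prod P. f t \<omega> \<in> Domain (adjoint_graph (G t \<omega>))) \<and>
    (\<exists>u. progressively_measurable E u \<and>
       (AE (t, \<omega>) in time_prod Q. adjoint_apply (G t (\<pi> \<omega>)) (f t (\<pi> \<omega>)) = u t \<omega>)) \<and>
    (AE \<omega> in P. \<forall>t\<ge>0.
       set_integrable lebesgue {0..t} (\<lambda>s. (norm (adjoint_apply (G s \<omega>) (f s \<omega>)))\<^sup>2)) \<and>
    quadratic_variation P F N
      (\<lambda>t \<omega>. LINT s:{0..t}|lebesgue. (norm (adjoint_apply (G s \<omega>) (f s \<omega>)))\<^sup>2)"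
proof -
  note rep = assms(5)[unfolded closed_operator_brownian_representation_def]
  from rep have enl: "enlargement P F Q E \<pi>"
    and G: "\<And>t \<omega>. 0 \<le> t \<Longrightarrow> \<omega> \<in> space P \<Longrightarrow> G t \<omega> \<in> closed_operators" by blast+
  obtain W :: "'h \<Rightarrow> real \<Rightarrow> 'b \<Rightarrow> real" and g :: "real \<Rightarrow> 'b \<Rightarrow> ('x \<Rightarrow>\<^sub>L real) \<Rightarrow> 'h" where
    W: "cylindrical_brownian_motion Q E W"
    and g: "\<And>x'. has_stochastic_integral Q E W (\<lambda>t \<omega>. g t \<omega> x') (\<lambda>t \<omega>. M x' t (\<pi> \<omega>))"
    and \<gamma>: "\<And>x'. \<exists>\<gamma> \<in> borel_measurable (time_prod P).
           (AE (t, \<omega>) in time_prod P. (x', \<gamma> (t, \<omega>)) \<in> adjoint_graph (G t \<omega>)) \<and>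
           (AE (t, \<omega>) in time_prod Q. \<gamma> (t, \<pi> \<omega>) = g t \<omega> x')"
    using rep by blast
  have E: "filtered_prob_space Q E" using enl by (simp add: enlargement_def)
  have "cyl_brownian Q E W" using E W by (simp add: cyl_brownian_def cyl_brownian_axioms_def)
  then have cb: "cyl_brownian_banach Q E W" by (simp add: cyl_brownian_banach_def)
  interpret enlarged_brownian P F Q E W \<pi>
    using assms(1) cb enl by (simp add: enlarged_brownian_def enlarged_brownian_axioms_def)
  \<comment> \<open>For each functional the representing process is replaced by a strongly
    measurable version, so that finite combinations stay measurable.\<close>
  have "\<exists>\<gamma>. strongly_measurable (time_prod P) \<gamma> \<and>
      (AE p in time_prod P. (x, \<gamma> p) \<in> adjoint_graph (G (fst p) (snd p))) \<and>
      approximable (\<lambda>t \<omega>. \<gamma> (t, \<pi> \<omega>)) (\<lambda>t \<omega>. M x t (\<pi> \<omega>))" for x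
  proof -
    obtain \<gamma> where \<gamma>: "\<gamma> \<in> borel_measurable (time_prod P)"
      "AE (t, \<omega>) in time_prod P. (x, \<gamma> (t, \<omega>)) \<in> adjoint_graph (G t \<omega>)"
      "AE (t, \<omega>) in time_prod Q. \<gamma> (t, \<pi> \<omega>) = g t \<omega> x" using \<gamma> by blast
    obtain \<gamma>' where \<gamma>': "strongly_measurable (time_prod P) \<gamma>'" "AE p in time_prod P. \<gamma>' p = \<gamma> p"
      "approximable (\<lambda>t \<omega>. \<gamma>' (t, \<pi> \<omega>)) (\<lambda>t \<omega>. M x t (\<pi> \<omega>))"
      by (rule integrand_strongly_measurable_version[OF g \<gamma>(1,3)])
    have "AE p in time_prod P. (x, \<gamma>' p) \<in> adjoint_graph (G (fst p) (snd p))"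
      using \<gamma>(2) \<gamma>'(2) by eventually_elim auto
    with \<gamma>' show ?thesis by blast
  qed
  from choice[OF allI, OF this] obtain \<gamma> where "\<forall>x. strongly_measurable (time_prod P) (\<gamma> x) \<and>
      (AE p in time_prod P. (x, \<gamma> x p) \<in> adjoint_graph (G (fst p) (snd p))) \<and>
      approximable (\<lambda>t \<omega>. \<gamma> x (t, \<pi> \<omega>)) (\<lambda>t \<omega>. M x t (\<pi> \<omega>))" ..
  then have \<gamma>m: "\<And>x. strongly_measurable (time_prod P) (\<gamma> x)"
    and \<gamma>_adjoint: "\<And>x. AE p in time_prod P. (x, \<gamma> x p) \<in> adjoint_graph (G (fst p) (snd p))"
    and \<gamma>_approx: "\<And>x. approximable (\<lambda>t \<omega>. \<gamma> x (t, \<pi> \<omega>)) (\<lambda>t \<omega>. M x t (\<pi> \<omega>))" by simp_all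
  interpret convergent_integrals P F Q E W \<pi> "\<lambda>n. elementary_image (fs n) \<gamma>" "\<lambda>n. elementary_integral (fs n) M" N
  proof unfold_locales
    show "strongly_measurable (time_prod P) (elementary_image (fs n) \<gamma>)" for n
      by (rule elementary_image_strongly_measurable[OF assms(6) \<gamma>m])
    show "approximable (\<lambda>t \<omega>. elementary_image (fs n) \<gamma> (t, \<pi> \<omega>)) (\<lambda>t \<omega>. elementary_integral (fs n) M t (\<pi> \<omega>))" for n
      by (rule elementary_image_approximable[OF assms(6) \<gamma>_approx])
  qed (fact assms(8,9))+
  obtain h J B r where "selected_integrals P F Q E W \<pi> (\<lambda>n. elementary_image (fs n) \<gamma>) (\<lambda>n. elementary_integral (fs n) M) N h J B r"
    using selected_integrals_exist by blast
  then interpret selected_integrals P F Q E W \<pi> "\<lambda>n. elementary_image (fs n) \<gamma>" "\<lambda>n. elementary_integral (fs n) M" N h J B r .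
  have image_adjoint: "AE (t, \<omega>) in time_prod P. (elementary_process (fs n) t \<omega>, elementary_image (fs n) \<gamma> (t, \<omega>)) \<in> adjoint_graph (G t \<omega>)" for n
  proof -
    \<comment> \<open>The exceptional set of \<open>\<gamma> x\<close> depends on \<open>x\<close>,
      but one elementary process involves only countably many indices \<open>k\<close>, so the null
      sets can be united.\<close>
    have "AE p in time_prod P. \<forall>k. (el_x (fs n) k, \<gamma> (el_x (fs n) k) p) \<in> adjoint_graph (G (fst p) (snd p))"
      using \<gamma>_adjoint unfolding AE_all_countable by blast
    then show ?thesis by eventually_elim (auto intro!: elementary_image_adjoint)
  qed
  note facts = G image_adjoint assms(7)
  show ?thesis
  proof (intro conjI)
    show "AE (t, \<omega>) in time_prod P. f t \<omega> \<in> Domain (adjoint_graph (G t \<omega>))"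
      by (rule limit_in_domain[OF facts])
    show "\<exists>u. progressively_measurable E u \<and>
       (AE (t, \<omega>) in time_prod Q. adjoint_apply (G t (\<pi> \<omega>)) (f t (\<pi> \<omega>)) = u t \<omega>)"
      by (rule adjoint_apply_limit_progressive[OF facts])
    show "AE \<omega> in P. \<forall>t\<ge>0. set_integrable lebesgue {0..t} (\<lambda>s. (norm (adjoint_apply (G s \<omega>) (f s \<omega>)))\<^sup>2)"
    proof (rule AE_mp)
      show "AE \<omega> in P. \<forall>t. set_integrable lebesgue {0..t} (\<lambda>s. (norm (adjoint_apply (G s \<omega>) (f s \<omega>)))\<^sup>2) \<and>
        (LINT s:{0..t}|lebesgue. (norm (adjoint_apply (G s \<omega>) (f s \<omega>)))\<^sup>2) = enn2real (sqnorm \<Gamma>\<^sub>0 t \<omega>)"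
        by (rule adjoint_apply_limit_integral[OF facts])
    qed auto
    show "quadratic_variation P F N (\<lambda>t \<omega>. LINT s:{0..t}|lebesgue. (norm (adjoint_apply (G s \<omega>) (f s \<omega>)))\<^sup>2)"
      by (rule quadratic_variation_adjoint_apply[OF facts])
  qed
qed

end
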